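(* Let $n\ge3$, $A\in M(\lambda,L)$, let $\Gamma$ be the fundamental solution of $-\mathrm{div}(A\nabla\cdot)$ in $\mathbb{R}^n$ with pole at the origin, and let $u\in H^1(B_1)$ be a weak solution of $\mathrm{div}(A\nabla u)=0$ in $B_1$. Then there exist $\alpha=\alpha(n,\lambda,L)\in(0,1)$ and $C=C(n,\lambda,L)>0$ such that $$\int_{B_r}\Gamma(x)\,A\nabla u\cdot\nabla u\,dx\le C\left(\frac rR\right)^{2\alpha}\int_{B_R}\Gamma(x)\,A\nabla u\cdot\nabla u\,dx\qquad\text{for all }0<r<R\le\tfrac12.$$ Moreover, $u\in C^{0,\alpha}(B_{1/2})$.
   Context: For $0<\lambda\le L<\infty$, $M(\lambda,L)$ denotes the set of symmetric matrix-valued functions $A=(a_{ij})$ on $\mathbb{R}^n$ with bounded measurable coefficients satisfying $\lambda|\xi|^2\le A(x)\xi\cdot\xi\le L|\xi|^2$ for all $\xi\in\mathbb{R}^n$ and a.e. $x\in\mathbb{R}^n$. $B_r$ is the ball of radius $r$ centered at the origin. The fundamental solution $\Gamma$ is the positive function with $-\mathrm{div}(A\nabla\Gamma)=\delta_0$ in $\mathbb{R}^n$ and $\Gamma\to0$ at infinity; it satisfies $C_1|x|^{2-n}\le\Gamma(x)\le C_2|x|^{2-n}$ with $C_1,C_2>0$ depending only on $n,\lambda,L$. *)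

theory Defs
  imports "HOL-Analysis.Analysis"
begin

definition pderiv :: "(real^'n \<Rightarrow> real) \<Rightarrow> 'n \<Rightarrow> real^'n \<Rightarrow> real" where
  "pderiv f i x = frechet_derivative f (at x) (axis i 1)"

definition grad :: "(real^'n \<Rightarrow> real) \<Rightarrow> real^'n \<Rightarrow> real^'n" where
  "grad f x = (\<chi> i. pderiv f i x)"

fun Ck :: "nat \<Rightarrow> (real^'n \<Rightarrow> real) \<Rightarrow> bool" where
  "Ck 0 f = continuous_on UNIV f"
| "Ck (Suc k) f = ((\<forall>x. f differentiable (at x)) \<and> (\<forall>i. Ck k (pderiv f i)))"

definition smooth :: "(real^'n \<Rightarrow> real) \<Rightarrow> bool" where
  "smooth f = (\<forall>k. Ck k f)"

definition test_fun :: "(real^'n) set \<Rightarrow> (real^'n \<Rightarrow> real) \<Rightarrow> bool" where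
  "test_fun U \<phi> = (smooth \<phi> \<and> compact (closure {x. \<phi> x \<noteq> 0}) \<and> closure {x. \<phi> x \<noteq> 0} \<subseteq> U)"

definition loc_integrable :: "(real^'n) set \<Rightarrow> (real^'n \<Rightarrow> real) \<Rightarrow> bool" where
  "loc_integrable U f = (\<forall>K. compact K \<and> K \<subseteq> U \<longrightarrow> set_integrable lebesgue K f)"

definition weak_grad :: "(real^'n) set \<Rightarrow> (real^'n \<Rightarrow> real) \<Rightarrow> (real^'n \<Rightarrow> real^'n) \<Rightarrow> bool" where
  "weak_grad U u g = (loc_integrable U u \<and> (\<forall>i. loc_integrable U (\<lambda>x. g x $ i)) \<and>
     (\<forall>\<phi> i. test_fun U \<phi> \<longrightarrow>
        (\<integral>x. u x * pderiv \<phi> i x \<partial>lebesgue) = - (\<integral>x. g x $ i * \<phi> x \<partial>lebesgue)))"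

definition H1 :: "(real^'n) set \<Rightarrow> (real^'n \<Rightarrow> real) \<Rightarrow> (real^'n \<Rightarrow> real^'n) \<Rightarrow> bool" where
  "H1 U u g = (weak_grad U u g \<and> set_integrable lebesgue U (\<lambda>x. (u x)\<^sup>2) \<and>
     (\<forall>i. set_integrable lebesgue U (\<lambda>x. (g x $ i)\<^sup>2)))"

definition elliptic_class :: "real \<Rightarrow> real \<Rightarrow> (real^'n \<Rightarrow> real^'n^'n) set" where
  "elliptic_class lam L = {A. (\<forall>i j. (\<lambda>x. A x $ i $ j) \<in> borel_measurable lebesgue) \<and>
     (AE x in lebesgue. transpose (A x) = A x \<and>
        (\<forall>\<xi>. lam * (norm \<xi>)\<^sup>2 \<le> (A x *v \<xi>) \<bullet> \<xi> \<and> (A x *v \<xi>) \<bullet> \<xi> \<le> L * (norm \<xi>)\<^sup>2))}"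

definition weak_solution :: "(real^'n \<Rightarrow> real^'n^'n) \<Rightarrow> (real^'n) set \<Rightarrow> (real^'n \<Rightarrow> real) \<Rightarrow> (real^'n \<Rightarrow> real^'n) \<Rightarrow> bool" where
  "weak_solution A U u Du = (H1 U u Du \<and>
     (\<forall>\<phi>. test_fun U \<phi> \<longrightarrow> (\<integral>x. (A x *v Du x) \<bullet> grad \<phi> x \<partial>lebesgue) = 0))"

definition fundamental_solution :: "(real^'n \<Rightarrow> real^'n^'n) \<Rightarrow> (real^'n \<Rightarrow> real) \<Rightarrow> (real^'n \<Rightarrow> real^'n) \<Rightarrow> bool" where
  "fundamental_solution A G DG = ((\<forall>x. x \<noteq> 0 \<longrightarrow> G x > 0) \<and> weak_grad UNIV G DG \<and>
     (\<forall>\<rho>>0. \<forall>i. set_integrable lebesgue (- cball 0 \<rho>) (\<lambda>x. (DG x $ i)\<^sup>2)) \<and>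
     (\<forall>\<phi>. test_fun UNIV \<phi> \<longrightarrow> (\<integral>x. (A x *v DG x) \<bullet> grad \<phi> x \<partial>lebesgue) = \<phi> 0) \<and>
     (G \<longlongrightarrow> 0) at_infinity)"

definition holder_class :: "real \<Rightarrow> (real^'n) set \<Rightarrow> (real^'n \<Rightarrow> real) \<Rightarrow> bool" where
  "holder_class \<alpha> U u = (\<exists>v K. (AE x in lebesgue. x \<in> U \<longrightarrow> u x = v x) \<and>
     (\<forall>x\<in>U. \<forall>y\<in>U. \<bar>v x - v y\<bar> \<le> K * dist x y powr \<alpha>))"

end

theory Submission
 imports Defs
begin

text \<open>
 The decay of the oscillation of a solution is the De Giorgi--Moser theory: Caccioppoli's inequality on superlevel
 sets and the Faber--Krahn inequality bound subsolutions locally, and applying this to the logarithm of a positive supersolution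
 shows that a supersolution which is large on a fixed portion of a ball is bounded below on a smaller ball.

 The truncations \<open>min \<Gamma> k\<close> are supersolutions with energy at most \<open>k / lam\<close>. Together with Hardy's inequality, local
 boundedness and the growth of supersolutions this gives two-sided bounds of \<open>\<Gamma>\<close> by \<open>|x|\<^bsup>2-n\<^esup>\<close>.

 Testing the equation of \<open>u\<close> with \<open>\<Phi>'(u - c) (\<Gamma> - k)\<^sup>+\<close>, where \<open>\<Phi>'' \<ge> 1/2\<close> on the range of \<open>u - c\<close>, bounds the
 weighted energy in a ball by the square of the oscillation of \<open>u\<close> in a comparable ball. The oscillation decays
 like \<open>(r / R)\<^bsup>\<alpha>\<^esup>\<close>, and at scale \<open>R\<close> its square is bounded by the weighted energy because of local boundedness, Poincare's
 inequality and the lower bound of \<open>\<Gamma>\<close>.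
\<close>

notation scaleR (infixr "*." 75)

abbreviation ind :: "'a set => 'a => 'b::zero_neq_one" where "ind \<equiv> indicator"

abbreviation ae :: "('a::euclidean_space => bool) => bool" (binder "AEL " 10) where
 "ae P \<equiv> eventually P (ae_filter lborel)"

abbreviation nn_int :: "('a::euclidean_space => ennreal) => ennreal" (binder "NN " 10) where
 "nn_int f \<equiv> nn_integral lborel f"

abbreviation Borel :: "('a::topological_space => 'b::topological_space) set" where
 "Borel \<equiv> borel_measurable borel"

abbreviation seq_tendsto :: "(nat => 'a::topological_space) => 'a => bool" (infixr "--->" 60) where
 "X ---> l \<equiv> X \<longlonglongrightarrow> l"

subsection \<open>Continuously differentiable functions\<close>

lemma vec_inner_axis_sum:
 fixes v h :: "real^'n"
 shows "v \<bullet> h = (\<Sum>i\<in>UNIV. h $ i * v $ i)"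
 by (simp add: inner_vec_def mult.commute)

lemma linear_axis_expansion:
 fixes D :: "real^'n => real"
 assumes "linear D"
 shows "D h = (\<chi> i. D (axis i 1)) \<bullet> h"
proof -
 have "h = (\<Sum>i\<in>UNIV. h $ i *. axis i 1)"
  using basis_expansion[of h] by (simp add: scalar_mult_eq_scaleR)
 then have "D h = D (\<Sum>i\<in>UNIV. h $ i *. axis i 1)" by simp
 also have "\<dots> = (\<Sum>i\<in>UNIV. h $ i * D (axis i 1))"
  using assms by (simp add: linear_sum linear_scale)
 finally show ?thesis by (simp add: vec_inner_axis_sum)
qed

lemma pderiv_eq:
 assumes "(f has_derivative D) (at x)"
 shows "pderiv f i x = D (axis i 1)"
 unfolding pderiv_def using frechet_derivative_at[OF assms] by simp

lemma grad_eq: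
 assumes "(f has_derivative (%h. v \<bullet> h)) (at x)"
 shows "grad f x = v"
 using pderiv_eq[OF assms] by (simp add: grad_def vec_eq_iff inner_axis)

lemma differentiable_grad:
 fixes f :: "real^'n => real"
 assumes "f differentiable (at x)"
 shows "(f has_derivative (%h. grad f x \<bullet> h)) (at x)"
proof -
 obtain D where D: "(f has_derivative D) (at x)"
  using assms by (auto simp: differentiable_def)
 have "D h = grad f x \<bullet> h" for h
  using linear_axis_expansion[OF has_derivative_linear[OF D], of h]
  by (simp add: grad_def pderiv_eq[OF D])
 then have "D = (%h. grad f x \<bullet> h)" by blast
 with D show ?thesis by simp
qed

definition C1 :: "(real^'n => real) => bool" where
 "C1 f \<longleftrightarrow> (ALL x. (f has_derivative (%h. grad f x \<bullet> h)) (at x)) & continuous_on UNIV (grad f)"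

lemma C1I:
 assumes "!!x. (f has_derivative (%h. g x \<bullet> h)) (at x)" and "continuous_on UNIV g"
 shows "C1 f" and "grad f = g"
proof -
 show "grad f = g" using grad_eq[OF assms(1)] by (auto simp: fun_eq_iff)
 then show "C1 f" using assms by (simp add: C1_def)
qed

lemma C1D: "C1 f ==> (f has_derivative (%h. grad f x \<bullet> h)) (at x)"
 by (simp add: C1_def)

lemma C1_continuous_grad: "C1 f ==> continuous_on UNIV (grad f)"
 by (simp add: C1_def)

lemma C1_continuous: "C1 f ==> continuous_on UNIV f"
 by (meson C1D continuous_at_imp_continuous_on has_derivative_continuous)

lemma C1_measurable: "C1 f ==> f : Borel"
 by (simp add: C1_continuous borel_measurable_continuous_onI)

lemma grad_measurable: "C1 f ==> grad f : Borel"
 by (simp add: C1_continuous_grad borel_measurable_continuous_onI)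

lemma
 assumes "C1 f" "C1 g"
 shows C1_mult: "C1 (%x. f x * g x)"
  and grad_mult: "grad (%x. f x * g x) = (%x. f x *. grad g x + g x *. grad f x)"
proof -
 have deriv: "((%x. f x * g x) has_derivative (%h. (f x *. grad g x + g x *. grad f x) \<bullet> h)) (at x)" for x
  by (rule derivative_eq_intros C1D assms | simp add: inner_add_left fun_eq_iff)+
 have "continuous_on UNIV (%x. f x *. grad g x + g x *. grad f x)"
  using assms by (intro continuous_intros C1_continuous_grad C1_continuous)
 from C1I[OF deriv this] show "C1 (%x. f x * g x)"
  "grad (%x. f x * g x) = (%x. f x *. grad g x + g x *. grad f x)" by auto
qed

lemma
 assumes "C1 f" and "!!t. (F has_real_derivative F' t) (at t)" and "continuous_on UNIV F'"
 shows C1_compose: "C1 (%x. F (f x))"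
  and grad_compose: "grad (%x. F (f x)) = (%x. F' (f x) *. grad f x)"
proof -
 have deriv: "((%x. F (f x)) has_derivative (%h. (F' (f x) *. grad f x) \<bullet> h)) (at x)" for x
  using has_derivative_compose[OF C1D[OF assms(1)] assms(2)[of "f x", unfolded has_field_derivative_def]]
  by simp
 have "continuous_on UNIV (%x. F' (f x) *. grad f x)"
  using assms
  by (intro continuous_intros C1_continuous_grad continuous_on_compose2[OF assms(3)] C1_continuous) auto
 from C1I[OF deriv this] show "C1 (%x. F (f x))"
  "grad (%x. F (f x)) = (%x. F' (f x) *. grad f x)" by auto
qed

lemma pderiv_conv_grad: "pderiv f i = (%x. grad f x $ i)"
 by (simp add: grad_def)

lemma C1_continuous_pderiv: "C1 f ==> continuous_on UNIV (pderiv f i)"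
 unfolding pderiv_conv_grad by (intro continuous_intros C1_continuous_grad)

definition supported_in :: "('a => 'b::zero) => 'a set => bool" where
 "supported_in f K \<longleftrightarrow> (ALL x. x ~: K --> f x = 0)"

lemma supported_inD: "supported_in f K ==> x ~: K ==> f x = 0"
 by (simp add: supported_in_def)

lemma supported_in_mono: "supported_in f K ==> K <= K' ==> supported_in f K'"
 by (auto simp: supported_in_def)

lemma grad_zero_open:
 assumes "open U" "x : U" "!!y. y : U ==> f y = 0"
 shows "grad f x = 0"
proof -
 have "(f has_derivative (%h. 0 \<bullet> h)) (at x)"
  by (rule has_derivative_transform_within_open[of "%_. 0" _ _ _ U]) (use assms in auto)
 from grad_eq[OF this] show ?thesis .
qed

lemma supported_in_grad: "supported_in f K ==> closed K ==> supported_in (grad f) K"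
 using grad_zero_open[of "-K" _ f] by (auto simp: supported_in_def)

lemma supported_in_pderiv: "supported_in f K ==> closed K ==> supported_in (pderiv f i) K"
 using supported_in_grad[of f K] by (simp add: supported_in_def pderiv_conv_grad)

subsection \<open>Smooth kernels\<close>

lemma Ck_continuous: "Ck k f ==> continuous_on UNIV f"
 by (cases k)
  (auto intro: differentiable_imp_continuous_within continuous_at_imp_continuous_on)

lemma Ck_Suc_imp: "Ck (Suc k) f ==> Ck k f"
proof (induction k arbitrary: f)
 case 0 then show ?case using Ck_continuous Ck.simps(1) by blast
next
 case (Suc k)
 then show ?case by (metis Ck.simps(2))
qed

lemma Ck_C1:
 assumes "Ck (Suc k) f"
 shows "C1 f"
proof -
 have "continuous_on UNIV (pderiv f i)" for i using assms Ck_continuous[of k "pderiv f i"] by simp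
 then have "continuous_on UNIV (grad f)"
  unfolding grad_def[abs_def] by (intro continuous_on_vec_lambda) simp
 then show "C1 f" unfolding C1_def using assms differentiable_grad by auto
qed

lemma Ck_SucI:
 assumes "!!x. (f has_derivative D x) (at x)" "!!i. Ck k (%x. D x (axis i 1))"
 shows "Ck (Suc k) f"
proof -
 have "pderiv f i = (%x. D x (axis i 1))" for i using pderiv_eq[OF assms(1)] by auto
 then show ?thesis using assms by (auto simp: differentiable_def)
qed

lemma Ck_has_derivative: "Ck (Suc k) f ==> (f has_derivative (%h. grad f x \<bullet> h)) (at x)"
 using Ck_C1 C1D by blast

lemma grad_axis: "grad f x \<bullet> axis i 1 = pderiv f i x"
 by (simp add: grad_def inner_axis)

lemma Ck_const: "Ck k (%x::real^'n. c)"
proof (induction k arbitrary: c)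
 case (Suc k)
 show ?case by (rule Ck_SucI[of _ "%x h. 0"]) (auto simp: Suc)
qed simp

lemma Ck_add: "Ck k f ==> Ck k g ==> Ck k (%x. f x + g x)"
proof (induction k arbitrary: f g)
 case (Suc k)
 have "((%x. f x + g x) has_derivative (%h. grad f x \<bullet> h + grad g x \<bullet> h)) (at x)" for x
  using has_derivative_add[OF Ck_has_derivative[OF Suc.prems(1)] Ck_has_derivative[OF Suc.prems(2)]] .
 then show ?case
  by (rule Ck_SucI) (use Suc in \<open>auto simp: grad_axis\<close>)
qed (auto intro: continuous_intros)

lemma Ck_mult: "Ck k f ==> Ck k g ==> Ck k (%x. f x * g x)"
proof (induction k arbitrary: f g)
 case (Suc k)
 have "((%x. f x * g x) has_derivative (%h. f x * (grad g x \<bullet> h) + (grad f x \<bullet> h) * g x)) (at x)" for x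
  using has_derivative_mult[OF Ck_has_derivative[OF Suc.prems(1)] Ck_has_derivative[OF Suc.prems(2)]] .
 then show ?case
  by (rule Ck_SucI)
   (use Suc in \<open>auto simp: grad_axis intro!: Ck_add Suc.IH Ck_Suc_imp[OF Suc.prems(1)] Ck_Suc_imp[OF Suc.prems(2)]\<close>)
qed (auto intro: continuous_intros)

lemma Ck_component: "Ck k (%x::real^'n. x $ i)"
proof (cases k)
 case (Suc j)
 have "((%x::real^'n. x $ i) has_derivative (%h. h $ i)) (at x)" for x
  by (rule bounded_linear_imp_has_derivative) (rule bounded_linear_vec_nth)
 from Ck_SucI[OF this, of j] show ?thesis unfolding Suc by (simp add: Ck_const)
qed (auto intro: continuous_intros)

lemma Ck_reflect: "Ck k f ==> Ck k (%y. f (x - y))"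
proof (induction k arbitrary: f)
 case 0
 then show ?case by (auto intro!: continuous_intros continuous_on_compose2[of UNIV f])
next
 case (Suc k)
 have "((%y. f (x - y)) has_derivative (%h. grad f (x - y) \<bullet> (- h))) (at y)" for y
  by (rule has_derivative_compose[OF _ Ck_has_derivative[OF Suc.prems]]) (auto intro!: derivative_eq_intros)
 then show ?case
 proof (rule Ck_SucI)
  show "Ck k (%y. grad f (x - y) \<bullet> - axis i 1)" for i
   using Ck_mult[OF Ck_const[of k "-1"] Suc.IH[of "pderiv f i"]] Suc.prems by (simp add: grad_axis)
 qed
qed

lemma pderiv_reflect:
 assumes "C1 f"
 shows "pderiv (%y. f (x - y)) i y = - pderiv f i (x - y)"
proof -
 have "((%y. f (x - y)) has_derivative (%h. grad f (x - y) \<bullet> (- h))) (at y)"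
  by (rule has_derivative_compose[OF _ C1D[OF assms]]) (auto intro!: derivative_eq_intros)
 from pderiv_eq[OF this, of i] show ?thesis by (simp add: grad_axis)
qed

definition flat :: "nat => real => real" where
 "flat m t = (if t > 0 then (1 / t) ^ m * exp (- (1 / t)) else 0)"

lemma flat_bound: "\<bar>flat m t\<bar> <= fact (m + 2) * t\<^sup>2"
proof (cases "t > 0")
 case True
 define y where "y = 1 / t"
 have y: "y > 0" "t = 1 / y" using True by (auto simp: y_def)
 have "(\<Sum>k\<in>{m+2}. y ^ k /\<^sub>R fact k) <= (\<Sum>k. y ^ k /\<^sub>R fact k)"
  using y by (intro sum_le_suminf summable_exp_generic) auto
 then have "inverse (fact (m + 2)) * y ^ (m + 2) <= exp y" by (simp add: exp_def)
 then have "fact (m + 2) * (inverse (fact (m + 2)) * y ^ (m + 2)) <= fact (m + 2) * exp y"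
  by (rule mult_left_mono) simp
 then have "y ^ m * y\<^sup>2 <= fact (m + 2) * exp y"
  by (simp add: mult.assoc[symmetric] power_add del: fact_Suc power_Suc add_2_eq_Suc')
 then have "y ^ m * y\<^sup>2 * (exp (- y) * t\<^sup>2) <= fact (m + 2) * exp y * (exp (- y) * t\<^sup>2)"
  by (rule mult_right_mono) simp
 moreover have "y\<^sup>2 * t\<^sup>2 = 1" using y by (simp add: power2_eq_square)
 moreover have "exp y * exp (- y) = 1" by (simp add: exp_minus)
 ultimately have "y ^ m * exp (- y) <= fact (m + 2) * t\<^sup>2"
  by (metis (no_types, opaque_lifting) mult.assoc mult.commute mult.left_commute mult_1)
 then show ?thesis using True by (simp add: flat_def y_def)
qed (simp add: flat_def)

lemma flat_has_derivative_pos: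
 assumes t: "t > 0"
 shows "(flat m has_real_derivative - real m * flat (m + 1) t + flat (m + 2) t) (at t)"
proof -
 have "((%t. (1 / t) ^ m * exp (- (1 / t))) has_real_derivative
  (real m * ((1 / t) ^ (m - 1) * (- (1 / t)\<^sup>2))) * exp (- (1 / t)) + (1 / t) ^ m * (exp (- (1 / t)) * (1 / t)^2)) (at t)"
  using t by (auto intro!: derivative_eq_intros simp: power2_eq_square divide_inverse)
 moreover have "(real m * ((1 / t) ^ (m - 1) * (- (1 / t)\<^sup>2))) * exp (- (1 / t)) + (1 / t) ^ m * (exp (- (1 / t)) * (1 / t)^2)
  = - real m * flat (m + 1) t + flat (m + 2) t"
 proof (cases m)
  case 0
  then show ?thesis using t by (simp add: flat_def power2_eq_square)
 next
  case (Suc k)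
  have "(1 / t) ^ (m + 1) = (1 / t) ^ (m - 1) * (1 / t)^2" using Suc by (simp add: power2_eq_square)
  moreover have "(1 / t) ^ (m + 2) = (1 / t) ^ m * (1 / t)^2" by (rule power_add)
  ultimately show ?thesis using t by (simp only: flat_def if_True) (simp add: algebra_simps)
 qed
 ultimately have "((%t. (1 / t) ^ m * exp (- (1 / t))) has_real_derivative
   - real m * flat (m + 1) t + flat (m + 2) t) (at t)" by simp
 then show ?thesis
  by (rule has_field_derivative_transform_within_open[of _ _ _ "{0<..}"]) (use t in \<open>auto simp: flat_def\<close>)
qed

lemma flat_has_derivative_0: "(flat m has_real_derivative 0) (at 0)"
proof -
 have "((%h. flat m h / h) \<longlongrightarrow> 0) (at 0)"
 proof (rule Lim_null_comparison)
  show "\<forall>\<^sub>F h in at 0. norm (flat m h / h) <= fact (m + 2) * \<bar>h\<bar>"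
  proof (rule always_eventually, rule allI)
   fix h :: real
   have "\<bar>flat m h\<bar> / \<bar>h\<bar> <= fact (m + 2) * h\<^sup>2 / \<bar>h\<bar>"
    by (intro divide_right_mono flat_bound) simp
   also have "\<dots> = fact (m + 2) * \<bar>h\<bar>"
    by (cases "h = 0") (auto simp: power2_eq_square abs_if simp del: fact_Suc)
   finally show "norm (flat m h / h) <= fact (m + 2) * \<bar>h\<bar>" by (simp add: abs_divide)
  qed
  show "((%h::real. fact (m + 2) * \<bar>h\<bar>) \<longlongrightarrow> 0) (at 0)"
   by (auto intro!: tendsto_eq_intros)
 qed
 then show ?thesis by (simp add: DERIV_def flat_def)
qed

lemma flat_has_derivative:
 "(flat m has_real_derivative (- real m * flat (m + 1) t + flat (m + 2) t)) (at t)"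
proof -
 consider "t > 0" | "t < 0" | "t = 0" by linarith
 then show ?thesis
 proof cases
  case 2
  then have "((%t. 0) has_real_derivative (- real m * flat (m + 1) t + flat (m + 2) t)) (at t)"
   by (simp add: flat_def)
  then show ?thesis
   by (rule has_field_derivative_transform_within_open[of _ _ _ "{..<0}"]) (use 2 in \<open>auto simp: flat_def\<close>)
 next
  case 3
  then show ?thesis using flat_has_derivative_0[of m] by (simp add: flat_def)
 qed (rule flat_has_derivative_pos)
qed

lemma Ck_flat: "Ck k (%x::real^'n. flat m (c - x \<bullet> x))"
proof (induction k arbitrary: m)
 case 0
 have "isCont (flat m) t" for t using flat_has_derivative DERIV_isCont by blast
 then have "continuous_on UNIV (flat m)" by (simp add: continuous_at_imp_continuous_on)
 then show ?case by (auto intro!: continuous_on_compose2[of UNIV "flat m"] continuous_intros)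
next
 case (Suc k)
 have "((%x::real^'n. flat m (c - x \<bullet> x)) has_derivative
   (%h. (- real m * flat (m + 1) (c - x \<bullet> x) + flat (m + 2) (c - x \<bullet> x)) * (- (2 * (x \<bullet> h))))) (at x)" for x
  by (rule has_derivative_compose[OF _ flat_has_derivative[unfolded has_field_derivative_def]])
   (auto intro!: derivative_eq_intros simp: inner_commute)
 then show ?case
 proof (rule Ck_SucI)
  fix i
  have "Ck k (%x::real^'n. (- real m * flat (m + 1) (c - x \<bullet> x) + flat (m + 2) (c - x \<bullet> x)) * ((- 2) * x $ i))"
   by (intro Ck_mult Ck_add Ck_const Ck_component Suc.IH)
  then show "Ck k (%x::real^'n. (- real m * flat (m + 1) (c - x \<bullet> x) + flat (m + 2) (c - x \<bullet> x)) *
    - (2 * (x \<bullet> axis i 1)))"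
   by (simp add: inner_axis)
 qed
qed

definition bump :: "real => real^'n => real" where
 "bump e x = flat 0 (e\<^sup>2 - x \<bullet> x)"

lemma bump_bounds: "0 <= bump e x" "bump e x <= 1"
 by (auto simp: bump_def flat_def)

lemma bump_eq_0_iff:
 assumes "e > 0"
 shows "bump e x = 0 \<longleftrightarrow> e <= norm x"
proof -
 have "e\<^sup>2 - x \<bullet> x > 0 \<longleftrightarrow> norm x < e"
  using assms power_strict_mono[of "norm x" e 2] power2_less_imp_less[of "norm x" e]
  by (auto simp: dot_square_norm)
 then show ?thesis by (auto simp: bump_def flat_def)
qed

lemma Ck_bump: "Ck k (bump e)"
 unfolding bump_def[abs_def] by (rule Ck_flat)

lemma bump_measurable [measurable]: "bump e : Borel"
 using Ck_bump Ck_C1 C1_measurable by blast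

lemma bump_integral:
 assumes "e > 0"
 obtains r where "r > 0" "(NN z. ennreal (bump e (z::real^'n))) = ennreal r"
proof -
 let ?I = "NN z. ennreal (bump e (z::real^'n))"
 have "?I <= (NN z. ind (cball (0::real^'n) e) z)"
  using assms
  by (intro nn_integral_mono) (auto simp: indicator_def ennreal_le_1 bump_bounds bump_eq_0_iff[THEN iffD2])
 also have "\<dots> < \<infinity>" using emeasure_lborel_cball_finite[of "0::real^'n" e] by simp
 finally have finite: "?I < \<infinity>" .
 have "?I ~= 0"
 proof
  assume "?I = 0"
  then have "AEL z::real^'n. bump e z = 0"
   using bump_bounds(1) by (subst (asm) nn_integral_0_iff_AE) (auto simp: ennreal_eq_0_iff dest: antisym)
  then have "AEL z. z ~: ball (0::real^'n) e"
   by eventually_elim (use assms in \<open>simp add: bump_eq_0_iff\<close>)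
  then have "emeasure lborel (ball (0::real^'n) e) = 0"
   by (subst (asm) AE_iff_measurable[of "ball 0 e"]) auto
  then show False
   using content_ball_pos[of e "0::real^'n"] assms by (simp add: measure_def)
 qed
 then show thesis
  using finite that by (cases ?I) (auto simp: ennreal_eq_0_iff not_le)
qed

definition kernel :: "real => (real^'n => real) => bool" where
 "kernel e \<rho> \<longleftrightarrow> smooth \<rho> & (ALL z. 0 <= \<rho> z) & (ALL z. e <= norm z --> \<rho> z = 0) &
  (NN z. ennreal (\<rho> z)) = 1"

lemma kernel_exists:
 assumes "e > 0"
 shows "EX \<rho>::real^'n => real. kernel e \<rho>"
proof -
 obtain r where r: "r > 0" "(NN z. ennreal (bump e (z::real^'n))) = ennreal r"
  by (rule bump_integral[OF assms])
 have "(NN z. ennreal ((1 / r) * bump e (z::real^'n))) = ennreal (1 / r) * ennreal r"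
  using r by (subst r(2)[symmetric], subst nn_integral_cmult[symmetric]) (auto simp: ennreal_mult'[symmetric])
 also have "\<dots> = 1" using r by (simp add: ennreal_mult'[symmetric])
 finally have "(NN z. ennreal ((1 / r) * bump e (z::real^'n))) = 1" .
 moreover have "smooth (%x::real^'n. (1 / r) * bump e x)"
  unfolding smooth_def by (intro allI Ck_mult Ck_const Ck_bump)
 ultimately have "kernel e (%x::real^'n. (1 / r) * bump e x)"
  using assms r by (auto simp: kernel_def bump_bounds bump_eq_0_iff)
 then show ?thesis by blast
qed

lemma kernel_Ck: "kernel e \<rho> ==> Ck k \<rho>"
 by (simp add: kernel_def smooth_def)

lemma kernel_C1: "kernel e \<rho> ==> C1 \<rho>"
 using kernel_Ck Ck_C1 by blast

lemma kernel_supported: "kernel e \<rho> ==> supported_in \<rho> (cball 0 e)"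
 by (auto simp: kernel_def supported_in_def)

lemma test_funI:
 assumes "smooth \<phi>" "supported_in \<phi> K" "compact K" "K <= U"
 shows "test_fun U \<phi>"
proof -
 have "closure {x. \<phi> x ~= 0} <= K"
  using assms by (intro closure_minimal) (auto simp: supported_in_def intro: compact_imp_closed)
 then show ?thesis
  unfolding test_fun_def using assms
  by (meson bounded_subset closed_closure compact_eq_bounded_closed order_trans)
qed

lemma kernel_test_fun:
 assumes "kernel e \<rho>" "cball x e <= U"
 shows "test_fun U (%y. \<rho> (x - y))"
proof (rule test_funI)
 show "smooth (%y. \<rho> (x - y))"
  using assms by (auto simp: smooth_def intro: Ck_reflect kernel_Ck)
 show "supported_in (%y. \<rho> (x - y)) (cball x e)"
  using assms(1) by (auto simp: kernel_def supported_in_def dist_norm)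
qed (use assms in auto)

subsection \<open>Convolution\<close>

definition conv :: "(real^'n => real) => (real^'n => real) => real^'n => real" where
 "conv \<kappa> f x = (LBINT y. \<kappa> (x - y) * f y)"

lemma uniformly_continuous_compact_support:
 fixes f :: "'a::euclidean_space => 'b::real_normed_vector"
 assumes "continuous_on UNIV f" "compact K" "supported_in f K"
 shows "uniformly_continuous_on UNIV f"
 unfolding uniformly_continuous_on_def
proof (intro allI impI)
 fix \<epsilon> :: real assume "\<epsilon> > 0"
 obtain e where e: "K <= cball 0 e"
  using compact_imp_bounded[OF assms(2)] by (metis bounded_iff mem_cball_0 subsetI)
 have "uniformly_continuous_on (cball 0 (e + 1)) f"
  using assms by (intro compact_uniformly_continuous) (auto intro: continuous_on_subset)
 then obtain d where d: "d > 0" "!!x y. x : cball 0 (e+1) ==> y : cball 0 (e+1) ==> dist x y < d ==> dist (f x) (f y) < \<epsilon>"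
  using \<open>\<epsilon> > 0\<close> unfolding uniformly_continuous_on_def by metis
 have "dist (f y) (f x) < \<epsilon>" if "dist y x < min d 1" for x y
 proof (cases "x : cball 0 e \<or> y : cball 0 e")
  case True
  have "norm x <= norm y + dist y x" "norm y <= norm x + dist y x"
   by (metis dist_commute dist_norm norm_triangle_sub)+
  then show ?thesis using True that by (intro d) auto
 next
  case False
  then have "f x = 0" "f y = 0" using e by (auto intro!: supported_inD[OF assms(3)])
  then show ?thesis using \<open>\<epsilon> > 0\<close> by simp
 qed
 then show "EX d>0. ALL x:UNIV. ALL y:UNIV. dist y x < d --> dist (f y) (f x) < \<epsilon>"
  using d(1) by (intro exI[of _ "min d 1"]) auto
qed

lemma compact_support_modulus:
 fixes f :: "'a::euclidean_space => 'b::real_normed_vector"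
 assumes "continuous_on UNIV f" "compact K" "supported_in f K" "\<epsilon> > 0"
 obtains d where "d > 0" "!!a b. dist a b < d ==> dist (f a) (f b) < \<epsilon>"
 using uniformly_continuous_compact_support[OF assms(1-3)] assms(4)
 unfolding uniformly_continuous_on_def by (metis UNIV_I)

lemma bounded_compact_support:
 fixes f :: "'a::euclidean_space => 'b::real_normed_vector"
 assumes "continuous_on UNIV f" "compact K" "supported_in f K"
 obtains B where "B > 0" "!!z. norm (f z) <= B"
proof -
 have "bounded (f ` K)"
  using assms by (intro compact_imp_bounded compact_continuous_image) (auto intro: continuous_on_subset)
 then obtain B where "B > 0" "!!z. z : K ==> norm (f z) <= B" by (auto simp: bounded_pos)
 then show thesis using assms(3) that by (metis less_imp_le norm_zero supported_inD)
qed

lemma conv_integrable: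
 fixes \<kappa> f :: "real^'n => real"
 assumes "continuous_on UNIV \<kappa>" "compact K" "supported_in \<kappa> K" "integrable lborel f"
 shows "integrable lborel (%y. \<kappa> (x - y) * f y)"
proof -
 obtain B where B: "!!z. norm (\<kappa> z) <= B"
  using bounded_compact_support[OF assms(1-3)] by auto
 have [measurable]: "f : Borel" using assms(4) by auto
 have "continuous_on UNIV (%y. \<kappa> (x - y))"
  by (intro continuous_on_compose2[OF assms(1)] continuous_intros) auto
 then have [measurable]: "(%y. \<kappa> (x - y)) : Borel"
  by (rule borel_measurable_continuous_onI)
 show ?thesis
 proof (rule Bochner_Integration.integrable_bound)
  show "integrable lborel (%y. B * f y)" using assms(4) by simp
  show "AEL y. norm (\<kappa> (x - y) * f y) <= norm (B * f y)"
   using order_trans[OF B abs_ge_self] by (auto simp: abs_mult intro!: mult_right_mono)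
 qed measurable
qed

lemma conv_continuous:
 assumes \<kappa>: "continuous_on UNIV \<kappa>" "compact K" "supported_in \<kappa> K" and f: "integrable lborel f"
 shows "continuous_on UNIV (conv \<kappa> f)"
proof (rule uniformly_continuous_imp_continuous)
 define J where "J = (LBINT y. \<bar>f y\<bar>) + 1"
 have J: "J > 0" unfolding J_def by (simp add: add_nonneg_pos)
 note int = conv_integrable[OF \<kappa> f]
 show "uniformly_continuous_on UNIV (conv \<kappa> f)"
  unfolding uniformly_continuous_on_def
 proof (intro allI impI)
  fix \<epsilon> :: real assume "\<epsilon> > 0"
  obtain d where d: "d > 0" "!!a b. dist a b < d ==> dist (\<kappa> a) (\<kappa> b) < \<epsilon> / J"
   using compact_support_modulus[OF \<kappa>, of "\<epsilon> / J"] \<open>\<epsilon> > 0\<close> J by auto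
  have "dist (conv \<kappa> f a) (conv \<kappa> f b) < \<epsilon>" if "dist a b < d" for a b
  proof -
   have "conv \<kappa> f a - conv \<kappa> f b = (LBINT y. \<kappa> (a - y) * f y - \<kappa> (b - y) * f y)"
    unfolding conv_def using int by (simp add: Bochner_Integration.integral_diff)
   also have "\<bar>\<dots>\<bar> <= (LBINT y. (\<epsilon> / J) * \<bar>f y\<bar>)"
   proof (rule integral_abs_bound_integral)
    fix y
    have "\<bar>\<kappa> (a - y) - \<kappa> (b - y)\<bar> <= \<epsilon> / J"
     using d(2)[of "a - y" "b - y"] that by (simp add: dist_norm)
    from mult_right_mono[OF this abs_ge_zero[of "f y"]]
    show "\<bar>\<kappa> (a - y) * f y - \<kappa> (b - y) * f y\<bar> <= (\<epsilon> / J) * \<bar>f y\<bar>"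
     by (simp add: abs_mult[symmetric] left_diff_distrib)
   qed (use int f in auto)
   also have "\<dots> < (\<epsilon> / J) * J"
    using \<open>\<epsilon> > 0\<close> J f by (simp del: times_divide_eq_left) (auto intro!: mult_strict_left_mono simp: J_def)
   finally show ?thesis using J by (simp add: dist_real_def)
  qed
  then show "EX d>0. ALL x:UNIV. ALL y:UNIV. dist y x < d --> dist (conv \<kappa> f y) (conv \<kappa> f x) < \<epsilon>"
   using d(1) by blast
 qed
qed

lemma C1_linearization:
 assumes "C1 \<kappa>" "!!b. norm (b - a) <= norm h ==> norm (grad \<kappa> b - grad \<kappa> a) <= w"
 shows "\<bar>\<kappa> (a + h) - \<kappa> a - grad \<kappa> a \<bullet> h\<bar> <= norm h * w"
proof -
 have "norm (\<kappa> (a + h) - \<kappa> a - grad \<kappa> a \<bullet> (a + h - a)) <= norm (a + h - a) * w"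
 proof (rule differentiable_bound_linearization[where S="cball a (norm h)" and f'="%x h. grad \<kappa> x \<bullet> h"])
  show "a + t *. (a + h - a) : cball a (norm h)" if "t : {0..1}" for t
   using that by (auto simp: dist_norm mult_left_le_one_le)
  show "(\<kappa> has_derivative (%h. grad \<kappa> x \<bullet> h)) (at x within cball a (norm h))" for x
   using C1D[OF assms(1)] has_derivative_at_withinI by blast
  show "onorm ((%i. grad \<kappa> x \<bullet> i) - (%i. grad \<kappa> a \<bullet> i)) <= w" if "x : cball a (norm h)" for x
   unfolding fun_diff_def
  proof (rule onorm_le)
   fix i
   have "norm (grad \<kappa> x \<bullet> i - grad \<kappa> a \<bullet> i) = \<bar>(grad \<kappa> x - grad \<kappa> a) \<bullet> i\<bar>"
    by (simp add: inner_diff_left)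
   also have "\<dots> <= norm (grad \<kappa> x - grad \<kappa> a) * norm i" by (rule Cauchy_Schwarz_ineq2)
   also have "\<dots> <= w * norm i"
    using that by (intro mult_right_mono assms(2)) (auto simp: dist_norm norm_minus_commute)
   finally show "norm (grad \<kappa> x \<bullet> i - grad \<kappa> a \<bullet> i) <= w * norm i" .
  qed
 qed auto
 then show ?thesis by simp
qed

lemma conv_linearization:
 assumes \<kappa>: "C1 \<kappa>" "compact K" "supported_in \<kappa> K" and f: "integrable lborel f"
  and osc: "!!a b. norm (b - a) <= norm h ==> norm (grad \<kappa> b - grad \<kappa> a) <= w"
 shows "\<bar>conv \<kappa> f (x + h) - conv \<kappa> f x - (\<Sum>i\<in>UNIV. h $ i * conv (pderiv \<kappa> i) f x)\<bar> <= norm h * w * (LBINT y. \<bar>f y\<bar>)"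
proof -
 note int = conv_integrable[OF C1_continuous[OF \<kappa>(1)] \<kappa>(2,3) f]
  conv_integrable[OF C1_continuous_pderiv[OF \<kappa>(1)] \<kappa>(2) supported_in_pderiv[OF \<kappa>(3) compact_imp_closed[OF \<kappa>(2)]] f]
 let ?R = "%z. \<kappa> (x - z + h) - \<kappa> (x - z) - grad \<kappa> (x - z) \<bullet> h"
 have remainder: "\<kappa> (x + h - z) * f z - \<kappa> (x - z) * f z - (\<Sum>i\<in>UNIV. h $ i * (pderiv \<kappa> i (x - z) * f z)) = ?R z * f z" for z
  by (simp add: vec_inner_axis_sum grad_def algebra_simps sum_distrib_left sum_subtractf)
 have "integrable lborel (%z. \<kappa> (x + h - z) * f z - \<kappa> (x - z) * f z - (\<Sum>i\<in>UNIV. h $ i * (pderiv \<kappa> i (x - z) * f z)))"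
  using int by (intro Bochner_Integration.integrable_diff Bochner_Integration.integrable_sum
   Bochner_Integration.integrable_mult_right) auto
 then have int_remainder: "integrable lborel (%z. ?R z * f z)" by (simp only: remainder)
 have "conv \<kappa> f (x + h) - conv \<kappa> f x - (\<Sum>i\<in>UNIV. h $ i * conv (pderiv \<kappa> i) f x)
  = (LBINT z. \<kappa> (x + h - z) * f z - \<kappa> (x - z) * f z - (\<Sum>i\<in>UNIV. h $ i * (pderiv \<kappa> i (x - z) * f z)))"
  unfolding conv_def using int
  by (simp add: Bochner_Integration.integral_diff Bochner_Integration.integral_sum)
 also have "\<dots> = (LBINT z. ?R z * f z)" by (simp only: remainder)
 also have "\<bar>\<dots>\<bar> <= (LBINT z. (norm h * w) * \<bar>f z\<bar>)"
 proof (rule integral_abs_bound_integral[OF int_remainder])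
  show "\<bar>?R z * f z\<bar> <= (norm h * w) * \<bar>f z\<bar>" for z
   unfolding abs_mult by (intro mult_right_mono C1_linearization[OF \<kappa>(1) osc]) auto
 qed (use f in auto)
 finally show ?thesis by simp
qed

lemma conv_has_derivative:
 assumes \<kappa>: "C1 \<kappa>" "compact K" "supported_in \<kappa> K" and f: "integrable lborel f"
 shows "(conv \<kappa> f has_derivative (%h. (\<Sum>i\<in>UNIV. h $ i * conv (pderiv \<kappa> i) f x))) (at x)"
 unfolding has_derivative_at_alt
proof (intro conjI allI impI)
 show "bounded_linear (%h. \<Sum>i\<in>UNIV. h $ i * conv (pderiv \<kappa> i) f x)"
  by (intro bounded_linear_sum bounded_linear_mult_left[THEN bounded_linear_compose] bounded_linear_vec_nth)
 fix \<epsilon> :: real assume "\<epsilon> > 0"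
 define J where "J = (LBINT y. \<bar>f y\<bar>) + 1"
 have J: "J > 0" unfolding J_def by (simp add: add_nonneg_pos)
 obtain d where d: "d > 0" "!!a b. dist a b < d ==> dist (grad \<kappa> a) (grad \<kappa> b) < \<epsilon> / J"
  using compact_support_modulus[OF C1_continuous_grad[OF \<kappa>(1)] \<kappa>(2) supported_in_grad[OF \<kappa>(3) compact_imp_closed[OF \<kappa>(2)]], of "\<epsilon> / J"]
   \<open>\<epsilon> > 0\<close> J by auto
 have "norm (conv \<kappa> f y - conv \<kappa> f x - (\<Sum>i\<in>UNIV. (y - x) $ i * conv (pderiv \<kappa> i) f x)) <= \<epsilon> * norm (y - x)"
  if "norm (y - x) < d" for y
 proof -
  have "norm (conv \<kappa> f (x + (y - x)) - conv \<kappa> f x - (\<Sum>i\<in>UNIV. (y - x) $ i * conv (pderiv \<kappa> i) f x))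
   <= norm (y - x) * (\<epsilon> / J) * (LBINT y. \<bar>f y\<bar>)"
   unfolding real_norm_def
   by (rule conv_linearization[OF assms]) (use d(2) that in \<open>force simp: dist_norm intro!: less_imp_le\<close>)
  also have "\<dots> <= norm (y - x) * (\<epsilon> / J) * J" using \<open>\<epsilon> > 0\<close> J by (intro mult_left_mono) (auto simp: J_def)
  finally show ?thesis using J by (simp add: mult.commute)
 qed
 then show "EX d>0. ALL y. norm (y - x) < d --> norm (conv \<kappa> f y - conv \<kappa> f x - (\<Sum>i\<in>UNIV. (y - x) $ i * conv (pderiv \<kappa> i) f x)) <= \<epsilon> * norm (y - x)"
  using d(1) by blast
qed

lemma conv_pderiv:
 assumes "C1 \<kappa>" "compact K" "supported_in \<kappa> K" "integrable lborel f"
 shows "pderiv (conv \<kappa> f) i x = conv (pderiv \<kappa> i) f x"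
 using pderiv_eq[OF conv_has_derivative[OF assms, of x], of i]
 by (simp add: axis_def if_distrib[of "%t. t * _"] cong: if_cong)

lemma conv_Ck:
 assumes "Ck k \<kappa>" "compact K" "supported_in \<kappa> K" "integrable lborel f"
 shows "Ck k (conv \<kappa> f)"
 using assms(1,3)
proof (induction k arbitrary: \<kappa>)
 case 0
 then show ?case using conv_continuous[OF _ assms(2) 0(2) assms(4)] by simp
next
 case (Suc k)
 have C: "C1 \<kappa>" using Suc.prems Ck_C1 by blast
 have "pderiv (conv \<kappa> f) i = conv (pderiv \<kappa> i) f" for i
  using conv_pderiv[OF C assms(2) Suc.prems(2) assms(4)] by blast
 moreover have "supported_in (pderiv \<kappa> i) K" for i
  by (rule supported_in_pderiv[OF Suc.prems(2) compact_imp_closed[OF assms(2)]])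
 ultimately have "Ck k (pderiv (conv \<kappa> f) i)" for i
  using Suc.IH[of "pderiv \<kappa> i"] Suc.prems(1) by simp
 then show ?case
  using conv_has_derivative[OF C assms(2) Suc.prems(2) assms(4)] by (auto simp: differentiable_def)
qed

lemma conv_kernel_smooth:
 assumes "kernel e \<rho>" "integrable lborel f"
 shows "smooth (conv \<rho> f)"
 unfolding smooth_def
 using conv_Ck[OF kernel_Ck[OF assms(1)] compact_cball kernel_supported[OF assms(1)] assms(2)] by blast

subsection \<open>Square integrals\<close>

lemma ennreal_tendsto_0I:
 fixes X :: "'a => ennreal"
 assumes "!!e::real. e > 0 ==> \<forall>\<^sub>F n in F. X n <= ennreal e"
 shows "(X \<longlongrightarrow> 0) F"
proof (rule order_tendstoI)
 fix a :: ennreal assume "0 < a"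
 then obtain b where b: "0 < b" "b < a" using dense by blast
 then obtain r where r: "b = ennreal r" "r > 0" by (cases b) (auto simp: top_unique)
 from assms[OF r(2)] show "\<forall>\<^sub>F n in F. X n < a"
  by eventually_elim (use b r in auto)
qed simp

lemma ennreal_tendsto_0D:
 fixes X :: "'a => ennreal"
 assumes "(X \<longlongrightarrow> 0) F" "e > 0"
 shows "\<forall>\<^sub>F n in F. X n < ennreal e"
 using order_tendstoD(2)[OF assms(1), of "ennreal e"] assms(2) by simp

lemma ennreal_tendsto_0_le:
 fixes X :: "'a => ennreal"
 assumes "(X \<longlongrightarrow> 0) F" "!!n. Y n <= X n"
 shows "(Y \<longlongrightarrow> 0) F"
 by (rule tendsto_sandwich[OF _ _ tendsto_const assms(1)]) (auto simp: assms(2))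

lemma ennreal_tendsto_0_lincomb:
 fixes X Y :: "'a => ennreal"
 assumes "(X \<longlongrightarrow> 0) F" "(Y \<longlongrightarrow> 0) F" "a < \<infinity>" "b < \<infinity>"
 shows "((%n. a * X n + b * Y n) \<longlongrightarrow> 0) F"
 using tendsto_add[OF ennreal_tendsto_cmult[OF _ assms(1), of a] ennreal_tendsto_cmult[OF _ assms(2), of b]] assms(3,4)
 by simp

text \<open>\<open>L2 S f\<close> is the square of the \<open>L\<^sup>2(S)\<close> norm.\<close>

definition L2 :: "'a::euclidean_space set => ('a => 'b::real_normed_vector) => ennreal" where
 "L2 S f = (NN x. ennreal ((norm (f x))^2) * ind S x)"

lemma L2_mono_set: "S <= T ==> L2 S f <= L2 T f"
 unfolding L2_def by (intro nn_integral_mono mult_left_mono) (auto simp: indicator_def)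

lemma L2_mono:
 assumes "!!x. x : S ==> norm (f x) <= norm (g x)"
 shows "L2 S f <= L2 S g"
 unfolding L2_def
 by (intro nn_integral_mono) (auto simp: indicator_def assms intro!: ennreal_leI power_mono)

lemma L2_cong_AE:
 assumes "AE x\<in>S in lborel. norm (f x) = norm (g x)"
 shows "L2 S f = L2 S g"
 unfolding L2_def
 by (intro nn_integral_cong_AE, use assms in eventually_elim) (auto simp: indicator_def)

lemma L2_minus_commute: "L2 S (%x. f x - g x) = L2 S (%x. g x - f x)"
 by (simp add: L2_def norm_minus_commute)

lemma norm_add_square_le:
 "(norm (a + b))^2 <= 2 * (norm a)^2 + 2 * (norm (b::'a::real_normed_vector))^2"
proof -
 have "(norm (a + b))^2 <= (norm a + norm b)^2"
  by (intro power_mono norm_triangle_ineq) simp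
 also have "\<dots> <= 2 * (norm a)^2 + 2 * (norm b)^2"
  using sum_squares_bound[of "norm a" "norm b"] by (simp add: power2_sum)
 finally show ?thesis .
qed

lemma L2_add:
 fixes f g :: "'a::euclidean_space => 'b::euclidean_space"
 assumes [measurable]: "f : Borel" "g : Borel" "S : sets borel"
 shows "L2 S (%x. f x + g x) <= 2 * L2 S f + 2 * L2 S g"
proof -
 have "L2 S (%x. f x + g x) <= (NN x. 2 * (ennreal ((norm (f x))^2) * ind S x) + 2 * (ennreal ((norm (g x))^2) * ind S x))"
  unfolding L2_def
 proof (intro nn_integral_mono)
  fix x
  have "ennreal ((norm (f x + g x))^2) <= ennreal (2 * (norm (f x))^2 + 2 * (norm (g x))^2)"
   by (intro ennreal_leI norm_add_square_le)
  also have "\<dots> = 2 * ennreal ((norm (f x))^2) + 2 * ennreal ((norm (g x))^2)"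
   by (simp add: ennreal_plus ennreal_mult' ennreal_numeral)
  finally show "ennreal ((norm (f x + g x))^2) * ind S x <=
    2 * (ennreal ((norm (f x))^2) * ind S x) + 2 * (ennreal ((norm (g x))^2) * ind S x)"
   by (auto simp: indicator_def)
 qed
 also have "\<dots> = 2 * L2 S f + 2 * L2 S g"
  unfolding L2_def by (subst nn_integral_add) (auto simp: nn_integral_cmult)
 finally show ?thesis .
qed

lemma L2_triangle:
 fixes f g h :: "'a::euclidean_space => 'b::euclidean_space"
 assumes "f : Borel" "g : Borel" "h : Borel" "S : sets borel"
 shows "L2 S (%x. f x - h x) <= 2 * L2 S (%x. f x - g x) + 2 * L2 S (%x. g x - h x)"
 using L2_add[of "%x. f x - g x" "%x. g x - h x" S] assms by simp

lemma L2_bound_mult: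
 fixes f :: "'a::euclidean_space => 'b::euclidean_space"
 assumes [measurable]: "f : Borel" "S : sets borel"
  and "!!x. x : S ==> norm (h x) <= M * norm (f x)" "0 <= M"
 shows "L2 S h <= ennreal (M\<^sup>2) * L2 S f"
proof -
 have "L2 S h <= (NN x. ennreal (M\<^sup>2) * (ennreal ((norm (f x))^2) * ind S x))"
  unfolding L2_def
 proof (intro nn_integral_mono)
  fix x
  show "ennreal ((norm (h x))^2) * ind S x <= ennreal (M\<^sup>2) * (ennreal ((norm (f x))^2) * ind S x)"
   using power_mono[OF assms(3)[of x], of 2] assms(4)
   by (auto simp: indicator_def power_mult_distrib ennreal_mult'[symmetric] intro!: ennreal_leI)
 qed
 also have "\<dots> = ennreal (M\<^sup>2) * L2 S f"
  unfolding L2_def by (subst nn_integral_cmult) auto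
 finally show ?thesis .
qed

lemma L2_bounded:
 assumes "!!x. x : S ==> norm (h x) <= M" "0 <= M" and [measurable]: "S : sets borel"
 shows "L2 S h <= ennreal (M\<^sup>2) * emeasure lborel S"
proof -
 have "L2 S h <= (NN x. ennreal (M\<^sup>2) * ind S x)"
  unfolding L2_def
  by (intro nn_integral_mono) (auto simp: indicator_def intro!: ennreal_leI power_mono assms)
 also have "\<dots> = ennreal (M\<^sup>2) * emeasure lborel S" by (subst nn_integral_cmult) auto
 finally show ?thesis .
qed

lemma L2_finite_if_close:
 fixes f g :: "'a::euclidean_space => 'b::euclidean_space"
 assumes "f : Borel" "g : Borel" "S : sets borel"
  "L2 S (%x. f x - g x) < \<infinity>" "L2 S f < \<infinity>"
 shows "L2 S g < \<infinity>"
proof -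
 have "L2 S g <= 2 * L2 S f + 2 * L2 S (%x. g x - f x)"
  using L2_add[of f "%x. g x - f x" S] assms by simp
 also have "\<dots> < \<infinity>" using assms by (simp add: L2_minus_commute[of S g f] ennreal_mult_less_top)
 finally show ?thesis .
qed

lemma L2_add_finite:
 fixes f g :: "'a::euclidean_space => 'b::euclidean_space"
 assumes "f : Borel" "g : Borel" "S : sets borel" "L2 S f < \<infinity>" "L2 S g < \<infinity>"
 shows "L2 S (%x. f x + g x) < \<infinity>"
 using le_less_trans[OF L2_add[OF assms(1-3)]] assms(4,5) by (simp add: ennreal_mult_less_top)

lemma L2_bound_mult_finite:
 fixes f :: "'a::euclidean_space => 'b::euclidean_space"
 assumes "f : Borel" "S : sets borel" "L2 S f < \<infinity>"
  and "!!x. x : S ==> norm (h x) <= M * norm (f x)" "0 <= M"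
 shows "L2 S h < \<infinity>"
 using le_less_trans[OF L2_bound_mult[OF assms(1,2,4,5)]] assms(3) by (simp add: ennreal_mult_less_top)

lemma L2_bounded_finite:
 assumes "!!x. x : S ==> norm (h x) <= M" "0 <= M" "S : sets borel" "emeasure lborel S < \<infinity>"
 shows "L2 S h < \<infinity>"
 using le_less_trans[OF L2_bounded[OF assms(1-3)]] assms(4) by (simp add: ennreal_mult_less_top)

lemma L2_dominated:
 fixes f :: "nat => 'a::euclidean_space => 'b::euclidean_space"
 assumes [measurable]: "!!j. f j : Borel" "h : Borel" "S : sets borel"
  and dom: "!!j x. x : S ==> norm (f j x) <= norm (h x)" "L2 S h < \<infinity>"
  and lim: "AE x\<in>S in lborel. (%j. f j x) ---> 0"
 shows "(%j. L2 S (f j)) ---> 0"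
proof -
 have "(%j. NN x. ennreal ((norm (f j x))^2) * ind S x) ---> (\<integral>\<^sup>+x. 0 \<partial>(lborel :: 'a measure))"
 proof (rule nn_integral_dominated_convergence[where w="%x. ennreal ((norm (h x))^2) * ind S x"])
  show "AEL x. ennreal ((norm (f j x))^2) * ind S x <= ennreal ((norm (h x))^2) * ind S x" for j
   by (auto simp: indicator_def intro!: ennreal_leI power_mono dom)
  show "(NN x. ennreal ((norm (h x))^2) * ind S x) < \<infinity>" using dom(2) by (simp add: L2_def)
  show "AEL x. (%i. ennreal ((norm (f i x))^2) * ind S x) ---> 0"
   using lim
  proof eventually_elim
   fix x assume "x : S --> (%j. f j x) ---> 0"
   then have "(%i. ennreal ((norm (f i x))^2)) ---> ennreal 0" if "x : S"
    using that by (intro tendsto_ennrealI) (auto intro!: tendsto_eq_intros)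
   then show "(%i. ennreal ((norm (f i x))^2) * ind S x) ---> 0" by (cases "x : S") auto
  qed
 qed measurable
 then show ?thesis by (simp add: L2_def)
qed

lemma L1_AE_subseq:
 fixes f :: "nat => 'a::euclidean_space => real"
 assumes [measurable]: "!!j. f j : Borel" "S : sets borel"
  and lim: "(%j. NN x. ennreal \<bar>f j x\<bar> * ind S x) ---> 0"
 obtains r :: "nat => nat" where "strict_mono r" "AE x\<in>S in lborel. (%j. f (r j) x) ---> 0"
proof -
 obtain N where N: "!!j. j \<ge> N ==> (NN x. ennreal \<bar>f j x\<bar> * ind S x) < 1"
  using ennreal_tendsto_0D[OF lim, of 1] by (auto simp: eventually_sequentially)
 define q where "q j x = f (j + N) x * ind S x" for j x
 have [measurable]: "q j : Borel" for j unfolding q_def by measurable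
 have norm_q: "(NN x. ennreal (norm (q j x))) = (NN x. ennreal \<bar>f (j + N) x\<bar> * ind S x)" for j
  unfolding q_def by (intro nn_integral_cong) (auto simp: indicator_def)
 have int: "integrable lborel (q j)" for j
  using N[of "j + N"] norm_q[of j] by (intro integrableI_bounded) (auto intro: less_trans[OF _ ennreal_one_less_top])
 have "ennreal (LBINT x. norm (q j x)) = (NN x. ennreal \<bar>f (j + N) x\<bar> * ind S x)" for j
  using nn_integral_eq_integral[OF integrable_norm[OF int[of j]]] norm_q[of j] by simp
 then have "(%j. ennreal (LBINT x. norm (q j x))) ---> ennreal 0"
  using LIMSEQ_ignore_initial_segment[OF lim, of N] by simp
 then have "(%j. LBINT x. norm (q j x)) ---> 0" by (subst (asm) tendsto_ennreal_iff) auto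
 from tendsto_L1_AE_subseq[OF int this] obtain r where r: "strict_mono r" "AEL x. (%n. q (r n) x) ---> 0"
  by blast
 from r(2) have "AE x\<in>S in lborel. (%j. f (r j + N) x) ---> 0" by eventually_elim (auto simp: q_def)
 then show thesis using r(1) by (intro that[of "%j. r j + N"]) (auto simp: strict_mono_def)
qed

lemma L2_AE_subseq:
 fixes f :: "nat => 'a::euclidean_space => 'b::euclidean_space"
 assumes [measurable]: "!!j. f j : Borel" "S : sets borel" and lim: "(%j. L2 S (f j)) ---> 0"
 obtains r :: "nat => nat" where "strict_mono r" "AE x\<in>S in lborel. (%j. f (r j) x) ---> 0"
proof (rule L1_AE_subseq[of "%j x. (norm (f j x))^2" S])
 fix r :: "nat => nat"
 assume r: "strict_mono r" "AE x\<in>S in lborel. (%j. (norm (f (r j) x))^2) ---> 0"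
 have "AE x\<in>S in lborel. (%j. f (r j) x) ---> 0"
  using r(2)
 proof (eventually_elim, intro impI)
  fix x assume "x : S --> (%j. (norm (f (r j) x))^2) ---> 0" "x : S"
  then have "(%j. sqrt ((norm (f (r j) x))^2)) ---> sqrt 0" by (intro tendsto_real_sqrt) auto
  then show "(%j. f (r j) x) ---> 0" by (simp add: tendsto_norm_zero_iff)
 qed
 with r(1) show thesis by (rule that)
qed (use lim in \<open>auto simp: L2_def\<close>)

subsection \<open>Translations and mollification\<close>

lemma nn_integral_affine:
 fixes f :: "'a::euclidean_space => ennreal"
 assumes [measurable]: "f : Borel" and "c ~= 0"
 shows "(NN x. f x) = ennreal (\<bar>c\<bar> ^ DIM('a)) * (NN x. f (t + c *. x))"
 by (subst lborel_affine[OF assms(2), of t])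
  (simp add: nn_integral_density nn_integral_distr nn_integral_cmult)

lemma nn_integral_shift:
 fixes f :: "'a::euclidean_space => ennreal"
 assumes "f : Borel"
 shows "(NN x. f (x + h)) = (NN x. f x)"
 using nn_integral_affine[OF assms, of 1 h] by (simp add: add.commute)

lemma shift_open_tendsto:
 fixes U :: "'a::euclidean_space set"
 assumes "open U" and fin: "emeasure lborel U < \<infinity>" and h: "h ---> 0"
 shows "(%n. NN x. ind U x * (1 - ind U (x + h n))) ---> 0"
proof -
 have [measurable]: "U : sets borel" using assms by auto
 have "(%n. NN x. ind U x * (1 - ind U (x + h n))) ---> (\<integral>\<^sup>+x. 0 \<partial>(lborel :: 'a measure))"
 proof (rule nn_integral_dominated_convergence[where w="ind U"])
  show "AEL x. (%n. ind U x * (1 - ind U (x + h n)) :: ennreal) ---> 0"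
  proof (rule AE_I2)
   fix x
   show "(%n. ind U x * (1 - ind U (x + h n)) :: ennreal) ---> 0"
   proof (cases "x : U")
    case True
    have "(%n. x + h n) ---> x" using h by (auto intro!: tendsto_eq_intros)
    then have "\<forall>\<^sub>F n in sequentially. x + h n : U"
     using topological_tendstoD True assms(1) by blast
    then have "\<forall>\<^sub>F n in sequentially. (ind U x * (1 - ind U (x + h n)) :: ennreal) = 0"
     by eventually_elim simp
    then show ?thesis by (rule tendsto_eventually)
   qed simp
  qed
  show "(NN x. ind U x) < \<infinity>" using fin by simp
 qed (auto simp: indicator_def)
 then show ?thesis by simp
qed

lemma shift_indicator_bound:
 fixes A U :: "'a::euclidean_space set"
 assumes [measurable]: "A : sets borel" "U : sets borel" and subset: "A <= U" and gap: "emeasure lborel (U - A) <= d"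
 shows "(NN x. ennreal \<bar>ind A (x + h) - ind A x\<bar>)
  <= (NN x. ind U x * (1 - ind U (x + h))) + (NN x. ind U x * (1 - ind U (x + - h))) + 2 * d"
proof -
 have "(NN x. ennreal \<bar>ind A (x + h) - ind A x\<bar>) <= (NN x. ind U x * (1 - ind U (x + h))
   + ind U (x + h) * (1 - ind U x) + ind (U - A) (x + h) + ind (U - A) x)"
  using subset by (intro nn_integral_mono) (auto simp: indicator_def)
 also have "\<dots> = (NN x. ind U x * (1 - ind U (x + h))) + (NN x. ind U (x + h) * (1 - ind U x))
  + (NN x. ind (U - A) (x + h)) + (NN x. ind (U - A) x)"
  by (simp add: nn_integral_add)
 also have "(NN x. ind (U - A) (x + h)) = emeasure lborel (U - A)"
  by (subst nn_integral_shift[of "ind (U - A)"]) auto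
 also have "(NN x. ind U (x + h) * (1 - ind U x)) = (NN x. ind U x * (1 - ind U (x + - h)))"
  using nn_integral_shift[of "%x. ind U x * (1 - ind U (x + - h))" h] by simp
 finally show ?thesis
  using gap by (elim order_trans) (auto simp: add.assoc mult_2 intro!: add_mono)
qed

lemma shift_indicator_tendsto:
 fixes A :: "'a::euclidean_space set"
 assumes A: "A : sets borel" "emeasure lborel A < \<infinity>" and h: "h ---> 0"
 shows "(%n. NN x. ennreal \<bar>ind A (x + h n) - ind A x\<bar>) ---> 0"
proof (rule ennreal_tendsto_0I)
 fix e :: real assume "e > 0"
 define d where "d = e / 4"
 have d: "d > 0" using \<open>e > 0\<close> by (simp add: d_def)
 obtain U where U: "open U" "A <= U" and gap: "emeasure lebesgue (U - A) < ennreal d"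
  by (rule sets_lebesgue_outer_open[of A d]) (use d A in auto)
 have gap: "emeasure lborel (U - A) < ennreal d" using gap A U by simp
 have "emeasure lborel U <= emeasure lborel A + emeasure lborel (U - A)"
  using emeasure_subadditive[of A lborel "U - A"] A U by (simp add: Un_absorb1)
 also have "\<dots> < \<infinity>" using A(2) less_trans[OF gap ennreal_less_top] by simp
 finally have finite: "emeasure lborel U < \<infinity>" .
 let ?leave = "%n. NN x. ind U x * (1 - ind U (x + h n))" and ?return = "%n. NN x. ind U x * (1 - ind U (x + - h n))"
 have leave: "?leave ---> 0" by (rule shift_open_tendsto[OF U(1) finite h])
 have return: "?return ---> 0" using shift_open_tendsto[OF U(1) finite, of "%n. - h n"] tendsto_minus[OF h] by simp
 show "\<forall>\<^sub>F n in sequentially. (NN x. ennreal \<bar>ind A (x + h n) - ind A x\<bar>) <= ennreal e"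
  using ennreal_tendsto_0D[OF leave d] ennreal_tendsto_0D[OF return d]
 proof eventually_elim
  fix n assume small: "?leave n < ennreal d" "?return n < ennreal d"
  have "(NN x. ennreal \<bar>ind A (x + h n) - ind A x\<bar>) <= ?leave n + ?return n + 2 * ennreal d"
   by (rule shift_indicator_bound) (use A U gap in auto)
  also have "\<dots> <= ennreal d + ennreal d + 2 * ennreal d"
   using small by (intro add_mono) auto
  also have "\<dots> = ennreal e" using d by (subst mult_2) (simp add: d_def ennreal_plus[symmetric] del: ennreal_plus)
  finally show "(NN x. ennreal \<bar>ind A (x + h n) - ind A x\<bar>) <= ennreal e" .
 qed
qed

lemma shift_L1_diff_le:
 fixes f s :: "'a::euclidean_space => real"
 assumes [measurable]: "f : Borel" "s : Borel"
 shows "(NN x. ennreal \<bar>f (x + h) - f x\<bar>) <= (NN x. ennreal \<bar>s (x + h) - s x\<bar>) + 2 * (NN x. ennreal \<bar>f x - s x\<bar>)"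
proof -
 have "(NN x. ennreal \<bar>f (x + h) - f x\<bar>) <=
   (NN x. ennreal \<bar>f (x + h) - s (x + h)\<bar> + ennreal \<bar>s (x + h) - s x\<bar> + ennreal \<bar>f x - s x\<bar>)"
  by (auto simp: ennreal_plus[symmetric] simp del: ennreal_plus intro!: nn_integral_mono ennreal_leI)
 also have "\<dots> = (NN x. ennreal \<bar>f (x + h) - s (x + h)\<bar>) + (NN x. ennreal \<bar>s (x + h) - s x\<bar>) + (NN x. ennreal \<bar>f x - s x\<bar>)"
  by (simp add: nn_integral_add)
 also have "(NN x. ennreal \<bar>f (x + h) - s (x + h)\<bar>) = (NN x. ennreal \<bar>f x - s x\<bar>)"
  by (rule nn_integral_shift[of "%x. ennreal \<bar>f x - s x\<bar>"]) measurable
 finally show ?thesis by (simp add: mult_2 add_ac)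
qed

lemma shift_L1_limit:
 fixes f :: "'a::euclidean_space => real"
 assumes [measurable]: "f : Borel" "!!i. s i : Borel"
  and approx: "(%i::nat. NN x. ennreal \<bar>f x - s i x\<bar>) ---> 0"
  and shift: "!!i. (%n. NN x. ennreal \<bar>s i (x + h n) - s i x\<bar>) ---> 0"
 shows "(%n. NN x. ennreal \<bar>f (x + h n) - f x\<bar>) ---> 0"
proof (rule ennreal_tendsto_0I)
 fix e :: real assume "e > 0"
 then have third: "e / 3 > 0" by simp
 obtain i where i: "(NN x. ennreal \<bar>f x - s i x\<bar>) < ennreal (e / 3)"
  using ennreal_tendsto_0D[OF approx third] by (auto simp: eventually_sequentially)
 show "\<forall>\<^sub>F n in sequentially. (NN x. ennreal \<bar>f (x + h n) - f x\<bar>) <= ennreal e"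
  using ennreal_tendsto_0D[OF shift[of i] third]
 proof eventually_elim
  fix n assume "(NN x. ennreal \<bar>s i (x + h n) - s i x\<bar>) < ennreal (e / 3)"
  then have "(NN x. ennreal \<bar>s i (x + h n) - s i x\<bar>) + 2 * (NN x. ennreal \<bar>f x - s i x\<bar>) <= ennreal (e / 3) + 2 * ennreal (e / 3)"
   using i by (intro add_mono mult_left_mono) auto
  also have "\<dots> = ennreal e" using \<open>e > 0\<close> by (subst mult_2) (simp add: ennreal_plus[symmetric] del: ennreal_plus)
  finally show "(NN x. ennreal \<bar>f (x + h n) - f x\<bar>) <= ennreal e"
   using shift_L1_diff_le[of f "s i" "h n"] by (elim order_trans[rotated]) measurable
 qed
qed

lemma shift_L1_tendsto:
 fixes f :: "'a::euclidean_space => real"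
 assumes "integrable lborel f" and h: "h ---> 0"
 shows "(%n. NN x. ennreal \<bar>f (x + h n) - f x\<bar>) ---> 0"
 using assms(1)
proof (induction rule: integrable_induct)
 case (base A c)
 then have [measurable]: "A : sets borel" by simp
 have "(NN x. ennreal \<bar>ind A (x + h n) *. c - ind A x *. c\<bar>) = ennreal \<bar>c\<bar> * (NN x. ennreal \<bar>ind A (x + h n) - ind A x\<bar>)" for n
  by (subst nn_integral_cmult[symmetric]) (auto simp: ennreal_mult[symmetric] indicator_def intro!: nn_integral_cong)
 then show ?case
  using ennreal_tendsto_cmult[OF _ shift_indicator_tendsto[OF _ _ h], of "ennreal \<bar>c\<bar>" A] base by simp
next
 case (add f g)
 have [measurable]: "f : Borel" "g : Borel" using add by auto
 have "(NN x. ennreal \<bar>(f (x + h n) + g (x + h n)) - (f x + g x)\<bar>) <=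
   1 * (NN x. ennreal \<bar>f (x + h n) - f x\<bar>) + 1 * (NN x. ennreal \<bar>g (x + h n) - g x\<bar>)" for n
  unfolding mult_1 by (subst nn_integral_add[symmetric])
   (auto simp: ennreal_plus[symmetric] simp del: ennreal_plus intro!: nn_integral_mono ennreal_leI)
 then show ?case
  by (intro ennreal_tendsto_0_le[OF ennreal_tendsto_0_lincomb[OF add.IH(1,2), of 1 1]]) auto
next
 case (lim f s)
 have [measurable]: "f : Borel" "!!i. s i : Borel" using lim by auto
 have "(%i. NN x. norm (f x - s i x)) ---> 0"
 proof (rule nn_integral_dominated_convergence_norm[where w="%x. 2 * norm (f x)"])
  have "(NN x. ennreal (2 * norm (f x))) = 2 * (NN x. ennreal (norm (f x)))"
   by (subst nn_integral_cmult[symmetric]) (auto simp: ennreal_mult')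
  also have "\<dots> < \<infinity>" using lim by (auto simp: integrable_iff_bounded ennreal_mult_less_top)
  finally show "(NN x. ennreal (2 * norm (f x))) < \<infinity>" .
 qed (use lim in auto)
 then show ?case by (intro shift_L1_limit[OF _ _ _ lim.IH(1)]) auto
qed

lemma diff_square_le_pos_neg_parts:
 fixes a b :: real
 shows "(a - b)^2 <= 2 * \<bar>(max a 0)\<^sup>2 - (max b 0)\<^sup>2\<bar> + 2 * \<bar>(max (- a) 0)\<^sup>2 - (max (- b) 0)\<^sup>2\<bar>"
proof -
 have nonneg: "\<bar>s - t\<bar>\<^sup>2 <= \<bar>s\<^sup>2 - t\<^sup>2\<bar>" if "0 <= s" "0 <= t" for s t :: real
 proof -
  have "\<bar>s - t\<bar> * \<bar>s - t\<bar> <= \<bar>s - t\<bar> * (s + t)" using that by (intro mult_left_mono) auto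
  also have "\<dots> = \<bar>(s - t) * (s + t)\<bar>" using that by (simp add: abs_mult)
  finally show ?thesis by (simp add: power2_eq_square algebra_simps)
 qed
 have "a - b = (max a 0 - max b 0) + (max (- b) 0 - max (- a) 0)" by (simp add: max_def)
 then have "(a - b)^2 <= 2 * (max a 0 - max b 0)^2 + 2 * (max (- b) 0 - max (- a) 0)^2"
  using norm_add_square_le[of "max a 0 - max b 0" "max (- b) 0 - max (- a) 0"] by simp
 then show ?thesis using nonneg[of "max a 0" "max b 0"] nonneg[of "max (- b) 0" "max (- a) 0"]
  by (simp add: abs_minus_commute[of "(max (- b) 0)^2"])
qed

lemma shift_L2_tendsto:
 fixes f :: "'a::euclidean_space => real"
 assumes [measurable]: "f : Borel" and fin: "L2 UNIV f < \<infinity>" and h: "h ---> 0"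
 shows "(%n. NN x. ennreal ((f (x + h n) - f x)^2)) ---> 0"
proof -
 define part where "part s x = (max (s * f x) 0)^2" for s :: real and x
 have [measurable]: "part s : Borel" for s unfolding part_def by measurable
 have int: "integrable lborel (part s)" if "s = 1 \<or> s = -1" for s
 proof (rule integrableI_nonneg)
  have "(NN x. ennreal (part s x)) <= (NN x. ennreal ((f x)^2))"
   using that by (intro nn_integral_mono ennreal_leI) (auto simp: part_def max_def)
  also have "\<dots> < \<infinity>" using fin by (simp add: L2_def)
  finally show "(NN x. ennreal (part s x)) < \<infinity>" .
 qed (auto simp: part_def)
 have "(NN x. ennreal ((f (x + h n) - f x)^2)) <=
   2 * (NN x. ennreal \<bar>part 1 (x + h n) - part 1 x\<bar>) + 2 * (NN x. ennreal \<bar>part (-1) (x + h n) - part (-1) x\<bar>)" for n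
 proof -
  have "(NN x. ennreal ((f (x + h n) - f x)^2)) <=
   (NN x. 2 * ennreal \<bar>part 1 (x + h n) - part 1 x\<bar> + 2 * ennreal \<bar>part (-1) (x + h n) - part (-1) x\<bar>)"
  proof (intro nn_integral_mono)
   fix x
   have "ennreal ((f (x + h n) - f x)^2) <= ennreal (2 * \<bar>part 1 (x + h n) - part 1 x\<bar> + 2 * \<bar>part (-1) (x + h n) - part (-1) x\<bar>)"
    using diff_square_le_pos_neg_parts[of "f (x + h n)" "f x"] by (intro ennreal_leI) (simp add: part_def)
   then show "ennreal ((f (x + h n) - f x)^2) <= 2 * ennreal \<bar>part 1 (x + h n) - part 1 x\<bar> + 2 * ennreal \<bar>part (-1) (x + h n) - part (-1) x\<bar>"
    by (simp add: ennreal_plus ennreal_mult' ennreal_numeral)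
  qed
  then show ?thesis by (simp add: nn_integral_add nn_integral_cmult)
 qed
 then show ?thesis
  by (intro ennreal_tendsto_0_le[OF ennreal_tendsto_0_lincomb[OF shift_L1_tendsto[OF int h] shift_L1_tendsto[OF int h], of 1 "-1" 2 2]]) auto
qed

lemma small_of_sequences:
 fixes T :: "'a::real_normed_vector => ennreal"
 assumes "!!h. h ---> 0 ==> (%n. T (h n)) ---> 0" "e > 0"
 obtains d where "d > 0" "!!z. norm z < d ==> T z <= ennreal e"
proof (rule ccontr)
 assume "\<not> thesis"
 then have "EX z. norm z < 1 / Suc n & ennreal e < T z" for n
  by (metis that of_nat_0_less_iff zero_less_Suc zero_less_divide_1_iff linorder_not_le)
 then obtain h where h: "!!n. norm (h n) < 1 / Suc n" "!!n. ennreal e < T (h n)" by metis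
 have "h ---> 0"
  by (rule Lim_null_comparison[OF _ LIMSEQ_inverse_real_of_nat])
   (use h(1) in \<open>auto simp: inverse_eq_divide less_imp_le\<close>)
 from ennreal_tendsto_0D[OF assms(1)[OF this] assms(2)] obtain n where "T (h n) < ennreal e"
  by (auto simp: eventually_sequentially)
 with h(2)[of n] show False by simp
qed

lemma kernel_measurable: "kernel e \<rho> ==> \<rho> : Borel"
 using kernel_C1 C1_measurable by blast

lemma kernel_reflect_integral:
 assumes k: "kernel e \<rho>"
 shows "(NN y. ennreal (\<rho> (x - y))) = 1"
 using nn_integral_affine[of "%z. ennreal (\<rho> z)" "-1" x] kernel_measurable[OF k] k
 by (simp add: kernel_def)

lemma kernel_double_integral:
 fixes f :: "real^'n => real"
 assumes k: "kernel e \<rho>" and [measurable]: "f : Borel" "p : Borel"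
  and small: "!!z. norm z < e ==> (NN y. ennreal (p (f (y + z) - f y))) <= \<epsilon>"
  and sym: "!!t. p (- t) = p t"
 shows "(NN x. (NN y. ennreal (\<rho> (x - y)) * ennreal (p (f y - f x)))) <= \<epsilon>"
proof -
 have [measurable]: "\<rho> : Borel" by (rule kernel_measurable[OF k])
 have "(NN x. (NN y. ennreal (\<rho> (x - y)) * ennreal (p (f y - f x))))
   = (NN y. (NN x. ennreal (\<rho> (x - y)) * ennreal (p (f y - f x))))"
  by (rule lborel_pair.Fubini'[symmetric]) measurable
 also have "\<dots> = (NN y. (NN z. ennreal (\<rho> z) * ennreal (p (f (y + z) - f y))))"
 proof (rule nn_integral_cong)
  fix y
  have "p (f y - f (z + y)) = p (f (y + z) - f y)" for z
   using sym[of "f (y + z) - f y"] by (simp add: add.commute)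
  then show "(NN x. ennreal (\<rho> (x - y)) * ennreal (p (f y - f x))) =
    (NN z. ennreal (\<rho> z) * ennreal (p (f (y + z) - f y)))"
   using nn_integral_shift[of "%x. ennreal (\<rho> (x - y)) * ennreal (p (f y - f x))" y] by simp
 qed
 also have "\<dots> = (NN z. (NN y. ennreal (\<rho> z) * ennreal (p (f (y + z) - f y))))"
  by (rule lborel_pair.Fubini') measurable
 also have "\<dots> = (NN z. ennreal (\<rho> z) * (NN y. ennreal (p (f (y + z) - f y))))"
  by (intro nn_integral_cong nn_integral_cmult) measurable
 also have "\<dots> <= (NN z. ennreal (\<rho> z) * \<epsilon>)"
 proof (rule nn_integral_mono)
  fix z
  show "ennreal (\<rho> z) * (NN y. ennreal (p (f (y + z) - f y))) <= ennreal (\<rho> z) * \<epsilon>"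
   using small[of z] k by (cases "norm z < e") (auto simp: kernel_def intro: mult_left_mono)
 qed
 also have "\<dots> = \<epsilon>" using k by (simp add: nn_integral_multc kernel_def)
 finally show ?thesis .
qed

lemma conv_diff_le:
 assumes k: "kernel e \<rho>" and f: "integrable lborel f"
 shows "ennreal \<bar>conv \<rho> f x - f x\<bar> <= (NN y. ennreal (\<rho> (x - y)) * ennreal \<bar>f y - f x\<bar>)"
proof -
 have [measurable]: "\<rho> : Borel" "f : Borel"
  using kernel_measurable[OF k] f by auto
 have nonneg: "0 <= \<rho> z" for z using k by (simp add: kernel_def)
 have int_conv: "integrable lborel (%y. \<rho> (x - y) * f y)"
  by (rule conv_integrable[OF C1_continuous[OF kernel_C1[OF k]] compact_cball kernel_supported[OF k] f])
 have int_kernel: "integrable lborel (%y. \<rho> (x - y))"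
  using kernel_reflect_integral[OF k, of x] nonneg by (intro integrableI_nonneg) auto
 have mass: "(LBINT y. \<rho> (x - y)) = 1"
  using kernel_reflect_integral[OF k, of x] nonneg by (subst integral_eq_nn_integral) auto
 have "conv \<rho> f x - f x = (LBINT y. \<rho> (x - y) * f y) - (LBINT y. \<rho> (x - y) * f x)"
  by (simp add: conv_def mass)
 also have "\<dots> = (LBINT y. \<rho> (x - y) * (f y - f x))"
  using int_conv int_kernel by (subst Bochner_Integration.integral_diff[symmetric]) (auto simp: right_diff_distrib)
 finally have "ennreal \<bar>conv \<rho> f x - f x\<bar> <= (NN y. norm (\<rho> (x - y) * (f y - f x)))"
  using integral_norm_bound_ennreal[of lborel "%y. \<rho> (x - y) * (f y - f x)"] int_conv int_kernel
  by (auto simp: right_diff_distrib)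
 also have "\<dots> = (NN y. ennreal (\<rho> (x - y)) * ennreal \<bar>f y - f x\<bar>)"
  using nonneg by (intro nn_integral_cong) (auto simp: abs_mult ennreal_mult)
 finally show ?thesis .
qed

lemma moll_L1_tendsto:
 assumes f: "integrable lborel f" and k: "!!j. kernel (e j) (\<rho> j)" and e: "e ---> 0"
 shows "(%j. NN x. ennreal \<bar>conv (\<rho> j) f x - f x\<bar>) ---> 0"
proof (rule ennreal_tendsto_0I)
 fix \<epsilon> :: real assume "\<epsilon> > 0"
 have [measurable]: "f : Borel" using f by auto
 obtain d where d: "d > 0" "!!z. norm z < d ==> (NN x. ennreal \<bar>f (x + z) - f x\<bar>) <= ennreal \<epsilon>"
  using small_of_sequences[of "%z. NN x. ennreal \<bar>f (x + z) - f x\<bar>" \<epsilon>] shift_L1_tendsto[OF f] \<open>\<epsilon> > 0\<close> by blast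
 show "\<forall>\<^sub>F j in sequentially. (NN x. ennreal \<bar>conv (\<rho> j) f x - f x\<bar>) <= ennreal \<epsilon>"
  using order_tendstoD(2)[OF e d(1)]
 proof eventually_elim
  fix j assume "e j < d"
  have "(NN x. ennreal \<bar>conv (\<rho> j) f x - f x\<bar>) <=
    (NN x. (NN y. ennreal (\<rho> j (x - y)) * ennreal \<bar>f y - f x\<bar>))"
   by (intro nn_integral_mono conv_diff_le[OF k f])
  also have "\<dots> <= ennreal \<epsilon>"
   using kernel_double_integral[OF k, of f abs j "ennreal \<epsilon>"] d(2) \<open>e j < d\<close> by auto
  finally show "(NN x. ennreal \<bar>conv (\<rho> j) f x - f x\<bar>) <= ennreal \<epsilon>" .
 qed
qed

lemma moll_L2_tendsto:
 assumes f: "integrable lborel f" and fin: "L2 UNIV f < \<infinity>"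
  and k: "!!j. kernel (e j) (\<rho> j)" and e: "e ---> 0"
 shows "(%j. L2 UNIV (%x. conv (\<rho> j) f x - f x)) ---> 0"
proof (rule ennreal_tendsto_0I)
 fix \<epsilon> :: real assume "\<epsilon> > 0"
 have [measurable]: "f : Borel" using f by auto
 obtain d where d: "d > 0" "!!z. norm z < d ==> (NN x. ennreal ((f (x + z) - f x)^2)) <= ennreal \<epsilon>"
  using small_of_sequences[of "%z. NN x. ennreal ((f (x + z) - f x)^2)" \<epsilon>] shift_L2_tendsto[OF _ fin] \<open>\<epsilon> > 0\<close>
  by (auto simp: f)
 show "\<forall>\<^sub>F j in sequentially. L2 UNIV (%x. conv (\<rho> j) f x - f x) <= ennreal \<epsilon>"
  using order_tendstoD(2)[OF e d(1)]
 proof eventually_elim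
  fix j assume "e j < d"
  have [measurable]: "\<rho> j : Borel" by (rule kernel_measurable[OF k])
  have nonneg: "0 <= \<rho> j z" for z using k[of j] by (simp add: kernel_def)
  have pointwise: "ennreal ((conv (\<rho> j) f x - f x)^2) <= (NN y. ennreal (\<rho> j (x - y)) * ennreal ((f y - f x)^2))" for x
  proof -
   have "ennreal \<bar>conv (\<rho> j) f x - f x\<bar> <= (NN y. ennreal (sqrt (\<rho> j (x - y))) * ennreal (sqrt (\<rho> j (x - y)) * \<bar>f y - f x\<bar>))"
    using conv_diff_le[OF k f, of j x] nonneg by (simp add: ennreal_mult[symmetric] mult.assoc[symmetric])
   then have "(ennreal \<bar>conv (\<rho> j) f x - f x\<bar>)^2 <= (NN y. ennreal (sqrt (\<rho> j (x - y))) * ennreal (sqrt (\<rho> j (x - y)) * \<bar>f y - f x\<bar>))^2"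
    by (rule power_mono) simp
   also have "\<dots> <= (NN y. (ennreal (sqrt (\<rho> j (x - y))))^2) * (NN y. (ennreal (sqrt (\<rho> j (x - y)) * \<bar>f y - f x\<bar>))^2)"
    by (rule Cauchy_Schwarz_nn_integral) measurable
   also have "(NN y. (ennreal (sqrt (\<rho> j (x - y))))^2) = 1"
    using kernel_reflect_integral[OF k, of j x] nonneg by (simp add: ennreal_power)
   also have "(NN y. (ennreal (sqrt (\<rho> j (x - y)) * \<bar>f y - f x\<bar>))^2) = (NN y. ennreal (\<rho> j (x - y)) * ennreal ((f y - f x)^2))"
    using nonneg by (intro nn_integral_cong) (simp add: ennreal_power power_mult_distrib ennreal_mult)
   finally show ?thesis by (simp add: ennreal_power)
  qed
  have "L2 UNIV (%x. conv (\<rho> j) f x - f x) <=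
    (NN x. (NN y. ennreal (\<rho> j (x - y)) * ennreal ((f y - f x)^2)))"
   unfolding L2_def using pointwise by (intro nn_integral_mono) simp
  also have "\<dots> <= ennreal \<epsilon>"
   using kernel_double_integral[OF k, of f "%t. t\<^sup>2" j "ennreal \<epsilon>"] d(2) \<open>e j < d\<close> by auto
  finally show "L2 UNIV (%x. conv (\<rho> j) f x - f x) <= ennreal \<epsilon>" .
 qed
qed

subsection \<open>Sobolev functions as limits of differentiable functions\<close>

definition H1_tendsto :: "(real^'n) set => (nat => real^'n => real) => (real^'n => real) => (real^'n => real^'n) => bool" where
 "H1_tendsto S w u g \<longleftrightarrow> (ALL j. C1 (w j)) & (%j. L2 S (%x. w j x - u x)) ---> 0 &
  (%j. L2 S (%x. grad (w j) x - g x)) ---> 0 & (AE x\<in>S in lborel. (%j. w j x) ---> u x)"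

lemma H1_tendstoD:
 assumes "H1_tendsto S w u g"
 shows "C1 (w j)" "(%j. L2 S (%x. w j x - u x)) ---> 0" "(%j. L2 S (%x. grad (w j) x - g x)) ---> 0"
  "AE x\<in>S in lborel. (%j. w j x) ---> u x" "w j : Borel" "grad (w j) : Borel"
 using assms by (auto simp: H1_tendsto_def intro: C1_measurable grad_measurable)

text \<open>Sign, size and support conditions on the approximating functions are kept in the class \<open>X\<close>.\<close>

definition sobolev :: "(real^'n) set => (real^'n => real) set => (real^'n => real) => (real^'n => real^'n) => bool" where
 "sobolev S X u g \<longleftrightarrow> S : sets borel & u : Borel & g : Borel & L2 S u < \<infinity> & L2 S g < \<infinity> &
  (EX w. (ALL j. w j : X) & H1_tendsto S w u g)"

lemma sobolevD:
 assumes "sobolev S X u g"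
 shows "S : sets borel" "u : Borel" "g : Borel" "L2 S u < \<infinity>" "L2 S g < \<infinity>"
 using assms unfolding sobolev_def by auto

lemma sobolevE:
 assumes "sobolev S X u g"
 obtains w where "!!j. w j : X" "H1_tendsto S w u g"
 using assms unfolding sobolev_def by (elim conjE exE) (rule that, auto)

lemma sobolevI:
 assumes [measurable]: "S : sets borel" "u : Borel" "g : Borel"
  and "L2 S u < \<infinity>" "L2 S g < \<infinity>" and w: "!!j::nat. w j : X" "!!j. C1 (w j)"
  and lim: "(%j. L2 S (%x. w j x - u x)) ---> 0" "(%j. L2 S (%x. grad (w j) x - g x)) ---> 0"
 shows "sobolev S X u g"
proof -
 note [measurable] = C1_measurable[OF w(2)]
 obtain r :: "nat => nat" where r: "strict_mono r"
  "AE x\<in>S in lborel. (%j. w (r j) x - u x) ---> 0"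
  using L2_AE_subseq[of "%j x. w j x - u x" S] lim(1) by auto
 have "AE x\<in>S in lborel. (%j. w (r j) x) ---> u x"
  using r(2) by eventually_elim (simp add: LIM_zero_iff)
 then have "H1_tendsto S (%j. w (r j)) u g"
  unfolding H1_tendsto_def
  using w LIMSEQ_subseq_LIMSEQ[OF lim(1) r(1)] LIMSEQ_subseq_LIMSEQ[OF lim(2) r(1)] by (auto simp: o_def)
 with assms(1-5) w(1) show ?thesis unfolding sobolev_def by (intro conjI exI[of _ "%j. w (r j)"]) auto
qed

lemma sobolev_mono:
 assumes "sobolev T X u g" "S <= T" "S : sets borel" "!!w. w : X ==> C1 w ==> w : Y"
 shows "sobolev S Y u g"
proof -
 obtain w where w: "!!j. w j : X" "H1_tendsto T w u g" using sobolevE[OF assms(1)] by blast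
 note lim = H1_tendstoD[OF w(2)]
 show ?thesis
 proof (rule sobolevI[where w=w])
  show "L2 S u < \<infinity>" "L2 S g < \<infinity>"
   using sobolevD(4,5)[OF assms(1)] L2_mono_set[OF assms(2)] le_less_trans by blast+
  show "(%j. L2 S (%x. w j x - u x)) ---> 0" "(%j. L2 S (%x. grad (w j) x - g x)) ---> 0"
   by (rule ennreal_tendsto_0_le[OF _ L2_mono_set[OF assms(2)]], rule lim)+
 qed (use sobolevD[OF assms(1)] assms w lim(1) in auto)
qed

lemma sobolev_cong:
 assumes "sobolev S X u g" "u' : Borel" "g' : Borel"
  "AE x\<in>S in lborel. u' x = u x" "AE x\<in>S in lborel. g' x = g x"
 shows "sobolev S X u' g'"
proof -
 obtain w where w: "!!j. w j : X" "H1_tendsto S w u g" using sobolevE[OF assms(1)] by blast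
 have "L2 S u' = L2 S u" "L2 S g' = L2 S g"
  "L2 S (%x. w j x - u' x) = L2 S (%x. w j x - u x)"
  "L2 S (%x. grad (w j) x - g' x) = L2 S (%x. grad (w j) x - g x)" for j
  by (rule L2_cong_AE, use assms(4,5) in eventually_elim, simp)+
 then show ?thesis
  using w(1) H1_tendstoD(1-3)[OF w(2)] sobolevD[OF assms(1)] assms by (intro sobolevI[where w=w]) auto
qed

lemma sobolev_approximant:
 assumes "sobolev S X u g" "e > 0"
 obtains w where "w : X" "C1 w" "L2 S (%x. w x - u x) <= ennreal e" "L2 S (%x. grad w x - g x) <= ennreal e"
proof -
 obtain w where w: "!!j. w j : X" "H1_tendsto S w u g" using sobolevE[OF assms(1)] by blast
 note lim = H1_tendstoD[OF w(2)]
 from eventually_conj[OF ennreal_tendsto_0D[OF lim(2) assms(2)] ennreal_tendsto_0D[OF lim(3) assms(2)]]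
 obtain i where "L2 S (%x. w i x - u x) < ennreal e" "L2 S (%x. grad (w i) x - g x) < ennreal e"
  by (auto simp: eventually_sequentially)
 then show thesis using w(1) lim(1) that less_imp_le by blast
qed

lemma L2_tendsto_approximants:
 fixes a b :: "nat => 'a::euclidean_space => 'b::euclidean_space"
 assumes "!!j. a j : Borel" "!!j. b j : Borel" "f : Borel" "S : sets borel"
  and close: "!!j. L2 S (%x. a j x - b j x) <= ennreal (1 / Suc j)" and lim: "(%j. L2 S (%x. b j x - f x)) ---> 0"
 shows "(%j. L2 S (%x. a j x - f x)) ---> 0"
proof (rule ennreal_tendsto_0_le)
 have "(%j. ennreal (1 / Suc j)) ---> 0"
  using tendsto_ennrealI[OF LIMSEQ_inverse_real_of_nat] by (simp add: inverse_eq_divide)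
 then show "(%j. 2 * ennreal (1 / Suc j) + 2 * L2 S (%x. b j x - f x)) ---> 0"
  by (rule ennreal_tendsto_0_lincomb[OF _ lim]) auto
 fix j
 have "L2 S (%x. a j x - f x) <= 2 * L2 S (%x. a j x - b j x) + 2 * L2 S (%x. b j x - f x)"
  by (rule L2_triangle) (use assms in auto)
 also have "\<dots> <= 2 * ennreal (1 / Suc j) + 2 * L2 S (%x. b j x - f x)"
  by (intro add_mono mult_left_mono close) auto
 finally show "L2 S (%x. a j x - f x) <= 2 * ennreal (1 / Suc j) + 2 * L2 S (%x. b j x - f x)" .
qed

lemma L2_finite_limit:
 fixes f :: "nat => 'a::euclidean_space => 'b::euclidean_space"
 assumes "!!j. f j : Borel" "h : Borel" "S : sets borel" "!!j. L2 S (f j) < \<infinity>"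
  and lim: "(%j. L2 S (%x. f j x - h x)) ---> 0"
 shows "L2 S h < \<infinity>"
proof -
 obtain i where "L2 S (%x. f i x - h x) < ennreal 1"
  using eventually_happens'[OF sequentially_bot ennreal_tendsto_0D[OF lim, of 1]] by auto
 then have "L2 S (%x. f i x - h x) < \<infinity>" by (rule less_trans) simp
 then show ?thesis by (rule L2_finite_if_close[OF assms(1-3) _ assms(4)])
qed

lemma sobolev_limit:
 assumes approx: "!!j::nat. sobolev S X (u' j) (g' j)"
  and [measurable]: "u : Borel" "g : Borel"
  and lim: "(%j. L2 S (%x. u' j x - u x)) ---> 0" "(%j. L2 S (%x. g' j x - g x)) ---> 0"
 shows "sobolev S X u g"
proof -
 note [measurable] = sobolevD(1-3)[OF approx]
 have "ALL j. EX w. w : X & C1 w & L2 S (%x. w x - u' j x) <= ennreal (1 / Suc j) & L2 S (%x. grad w x - g' j x) <= ennreal (1 / Suc j)"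
 proof
  fix j
  have "(0::real) < 1 / Suc j" by simp
  from sobolev_approximant[OF approx[of j] this]
  show "EX w. w : X & C1 w & L2 S (%x. w x - u' j x) <= ennreal (1 / Suc j) & L2 S (%x. grad w x - g' j x) <= ennreal (1 / Suc j)"
   by blast
 qed
 from choice[OF this] obtain w where w: "!!j. w j : X" "!!j. C1 (w j)"
  "!!j. L2 S (%x. w j x - u' j x) <= ennreal (1 / Suc j)" "!!j. L2 S (%x. grad (w j) x - g' j x) <= ennreal (1 / Suc j)"
  by blast
 show ?thesis
 proof (rule sobolevI[OF _ _ _ _ _ w(1,2)])
  show "L2 S u < \<infinity>" "L2 S g < \<infinity>"
   by (rule L2_finite_limit[OF _ _ _ _ lim(1)] L2_finite_limit[OF _ _ _ _ lim(2)]; use sobolevD[OF approx] in simp)+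
  show "(%j. L2 S (%x. w j x - u x)) ---> 0"
   by (rule L2_tendsto_approximants[OF _ _ _ _ w(3) lim(1)]) (use C1_measurable[OF w(2)] in auto)
  show "(%j. L2 S (%x. grad (w j) x - g x)) ---> 0"
   by (rule L2_tendsto_approximants[OF _ _ _ _ w(4) lim(2)]) (use grad_measurable[OF w(2)] in auto)
 qed measurable
qed

definition lipschitz_C1 :: "real => (real => real) => (real => real) => bool" where
 "lipschitz_C1 M F F' \<longleftrightarrow> (ALL t. (F has_real_derivative F' t) (at t)) & continuous_on UNIV F' & (ALL t. \<bar>F' t\<bar> <= M)"

lemma lipschitz_C1D:
 assumes "lipschitz_C1 M F F'"
 shows "(F has_real_derivative F' t) (at t)" "continuous_on UNIV F'" "\<bar>F' t\<bar> <= M" "0 <= M"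
  "F : Borel" "F' : Borel" "\<bar>F a - F b\<bar> <= M * \<bar>a - b\<bar>"
proof -
 have deriv: "(F has_real_derivative F' t) (at t)" and bound: "\<bar>F' t\<bar> <= M" for t
  using assms by (auto simp: lipschitz_C1_def)
 show "(F has_real_derivative F' t) (at t)" "\<bar>F' t\<bar> <= M" by (rule deriv bound)+
 show "continuous_on UNIV F'" using assms by (simp add: lipschitz_C1_def)
 then show "F' : Borel" by (rule borel_measurable_continuous_onI)
 show "0 <= M" using bound[of 0] by simp
 show "F : Borel" using deriv
  by (intro borel_measurable_continuous_onI) (meson DERIV_isCont continuous_at_imp_continuous_on)
 show "\<bar>F a - F b\<bar> <= M * \<bar>a - b\<bar>"
  using field_differentiable_bound[of UNIV F F' M a b] deriv bound by simp
qed

lemma lipschitz_C1_compose: "lipschitz_C1 M F F' ==> C1 w ==> C1 (%x. F (w x))"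
 and lipschitz_C1_grad: "lipschitz_C1 M F F' ==> C1 w ==> grad (%x. F (w x)) = (%x. F' (w x) *. grad w x)"
 using C1_compose[of w F F'] grad_compose[of w F F'] by (auto simp: lipschitz_C1_def)

lemma lipschitz_C1_affine: "lipschitz_C1 \<bar>a\<bar> (%t. a * t + b) (%_. a)"
 by (auto simp: lipschitz_C1_def intro!: derivative_eq_intros)

lemma lipschitz_C1_comp_affine:
 assumes "lipschitz_C1 M F F'"
 shows "lipschitz_C1 (\<bar>a\<bar> * M) (%t. F (a * t + b)) (%t. a * F' (a * t + b))"
 unfolding lipschitz_C1_def
proof (intro conjI allI)
 have "((%t. a * t + b) has_real_derivative a) (at t)" for t by (auto intro!: derivative_eq_intros)
 from DERIV_chain2[OF lipschitz_C1D(1)[OF assms] this]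
 show "((%t. F (a * t + b)) has_real_derivative a * F' (a * t + b)) (at t)" for t by (simp only: mult.commute[of a])
 show "continuous_on UNIV (%t. a * F' (a * t + b))"
  by (intro continuous_intros continuous_on_compose2[OF lipschitz_C1D(2)[OF assms]]) auto
 show "\<bar>a * F' (a * t + b)\<bar> <= \<bar>a\<bar> * M" for t
  using lipschitz_C1D(3)[OF assms] by (simp add: abs_mult mult_left_mono)
qed

lemma lipschitz_C1_affine_comp:
 assumes "lipschitz_C1 M F F'"
 shows "lipschitz_C1 (\<bar>a\<bar> * M) (%t. a * F t + b) (%t. a * F' t)"
 using assms unfolding lipschitz_C1_def
 by (auto intro!: derivative_eq_intros continuous_intros mult_left_mono simp: abs_mult)

lemma L2_lipschitz_C1_finite:
 assumes [measurable]: "S : sets borel" "u : Borel" and "emeasure lborel S < \<infinity>" "L2 S u < \<infinity>"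
  and F: "lipschitz_C1 M F F'"
 shows "L2 S (%x. F (u x)) < \<infinity>"
proof -
 note [measurable] = lipschitz_C1D(5)[OF F]
 have "L2 S (%x. F 0 + (F (u x) - F 0)) < \<infinity>"
 proof (rule L2_add_finite)
  show "L2 S (%x. F 0) < \<infinity>" by (rule L2_bounded_finite[where M="\<bar>F 0\<bar>"]) (use assms(1,3) in auto)
  show "L2 S (%x. F (u x) - F 0) < \<infinity>"
   by (rule L2_bound_mult_finite[where f=u and M=M]) (use lipschitz_C1D(4)[OF F] lipschitz_C1D(7)[OF F, of _ 0] assms(1,2,4) in auto)
 qed measurable
 then show ?thesis by simp
qed

lemma L2_tendsto_mult:
 fixes f :: "nat => 'a::euclidean_space => real" and h :: "nat => 'a => 'b::euclidean_space"
 assumes [measurable]: "!!j. f j : Borel" "!!j. h j : Borel"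
  "f' : Borel" "h' : Borel" "S : sets borel"
  and bounds: "!!j x. x : S ==> \<bar>f j x\<bar> <= B" "!!x. x : S ==> \<bar>f' x\<bar> <= B" "0 <= B"
  and ae: "AE x\<in>S in lborel. (%j. f j x) ---> f' x"
  and lim: "(%j. L2 S (%x. h j x - h' x)) ---> 0" and fin: "L2 S h' < \<infinity>"
 shows "(%j. L2 S (%x. f j x *. h j x - f' x *. h' x)) ---> 0"
proof (rule ennreal_tendsto_0_le)
 have "(%j. L2 S (%x. (f j x - f' x) *. h' x)) ---> 0"
 proof (rule L2_dominated[where h="%x. (2 * B) *. h' x"])
  show "norm ((f j x - f' x) *. h' x) <= norm ((2 * B) *. h' x)" if "x : S" for j x
  proof -
   have "\<bar>f j x - f' x\<bar> <= 2 * B" using bounds(1)[OF that, of j] bounds(2)[OF that] by simp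
   then show ?thesis using bounds(3) by (simp add: mult_right_mono)
  qed
  show "L2 S (%x. (2 * B) *. h' x) < \<infinity>"
   by (rule L2_bound_mult_finite[of h' S _ "2 * B"]) (use bounds(3) fin in auto)
  show "AE x\<in>S in lborel. (%j. (f j x - f' x) *. h' x) ---> 0"
   using ae by eventually_elim (auto intro!: tendsto_eq_intros)
 qed measurable
 then show "(%j. (2 * ennreal (B\<^sup>2)) * L2 S (%x. h j x - h' x) + 2 * L2 S (%x. (f j x - f' x) *. h' x)) ---> 0"
  by (intro ennreal_tendsto_0_lincomb[OF lim]) (auto simp: ennreal_mult_less_top)
 fix j
 have "L2 S (%x. f j x *. h j x - f' x *. h' x) = L2 S (%x. f j x *. (h j x - h' x) + (f j x - f' x) *. h' x)"
  by (simp add: algebra_simps)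
 also have "\<dots> <= 2 * L2 S (%x. f j x *. (h j x - h' x)) + 2 * L2 S (%x. (f j x - f' x) *. h' x)"
  by (rule L2_add) measurable
 also have "\<dots> <= 2 * (ennreal (B\<^sup>2) * L2 S (%x. h j x - h' x)) + 2 * L2 S (%x. (f j x - f' x) *. h' x)"
  by (intro add_mono mult_left_mono L2_bound_mult) (use bounds in \<open>auto intro!: mult_right_mono\<close>)
 finally show "L2 S (%x. f j x *. h j x - f' x *. h' x) <=
  (2 * ennreal (B\<^sup>2)) * L2 S (%x. h j x - h' x) + 2 * L2 S (%x. (f j x - f' x) *. h' x)"
  by (simp add: mult.assoc)
qed

lemma sobolev_chain:
 assumes u: "sobolev S X u g" and F: "lipschitz_C1 M F F'"
  and Y: "!!w. w : X ==> C1 w ==> (%x. F (w x)) : Y" and fin: "L2 S (%x. F (u x)) < \<infinity>"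
 shows "sobolev S Y (%x. F (u x)) (%x. F' (u x) *. g x)"
proof -
 obtain w where w: "!!j. w j : X" "H1_tendsto S w u g" using sobolevE[OF u] by blast
 note lim = H1_tendstoD[OF w(2)]
 note [measurable] = sobolevD(1-3)[OF u] lim(5,6) lipschitz_C1D(5,6)[OF F]
 show ?thesis
 proof (rule sobolevI[where w="%j x. F (w j x)"])
  show "(%j. L2 S (%x. F (w j x) - F (u x))) ---> 0"
  proof (rule ennreal_tendsto_0_le)
   show "(%j. ennreal (M\<^sup>2) * L2 S (%x. w j x - u x) + 0 * 0) ---> 0"
    by (rule ennreal_tendsto_0_lincomb[OF lim(2) tendsto_const]) auto
   show "L2 S (%x. F (w j x) - F (u x)) <= ennreal (M\<^sup>2) * L2 S (%x. w j x - u x) + 0 * 0" for j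
    unfolding mult_zero_left add_0_right
    by (rule L2_bound_mult) (use lipschitz_C1D(4,7)[OF F] in auto)
  qed
  have "AE x\<in>S in lborel. (%j. F' (w j x)) ---> F' (u x)"
   using lim(4)
   by eventually_elim (use lipschitz_C1D(2)[OF F] in \<open>auto simp: continuous_on_eq_continuous_at intro: isCont_tendsto_compose\<close>)
  then show "(%j. L2 S (%x. grad (%x. F (w j x)) x - F' (u x) *. g x)) ---> 0"
   unfolding lipschitz_C1_grad[OF F lim(1)]
   by (intro L2_tendsto_mult[where B=M]) (use lim lipschitz_C1D(3,4)[OF F] sobolevD(5)[OF u] in auto)
  show "L2 S (%x. F' (u x) *. g x) < \<infinity>"
   by (rule L2_bound_mult_finite[of g S _ M])
    (use lipschitz_C1D(3,4)[OF F] sobolevD(5)[OF u] in \<open>auto intro!: mult_right_mono\<close>)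
 qed (use fin Y w(1) lim(1) lipschitz_C1_compose[OF F] in auto)
qed

lemma sobolev_affine:
 assumes "sobolev S UNIV u g" "emeasure lborel S < \<infinity>"
 shows "sobolev S UNIV (%x. a * u x + b) (%x. a *. g x)"
 by (rule sobolev_chain[OF assms(1) lipschitz_C1_affine])
  (use L2_lipschitz_C1_finite[OF _ _ _ _ lipschitz_C1_affine] sobolevD[OF assms(1)] assms(2) in auto)

lemma L2_bound_mult_on:
 fixes f :: "'a::euclidean_space => 'b::euclidean_space"
 assumes [measurable]: "f : Borel" "S : sets borel"
  and "!!x. x : T ==> x : S ==> norm (h x) <= M * norm (f x)" "!!x. x : T ==> x ~: S ==> h x = 0" "0 <= M"
 shows "L2 T h <= ennreal (M\<^sup>2) * L2 S f"
proof -
 have "L2 T h <= L2 S (%x. if x : T then h x else 0)"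
  unfolding L2_def by (intro nn_integral_mono) (auto simp: indicator_def assms)
 also have "\<dots> <= ennreal (M\<^sup>2) * L2 S f"
  by (rule L2_bound_mult) (use assms in auto)
 finally show ?thesis .
qed

lemma L2_product_rule_bound:
 fixes f :: "real^'n => real^'n"
 assumes [measurable]: "f : Borel" "h : Borel" "\<eta> : Borel" "grad \<eta> : Borel" "S : sets borel" "T : sets borel"
  and bounds: "!!x. \<bar>\<eta> x\<bar> <= B" "!!x. norm (grad \<eta> x) <= B"
  and zero: "!!x. x : T ==> x ~: S ==> \<eta> x = 0 & grad \<eta> x = 0"
 shows "L2 T (%x. \<eta> x *. f x + h x *. grad \<eta> x) <= (2 * ennreal (B\<^sup>2)) * L2 S f + (2 * ennreal (B\<^sup>2)) * L2 S h"
proof -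
 have B: "0 <= B" using bounds(2)[of 0] norm_ge_zero order_trans by blast
 have "L2 T (%x. \<eta> x *. f x + h x *. grad \<eta> x) <= 2 * L2 T (%x. \<eta> x *. f x) + 2 * L2 T (%x. h x *. grad \<eta> x)"
  by (rule L2_add) measurable
 also have "L2 T (%x. \<eta> x *. f x) <= ennreal (B\<^sup>2) * L2 S f"
  by (rule L2_bound_mult_on) (use zero bounds B in \<open>auto intro!: mult_right_mono\<close>)
 also have "L2 T (%x. h x *. grad \<eta> x) <= ennreal (B\<^sup>2) * L2 S h"
  by (rule L2_bound_mult_on) (use zero bounds B in \<open>auto simp: mult.commute[of B] intro!: mult_left_mono\<close>)
 finally show ?thesis by (simp add: mult.assoc mult_left_mono add_mono)
qed

lemma sobolev_mult_C1:
 fixes u :: "real^'n => real"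
 assumes u: "sobolev S X u g" and \<eta>: "C1 \<eta>" and [measurable]: "T : sets borel"
  and bounds: "!!x. \<bar>\<eta> x\<bar> <= B" "!!x. norm (grad \<eta> x) <= B"
  and zero: "!!x. x : T ==> x ~: S ==> \<eta> x = 0 & grad \<eta> x = 0"
  and Y: "!!w. w : X ==> C1 w ==> (%x. \<eta> x * w x) : Y"
 shows "sobolev T Y (%x. \<eta> x * u x) (%x. \<eta> x *. g x + u x *. grad \<eta> x)"
proof -
 obtain w where w: "!!j. w j : X" "H1_tendsto S w u g" using sobolevE[OF u] by blast
 note lim = H1_tendstoD[OF w(2)]
 note [measurable] = sobolevD(1-3)[OF u] lim(5,6) C1_measurable[OF \<eta>] grad_measurable[OF \<eta>]
 have B: "0 <= B" using bounds(2)[of 0] norm_ge_zero order_trans by blast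
 have mult_bound: "L2 T (%x. \<eta> x * f x) <= ennreal (B\<^sup>2) * L2 S f" if "f : Borel" for f :: "real^'n => real"
  by (rule L2_bound_mult_on) (use that zero bounds B in \<open>auto simp: abs_mult intro!: mult_right_mono\<close>)
 note product_bound = L2_product_rule_bound[where S=S and T=T, OF _ _ _ _ _ _ bounds zero]
 show ?thesis
 proof (rule sobolevI[where w="%j x. \<eta> x * w j x"])
  show "L2 T (%x. \<eta> x * u x) < \<infinity>"
   using le_less_trans[OF mult_bound[of u]] sobolevD[OF u] by (simp add: ennreal_mult_less_top)
  show "L2 T (%x. \<eta> x *. g x + u x *. grad \<eta> x) < \<infinity>"
   using le_less_trans[OF product_bound[of g u]] sobolevD[OF u] by (simp add: ennreal_mult_less_top)
  show "(%j. L2 T (%x. \<eta> x * w j x - \<eta> x * u x)) ---> 0"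
  proof (rule ennreal_tendsto_0_le)
   show "(%j. ennreal (B\<^sup>2) * L2 S (%x. w j x - u x) + 0 * 0) ---> 0"
    by (rule ennreal_tendsto_0_lincomb[OF lim(2) tendsto_const]) auto
   show "L2 T (%x. \<eta> x * w j x - \<eta> x * u x) <= ennreal (B\<^sup>2) * L2 S (%x. w j x - u x) + 0 * 0" for j
    using mult_bound[of "%x. w j x - u x"] by (simp add: right_diff_distrib)
  qed
  show "(%j. L2 T (%x. grad (%x. \<eta> x * w j x) x - (\<eta> x *. g x + u x *. grad \<eta> x))) ---> 0"
  proof (rule ennreal_tendsto_0_le)
   show "(%j. (2 * ennreal (B\<^sup>2)) * L2 S (%x. grad (w j) x - g x) + (2 * ennreal (B\<^sup>2)) * L2 S (%x. w j x - u x)) ---> 0"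
    by (intro ennreal_tendsto_0_lincomb[OF lim(3,2)]) (auto simp: ennreal_mult_less_top)
   show "L2 T (%x. grad (%x. \<eta> x * w j x) x - (\<eta> x *. g x + u x *. grad \<eta> x))
    <= (2 * ennreal (B\<^sup>2)) * L2 S (%x. grad (w j) x - g x) + (2 * ennreal (B\<^sup>2)) * L2 S (%x. w j x - u x)" for j
    using product_bound[of "%x. grad (w j) x - g x" "%x. w j x - u x"] by (simp add: grad_mult[OF \<eta> lim(1)] algebra_simps)
  qed
 qed (use Y w(1) lim(1) in \<open>auto intro!: C1_mult[OF \<eta>]\<close>)
qed

lemma sobolev_mult:
 fixes u v :: "real^'n => real"
 assumes u: "sobolev S X u g" and v: "sobolev S Y v h"
  and bounds: "!!w x. w : X ==> \<bar>w x\<bar> <= B" "!!w x. w : Y ==> \<bar>w x\<bar> <= B"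
   "!!x. x : S ==> \<bar>u x\<bar> <= B" "!!x. x : S ==> \<bar>v x\<bar> <= B" "0 <= B"
  and Z: "!!w w'. w : X ==> C1 w ==> w' : Y ==> C1 w' ==> (%x. w x * w' x) : Z"
 shows "sobolev S Z (%x. u x * v x) (%x. u x *. h x + v x *. g x)"
proof -
 obtain w where w: "!!j. w j : X" "H1_tendsto S w u g" using sobolevE[OF u] by blast
 obtain w' where w': "!!j. w' j : Y" "H1_tendsto S w' v h" using sobolevE[OF v] by blast
 note lim = H1_tendstoD[OF w(2)] and lim' = H1_tendstoD[OF w'(2)]
 note [measurable] = sobolevD(1-3)[OF u] sobolevD(1-3)[OF v] lim(5,6) lim'(5,6)
 note facts = lim(2-4) lim'(2-4) bounds bounds(1)[OF w(1)] bounds(2)[OF w'(1)] sobolevD(4,5)[OF u] sobolevD(4,5)[OF v]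
 have value_lim: "(%j. L2 S (%x. w j x *. w' j x - u x *. v x)) ---> 0"
  by (rule L2_tendsto_mult[where B=B]) (use facts in auto)
 have grad_lim: "(%j. L2 S (%x. w j x *. grad (w' j) x - u x *. h x)) ---> 0"
  "(%j. L2 S (%x. w' j x *. grad (w j) x - v x *. g x)) ---> 0"
  by (rule L2_tendsto_mult[where B=B]; use facts in auto)+
 have fin: "L2 S (%x. f x *. k x) < \<infinity>"
  if "L2 S k < \<infinity>" "!!x. x : S ==> \<bar>f x\<bar> <= B" "k : Borel" for f and k :: "real^'n => 'c::euclidean_space"
  by (rule L2_bound_mult_finite[of k S _ B]) (use that bounds(5) in \<open>auto intro!: mult_right_mono\<close>)
 show ?thesis
 proof (rule sobolevI[where w="%j x. w j x * w' j x"])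
  show "L2 S (%x. u x * v x) < \<infinity>" using fin[of v u] facts by simp
  show "L2 S (%x. u x *. h x + v x *. g x) < \<infinity>" using fin[of h u] fin[of g v] facts by (intro L2_add_finite) auto
  show "(%j. L2 S (%x. w j x * w' j x - u x * v x)) ---> 0" using value_lim by simp
  show "(%j. L2 S (%x. grad (%x. w j x * w' j x) x - (u x *. h x + v x *. g x))) ---> 0"
  proof (rule ennreal_tendsto_0_le[OF ennreal_tendsto_0_lincomb[OF grad_lim, of 2 2]])
   fix j
   have "L2 S (%x. grad (%x. w j x * w' j x) x - (u x *. h x + v x *. g x))
    = L2 S (%x. (w j x *. grad (w' j) x - u x *. h x) + (w' j x *. grad (w j) x - v x *. g x))"
    unfolding grad_mult[OF lim(1) lim'(1)] by (simp add: add_diff_add)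
   also have "\<dots> <= 2 * L2 S (%x. w j x *. grad (w' j) x - u x *. h x) + 2 * L2 S (%x. w' j x *. grad (w j) x - v x *. g x)"
    by (rule L2_add) measurable
   finally show "L2 S (%x. grad (%x. w j x * w' j x) x - (u x *. h x + v x *. g x))
    <= 2 * L2 S (%x. w j x *. grad (w' j) x - u x *. h x) + 2 * L2 S (%x. w' j x *. grad (w j) x - v x *. g x)" .
  qed auto
 qed (use w(1) w'(1) lim(1) lim'(1) Z in \<open>auto intro!: C1_mult\<close>)
qed

subsection \<open>Truncations and cut-offs\<close>

lemma DERIV_join:
 fixes f g :: "real => real"
 assumes "!!t. t <= a ==> (f has_real_derivative f' t) (at t)"
  "!!t. t \<ge> a ==> (g has_real_derivative g' t) (at t)" "f a = g a" "f' a = g' a"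
 shows "((%t. if t <= a then f t else g t) has_real_derivative (if t <= a then f' t else g' t)) (at t)"
proof -
 have "((%t. if t : {..a} then f t else g t) has_vector_derivative (if t : {..a} then f' t else g' t)) (at t within UNIV)"
  by (rule has_vector_derivative_If_within_closures[where T="{a<..}"])
   (use assms in \<open>auto simp: has_real_derivative_iff_has_vector_derivative[symmetric] has_field_derivative_at_within\<close>)
 then show ?thesis by (simp add: has_real_derivative_iff_has_vector_derivative)
qed

lemma continuous_join:
 fixes f g :: "real => real"
 assumes "continuous_on {..a} f" "continuous_on {a..} g" "f a = g a"
 shows "continuous_on UNIV (%t. if t <= a then f t else g t)"
 using assms by (intro continuous_on_cases_le) (auto intro: continuous_on_subset continuous_intros)

definition smooth_pos :: "real => real => real" where
 "smooth_pos e t = (if t <= 0 then 0 else t\<^sup>2 / (t + e))"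

definition smooth_pos' :: "real => real => real" where
 "smooth_pos' e t = (if t <= 0 then 0 else 1 - (e / (t + e))\<^sup>2)"

lemma smooth_pos_deriv:
 assumes "e > 0"
 shows "(smooth_pos e has_real_derivative smooth_pos' e t) (at t)"
proof -
 have "((%t. if t <= 0 then 0 else t\<^sup>2 / (t + e)) has_real_derivative
   (if t <= 0 then 0 else 1 - (e / (t + e))\<^sup>2)) (at t)"
 proof (rule DERIV_join)
  fix t :: real assume "0 <= t"
  then have "((%t. t\<^sup>2 / (t + e)) has_real_derivative (2 * t * (t + e) - t\<^sup>2) / (t + e)^2) (at t)"
   using assms by (auto intro!: derivative_eq_intros simp: power2_eq_square)
  moreover have "(2 * t * (t + e) - t\<^sup>2) / (t + e)^2 = 1 - (e / (t + e))\<^sup>2"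
  proof -
   have "2 * t * (t + e) - t\<^sup>2 = (t + e)^2 - e\<^sup>2" by (simp add: power2_eq_square algebra_simps)
   then show ?thesis using assms \<open>0 <= t\<close> by (simp add: power_divide diff_divide_distrib)
  qed
  ultimately show "((%t. t\<^sup>2 / (t + e)) has_real_derivative 1 - (e / (t + e))\<^sup>2) (at t)" by simp
 qed (use assms in auto)
 then show ?thesis by (simp add: smooth_pos_def[abs_def] smooth_pos'_def)
qed

lemma smooth_pos'_continuous:
 assumes "e > 0"
 shows "continuous_on UNIV (smooth_pos' e)"
 unfolding smooth_pos'_def[abs_def]
 by (rule continuous_join) (use assms in \<open>auto intro!: continuous_intros\<close>)

lemma smooth_pos'_bounds:
 assumes "e > 0"
 shows "0 <= smooth_pos' e t" "smooth_pos' e t <= 1"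
proof -
 have "(e / (t + e))^2 <= 1" if "t > 0"
  using assms that by (intro power_le_one) auto
 then show "0 <= smooth_pos' e t" "smooth_pos' e t <= 1" by (auto simp: smooth_pos'_def)
qed

lemma smooth_pos_bounds:
 assumes "e > 0"
 shows "0 <= smooth_pos e t" "smooth_pos e t <= max t 0"
 using assms by (auto simp: smooth_pos_def max_def power2_eq_square field_simps)

lemma smooth_pos_error:
 assumes "e > 0"
 shows "\<bar>smooth_pos e t - max t 0\<bar> <= e"
proof (cases "t <= 0")
 case False
 then have "t\<^sup>2 / (t + e) - t = - (e * t / (t + e))"
  using assms by (simp add: field_simps power2_eq_square)
 moreover have "e * t / (t + e) <= e" using False assms by (simp add: field_simps)
 moreover have "0 <= e * t / (t + e)" using False assms by simp
 ultimately show ?thesis using False by (simp add: smooth_pos_def)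
qed (use assms in \<open>simp add: smooth_pos_def\<close>)

lemma lipschitz_C1_smooth_pos: "e > 0 ==> lipschitz_C1 1 (smooth_pos e) (smooth_pos' e)"
 using smooth_pos_deriv smooth_pos'_continuous smooth_pos'_bounds by (auto simp: lipschitz_C1_def)

lemmas smooth_pos_measurable = lipschitz_C1D(5)[OF lipschitz_C1_smooth_pos]
lemmas smooth_pos'_measurable = lipschitz_C1D(6)[OF lipschitz_C1_smooth_pos]

lemma smooth_pos'_tendsto: "(%j. smooth_pos' (1 / Suc j) t) ---> (if t > 0 then 1 else 0)"
proof (cases "t > 0")
 case True
 have "(%j. 1 - (inverse (real (Suc j)) / (t + inverse (real (Suc j))))\<^sup>2) ---> 1 - (0 / (t + 0))\<^sup>2"
  using True by (intro tendsto_intros LIMSEQ_inverse_real_of_nat) auto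
 then show ?thesis using True by (simp add: smooth_pos'_def inverse_eq_divide)
qed (simp add: smooth_pos'_def)

lemma smooth_pos_tendsto: "(%j. smooth_pos (1 / Suc j) t) ---> max t 0"
proof -
 have "(%j. smooth_pos (1 / Suc j) t - max t 0) ---> 0"
  by (rule Lim_null_comparison[OF _ LIMSEQ_inverse_real_of_nat])
   (use smooth_pos_error[of "1 / real (Suc j)" t for j] in \<open>auto simp: inverse_eq_divide\<close>)
 then show ?thesis by (simp add: LIM_zero_iff)
qed

lemma sobolev_pos:
 assumes u: "sobolev S X u g"
  and Y: "!!w e. w : X ==> C1 w ==> e > 0 ==> (%x. smooth_pos e (w x)) : Y"
 shows "sobolev S Y (%x. max (u x) 0) (%x. if u x > 0 then g x else 0)"
proof (rule sobolev_limit[where u'="%j x. smooth_pos (1 / Suc j) (u x)" and g'="%j x. smooth_pos' (1 / Suc j) (u x) *. g x"])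
 note [measurable] = sobolevD(1-3)[OF u] smooth_pos_measurable smooth_pos'_measurable
 show "sobolev S Y (%x. smooth_pos (1 / Suc j) (u x)) (%x. smooth_pos' (1 / Suc j) (u x) *. g x)" for j
 proof (rule sobolev_chain[OF u lipschitz_C1_smooth_pos])
  show "L2 S (%x. smooth_pos (1 / real (Suc j)) (u x)) < \<infinity>"
  proof (rule L2_bound_mult_finite[of u S _ 1])
   show "norm (smooth_pos (1 / real (Suc j)) (u x)) <= 1 * norm (u x)" for x
    using smooth_pos_bounds[of "1 / real (Suc j)" "u x"] by (auto simp: max_def split: if_splits)
  qed (use sobolevD[OF u] in auto)
 qed (use Y in auto)
 show "(%j. L2 S (%x. smooth_pos (1 / Suc j) (u x) - max (u x) 0)) ---> 0"
 proof (rule L2_dominated[where h=u])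
  show "norm (smooth_pos (1 / Suc j) (u x) - max (u x) 0) <= norm (u x)" for j x
   using smooth_pos_bounds[of "1 / Suc j" "u x"] by (auto simp: max_def split: if_splits)
  show "AE x\<in>S in lborel. (%j. smooth_pos (1 / Suc j) (u x) - max (u x) 0) ---> 0"
   using smooth_pos_tendsto by (auto simp: LIM_zero_iff)
 qed (use sobolevD(4)[OF u] in auto)
 have "(%j. L2 S (%x. smooth_pos' (1 / Suc j) (u x) *. g x - (if u x > 0 then 1 else 0) *. g x)) ---> 0"
 proof (rule L2_tendsto_mult[where B=1])
  show "\<bar>smooth_pos' (1 / Suc j) (u x)\<bar> <= 1" for j x
   using smooth_pos'_bounds[of "1 / real (Suc j)"] by simp
  show "AE x\<in>S in lborel. (%j. smooth_pos' (1 / Suc j) (u x)) ---> (if u x > 0 then 1 else 0)"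
   by (intro AE_I2 impI smooth_pos'_tendsto)
  show "(%j. L2 S (%x. g x - g x)) ---> 0" by (simp add: L2_def)
 qed (use sobolevD(5)[OF u] in auto)
 then show "(%j. L2 S (%x. smooth_pos' (1 / Suc j) (u x) *. g x - (if u x > 0 then g x else 0))) ---> 0"
  by (simp add: if_distrib[of "%t. t *. _"] cong: if_cong)
qed (use sobolevD(2,3)[OF u] in auto)

definition smoothstep :: "real => real" where
 "smoothstep y = (if y <= 0 then 0 else if y <= 1 then 3 * y\<^sup>2 - 2 * y ^ 3 else 1)"

definition smoothstep' :: "real => real" where
 "smoothstep' y = (if y <= 0 then 0 else if y <= 1 then 6 * y - 6 * y\<^sup>2 else 0)"

lemma smoothstep_deriv: "(smoothstep has_real_derivative smoothstep' y) (at y)"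
proof -
 have right: "((%y. if y <= 1 then 3 * y\<^sup>2 - 2 * y ^ 3 else 1) has_real_derivative
   (if y <= 1 then 6 * y - 6 * y\<^sup>2 else 0)) (at y)" for y :: real
  by (rule DERIV_join) (auto intro!: derivative_eq_intros simp: power2_eq_square)
 have "((%y. if y <= 0 then 0 else if y <= 1 then 3 * y\<^sup>2 - 2 * y ^ 3 else 1) has_real_derivative
   (if y <= 0 then 0 else if y <= 1 then 6 * y - 6 * y\<^sup>2 else 0)) (at y)"
  by (rule DERIV_join[OF _ right]) auto
 then show ?thesis by (simp add: smoothstep_def[abs_def] smoothstep'_def)
qed

lemma smoothstep'_continuous: "continuous_on UNIV smoothstep'"
proof -
 have right: "continuous_on UNIV (%y::real. if y <= 1 then 6 * y - 6 * y\<^sup>2 else 0)"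
  by (rule continuous_join) (auto intro!: continuous_intros)
 show ?thesis unfolding smoothstep'_def[abs_def]
  by (rule continuous_join) (auto intro!: continuous_intros continuous_on_subset[OF right])
qed

lemma smoothstep'_bound: "\<bar>smoothstep' y\<bar> <= 3 / 2"
proof (cases "0 < y & y <= 1")
 case True
 have "6 * y - 6 * y\<^sup>2 = 3 / 2 - 6 * (y - 1 / 2)^2" by (simp add: power2_eq_square algebra_simps)
 moreover have "0 <= 6 * y * (1 - y)" using True by simp
 moreover have "0 <= (y - 1 / 2)^2" by simp
 moreover have "6 * y * (1 - y) = 6 * y - 6 * y\<^sup>2" by (simp add: power2_eq_square algebra_simps)
 ultimately have "0 <= 6 * y - 6 * y\<^sup>2" "6 * y - 6 * y\<^sup>2 <= 3 / 2" by linarith+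
 then show ?thesis using True by (simp add: smoothstep'_def)
qed (auto simp: smoothstep'_def)

lemma smoothstep_bounds: "0 <= smoothstep y" "smoothstep y <= 1"
proof -
 have "3 * y\<^sup>2 - 2 * y ^ 3 = y\<^sup>2 * (3 - 2 * y)" "1 - (3 * y\<^sup>2 - 2 * y ^ 3) = (1 - y)^2 * (1 + 2 * y)"
  by (simp_all add: power2_eq_square power3_eq_cube algebra_simps)
 moreover have "0 <= y\<^sup>2 * (3 - 2 * y)" "0 <= (1 - y)^2 * (1 + 2 * y)" if "0 < y" "y <= 1"
  using that by (auto intro!: mult_nonneg_nonneg)
 ultimately show "0 <= smoothstep y" "smoothstep y <= 1" unfolding smoothstep_def by (auto, linarith)
qed

definition cutoff :: "real^'n => real => real => (real^'n => real) => bool" where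
 "cutoff z r1 r2 \<eta> \<longleftrightarrow> C1 \<eta> & (ALL x. 0 <= \<eta> x & \<eta> x <= 1 & norm (grad \<eta> x) <= 3 / (r2 - r1)) &
  (ALL x:cball z r1. \<eta> x = 1 & grad \<eta> x = 0) & (ALL x. x ~: ball z r2 --> \<eta> x = 0 & grad \<eta> x = 0)"

lemma cutoffD:
 assumes "cutoff z r1 r2 \<eta>"
 shows "C1 \<eta>" "0 <= \<eta> x" "\<eta> x <= 1" "norm (grad \<eta> x) <= 3 / (r2 - r1)"
  "x : cball z r1 ==> \<eta> x = 1" "x : cball z r1 ==> grad \<eta> x = 0"
  "x ~: ball z r2 ==> \<eta> x = 0" "x ~: ball z r2 ==> grad \<eta> x = 0"
 using assms by (auto simp: cutoff_def)

lemma quadratic_C1: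
 fixes z :: "real^'n"
 shows "C1 (%x. (c - (x - z) \<bullet> (x - z)) / d)"
  and "grad (%x. (c - (x - z) \<bullet> (x - z)) / d) = (%x. (- 2 / d) *. (x - z))"
proof -
 have deriv: "((%x. (c - (x - z) \<bullet> (x - z)) / d) has_derivative (%h. ((- 2 / d) *. (x - z)) \<bullet> h)) (at x)" for x
 proof -
  have "((%x. (x - z) \<bullet> (x - z)) has_derivative (%h. 2 * ((x - z) \<bullet> h))) (at x)"
   by (auto intro!: derivative_eq_intros simp: inner_commute)
  from has_derivative_mult_left[OF has_derivative_diff[OF has_derivative_const this], of c "1 / d"]
  have "((%x. (c - (x - z) \<bullet> (x - z)) * (1 / d)) has_derivative (%h. (0 - 2 * ((x - z) \<bullet> h)) * (1 / d))) (at x)" .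
  moreover have "(%h. (0 - 2 * ((x - z) \<bullet> h)) * (1 / d)) = (%h. ((- 2 / d) *. (x - z)) \<bullet> h)" by (auto simp: fun_eq_iff)
  ultimately show ?thesis by simp
 qed
 have "continuous_on UNIV (%x. (- 2 / d) *. (x - z))" by (intro continuous_intros)
 from C1I[OF deriv this] show "C1 (%x. (c - (x - z) \<bullet> (x - z)) / d)"
  "grad (%x. (c - (x - z) \<bullet> (x - z)) / d) = (%x. (- 2 / d) *. (x - z))" by auto
qed

lemma cutoff_exists:
 fixes z :: "real^'n"
 assumes r: "0 <= r1" "r1 < r2"
 obtains \<eta> where "cutoff z r1 r2 \<eta>"
proof
 define d where "d = r2\<^sup>2 - r1\<^sup>2"
 have d_factor: "d = (r2 - r1) * (r2 + r1)" by (simp add: d_def power2_eq_square algebra_simps)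
 have d: "d > 0" using r unfolding d_factor by (intro mult_pos_pos) auto
 define q where "q = (%x::real^'n. (r2\<^sup>2 - (x - z) \<bullet> (x - z)) / d)"
 have C1: "C1 (%x. smoothstep (q x))"
  unfolding q_def by (rule C1_compose[OF quadratic_C1(1) smoothstep_deriv smoothstep'_continuous])
 have grad: "grad (%x. smoothstep (q x)) x = smoothstep' (q x) *. ((- 2 / d) *. (x - z))" for x
  unfolding q_def by (simp add: grad_compose[OF quadratic_C1(1) smoothstep_deriv smoothstep'_continuous] quadratic_C1(2))
 have inside: "q x \<ge> 1" if "x : cball z r1" for x
 proof -
  have "(norm (x - z))^2 <= r1\<^sup>2" using that by (intro power_mono) (auto simp: dist_norm norm_minus_commute)
  then show ?thesis using d by (simp add: q_def dot_square_norm d_def)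
 qed
 have outside: "q x <= 0" if "x ~: ball z r2" for x
 proof -
  have "r2\<^sup>2 <= (norm (x - z))^2" using that r by (intro power_mono) (auto simp: dist_norm norm_minus_commute)
  then show ?thesis using d by (simp add: q_def dot_square_norm divide_le_0_iff)
 qed
 have "norm (grad (%x. smoothstep (q x)) x) <= 3 / (r2 - r1)" for x
 proof (cases "x : ball z r2")
  case True
  then have "norm (x - z) <= r2 + r1" using r by (auto simp: dist_norm norm_minus_commute)
  then have "\<bar>smoothstep' (q x)\<bar> * (2 / d * norm (x - z)) <= 3 / 2 * (2 / d * (r2 + r1))"
   using d r by (intro mult_mono smoothstep'_bound) auto
  also have "\<dots> = 3 / (r2 - r1)" using r unfolding d_factor by (simp add: divide_simps)
  finally show ?thesis using d unfolding grad norm_scaleR by simp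
 qed (use outside r in \<open>simp add: grad smoothstep'_def\<close>)
 moreover have "smoothstep (q x) = 1" "smoothstep' (q x) = 0" if "x : cball z r1" for x
  using inside[OF that] by (auto simp: smoothstep_def smoothstep'_def power2_eq_square)
 moreover have "smoothstep (q x) = 0" "smoothstep' (q x) = 0" if "x ~: ball z r2" for x
  using outside[OF that] by (auto simp: smoothstep_def smoothstep'_def)
 ultimately show "cutoff z r1 r2 (%x. smoothstep (q x))"
  unfolding cutoff_def using C1 smoothstep_bounds by (simp add: grad)
qed

subsection \<open>Test functions\<close>

definition C1c :: "(real^'n) set => (real^'n => real) set" where
 "C1c U = {\<phi>. C1 \<phi> & (EX K. compact K & K <= U & supported_in \<phi> K)}"

lemma C1cI: "C1 \<phi> ==> compact K ==> K <= U ==> supported_in \<phi> K ==> \<phi> : C1c U"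
 by (auto simp: C1c_def)

lemma C1cE:
 assumes "\<phi> : C1c U"
 obtains K where "compact K" "K <= U" "supported_in \<phi> K" "supported_in (grad \<phi>) K"
 using assms supported_in_grad compact_imp_closed by (auto simp: C1c_def)

lemma C1c_C1: "\<phi> : C1c U ==> C1 \<phi>"
 by (simp add: C1c_def)

lemma C1c_mono: "\<phi> : C1c U ==> U <= V ==> \<phi> : C1c V"
 unfolding C1c_def by blast

lemma C1c_mult: "\<eta> : C1c U ==> C1 f ==> (%x. \<eta> x * f x) : C1c U"
 unfolding C1c_def using C1_mult[of \<eta> f] by (auto simp: supported_in_def)

lemma C1c_zero:
 assumes "\<phi> : C1c U" "x ~: U"
 shows "\<phi> x = 0" "grad \<phi> x = 0"
 by (rule C1cE[OF assms(1)], use assms(2) in \<open>blast dest: supported_inD\<close>)+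

lemma cutoff_C1c: "cutoff z r1 r2 \<eta> ==> r2 < r3 ==> \<eta> : C1c (ball z r3)"
 by (rule C1cI[of _ "cball z r2"]) (auto simp: cutoff_def supported_in_def)

lemma C1c_bounded:
 assumes "\<phi> : C1c U"
 obtains B where "B > 0" "!!x. \<bar>\<phi> x\<bar> <= B" "!!x. norm (grad \<phi> x) <= B"
proof (rule C1cE[OF assms])
 fix K assume K: "compact K" "supported_in \<phi> K" "supported_in (grad \<phi>) K"
 obtain B where B: "B > 0" "!!x. norm (\<phi> x) <= B"
  using bounded_compact_support[OF C1_continuous[OF C1c_C1[OF assms]] K(1,2)] by blast
 obtain B' where "!!x. norm (grad \<phi> x) <= B'"
  using bounded_compact_support[OF C1_continuous_grad[OF C1c_C1[OF assms]] K(1,3)] by blast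
 then show thesis using B by (intro that[of "max B B'"]) (auto simp: le_max_iff_disj)
qed

lemma integral_reflect:
 fixes f :: "real^'n => real"
 assumes [measurable]: "f : Borel"
 shows "(LBINT y. f (x - y)) = (LBINT y. f y)"
proof -
 have "lborel = distr lborel borel (%y::real^'n. x - y)"
  using lborel_affine[of "-1" x] by (simp add: density_1)
 then have "(LBINT y. f y) = (\<integral>y. f y \<partial>distr lborel borel (%y. x - y))" by simp
 also have "\<dots> = (LBINT y. f (x - y))" by (rule integral_distr) measurable
 finally show ?thesis by simp
qed

lemma conv_commute:
 assumes [measurable]: "\<kappa> : Borel" "f : Borel"
 shows "conv \<kappa> f = conv f \<kappa>"
proof
 fix x
 show "conv \<kappa> f x = conv f \<kappa> x"
  unfolding conv_def using integral_reflect[of "%y. \<kappa> (x - y) * f y" x] by (simp add: mult.commute)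
qed

lemma continuous_compact_support_integrable:
 assumes "continuous_on UNIV f" "compact K" "supported_in f K"
 shows "integrable lborel (f :: real^'n => real)"
proof -
 have "integrable lborel (%x. ind K x *. f x)"
  using assms by (intro borel_integrable_compact) (auto intro: continuous_on_subset)
 moreover have "(%x. ind K x *. f x) = f" using assms(3) by (force simp: supported_in_def)
 ultimately show ?thesis by simp
qed

lemma conv_indicator_ball:
 assumes "f : Borel" "supported_in f (cball 0 e)" "x : ball 0 1"
 shows "conv f (ind (ball 0 (e + 1))) x = (LBINT y. f y)"
proof -
 have "f (x - y) * ind (ball 0 (e + 1)) y = f (x - y)" for y
 proof (cases "y : ball 0 (e + 1)")
  case False
  then have "x - y ~: cball 0 e" using assms(3) norm_triangle_ineq3[of y x] by (auto simp: norm_minus_commute)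
  then show ?thesis using supported_inD[OF assms(2)] by simp
 qed simp
 then have "(%y. f (x - y) * ind (ball 0 (e + 1)) y) = (%y. f (x - y))" by (rule ext)
 then show ?thesis unfolding conv_def using integral_reflect[OF assms(1), of x] by simp
qed

lemma integral_pderiv_zero:
 fixes \<phi> :: "real^'n => real"
 assumes "\<phi> : C1c UNIV"
 shows "(LBINT x. pderiv \<phi> i x) = 0"
proof -
 note C1 = C1c_C1[OF assms]
 obtain K where K: "compact K" "supported_in \<phi> K" using assms by (rule C1cE)
 obtain e where "K <= cball 0 e"
  using compact_imp_bounded[OF K(1)] by (metis bounded_iff mem_cball_0 subsetI)
 then have supp: "supported_in \<phi> (cball 0 e)" using K(2) supported_in_mono by blast
 define f where "f = (ind (ball (0::real^'n) (e + 1)) :: _ => real)"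
 have int: "integrable lborel f"
  unfolding f_def using emeasure_lborel_ball_finite[of "0::real^'n" "e + 1"] by (intro integrable_real_indicator) auto
 have "((%x::real^'n. LBINT y. \<phi> y) has_derivative (%h. 0)) (at 0)" by simp
 then have "((conv \<phi> f) has_derivative (%h. 0)) (at 0)"
  by (rule has_derivative_transform_within_open[OF _ open_ball[of 0 1]])
   (use conv_indicator_ball[OF C1_measurable[OF C1] supp] in \<open>auto simp: f_def\<close>)
 from pderiv_eq[OF this, of i] have "conv (pderiv \<phi> i) f 0 = 0"
  using conv_pderiv[OF C1 compact_cball supp int] by simp
 moreover have "conv (pderiv \<phi> i) f 0 = (LBINT y. pderiv \<phi> i y)"
  unfolding f_def
  by (rule conv_indicator_ball[OF borel_measurable_continuous_onI[OF C1_continuous_pderiv[OF C1]] supported_in_pderiv[OF supp closed_cball]]) simp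
 ultimately show ?thesis by simp
qed

lemma conv_kernel_uniform:
 assumes k: "kernel d \<rho>" and f: "continuous_on UNIV f" "compact K" "supported_in f K"
  and osc: "!!x y. norm (x - y) < d ==> \<bar>f y - f x\<bar> <= \<epsilon>" and "0 <= \<epsilon>"
 shows "\<bar>conv \<rho> f x - f x\<bar> <= \<epsilon>"
proof -
 have [measurable]: "\<rho> : Borel" "f : Borel"
  using kernel_measurable[OF k] f(1) borel_measurable_continuous_onI by auto
 have "ennreal \<bar>conv \<rho> f x - f x\<bar> <= (NN y. ennreal (\<rho> (x - y)) * ennreal \<bar>f y - f x\<bar>)"
  by (rule conv_diff_le[OF k continuous_compact_support_integrable[OF f]])
 also have "\<dots> <= (NN y. ennreal (\<rho> (x - y)) * ennreal \<epsilon>)"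
 proof (rule nn_integral_mono)
  fix y
  show "ennreal (\<rho> (x - y)) * ennreal \<bar>f y - f x\<bar> <= ennreal (\<rho> (x - y)) * ennreal \<epsilon>"
   using osc[of x y] k by (cases "norm (x - y) < d") (auto simp: kernel_def intro!: mult_left_mono ennreal_leI)
 qed
 also have "\<dots> = ennreal \<epsilon>" using kernel_reflect_integral[OF k, of x] by (simp add: nn_integral_multc)
 finally show ?thesis using \<open>0 <= \<epsilon>\<close> by simp
qed

lemma conv_kernel_supported:
 assumes "kernel d \<rho>" "d <= e" "supported_in \<phi> K"
 shows "supported_in (conv \<rho> \<phi>) {x + y | x y. x : K & y : cball 0 e}"
 unfolding supported_in_def
proof (intro allI impI)
 fix x assume x: "x ~: {x + y | x y. x : K & y : cball 0 e}"
 have "\<rho> (x - y) * \<phi> y = 0" for y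
 proof (cases "y : K")
  case True
  have "x = y + (x - y)" by simp
  then have "x - y ~: cball 0 e" using x True by blast
  then show ?thesis using assms(1,2) by (auto simp: kernel_def)
 qed (simp add: supported_inD[OF assms(3)])
 then have "(%y. \<rho> (x - y) * \<phi> y) = (%y. 0)" by (rule ext)
 then show "conv \<rho> \<phi> x = 0" unfolding conv_def by simp
qed

lemma conv_kernel_pderiv:
 assumes k: "kernel d \<rho>" and \<phi>: "C1 \<phi>" "compact K" "supported_in \<phi> K"
 shows "pderiv (conv \<rho> \<phi>) i x = conv \<rho> (pderiv \<phi> i) x"
proof -
 note \<rho> = kernel_measurable[OF k]
 have "integrable lborel \<rho>"
  using k \<rho> by (intro integrableI_nonneg) (auto simp: kernel_def)
 then have "pderiv (conv \<phi> \<rho>) i x = conv (pderiv \<phi> i) \<rho> x" by (rule conv_pderiv[OF \<phi>])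
 then show ?thesis
  using conv_commute[OF \<rho> C1_measurable[OF \<phi>(1)]]
   conv_commute[OF \<rho> borel_measurable_continuous_onI[OF C1_continuous_pderiv[OF \<phi>(1), of i]]] by simp
qed

lemma conv_kernel_grad_uniform:
 fixes \<phi> :: "real^'n => real"
 assumes k: "kernel d \<rho>" and \<phi>: "C1 \<phi>" "compact K" "supported_in \<phi> K" and \<epsilon>: "0 <= \<epsilon>"
  and osc: "!!x y. norm (x - y) < d ==> norm (grad \<phi> y - grad \<phi> x) <= \<epsilon> / CARD('n)"
 shows "norm (grad (conv \<rho> \<phi>) x - grad \<phi> x) <= \<epsilon>"
proof -
 have component: "\<bar>(grad (conv \<rho> \<phi>) x - grad \<phi> x) $ i\<bar> <= \<epsilon> / CARD('n)" for i
 proof -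
  have "\<bar>conv \<rho> (pderiv \<phi> i) x - pderiv \<phi> i x\<bar> <= \<epsilon> / CARD('n)"
  proof (rule conv_kernel_uniform[OF k C1_continuous_pderiv[OF \<phi>(1)] \<phi>(2) supported_in_pderiv[OF \<phi>(3) compact_imp_closed[OF \<phi>(2)]]])
   show "\<bar>pderiv \<phi> i y - pderiv \<phi> i x\<bar> <= \<epsilon> / CARD('n)" if "norm (x - y) < d" for x y
    using order_trans[OF component_le_norm_cart osc[OF that], of i] by (simp add: grad_def)
  qed (use \<epsilon> in auto)
  then show ?thesis by (simp add: grad_def conv_kernel_pderiv[OF k \<phi>])
 qed
 have "norm (grad (conv \<rho> \<phi>) x - grad \<phi> x) <= (\<Sum>i\<in>UNIV. \<bar>(grad (conv \<rho> \<phi>) x - grad \<phi> x) $ i\<bar>)" by (rule norm_le_l1_cart)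
 also have "\<dots> <= (\<Sum>i\<in>(UNIV::'n set). \<epsilon> / CARD('n))" by (intro sum_mono component)
 finally show ?thesis by simp
qed

lemma test_fun_dense:
 fixes \<phi> :: "real^'n => real"
 assumes \<phi>: "\<phi> : C1c U" and U: "open U"
 obtains K where "compact K" "K <= U" "supported_in \<phi> K"
  "!!\<epsilon>. \<epsilon> > 0 ==> EX \<psi>. test_fun U \<psi> & supported_in \<psi> K & (ALL x. \<bar>\<psi> x - \<phi> x\<bar> <= \<epsilon> & norm (grad \<psi> x - grad \<phi> x) <= \<epsilon>)"
proof -
 note C1 = C1c_C1[OF \<phi>]
 obtain K where K: "compact K" "K <= U" "supported_in \<phi> K" "supported_in (grad \<phi>) K" using \<phi> by (rule C1cE)
 obtain e where e: "e > 0" "(\<Union>x\<in>K. cball x e) <= U"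
  using compact_subset_open_imp_cball_epsilon_subset[OF K(1) U K(2)] by blast
 define K' where "K' = {x + y | x y. x : K & y : cball 0 e}"
 have K': "compact K'" "K' <= U" "K <= K'"
  unfolding K'_def using compact_sums[OF K(1) compact_cball] e by (blast, force simp: dist_norm, force)
 have "EX \<psi>. test_fun U \<psi> & supported_in \<psi> K' & (ALL x. \<bar>\<psi> x - \<phi> x\<bar> <= \<epsilon> & norm (grad \<psi> x - grad \<phi> x) <= \<epsilon>)"
  if \<epsilon>: "\<epsilon> > 0" for \<epsilon> :: real
 proof -
  obtain d1 where d1: "d1 > 0" "!!a b. dist a b < d1 ==> dist (\<phi> a) (\<phi> b) < \<epsilon>"
   using compact_support_modulus[OF C1_continuous[OF C1] K(1,3) \<epsilon>] by blast
  obtain d2 where d2: "d2 > 0" "!!a b. dist a b < d2 ==> dist (grad \<phi> a) (grad \<phi> b) < \<epsilon> / CARD('n)"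
   using compact_support_modulus[OF C1_continuous_grad[OF C1] K(1,4), of "\<epsilon> / CARD('n)"] \<epsilon> by auto
  define d where "d = min e (min d1 d2)"
  have d: "d > 0" "d <= e" "d <= d1" "d <= d2" using d1 d2 e by (auto simp: d_def)
  obtain \<rho> :: "real^'n => real" where k: "kernel d \<rho>" using kernel_exists[OF d(1)] by blast
  have supp: "supported_in (conv \<rho> \<phi>) K'" unfolding K'_def by (rule conv_kernel_supported[OF k d(2) K(3)])
  have "test_fun U (conv \<rho> \<phi>)"
   by (rule test_funI[OF _ supp K'(1,2)])
    (rule conv_kernel_smooth[OF k continuous_compact_support_integrable[OF C1_continuous[OF C1] K(1,3)]])
  moreover have "\<bar>conv \<rho> \<phi> x - \<phi> x\<bar> <= \<epsilon>" for x
  proof (rule conv_kernel_uniform[OF k C1_continuous[OF C1] K(1,3)])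
   show "\<bar>\<phi> y - \<phi> x\<bar> <= \<epsilon>" if "norm (x - y) < d" for x y
    using d1(2)[of x y] d that by (simp add: dist_norm norm_minus_commute dist_real_def)
  qed (use \<epsilon> in auto)
  moreover have "norm (grad (conv \<rho> \<phi>) x - grad \<phi> x) <= \<epsilon>" for x
   by (rule conv_kernel_grad_uniform[OF k C1 K(1,3)])
    (use d2(2) d \<epsilon> in \<open>auto simp: dist_norm norm_minus_commute intro!: less_imp_le\<close>)
  ultimately show ?thesis using supp by blast
 qed
 then show thesis by (rule that[OF K'(1,2) supported_in_mono[OF K(3) K'(3)]])
qed

subsection \<open>Weak gradients\<close>

definition wgrad :: "(real^'n) set => (real^'n => real) => (real^'n => real^'n) => bool" where
 "wgrad U u g \<longleftrightarrow> (ALL \<phi> i. test_fun U \<phi> -->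
  (LBINT x. u x * pderiv \<phi> i x) = - (LBINT x. g x $ i * \<phi> x))"

lemma vec_component_measurable:
 "f : Borel ==> (%x. (f x :: real^'n) $ i) : Borel"
 using borel_measurable_inner[OF _ borel_measurable_const, of f borel "axis i 1"] by (simp add: inner_axis)

lemma L2_components:
 fixes f :: "'a::euclidean_space => real^'n"
 assumes f: "f : Borel" and [measurable]: "S : sets borel"
 shows "L2 S f = (\<Sum>i\<in>UNIV. L2 S (%x. f x $ i))"
proof -
 note [measurable] = vec_component_measurable[OF f]
 have "(norm v)^2 = (\<Sum>i\<in>UNIV. (v $ i)^2)" for v :: "real^'n"
  unfolding power2_norm_eq_inner by (simp add: inner_vec_def power2_eq_square)
 then have "L2 S f = (NN x. (\<Sum>i\<in>UNIV. ennreal ((norm (f x $ i))^2) * ind S x))"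
  by (simp add: L2_def sum_ennreal sum_distrib_right[symmetric])
 also have "\<dots> = (\<Sum>i\<in>UNIV. L2 S (%x. f x $ i))"
  unfolding L2_def by (rule nn_integral_sum) measurable
 finally show ?thesis .
qed

lemma moll_weak_pderiv:
 assumes w: "wgrad U u g" and k: "kernel e \<rho>" and x: "cball x e <= S'" and subset: "S' <= U"
  and u_int: "integrable lborel (%x. ind S' x * u x)"
 shows "pderiv (conv \<rho> (%x. ind S' x * u x)) i x = conv \<rho> (%x. ind S' x * g x $ i) x"
proof -
 have "pderiv (conv \<rho> (%x. ind S' x * u x)) i x = conv (pderiv \<rho> i) (%x. ind S' x * u x) x"
  by (rule conv_pderiv[OF kernel_C1[OF k] compact_cball kernel_supported[OF k] u_int])
 also have "\<dots> = (LBINT y. u y * (- pderiv (%y. \<rho> (x - y)) i y))"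
  unfolding conv_def
 proof (intro Bochner_Integration.integral_cong refl)
  fix y
  have "pderiv \<rho> i (x - y) = 0" if "y ~: S'"
  proof -
   have "y ~: cball x e" using x that by blast
   then show ?thesis
    by (intro supported_inD[OF supported_in_pderiv[OF kernel_supported[OF k] closed_cball]]) (simp add: dist_norm norm_minus_commute)
  qed
  then show "pderiv \<rho> i (x - y) * (ind S' y * u y) = u y * (- pderiv (%y. \<rho> (x - y)) i y)"
   by (auto simp: pderiv_reflect[OF kernel_C1[OF k]] indicator_def)
 qed
 also have "\<dots> = - (LBINT y. u y * pderiv (%y. \<rho> (x - y)) i y)" by simp
 also have "\<dots> = (LBINT y. g y $ i * \<rho> (x - y))"
  using w kernel_test_fun[OF k order_trans[OF x subset]] unfolding wgrad_def by simp
 also have "\<dots> = conv \<rho> (%x. ind S' x * g x $ i) x"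
  unfolding conv_def
 proof (intro Bochner_Integration.integral_cong refl)
  fix y
  have "\<rho> (x - y) = 0" if "y ~: S'"
  proof -
   have "y ~: cball x e" using x that by blast
   then show ?thesis by (intro supported_inD[OF kernel_supported[OF k]]) (simp add: dist_norm norm_minus_commute)
  qed
  then show "g y $ i * \<rho> (x - y) = \<rho> (x - y) * (ind S' y * g y $ i)"
   by (auto simp: indicator_def)
 qed
 finally show ?thesis .
qed

lemma kernel_sequence:
 assumes "e0 > 0"
 obtains e and \<rho> :: "nat => real^'n => real" where "!!j. kernel (e j) (\<rho> j)" "!!j. e j <= e0" "e ---> 0"
proof -
 define e where "e j = e0 / Suc j" for j
 have e: "e j > 0" "e j <= e0" for j using assms by (auto simp: e_def field_simps)
 have "e ---> 0"
  using tendsto_mult[OF tendsto_const[of e0] LIMSEQ_inverse_real_of_nat] by (simp add: e_def[abs_def] divide_inverse)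
 moreover have "ALL j. EX \<rho>::real^'n => real. kernel (e j) \<rho>" using kernel_exists[OF e(1)] by blast
 from choice[OF this] obtain \<rho> :: "nat => real^'n => real" where "!!j. kernel (e j) (\<rho> j)" by blast
 ultimately show thesis using e(2) that by blast
qed

lemma moll_weak_grad_tendsto:
 fixes u :: "real^'n => real"
 assumes w: "wgrad U u g" and S'U: "S' <= U" and [measurable]: "S : sets borel" "S' : sets borel" "g : Borel"
  and u_int: "integrable lborel (%x. ind S' x * u x)"
  and g_int: "!!i. integrable lborel (%x. ind S' x * g x $ i)" and g_L2: "L2 S' g < \<infinity>"
  and k: "!!j. kernel (e j) (\<rho> j)" and e: "e ---> 0" and nbhd: "!!x j. x : S ==> x : S' & cball x (e j) <= S'"
 shows "(%j. L2 S (%x. grad (conv (\<rho> j) (%x. ind S' x * u x)) x - g x)) ---> 0"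
proof (rule ennreal_tendsto_0_le)
 define w where "w j = conv (\<rho> j) (%x. ind S' x * u x)" for j
 define h where "h = (%i x. ind S' x * g x $ i)"
 have "C1 (w j)" for j
  using conv_kernel_smooth[OF k u_int] Ck_C1 unfolding w_def smooth_def by blast
 note [measurable] = vec_component_measurable grad_measurable[OF this]
 have component: "(grad (w j) x - g x) $ i = conv (\<rho> j) (h i) x - h i x" if "x : S" for x j i
  using moll_weak_pderiv[OF assms(1) k _ S'U u_int, of x j i] nbhd[OF that, of j]
  by (simp add: w_def h_def grad_def)
 have "(%j. L2 UNIV (%x. conv (\<rho> j) (h i) x - h i x)) ---> 0" for i
 proof (rule moll_L2_tendsto[OF _ _ k e])
  have "L2 UNIV (h i) <= L2 S' g"
   unfolding L2_def h_def
   by (intro nn_integral_mono) (auto simp: indicator_def intro!: ennreal_leI power_mono component_le_norm_cart abs_le_square_iff[THEN iffD1])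
  then show "L2 UNIV (h i) < \<infinity>" using g_L2 by (rule le_less_trans)
 qed (simp add: h_def g_int)
 then have "(%j. \<Sum>i\<in>UNIV. L2 UNIV (%x. conv (\<rho> j) (h i) x - h i x)) ---> (\<Sum>i\<in>(UNIV::'n set). 0)"
  by (intro tendsto_sum)
 then show "(%j. \<Sum>i\<in>UNIV. L2 UNIV (%x. conv (\<rho> j) (h i) x - h i x)) ---> 0" by simp
 fix j
 have "L2 S (%x. grad (w j) x - g x) = (\<Sum>i\<in>UNIV. L2 S (%x. (grad (w j) x - g x) $ i))"
  by (rule L2_components) measurable
 also have "\<dots> <= (\<Sum>i\<in>UNIV. L2 UNIV (%x. conv (\<rho> j) (h i) x - h i x))"
  unfolding L2_def using component by (intro sum_mono nn_integral_mono) (auto simp: indicator_def simp del: vector_minus_component)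
 finally show "L2 S (%x. grad (conv (\<rho> j) (%x. ind S' x * u x)) x - g x) <= (\<Sum>i\<in>UNIV. L2 UNIV (%x. conv (\<rho> j) (h i) x - h i x))"
  by (simp add: w_def)
qed

lemma weak_grad_approximation:
 fixes u :: "real^'n => real"
 assumes w: "wgrad U u g" and S'U: "S' <= U" and [measurable]: "S : sets borel" "S' : sets borel"
  "u : Borel" "g : Borel"
  and u_int: "integrable lborel (%x. ind S' x * u x)"
  and g_int: "!!i. integrable lborel (%x. ind S' x * g x $ i)" and g_L2: "L2 S' g < \<infinity>"
  and e0: "e0 > 0" "!!x. x : S ==> cball x e0 <= S'"
 obtains w :: "nat => _" where "!!j. C1 (w j)" "(%j. NN x. ennreal \<bar>w j x - u x\<bar> * ind S x) ---> 0"
  "(%j. L2 S (%x. grad (w j) x - g x)) ---> 0" "L2 S' u < \<infinity> ==> (%j. L2 S (%x. w j x - u x)) ---> 0"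
proof -
 obtain e and \<rho> :: "nat => real^'n => real" where k: "!!j. kernel (e j) (\<rho> j)" and e: "!!j. e j <= e0" "e ---> 0"
  using kernel_sequence[OF e0(1)] by blast
 define f where "f = (%x. ind S' x * u x)"
 have nbhd: "x : S' & cball x (e j) <= S'" if "x : S" for x j
  using e0 that e(1)[of j] subset_cball[of "e j" e0 x] by force
 have C1: "C1 (conv (\<rho> j) f)" for j
  using conv_kernel_smooth[OF k u_int] Ck_C1 unfolding f_def smooth_def by blast
 have "(%j. NN x. ennreal \<bar>conv (\<rho> j) f x - u x\<bar> * ind S x) ---> 0"
 proof (rule ennreal_tendsto_0_le[OF moll_L1_tendsto[OF u_int k e(2)]])
  show "(NN x. ennreal \<bar>conv (\<rho> j) f x - u x\<bar> * ind S x) <=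
   (NN x. ennreal \<bar>conv (\<rho> j) (%x. ind S' x * u x) x - ind S' x * u x\<bar>)" for j
   using nbhd by (intro nn_integral_mono) (auto simp: f_def indicator_def)
 qed
 moreover have "(%j. L2 S (%x. conv (\<rho> j) f x - u x)) ---> 0" if "L2 S' u < \<infinity>"
 proof (rule ennreal_tendsto_0_le)
  have "L2 UNIV f = L2 S' u"
   unfolding L2_def f_def by (intro nn_integral_cong) (auto simp: indicator_def)
  then show "(%j. L2 UNIV (%x. conv (\<rho> j) f x - f x)) ---> 0"
   using that by (intro moll_L2_tendsto[OF _ _ k e(2)]) (auto simp: f_def u_int)
  show "L2 S (%x. conv (\<rho> j) f x - u x) <= L2 UNIV (%x. conv (\<rho> j) f x - f x)" for j
   unfolding L2_def using nbhd by (intro nn_integral_mono) (auto simp: f_def indicator_def)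
 qed
 moreover have "(%j. L2 S (%x. grad (conv (\<rho> j) f) x - g x)) ---> 0"
  unfolding f_def by (rule moll_weak_grad_tendsto[OF w S'U _ _ _ u_int g_int g_L2 k e(2) nbhd]) auto
 ultimately show thesis using C1 by (intro that)
qed

lemma weak_grad_sobolev:
 fixes u :: "real^'n => real"
 assumes "wgrad U u g" "S' <= U" and [measurable]: "S : sets borel" "S' : sets borel"
  "u : Borel" "g : Borel"
  and "integrable lborel (%x. ind S' x * u x)"
  "!!i. integrable lborel (%x. ind S' x * g x $ i)" and g_L2: "L2 S' g < \<infinity>"
  and e0: "e0 > 0" "!!x. x : S ==> cball x e0 <= S'" and u_L2: "L2 S' u < \<infinity>"
 shows "sobolev S UNIV u g"
proof -
 obtain w :: "nat => _" where w: "!!j. C1 (w j)" "(%j. L2 S (%x. grad (w j) x - g x)) ---> 0"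
  "(%j. L2 S (%x. w j x - u x)) ---> 0"
  using weak_grad_approximation[OF assms(1-11)] u_L2 by blast
 have S_subset: "S <= S'" using e0 by (meson centre_in_cball less_imp_le subset_iff)
 show ?thesis
  by (rule sobolevI[where w=w]) (use w L2_mono_set[OF S_subset] g_L2 u_L2 in \<open>auto intro: le_less_trans\<close>)
qed

subsection \<open>Poincare, Faber--Krahn and Hardy inequalities\<close>

lemma liminf_bound:
 fixes X Y :: "nat => ennreal"
 assumes "!!j. X j <= c + Y j" "Y ---> 0"
 shows "liminf X <= c"
proof -
 have "(%j. c + Y j) ---> c + 0" by (intro tendsto_intros assms(2))
 then have "liminf (%j. c + Y j) = c" using lim_imp_Liminf[OF sequentially_bot] by fastforce
 moreover have "liminf X <= liminf (%j. c + Y j)" by (intro Liminf_mono always_eventually allI assms(1))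
 ultimately show ?thesis by simp
qed

lemma L2_le_liminf:
 fixes f :: "nat => 'a::euclidean_space => 'b::euclidean_space"
 assumes [measurable]: "!!j. f j : Borel" "h : Borel" "S : sets borel"
  and ae: "AE x\<in>S in lborel. (%j. f j x) ---> h x"
 shows "L2 S h <= liminf (%j. L2 S (f j))"
proof -
 have "L2 S h <= (NN x. liminf (%j. ennreal ((norm (f j x))^2) * ind S x))"
  unfolding L2_def
 proof (rule nn_integral_mono_AE, use ae in eventually_elim)
  fix x assume lim: "x : S --> (%j. f j x) ---> h x"
  show "ennreal ((norm (h x))^2) * ind S x <= liminf (%j. ennreal ((norm (f j x))^2) * ind S x)"
  proof (cases "x : S")
   case True
   then have "(%j. ennreal ((norm (f j x))^2)) ---> ennreal ((norm (h x))^2)"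
    using lim by (intro tendsto_ennrealI tendsto_power tendsto_norm) blast
   then have "liminf (%j. ennreal ((norm (f j x))^2)) = ennreal ((norm (h x))^2)"
    by (intro lim_imp_Liminf) auto
   then show ?thesis using True by simp
  qed simp
 qed
 also have "\<dots> <= liminf (%j. L2 S (f j))"
  unfolding L2_def by (rule nn_integral_liminf) measurable
 finally show ?thesis .
qed

lemma L2_fatou:
 fixes f :: "nat => 'a::euclidean_space => 'b::euclidean_space"
 assumes "!!j. f j : Borel" "h : Borel" "S : sets borel" "AE x\<in>S in lborel. (%j. f j x) ---> h x"
  and "!!j. L2 S (f j) <= c + Y j" "Y ---> 0"
 shows "L2 S h <= c"
 using L2_le_liminf[OF assms(1-4)] liminf_bound[OF assms(5,6)] by (rule order_trans)

lemma C1_segment_integral: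
 fixes w :: "real^'n => real"
 assumes w: "C1 w"
 shows "has_bochner_integral lborel (%t. ind {0..1} t *. (grad w (y + t *. (x - y)) \<bullet> (x - y))) (w x - w y)"
proof -
 let ?f = "%t. grad w (y + t *. (x - y)) \<bullet> (x - y)"
 have cont: "continuous_on UNIV ?f"
  by (intro continuous_intros continuous_on_compose2[OF C1_continuous_grad[OF w]]) auto
 have "((%t. w (y + t *. (x - y))) has_vector_derivative ?f t) (at t)" for t
 proof -
  have "((%t. y + t *. (x - y)) has_derivative (%h. h *. (x - y))) (at t)"
   by (auto intro!: derivative_eq_intros)
  from has_derivative_compose[OF this C1D[OF w]] show ?thesis
   by (simp add: has_vector_derivative_def)
 qed
 then have "has_bochner_integral lborel (%t. ind {0..1} t *. ?f t) (w (y + 1 *. (x - y)) - w (y + 0 *. (x - y)))"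
  by (intro has_bochner_integral_FTC_Icc) (auto intro: has_vector_derivative_at_within continuous_on_subset[OF cont])
 then show ?thesis by simp
qed

lemma C1_segment_bound:
 fixes w :: "real^'n => real"
 assumes w: "C1 w"
 shows "ennreal ((w x - w y)^2) <= (NN t. ind {0..1} t * ennreal ((norm (x - y))^2 * (norm (grad w (y + t *. (x - y))))^2))"
proof -
 define f where "f t = grad w (y + t *. (x - y)) \<bullet> (x - y)" for t
 have "continuous_on UNIV f"
  unfolding f_def by (intro continuous_intros continuous_on_compose2[OF C1_continuous_grad[OF w]]) auto
 then have [measurable]: "f : Borel" by (rule borel_measurable_continuous_onI)
 have "ennreal \<bar>w x - w y\<bar> <= (NN t. norm (ind {0..1} t *. f t))"
  using C1_segment_integral[OF w, of y x] integral_norm_bound_ennreal[of lborel "%t. ind {0..1} t *. f t"]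
  by (simp add: has_bochner_integral_iff f_def)
 also have "\<dots> = (NN t. ind {0..1} t * (ind {0..1} t * ennreal \<bar>f t\<bar>))"
  by (intro nn_integral_cong) (auto simp: indicator_def)
 finally have "(ennreal \<bar>w x - w y\<bar>)^2 <= (NN t. ind {0..1} t * (ind {0..1} t * ennreal \<bar>f t\<bar>))^2"
  by (rule power_mono) simp
 also have "\<dots> <= (NN t. (ind {0..1} (t::real))^2) * (NN t. (ind {0..1} t * ennreal \<bar>f t\<bar>)^2)"
  by (rule Cauchy_Schwarz_nn_integral) measurable
 also have "(NN t. (ind {0..1} (t::real))^2) = (NN t. ind {0..1} (t::real))"
  by (intro nn_integral_cong) (auto simp: indicator_def)
 also have "\<dots> = 1" by simp
 also have "(NN t. (ind {0..1} t * ennreal \<bar>f t\<bar>)^2) <=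
   (NN t. ind {0..1} t * ennreal ((norm (x - y))^2 * (norm (grad w (y + t *. (x - y))))^2))"
 proof (rule nn_integral_mono)
  fix t :: real
  have "\<bar>f t\<bar> <= norm (grad w (y + t *. (x - y))) * norm (x - y)" unfolding f_def by (rule Cauchy_Schwarz_ineq2)
  from power_mono[OF this, of 2] have "\<bar>f t\<bar>\<^sup>2 <= (norm (x - y))^2 * (norm (grad w (y + t *. (x - y))))^2"
   by (simp add: power_mult_distrib mult.commute)
  then show "(ind {0..1} t * ennreal \<bar>f t\<bar>)^2 <=
    ind {0..1} t * ennreal ((norm (x - y))^2 * (norm (grad w (y + t *. (x - y))))^2)"
   by (auto simp: indicator_def ennreal_power intro!: ennreal_leI)
 qed
 finally show ?thesis by (simp add: ennreal_power)
qed

lemma affine_contraction_le: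
 fixes f :: "'a::euclidean_space => ennreal"
 assumes [measurable]: "f : Borel" and "c \<ge> 1 / 2"
 shows "(NN x. f (s + c *. x)) <= ennreal (2 ^ DIM('a)) * (NN x. f x)"
proof -
 let ?X = "(NN x. f (s + c *. x))"
 have "1 <= (2 * c) ^ DIM('a)" using assms by (intro one_le_power) auto
 then have "1 * ?X <= ennreal ((2 * c) ^ DIM('a)) * ?X"
  by (intro mult_right_mono) auto
 also have "\<dots> = ennreal (2 ^ DIM('a)) * (ennreal (\<bar>c\<bar> ^ DIM('a)) * ?X)"
  using assms(2) by (simp add: power_mult_distrib ennreal_mult mult.assoc)
 also have "\<dots> = ennreal (2 ^ DIM('a)) * (NN x. f x)"
  using nn_integral_affine[of f c s] assms by simp
 finally show ?thesis by simp
qed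

lemma convex_segment_integral_half:
 fixes h :: "'a::euclidean_space => ennreal"
 assumes [measurable]: "h : Borel" "B : sets borel" and B: "convex B" and t: "1 / 2 <= t" "t <= 1"
 shows "(NN y. (NN x. ind B x * (ind B y * h (y + t *. (x - y)))))
  <= ennreal (2 ^ DIM('a)) * (emeasure lborel B * (NN v. ind B v * h v))"
proof -
 let ?I = "NN v. ind B v * h v"
 have "(NN x. ind B x * (ind B y * h (y + t *. (x - y)))) <= ind B y * (ennreal (2 ^ DIM('a)) * ?I)" for y
 proof -
  let ?p = "%x. (1 - t) *. y + t *. x"
  have "(NN x. ind B x * (ind B y * h (y + t *. (x - y)))) <= (NN x. ind B y * (ind B (?p x) * h (?p x)))"
  proof (rule nn_integral_mono)
   fix x
   have "y + t *. (x - y) = ?p x" by (simp add: algebra_simps)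
   moreover have "?p x : B" if "x : B" "y : B" using B that t unfolding convex_alt by auto
   ultimately show "ind B x * (ind B y * h (y + t *. (x - y))) <= ind B y * (ind B (?p x) * h (?p x))"
    by (auto simp: indicator_def)
  qed
  also have "\<dots> = ind B y * (NN x. ind B (?p x) * h (?p x))" by (rule nn_integral_cmult) measurable
  also have "\<dots> <= ind B y * (ennreal (2 ^ DIM('a)) * ?I)"
   using affine_contraction_le[of "%v. ind B v * h v" t "(1 - t) *. y"] t by (intro mult_left_mono) auto
  finally show ?thesis .
 qed
 then have "(NN y. (NN x. ind B x * (ind B y * h (y + t *. (x - y))))) <= (NN y. ind B y * (ennreal (2 ^ DIM('a)) * ?I))"
  by (intro nn_integral_mono)
 also have "\<dots> = ennreal (2 ^ DIM('a)) * (emeasure lborel B * ?I)"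
  by (subst nn_integral_multc) (auto simp: mult.left_commute)
 finally show ?thesis .
qed

lemma convex_segment_integral:
 fixes h :: "'a::euclidean_space => ennreal"
 assumes [measurable]: "h : Borel" "B : sets borel" and B: "convex B" and t: "0 <= t" "t <= 1"
 shows "(NN x. (NN y. ind B x * (ind B y * h (y + t *. (x - y)))))
  <= ennreal (2 ^ DIM('a)) * (emeasure lborel B * (NN v. ind B v * h v))"
proof (cases "1 / 2 <= t")
 case True
 have "(NN x. (NN y. ind B x * (ind B y * h (y + t *. (x - y))))) = (NN y. (NN x. ind B x * (ind B y * h (y + t *. (x - y)))))"
  by (rule lborel_pair.Fubini'[symmetric]) measurable
 then show ?thesis using convex_segment_integral_half[OF assms(1-3) True t(2)] by simp
next
 case False
 have "y + t *. (x - y) = x + (1 - t) *. (y - x)" for x y :: 'a by (simp add: algebra_simps)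
 then show ?thesis
  using convex_segment_integral_half[OF assms(1-3), of "1 - t"] False t by (simp add: mult.left_commute)
qed

definition mean_osc :: "'a::euclidean_space set => ('a => real) => ennreal" where
 "mean_osc B u = (NN x. L2 B (%y. u x - u y) * ind B x)"

lemma L2_diff_measurable [measurable]:
 fixes u :: "'a::euclidean_space => real"
 assumes [measurable]: "u : Borel" "B : sets borel"
 shows "(%x. L2 B (%y. u x - u y)) : borel_measurable borel"
 unfolding L2_def by measurable

lemma C1_ball_osc_le:
 fixes w :: "real^'n => real"
 assumes w: "C1 w"
 shows "L2 (ball z R) (%y. w x - w y) * ind (ball z R) x <= (NN y. ennreal (4 * R\<^sup>2) *
  (NN t. ind {0..1} (t::real) * (ind (ball z R) x * (ind (ball z R) y * ennreal ((norm (grad w (y + t *. (x - y))))^2)))))"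
proof -
 define B where "B = ball z R"
 note [measurable] = C1_measurable[OF w] grad_measurable[OF w]
 have [measurable]: "B : sets borel" by (simp add: B_def)
 let ?F = "%y t. ind {0..1} (t::real) * (ind B x * (ind B y * ennreal ((norm (grad w (y + t *. (x - y))))^2)))"
 have "L2 B (%y. w x - w y) * ind B x = (NN y. ennreal ((w x - w y)^2) * ind B y * ind B x)"
  unfolding L2_def by (subst nn_integral_multc) auto
 also have "\<dots> <= (NN y. ennreal (4 * R\<^sup>2) * (NN t. ?F y t))"
 proof (rule nn_integral_mono)
  fix y
  show "ennreal ((w x - w y)^2) * ind B y * ind B x <= ennreal (4 * R\<^sup>2) * (NN t. ?F y t)"
  proof (cases "x : B & y : B")
   case True
   then have "norm (x - y) <= 2 * R"
    using dist_triangle_less_add[of x z R y R] by (auto simp: B_def dist_norm norm_minus_commute)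
   then have "(norm (x - y))^2 <= (2 * R)^2" by (intro power_mono) auto
   then have diam: "(norm (x - y))^2 <= 4 * R\<^sup>2" by (simp add: power_mult_distrib)
   have "ennreal ((w x - w y)^2) <= (NN t. ind {0..1} t * ennreal ((norm (x - y))^2 * (norm (grad w (y + t *. (x - y))))^2))"
    by (rule C1_segment_bound[OF w])
   also have "\<dots> <= (NN t. ennreal (4 * R\<^sup>2) * ?F y t)"
    using True diam by (intro nn_integral_mono)
     (auto simp: indicator_def ennreal_mult[symmetric] intro!: ennreal_leI mult_right_mono)
   also have "\<dots> = ennreal (4 * R\<^sup>2) * (NN t. ?F y t)" by (rule nn_integral_cmult) measurable
   finally show ?thesis using True by simp
  qed (auto simp: indicator_def)
 qed
 finally show ?thesis by (simp add: B_def)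
qed

lemma poincare_C1:
 fixes w :: "real^'n => real"
 assumes w: "C1 w"
 shows "mean_osc (ball z R) w
  <= ennreal (4 * R\<^sup>2 * 2 ^ CARD('n)) * (emeasure lborel (ball z R) * L2 (ball z R) (grad w))"
proof -
 define B where "B = ball z R"
 have [measurable]: "B : sets borel" by (simp add: B_def)
 note [measurable] = C1_measurable[OF w] grad_measurable[OF w]
 define h where "h v = ennreal ((norm (grad w v))^2)" for v
 have [measurable]: "h : Borel" unfolding h_def by measurable
 define F where "F t x y = ind {0..1::real} t * (ind B x * (ind B y * h (y + t *. (x - y))))" for t x y
 have [measurable]: "(%(p::real \<times> (real^'n) \<times> (real^'n)). F (fst p) (fst (snd p)) (snd (snd p))) : Borel"
  unfolding F_def borel_prod[symmetric] by measurable
 let ?bound = "ennreal (2 ^ CARD('n)) * (emeasure lborel B * L2 B (grad w))"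
 have slice: "(NN x. (NN y. F t x y)) <= ind {0..1} t * ?bound" for t
 proof (cases "t : {0..1}")
  case True
  then show ?thesis
   using convex_segment_integral[of h B t] by (simp add: F_def B_def L2_def h_def mult.commute)
 qed (simp add: F_def)
 have "mean_osc B w <= (NN x. (NN y. ennreal (4 * R\<^sup>2) * (NN t. F t x y)))"
  unfolding mean_osc_def B_def F_def h_def by (intro nn_integral_mono C1_ball_osc_le[OF w])
 also have "\<dots> = (NN x. ennreal (4 * R\<^sup>2) * (NN y. (NN t. F t x y)))"
  unfolding F_def by (intro nn_integral_cong nn_integral_cmult) measurable
 also have "\<dots> = ennreal (4 * R\<^sup>2) * (NN x. (NN y. (NN t. F t x y)))"
  unfolding F_def by (intro nn_integral_cmult) measurable
 also have "(NN x. (NN y. (NN t. F t x y))) = (NN x. (NN t. (NN y. F t x y)))"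
  unfolding F_def by (intro nn_integral_cong lborel_pair.Fubini') measurable
 also have "\<dots> = (NN t. (NN x. (NN y. F t x y)))"
  unfolding F_def by (intro lborel_pair.Fubini') measurable
 also have "\<dots> <= (NN t. ind {0..1} (t::real) * ?bound)" by (intro nn_integral_mono slice)
 also have "\<dots> = ?bound" by (subst nn_integral_multc) auto
 finally show ?thesis
  unfolding B_def[symmetric] by (simp add: ennreal_mult mult.assoc mult_left_mono)
qed

lemma mean_osc_le_liminf:
 fixes w :: "nat => 'a::euclidean_space => real"
 assumes [measurable]: "!!j. w j : Borel" "u : Borel" "B : sets borel"
  and ae: "AE x\<in>B in lborel. (%j. w j x) ---> u x"
 shows "mean_osc B u <= liminf (%j. mean_osc B (w j))"
proof -
 have "mean_osc B u <= (NN x. liminf (%j. L2 B (%y. w j x - w j y) * ind B x))"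
  unfolding mean_osc_def
 proof (rule nn_integral_mono_AE, use ae in eventually_elim)
  fix x assume lim: "x : B --> (%j. w j x) ---> u x"
  show "L2 B (%y. u x - u y) * ind B x <= liminf (%j. L2 B (%y. w j x - w j y) * ind B x)"
  proof (cases "x : B")
   case True
   have "L2 B (%y. u x - u y) <= liminf (%j. L2 B (%y. w j x - w j y))"
    by (rule L2_le_liminf) (measurable, use ae in eventually_elim, use lim True in \<open>auto intro: tendsto_diff\<close>)
   then show ?thesis using True by simp
  qed simp
 qed
 also have "\<dots> <= liminf (%j. mean_osc B (w j))"
  unfolding mean_osc_def by (rule nn_integral_liminf) measurable
 finally show ?thesis .
qed

lemma poincare_limit:
 fixes w :: "nat => real^'n => real"
 assumes C1: "!!j. C1 (w j)" and [measurable]: "u : Borel" "g : Borel"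
  and ae: "AE x\<in>ball z R in lborel. (%j. w j x) ---> u x"
  and lim: "(%j. L2 (ball z R) (%x. grad (w j) x - g x)) ---> 0"
 shows "mean_osc (ball z R) u
  <= ennreal (8 * R\<^sup>2 * 2 ^ CARD('n)) * (emeasure lborel (ball z R) * L2 (ball z R) g)"
proof -
 define B where "B = ball z R"
 have [measurable]: "B : sets borel" by (simp add: B_def)
 note [measurable] = C1_measurable[OF C1] grad_measurable[OF C1]
 let ?K = "ennreal (4 * R\<^sup>2 * 2 ^ CARD('n))"
 have "mean_osc B u <= liminf (%j. mean_osc B (w j))"
  by (rule mean_osc_le_liminf) (use ae in \<open>auto simp: B_def\<close>)
 also have "\<dots> <= ?K * (emeasure lborel B * (2 * L2 B g))"
 proof (rule liminf_bound)
  have "(?K * (emeasure lborel B * 2)) < \<infinity>"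
   using emeasure_lborel_ball_finite[of z R] by (simp add: B_def ennreal_mult_less_top)
  then show "(%j. (?K * (emeasure lborel B * 2)) * L2 B (%x. grad (w j) x - g x) + 0 * 0) ---> 0"
   by (intro ennreal_tendsto_0_lincomb[OF _ tendsto_const]) (use lim in \<open>auto simp: B_def\<close>)
  fix j
  have "mean_osc B (w j) <= ?K * (emeasure lborel B * L2 B (grad (w j)))"
   unfolding B_def by (rule poincare_C1[OF C1])
  also have "L2 B (grad (w j)) <= 2 * L2 B g + 2 * L2 B (%x. grad (w j) x - g x)"
   using L2_add[of g "%x. grad (w j) x - g x" B] by simp
  finally show "mean_osc B (w j) <=
   ?K * (emeasure lborel B * (2 * L2 B g)) + ((?K * (emeasure lborel B * 2)) * L2 B (%x. grad (w j) x - g x) + 0 * 0)"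
   by (simp add: distrib_left mult.assoc mult_left_mono)
 qed
 also have "\<dots> = ennreal (8 * R\<^sup>2 * 2 ^ CARD('n)) * (emeasure lborel B * L2 B g)"
 proof -
  have "ennreal (8 * R\<^sup>2 * 2 ^ CARD('n)) = ?K * 2"
   by (subst ennreal_numeral[symmetric], subst ennreal_mult[symmetric]) (auto simp: algebra_simps)
  then show ?thesis by (simp add: mult_ac)
 qed
 finally show ?thesis by (simp add: B_def)
qed

lemma emeasure_ball_eq:
 "0 <= r ==> emeasure lborel (ball (z::real^'n) r) = ennreal (unit_ball_vol (real CARD('n)) * r ^ CARD('n))"
 using emeasure_ball[of r z] by simp

lemma mean_osc_constant:
 fixes u :: "'a::euclidean_space => real"
 assumes [measurable]: "u : Borel" "B : sets borel"
  and B: "0 < emeasure lborel B" "emeasure lborel B < \<infinity>"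
  and osc: "mean_osc B u <= emeasure lborel B * X" and X: "X < \<infinity>"
 obtains c where "L2 B (%x. u x - c) <= X"
proof (rule ccontr)
 assume "\<not> thesis"
 then have large: "X < L2 B (%y. u x - u y)" for x
  using that[of "u x"] by (simp add: L2_minus_commute[of B "%_. u x" u] not_le) (meson not_le)
 have "(NN x. X * ind B x) < (NN x. L2 B (%y. u x - u y) * ind B x)"
 proof (rule nn_integral_less)
  show "(NN x. X * ind B x) ~= \<infinity>" using B X by (auto simp: nn_integral_cmult ennreal_mult_eq_top_iff)
  show "AEL x. X * ind B x <= L2 B (%y. u x - u y) * ind B x"
   using large by (intro AE_I2 mult_right_mono) (auto intro: less_imp_le)
  show "\<not> (AEL x. L2 B (%y. u x - u y) * ind B x <= X * ind B x)"
  proof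
   assume "AEL x. L2 B (%y. u x - u y) * ind B x <= X * ind B x"
   then have "AEL x. x ~: B" by eventually_elim (use large in \<open>auto simp: indicator_def not_le[symmetric]\<close>)
   then have "emeasure lborel B = 0" by (subst (asm) AE_iff_measurable[of B]) auto
   then show False using B by simp
  qed
 qed measurable
 then have "X * emeasure lborel B < mean_osc B u" by (simp add: nn_integral_cmult mean_osc_def)
 then show False using osc by (simp add: mult.commute)
qed

lemma poincare_constant:
 fixes w :: "nat => real^'n => real"
 assumes "!!j. C1 (w j)" "u : Borel" "g : Borel" "AE x\<in>ball z R in lborel. (%j. w j x) ---> u x"
  "(%j. L2 (ball z R) (%x. grad (w j) x - g x)) ---> 0" and fin: "L2 (ball z R) g < \<infinity>" and R: "R > 0"
 obtains c where "L2 (ball z R) (%x. u x - c) <= ennreal (8 * R\<^sup>2 * 2 ^ CARD('n)) * L2 (ball z R) g"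
proof (rule mean_osc_constant[of u "ball z R" "ennreal (8 * R\<^sup>2 * 2 ^ CARD('n)) * L2 (ball z R) g"])
 show "0 < emeasure lborel (ball z R)" using R by (simp add: emeasure_ball_eq)
 show "mean_osc (ball z R) u <= emeasure lborel (ball z R) * (ennreal (8 * R\<^sup>2 * 2 ^ CARD('n)) * L2 (ball z R) g)"
  using poincare_limit[OF assms(1-5)] by (simp add: mult.left_commute)
 show "ennreal (8 * R\<^sup>2 * 2 ^ CARD('n)) * L2 (ball z R) g < \<infinity>" using fin by (simp add: ennreal_mult_less_top)
qed (use assms(2) emeasure_lborel_ball_finite[of z R] that in simp_all)

lemma poincare_sobolev:
 fixes u :: "real^'n => real"
 assumes "sobolev (ball z R) X u g"
 shows "mean_osc (ball z R) u
  <= ennreal (8 * R\<^sup>2 * 2 ^ CARD('n)) * (emeasure lborel (ball z R) * L2 (ball z R) g)"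
proof -
 obtain w where "H1_tendsto (ball z R) w u g" using sobolevE[OF assms] by blast
 note lim = H1_tendstoD[OF this]
 show ?thesis by (rule poincare_limit[OF lim(1) sobolevD(2,3)[OF assms] lim(4,3)])
qed

lemma mean_osc_ge_vanishing:
 fixes v :: "'a::euclidean_space => real"
 assumes [measurable]: "v : Borel" "B : sets borel" "Z : sets borel" and Z: "Z <= B" "!!x. x : Z ==> v x = 0"
 shows "emeasure lborel Z * L2 B v <= mean_osc B v"
proof -
 have "emeasure lborel Z * L2 B v = (NN x. (ennreal ((v x)^2) * ind B x) * emeasure lborel Z)"
  unfolding L2_def by (subst nn_integral_multc) (auto simp: mult.commute)
 also have "\<dots> <= mean_osc B v"
  unfolding mean_osc_def
 proof (rule nn_integral_mono)
  fix x
  have "ennreal ((v x)^2) * emeasure lborel Z = (NN y. ennreal ((v x)^2) * ind Z y)"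
   by (subst nn_integral_cmult) auto
  also have "\<dots> <= L2 B (%y. v x - v y)"
   unfolding L2_def using Z by (intro nn_integral_mono) (auto simp: indicator_def)
  finally show "(ennreal ((v x)^2) * ind B x) * emeasure lborel Z <= L2 B (%y. v x - v y) * ind B x"
   by (auto simp: indicator_def)
 qed
 finally show ?thesis .
qed

lemma ennreal_le_mult_cancel:
 assumes "ennreal c * X <= ennreal c * Y" "c > 0"
 shows "X <= Y"
proof -
 have "ennreal (1 / c) * (ennreal c * Z) = Z" for Z
  using assms(2) by (simp add: mult.assoc[symmetric] ennreal_mult[symmetric])
 then show ?thesis using mult_left_mono[OF assms(1), of "ennreal (1 / c)"] by simp
qed

lemma poincare_vanishing:
 fixes v :: "real^'n => real"
 assumes v: "sobolev (ball z R) X v g" and R: "R > 0" and Z_sets: "Z : sets borel"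
  and Z: "Z <= ball z R" "!!x. x : Z ==> v x = 0"
  and \<theta>: "ennreal \<theta> * emeasure lborel (ball z R) <= emeasure lborel Z" "\<theta> > 0"
 shows "L2 (ball z R) v <= ennreal (8 * R\<^sup>2 * 2 ^ CARD('n) / \<theta>) * L2 (ball z R) g"
proof (rule ennreal_le_mult_cancel)
 define b where "b = unit_ball_vol (real CARD('n)) * R ^ CARD('n)"
 have b: "emeasure lborel (ball z R) = ennreal b" "b > 0" using R by (auto simp: b_def emeasure_ball_eq)
 show "\<theta> * b > 0" using \<theta>(2) b(2) by simp
 have "ennreal (\<theta> * b) * L2 (ball z R) v <= emeasure lborel Z * L2 (ball z R) v"
  using \<theta> b by (intro mult_right_mono) (auto simp: ennreal_mult)
 also have "\<dots> <= mean_osc (ball z R) v"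
  by (rule mean_osc_ge_vanishing[OF sobolevD(2,1)[OF v] Z_sets Z])
 also have "\<dots> <= ennreal (8 * R\<^sup>2 * 2 ^ CARD('n)) * (ennreal b * L2 (ball z R) g)"
  using poincare_sobolev[OF v] by (simp add: b)
 also have "\<dots> = ennreal (\<theta> * b) * (ennreal (8 * R\<^sup>2 * 2 ^ CARD('n) / \<theta>) * L2 (ball z R) g)"
  using \<theta>(2) b(2) by (simp add: mult.assoc[symmetric] ennreal_mult[symmetric]) (simp add: mult_ac)
 finally show "ennreal (\<theta> * b) * L2 (ball z R) v <= ennreal (\<theta> * b) * (ennreal (8 * R\<^sup>2 * 2 ^ CARD('n) / \<theta>) * L2 (ball z R) g)" .
qed

lemma indicator_ball_eq: "ind (ball z r) x = (if norm (x - z) < r then 1 else 0)"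
 by (simp add: indicator_def dist_norm norm_minus_commute)

lemma L2_ball_measurable:
 fixes f :: "'a::euclidean_space => 'b::euclidean_space"
 assumes [measurable]: "f : Borel"
 shows "(%z. L2 (ball z r) f) : borel_measurable borel"
 unfolding L2_def indicator_ball_eq by measurable

lemma ball_average:
 fixes f :: "real^'n => 'b::euclidean_space"
 assumes [measurable]: "f : Borel" and "r > 0"
 shows "(NN z. L2 (ball z r) f) = emeasure lborel (ball (0::real^'n) r) * L2 UNIV f"
proof -
 have "(NN z. L2 (ball z r) f) = (NN x. (NN z. ennreal ((norm (f x))^2) * ind (ball z r) x))"
  unfolding L2_def indicator_ball_eq by (rule lborel_pair.Fubini'[symmetric]) measurable
 also have "\<dots> = (NN x. ennreal ((norm (f x))^2) * emeasure lborel (ball (0::real^'n) r))"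
 proof (rule nn_integral_cong)
  fix x
  have "(NN z. ennreal ((norm (f x))^2) * ind (ball z r) x) = (NN z. ennreal ((norm (f x))^2) * ind (ball x r) z)"
   by (simp add: indicator_ball_eq norm_minus_commute)
  also have "\<dots> = ennreal ((norm (f x))^2) * emeasure lborel (ball x r)" by (rule nn_integral_cmult_indicator) simp
  finally show "(NN z. ennreal ((norm (f x))^2) * ind (ball z r) x) = ennreal ((norm (f x))^2) * emeasure lborel (ball (0::real^'n) r)"
   using \<open>r > 0\<close> by (simp add: emeasure_ball_eq)
 qed
 also have "\<dots> = emeasure lborel (ball (0::real^'n) r) * L2 UNIV f"
  unfolding L2_def by (subst nn_integral_multc) (auto simp: mult.commute)
 finally show ?thesis .
qed

lemma poincare_half_support:
 fixes v :: "real^'n => real"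
 assumes v: "sobolev (ball z r) X v g" and r: "r > 0" and [measurable]: "v : Borel"
  and supp: "emeasure lborel {x. v x ~= 0} <= ennreal (unit_ball_vol (real CARD('n)) * r ^ CARD('n) / 2)"
 shows "L2 (ball z r) v <= ennreal (16 * r\<^sup>2 * 2 ^ CARD('n)) * L2 (ball z r) g"
proof -
 define V where "V = unit_ball_vol (real CARD('n)) * r ^ CARD('n)"
 have V: "V > 0" "emeasure lborel (ball z r) = ennreal V" using r by (auto simp: V_def emeasure_ball_eq)
 define Z where "Z = ball z r \<inter> {x. v x = 0}"
 have Z [measurable]: "Z : sets borel" unfolding Z_def by measurable
 have "emeasure lborel (ball z r) <= emeasure lborel (Z \<union> {x. v x ~= 0})"
  by (intro emeasure_mono) (auto simp: Z_def)
 also have "\<dots> <= emeasure lborel Z + emeasure lborel {x. v x ~= 0}"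
  by (intro emeasure_subadditive) auto
 also have "\<dots> <= emeasure lborel Z + ennreal (V / 2)" using supp by (intro add_left_mono) (simp add: V_def)
 finally have cover: "ennreal V <= emeasure lborel Z + ennreal (V / 2)" by (simp add: V)
 have "emeasure lborel Z <= emeasure lborel (ball z r)" by (intro emeasure_mono) (auto simp: Z_def)
 then obtain m where m: "emeasure lborel Z = ennreal m" "m \<ge> 0"
  using emeasure_lborel_ball_finite[of z r] by (cases "emeasure lborel Z") (auto simp: top_unique)
 have "ennreal (1 / 2) * emeasure lborel (ball z r) = ennreal (1 / 2 * V)"
  unfolding V(2) by (rule ennreal_mult[symmetric]) (use V in auto)
 also have "\<dots> <= emeasure lborel Z"
  using cover m V by (simp add: ennreal_plus[symmetric] del: ennreal_plus)
 finally have "L2 (ball z r) v <= ennreal (8 * r\<^sup>2 * 2 ^ CARD('n) / (1 / 2)) * L2 (ball z r) g"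
  by (intro poincare_vanishing[OF v r Z]) (auto simp: Z_def)
 moreover have "8 * r\<^sup>2 * 2 ^ CARD('n) / (1 / 2) = 16 * r\<^sup>2 * 2 ^ CARD('n)" by simp
 ultimately show ?thesis by (simp only:)
qed

text \<open>Averaging the Poincare inequality for functions vanishing on half of a ball over all balls of
 radius \<open>r\<close> gains the factor \<open>r\<^sup>2\<close>, where \<open>r\<close> is comparable to the \<open>n\<close>-th root of the measure of the support.\<close>

lemma faber_krahn:
 fixes v :: "real^'n => real"
 assumes v: "sobolev UNIV X v g" and r: "r > 0"
  and supp: "emeasure lborel {x. v x ~= 0} <= ennreal (unit_ball_vol (real CARD('n)) * r ^ CARD('n) / 2)"
 shows "L2 UNIV v <= ennreal (16 * r\<^sup>2 * 2 ^ CARD('n)) * L2 UNIV g"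
proof (rule ennreal_le_mult_cancel)
 let ?C = "ennreal (16 * r\<^sup>2 * 2 ^ CARD('n))"
 note [measurable] = sobolevD(2,3)[OF v]
 define V where "V = unit_ball_vol (real CARD('n)) * r ^ CARD('n)"
 show "V > 0" using r by (simp add: V_def)
 have vol: "emeasure lborel (ball (0::real^'n) r) = ennreal V" using r by (simp add: emeasure_ball_eq V_def)
 have "ennreal V * L2 UNIV v = (NN z. L2 (ball z r) v)"
  using ball_average[of v r] r vol by simp
 also have "\<dots> <= (NN z. ?C * L2 (ball z r) g)"
  by (intro nn_integral_mono poincare_half_support[OF sobolev_mono[OF v] r _ supp]) auto
 also have "\<dots> = ?C * (NN z. L2 (ball z r) g)"
  by (rule nn_integral_cmult) (simp add: L2_ball_measurable)
 also have "\<dots> = ennreal V * (?C * L2 UNIV g)"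
  using ball_average[of g r] r vol by (simp add: mult_ac)
 finally show "ennreal V * L2 UNIV v <= ennreal V * (?C * L2 UNIV g)" .
qed

lemma coordinate_over_square:
 fixes \<epsilon> :: real
 assumes "\<epsilon> > 0"
 defines "q \<equiv> %x::real^'n. x \<bullet> x + \<epsilon>"
 shows "C1 (%x. x $ i / q x)"
  and "grad (%x. x $ i / q x) = (%x. (1 / q x) *. axis i 1 - (2 * x $ i / (q x)^2) *. x)"
proof -
 have q: "q x > 0" for x unfolding q_def using assms(1) by (simp add: add_nonneg_pos)
 have q_derivative: "(q has_derivative (%h. 2 * (x \<bullet> h))) (at x)" for x
  unfolding q_def by (auto intro!: derivative_eq_intros simp: inner_commute)
 have component_derivative: "((%x::real^'n. x $ i) has_derivative (%h. h $ i)) (at x)" for x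
  by (rule bounded_linear_imp_has_derivative) (rule bounded_linear_vec_nth)
 have deriv: "((%x. x $ i / q x) has_derivative (%h. ((1 / q x) *. axis i 1 - (2 * x $ i / (q x)^2) *. x) \<bullet> h)) (at x)" for x
 proof -
  have "q x ~= 0" using q[of x] by simp
  from has_derivative_divide'[OF component_derivative q_derivative this]
  have "((%x. x $ i / q x) has_derivative (%h. (h $ i * q x - x $ i * (2 * (x \<bullet> h))) / (q x * q x))) (at x)" .
  moreover have "(%h. (h $ i * q x - x $ i * (2 * (x \<bullet> h))) / (q x * q x)) =
   (%h. ((1 / q x) *. axis i 1 - (2 * x $ i / (q x)^2) *. x) \<bullet> h)"
   using q[of x] by (auto simp: fun_eq_iff inner_diff_left inner_axis inner_commute[of "axis i 1"] power2_eq_square field_simps)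
  ultimately show ?thesis by simp
 qed
 have q_continuous: "continuous_on UNIV q" unfolding q_def by (intro continuous_intros)
 have "continuous_on UNIV (%x. (1 / q x) *. axis i 1 - (2 * x $ i / (q x)^2) *. x)"
  by (intro continuous_intros q_continuous) (use q in \<open>auto simp: less_imp_neq[THEN not_sym]\<close>)
 from C1I[OF deriv this] show "C1 (%x. x $ i / q x)"
  "grad (%x. x $ i / q x) = (%x. (1 / q x) *. axis i 1 - (2 * x $ i / (q x)^2) *. x)" by auto
qed

lemma hardy_divergence:
 fixes w :: "real^'n => real"
 assumes w: "C1 w" and \<epsilon>: "\<epsilon> > 0"
 defines "q \<equiv> %x::real^'n. x \<bullet> x + \<epsilon>"
 shows "C1 (%x. (w x * w x) * (x $ i / q x))"
  and "(\<Sum>i\<in>UNIV. pderiv (%x. (w x * w x) * (x $ i / q x)) i x)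
   = (w x)^2 * (real CARD('n) / q x - 2 * (x \<bullet> x) / (q x)^2) + 2 * w x * ((grad w x \<bullet> x) / q x)"
proof -
 have f: "C1 (%x. x $ i / q x)" "grad (%x. x $ i / q x) = (%x. (1 / q x) *. axis i 1 - (2 * x $ i / (q x)^2) *. x)" for i
  using coordinate_over_square[OF \<epsilon>, of i] unfolding q_def by auto
 have w_square: "C1 (%x. w x * w x)" by (rule C1_mult[OF w w])
 show "C1 (%x. (w x * w x) * (x $ i / q x))" by (rule C1_mult[OF w_square f(1)])
 have "pderiv (%x. (w x * w x) * (x $ i / q x)) i x = (w x)^2 * (1 / q x - 2 * (x $ i)^2 / (q x)^2) + 2 * w x * (grad w x $ i * (x $ i / q x))" for i
  unfolding pderiv_conv_grad grad_mult[OF w_square f(1)] grad_mult[OF w w] f(2)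
  by (simp add: power2_eq_square algebra_simps)
 then show "(\<Sum>i\<in>UNIV. pderiv (%x. (w x * w x) * (x $ i / q x)) i x)
   = (w x)^2 * (real CARD('n) / q x - 2 * (x \<bullet> x) / (q x)^2) + 2 * w x * ((grad w x \<bullet> x) / q x)"
  by (simp add: sum.distrib sum_distrib_left[symmetric] sum_subtractf sum_divide_distrib[symmetric]
   inner_vec_def power2_eq_square)
qed

lemma hardy_pointwise:
 fixes x v :: "'a::euclidean_space"
 assumes \<epsilon>: "\<epsilon> > 0" and n: "n \<ge> 3"
 defines "q \<equiv> x \<bullet> x + \<epsilon>"
 shows "a\<^sup>2 / q / 2 - 2 * (norm v)^2 <= a\<^sup>2 * (real n / q - 2 * (x \<bullet> x) / q\<^sup>2) + 2 * a * ((v \<bullet> x) / q)"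
proof -
 define s where "s = sqrt q"
 have q: "q > 0" unfolding q_def using \<epsilon> by (simp add: add_nonneg_pos)
 have s: "s > 0" "q = s\<^sup>2" using q by (auto simp: s_def)
 have norm_le_s: "norm x <= s" unfolding s_def q_def using \<epsilon> by (simp add: norm_eq_sqrt_inner)
 have "(x \<bullet> x) / q\<^sup>2 <= 1 / q" using q \<epsilon> by (simp add: power2_eq_square divide_simps) (simp add: q_def)
 moreover have "3 / q <= real n / q" using q n by (intro divide_right_mono) auto
 ultimately have "1 / q <= real n / q - 2 * (x \<bullet> x) / q\<^sup>2" by simp
 from mult_left_mono[OF this, of "a\<^sup>2"]
 have "a\<^sup>2 / q <= a\<^sup>2 * (real n / q - 2 * (x \<bullet> x) / q\<^sup>2)" by simp
 moreover have "\<bar>2 * a * ((v \<bullet> x) / q)\<bar> <= a\<^sup>2 / q / 2 + 2 * (norm v)^2"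
 proof -
  have "\<bar>2 * a * ((v \<bullet> x) / q)\<bar> <= 2 * \<bar>a\<bar> * (norm v * s / q)"
   using norm_le_s q by (auto simp: abs_mult abs_divide intro!: mult_left_mono divide_right_mono order_trans[OF Cauchy_Schwarz_ineq2])
  also have "\<dots> = 2 * (\<bar>a\<bar> / s) * norm v" using s by (simp add: power2_eq_square)
  also have "\<dots> <= (\<bar>a\<bar> / s)^2 / 2 + 2 * (norm v)^2"
   using zero_le_power2[of "\<bar>a\<bar> / s - 2 * norm v"] by (simp add: power2_diff power_mult_distrib)
  also have "\<dots> = a\<^sup>2 / q / 2 + 2 * (norm v)^2" using s by (simp add: power_divide)
  finally show ?thesis .
 qed
 ultimately show ?thesis by linarith
qed

lemma hardy_C1:
 fixes w :: "real^'n => real"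
 assumes w: "w : C1c UNIV" and n: "CARD('n) \<ge> 3" and \<epsilon>: "\<epsilon> > 0"
 shows "L2 UNIV (%x. w x / sqrt (x \<bullet> x + \<epsilon>)) <= 4 * L2 UNIV (grad w)"
proof -
 define q where "q = (%x::real^'n. x \<bullet> x + \<epsilon>)"
 have q: "q x > 0" for x unfolding q_def using \<epsilon> by (simp add: add_nonneg_pos)
 note C1 = C1c_C1[OF w]
 obtain K where K: "compact K" "supported_in w K" "supported_in (grad w) K" using w by (rule C1cE)
 define f where "f i x = (w x * w x) * (x $ i / q x)" for i and x :: "real^'n"
 have f: "f i : C1c UNIV" and f_C1: "C1 (f i)" and f_supp: "supported_in (f i) K" for i
  using hardy_divergence(1)[OF C1 \<epsilon>, of i] K by (auto simp: f_def[abs_def] q_def supported_in_def intro!: C1cI)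
 have int_pderiv: "integrable lborel (pderiv (f i) i)" for i
  by (rule continuous_compact_support_integrable[OF C1_continuous_pderiv[OF f_C1] K(1) supported_in_pderiv[OF f_supp compact_imp_closed[OF K(1)]]])
 define A where "A x = (w x)^2 / q x" for x
 define D where "D x = (norm (grad w x))^2" for x
 have "continuous_on UNIV A"
  unfolding A_def q_def using q[unfolded q_def]
  by (intro continuous_intros C1_continuous[OF C1]) (metis less_irrefl)
 then have int_A: "integrable lborel A"
  by (rule continuous_compact_support_integrable[OF _ K(1)]) (use K in \<open>auto simp: A_def supported_in_def\<close>)
 have "continuous_on UNIV D" unfolding D_def by (intro continuous_intros C1_continuous_grad[OF C1])
 then have int_D: "integrable lborel D"
  by (rule continuous_compact_support_integrable[OF _ K(1)]) (use K in \<open>auto simp: D_def supported_in_def\<close>)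
 have pointwise: "A x / 2 - 2 * D x <= (\<Sum>i\<in>UNIV. pderiv (f i) i x)" for x
  unfolding A_def D_def f_def[abs_def] q_def hardy_divergence(2)[OF C1 \<epsilon>] by (rule hardy_pointwise[OF \<epsilon> n])
 have "(LBINT x. A x / 2 - 2 * D x) <= (LBINT x. (\<Sum>i\<in>UNIV. pderiv (f i) i x))"
  using int_A int_D int_pderiv pointwise by (intro integral_mono) auto
 also have "\<dots> = 0" using int_pderiv integral_pderiv_zero[OF f] by (subst Bochner_Integration.integral_sum) auto
 finally have integral_A_le: "(LBINT x. A x) <= 4 * (LBINT x. D x)" using int_A int_D by simp
 have "L2 UNIV (%x. w x / sqrt (x \<bullet> x + \<epsilon>)) = (NN x. ennreal (A x))"
  using q by (simp add: L2_def A_def q_def power_divide less_imp_le)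
 also have "\<dots> = ennreal (LBINT x. A x)"
  by (rule nn_integral_eq_integral[OF int_A]) (use q in \<open>auto simp: A_def intro!: divide_nonneg_pos\<close>)
 also have "\<dots> <= 4 * ennreal (LBINT x. D x)" using ennreal_leI[OF integral_A_le] by (simp add: ennreal_mult')
 also have "ennreal (LBINT x. D x) = L2 UNIV (grad w)"
  using nn_integral_eq_integral[OF int_D] by (simp add: L2_def D_def[abs_def])
 finally show ?thesis .
qed

lemma hardy_sobolev:
 fixes v :: "real^'n => real"
 assumes v: "sobolev UNIV (C1c UNIV) v g" and n: "CARD('n) \<ge> 3" and r: "r > 0"
 shows "L2 UNIV (%x. v x / sqrt (x \<bullet> x + r\<^sup>2)) <= 8 * L2 UNIV g"
proof -
 obtain w where w: "!!j. w j : C1c UNIV" "H1_tendsto UNIV w v g" using sobolevE[OF v] by blast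
 note lim = H1_tendstoD[OF w(2)]
 note [measurable] = sobolevD(2,3)[OF v] lim(5,6)
 have pos: "x \<bullet> x + r\<^sup>2 > 0" for x :: "real^'n" using r by (simp add: add_nonneg_pos)
 show ?thesis
 proof (rule L2_fatou)
  show "AE x\<in>UNIV in lborel. (%j. w j x / sqrt (x \<bullet> x + r\<^sup>2)) ---> v x / sqrt (x \<bullet> x + r\<^sup>2)"
   using lim(4) by eventually_elim (use pos in \<open>auto intro!: tendsto_intros simp: less_imp_neq[THEN not_sym]\<close>)
  show "(%j. 8 * L2 UNIV (%x. grad (w j) x - g x) + 0 * 0) ---> 0"
   by (intro ennreal_tendsto_0_lincomb[OF lim(3) tendsto_const]) auto
  fix j
  have "L2 UNIV (%x. w j x / sqrt (x \<bullet> x + r\<^sup>2)) <= 4 * L2 UNIV (grad (w j))"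
   using hardy_C1[OF w(1) n, of "r\<^sup>2"] r by simp
  also have "L2 UNIV (grad (w j)) <= 2 * L2 UNIV g + 2 * L2 UNIV (%x. grad (w j) x - g x)"
   using L2_add[of g "%x. grad (w j) x - g x" UNIV] by simp
  finally show "L2 UNIV (%x. w j x / sqrt (x \<bullet> x + r\<^sup>2)) <= 8 * L2 UNIV g + (8 * L2 UNIV (%x. grad (w j) x - g x) + 0 * 0)"
   by (simp add: distrib_left mult.assoc[symmetric] mult_left_mono)
 qed measurable
qed

lemma hardy_ball:
 fixes v :: "real^'n => real"
 assumes v: "sobolev UNIV (C1c UNIV) v g" and n: "CARD('n) \<ge> 3" and r: "r > 0"
 shows "L2 (ball 0 r) v <= ennreal (16 * r\<^sup>2) * L2 UNIV g"
proof -
 note [measurable] = sobolevD(2)[OF v]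
 have "L2 (ball 0 r) v <= ennreal ((sqrt (2 * r\<^sup>2))\<^sup>2) * L2 UNIV (%x. v x / sqrt (x \<bullet> x + r\<^sup>2))"
 proof (rule L2_bound_mult_on)
  fix x :: "real^'n" assume "x : ball 0 r"
  then have "(norm x)^2 <= r\<^sup>2" by (intro power_mono) auto
  then have "sqrt (x \<bullet> x + r\<^sup>2) <= sqrt (2 * r\<^sup>2)" by (simp add: dot_square_norm)
  moreover have pos: "sqrt (x \<bullet> x + r\<^sup>2) > 0" using r by (simp add: add_nonneg_pos)
  ultimately have "\<bar>v x\<bar> * sqrt (x \<bullet> x + r\<^sup>2) <= \<bar>v x\<bar> * sqrt (2 * r\<^sup>2)" by (intro mult_left_mono) auto
  then show "norm (v x) <= sqrt (2 * r\<^sup>2) * norm (v x / sqrt (x \<bullet> x + r\<^sup>2))"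
   using pos by (simp add: pos_le_divide_eq mult.commute)
 qed auto
 also have "\<dots> <= ennreal (2 * r\<^sup>2) * (8 * L2 UNIV g)" by (intro mult_mono hardy_sobolev[OF assms]) auto
 also have "\<dots> = ennreal (16 * r\<^sup>2) * L2 UNIV g"
 proof -
  have "ennreal (16 * r\<^sup>2) = ennreal (2 * r\<^sup>2) * 8"
   by (subst ennreal_numeral[symmetric], subst ennreal_mult[symmetric]) auto
  then show ?thesis by (simp add: mult.assoc)
 qed
 finally show ?thesis .
qed

subsection \<open>Supersolutions\<close>

lemma L2_inner_bound:
 fixes f h :: "real^'n => real^'n"
 assumes [measurable]: "f : Borel" "h : Borel" "S : sets borel"
 shows "(NN x. ennreal \<bar>ind S x * (f x \<bullet> h x)\<bar>)^2 <= L2 S f * L2 S h"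
proof -
 have "(NN x. ennreal \<bar>ind S x * (f x \<bullet> h x)\<bar>) <=
   (NN x. ennreal (ind S x * norm (f x)) * ennreal (ind S x * norm (h x)))"
  by (intro nn_integral_mono)
   (auto simp: indicator_def ennreal_mult[symmetric] Cauchy_Schwarz_ineq2 intro!: ennreal_leI)
 then have "(NN x. ennreal \<bar>ind S x * (f x \<bullet> h x)\<bar>)^2 <=
   (NN x. ennreal (ind S x * norm (f x)) * ennreal (ind S x * norm (h x)))^2"
  by (rule power_mono) simp
 also have "\<dots> <= (NN x. (ennreal (ind S x * norm (f x)))^2) * (NN x. (ennreal (ind S x * norm (h x)))^2)"
  by (rule Cauchy_Schwarz_nn_integral) measurable
 also have "(NN x. (ennreal (ind S x * norm (f x)))^2) = L2 S f"
  unfolding L2_def by (intro nn_integral_cong) (auto simp: indicator_def ennreal_power)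
 also have "(NN x. (ennreal (ind S x * norm (h x)))^2) = L2 S h"
  unfolding L2_def by (intro nn_integral_cong) (auto simp: indicator_def ennreal_power)
 finally show ?thesis .
qed

lemma L2_inner_integrable:
 fixes f h :: "real^'n => real^'n"
 assumes [measurable]: "f : Borel" "h : Borel" "S : sets borel"
  and fin: "L2 S f < \<infinity>" "L2 S h < \<infinity>"
 shows "integrable lborel (%x. ind S x * (f x \<bullet> h x))"
proof (rule integrableI_bounded)
 have "(NN x. ennreal \<bar>ind S x * (f x \<bullet> h x)\<bar>)^2 < \<infinity>"
  using L2_inner_bound[of f h S] fin by (simp add: ennreal_mult_less_top le_less_trans)
 then show "(NN x. ennreal (norm (ind S x * (f x \<bullet> h x)))) < \<infinity>"
  by (auto simp: power2_eq_square ennreal_mult_less_top less_top[symmetric])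
qed measurable

lemma L2_inner_tendsto:
 fixes f h :: "real^'n => real^'n"
 assumes [measurable]: "f : Borel" "h : Borel" "S : sets borel" "!!j. h' j : Borel"
  and fin: "L2 S f < \<infinity>" "L2 S h < \<infinity>" "!!j. L2 S (h' j) < \<infinity>" and lim: "(%j::nat. L2 S (%x. h' j x - h x)) ---> 0"
 shows "(%j. LBINT x. ind S x * (f x \<bullet> h' j x)) ---> (LBINT x. ind S x * (f x \<bullet> h x))"
proof -
 define a where "a j = (LBINT x. ind S x * (f x \<bullet> h' j x)) - (LBINT x. ind S x * (f x \<bullet> h x))" for j
 have int: "integrable lborel (%x. ind S x * (f x \<bullet> h x))" "integrable lborel (%x. ind S x * (f x \<bullet> h' j x))" for j
  using fin by (auto intro!: L2_inner_integrable)
 have a_eq: "a j = (LBINT x. ind S x * (f x \<bullet> (h' j x - h x)))" for j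
  unfolding a_def using int by (subst Bochner_Integration.integral_diff[symmetric]) (auto simp: inner_diff_right right_diff_distrib)
 have int_diff: "integrable lborel (%x. ind S x * (f x \<bullet> (h' j x - h x)))" for j
  using Bochner_Integration.integrable_diff[OF int(2)[of j] int(1)] by (simp add: inner_diff_right right_diff_distrib)
 have "ennreal ((a j)^2) <= L2 S f * L2 S (%x. h' j x - h x)" for j
 proof -
  have "ennreal \<bar>a j\<bar> <= (NN x. ennreal \<bar>ind S x * (f x \<bullet> (h' j x - h x))\<bar>)"
   using integral_norm_bound_ennreal[OF int_diff[of j]] by (simp add: a_eq)
  then have "(ennreal \<bar>a j\<bar>)^2 <= (NN x. ennreal \<bar>ind S x * (f x \<bullet> (h' j x - h x))\<bar>)^2"
   by (rule power_mono) simp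
  also have "\<dots> <= L2 S f * L2 S (%x. h' j x - h x)" by (rule L2_inner_bound) measurable
  finally show ?thesis by (simp add: ennreal_power)
 qed
 moreover have "(%j. L2 S f * L2 S (%x. h' j x - h x)) ---> 0"
  using ennreal_tendsto_0_lincomb[OF lim tendsto_const[of 0], of "L2 S f" 0] fin(1) by simp
 ultimately have "(%j. ennreal ((a j)^2)) ---> 0" by (rule ennreal_tendsto_0_le[rotated])
 then have "(%j. (a j)^2) ---> 0"
  by (subst (asm) ennreal_0[symmetric], subst (asm) tendsto_ennreal_iff) auto
 then have "(%j. sqrt ((a j)^2)) ---> sqrt 0" by (intro tendsto_real_sqrt)
 then show ?thesis by (simp add: a_def tendsto_rabs_zero_iff LIM_zero_iff)
qed

locale elliptic =
 fixes A :: "real^'n => real^'n^'n" and lam L :: real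
 assumes lam_pos: "0 < lam" and lam_le: "lam <= L"
  and A_measurable: "A : Borel"
  and A_sym: "transpose (A x) = A x"
  and A_lower: "lam * (norm \<xi>)^2 <= (A x *v \<xi>) \<bullet> \<xi>"
  and A_upper: "(A x *v \<xi>) \<bullet> \<xi> <= L * (norm \<xi>)^2"
begin

lemma L_pos: "0 < L" using lam_pos lam_le by simp

lemma caccioppoli_const_pos: "0 < 4 * L / lam" using lam_pos L_pos by simp

lemma A_commute: "(A x *v \<xi>) \<bullet> \<zeta> = (A x *v \<zeta>) \<bullet> \<xi>"
proof -
 have "(A x *v \<xi>) \<bullet> \<zeta> = \<xi> \<bullet> (transpose (A x) *v \<zeta>)"
  by (metis dot_lmul_matrix inner_commute transpose_matrix_vector transpose_transpose)
 then show ?thesis by (simp add: A_sym inner_commute)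
qed

lemma A_nonneg: "0 <= (A x *v \<xi>) \<bullet> \<xi>"
 using A_lower[where x=x and \<xi>=\<xi>] lam_pos by (meson order_trans zero_le_power2 mult_nonneg_nonneg less_imp_le)

lemma A_young:
 "2 * \<bar>(A x *v \<xi>) \<bullet> \<zeta>\<bar> <= (A x *v \<xi>) \<bullet> \<xi> + (A x *v \<zeta>) \<bullet> \<zeta>"
proof -
 have "0 <= (A x *v (\<xi> + \<zeta>)) \<bullet> (\<xi> + \<zeta>)" "0 <= (A x *v (\<xi> - \<zeta>)) \<bullet> (\<xi> - \<zeta>)" by (rule A_nonneg)+
 then show ?thesis
  using A_commute[of x \<xi> \<zeta>]
  by (simp add: matrix_vector_right_distrib matrix_vector_mult_diff_distrib inner_add_left inner_add_right inner_diff_left inner_diff_right)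
qed

lemma A_norm: "norm (A x *v \<xi>) <= L * norm \<xi>"
proof (cases "\<xi> = 0 \<or> A x *v \<xi> = 0")
 case False
 define \<zeta> where "\<zeta> = A x *v \<xi>"
 define s where "s = norm \<zeta> / norm \<xi>"
 have s: "s > 0" "norm \<zeta> = s * norm \<xi>" using False by (auto simp: s_def \<zeta>_def)
 have "2 * \<bar>(A x *v (s *. \<xi>)) \<bullet> \<zeta>\<bar> <= L * (norm (s *. \<xi>))^2 + L * (norm \<zeta>)^2"
  using A_young[of x "s *. \<xi>" \<zeta>] A_upper[of x "s *. \<xi>"] A_upper[of x \<zeta>] by linarith
 moreover have "(A x *v (s *. \<xi>)) \<bullet> \<zeta> = s * (norm \<zeta>)^2"
  by (simp add: matrix_vector_mult_scaleR \<zeta>_def dot_square_norm)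
 ultimately have "s * (norm \<zeta>)^2 <= L * (norm \<zeta>)^2" using s by (simp add: abs_mult)
 then have "s <= L" using False by (simp add: \<zeta>_def)
 then show ?thesis using s(2) by (simp add: \<zeta>_def mult_right_mono)
qed (auto simp: L_pos less_imp_le)

lemma A_mult_measurable [measurable (raw)]:
 assumes "g : borel_measurable M"  "f : measurable M borel"
 shows "(%x. A (f x) *v g x) : borel_measurable M"
proof -
 have "(%x. A (f x)) : borel_measurable M" using A_measurable assms(2) by (rule measurable_compose[rotated])
 moreover have "continuous_on UNIV (%x::(real^'n^'n) \<times> (real^'n). fst x *v snd x)"
  unfolding matrix_vector_mult_def
  by (intro continuous_on_vec_lambda continuous_on_sum continuous_on_mult continuous_on_component
   continuous_on_fst continuous_on_snd continuous_on_id)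
 ultimately show ?thesis
  using borel_measurable_continuous_Pair[OF _ assms(1), of "%x. A (f x)" "%M v. M *v v"] by blast
qed

lemma L2_A_finite: "g : Borel ==> S : sets borel ==> L2 S g < \<infinity> ==> L2 S (%x. A x *v g x) < \<infinity>"
 by (rule L2_bound_mult_finite[of g S _ L]) (use A_norm L_pos in auto)

lemma A_minus: "A x *v - \<xi> = - (A x *v \<xi>)"
 using matrix_vector_mult_scaleR[of "A x" "-1" \<xi>] by simp

definition supersol :: "(real^'n) set => (real^'n => real^'n) => bool" where
 "supersol S g \<longleftrightarrow> (ALL \<phi>:C1c S. (ALL x. 0 <= \<phi> x) --> 0 <= (LBINT x. ind S x * ((A x *v g x) \<bullet> grad \<phi> x)))"

lemma C1c_L2_finite:
 assumes \<phi>: "\<phi> : C1c S"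
 shows "L2 S (grad \<phi>) < \<infinity>"
proof -
 obtain K where K: "compact K" "supported_in (grad \<phi>) K" using \<phi> by (rule C1cE)
 obtain B where B: "B > 0" "!!x. \<bar>\<phi> x\<bar> <= B" "!!x. norm (grad \<phi> x) <= B" using C1c_bounded[OF \<phi>] by blast
 have "L2 S (grad \<phi>) <= L2 K (grad \<phi>)"
  unfolding L2_def using K(2) by (intro nn_integral_mono) (auto simp: indicator_def supported_in_def)
 also have "\<dots> < \<infinity>"
  by (rule L2_bounded_finite[of _ _ B]) (use B K emeasure_compact_finite[OF K(1)] in \<open>auto intro: borel_compact\<close>)
 finally show ?thesis .
qed

lemma C1c_pairing_limit:
 assumes g [measurable]: "g : Borel" and fin: "L2 S g < \<infinity>" and \<phi>: "sobolev S X \<phi> h" and X: "X <= C1c S"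
 obtains w :: "nat => real^'n => real" where "!!j. w j : X"
  "(%j. LBINT x. ind S x * ((A x *v g x) \<bullet> grad (w j) x)) ---> (LBINT x. ind S x * ((A x *v g x) \<bullet> h x))"
proof -
 obtain w where w: "!!j. w j : X" "H1_tendsto S w \<phi> h" using sobolevE[OF \<phi>] by blast
 note lim = H1_tendstoD[OF w(2)]
 note [measurable] = sobolevD(1-3)[OF \<phi>] lim(6)
 have "(%j. LBINT x. ind S x * ((A x *v g x) \<bullet> grad (w j) x)) ---> (LBINT x. ind S x * ((A x *v g x) \<bullet> h x))"
 proof (rule L2_inner_tendsto[OF _ _ _ _ L2_A_finite[OF g sobolevD(1)[OF \<phi>] fin] sobolevD(5)[OF \<phi>] _ lim(3)])
  show "L2 S (grad (w j)) < \<infinity>" for j using C1c_L2_finite w(1) X by blast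
 qed measurable
 with w(1) show ?thesis by (rule that)
qed

lemma supersol_sobolev:
 assumes s: "supersol S g" and g: "g : Borel" "L2 S g < \<infinity>"
  and \<phi>: "sobolev S {\<phi> : C1c S. ALL x. 0 <= \<phi> x} \<phi> h"
 shows "0 <= (LBINT x. ind S x * ((A x *v g x) \<bullet> h x))"
proof (rule C1c_pairing_limit[OF g \<phi>])
 fix w :: "nat => real^'n => real" assume w: "!!j. w j : {\<phi> : C1c S. ALL x. 0 <= \<phi> x}"
  "(%j. LBINT x. ind S x * ((A x *v g x) \<bullet> grad (w j) x)) ---> (LBINT x. ind S x * ((A x *v g x) \<bullet> h x))"
 show ?thesis by (rule LIMSEQ_le_const[OF w(2)]) (use s w(1) in \<open>auto simp: supersol_def\<close>)
qed blast

lemma test_integrable: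
 assumes u: "sobolev S X u g" and F: "lipschitz_C1 M F F'" and fin: "L2 S (%x. F (u x)) < \<infinity>" and \<eta>: "\<eta> : C1c S"
 shows "integrable lborel (%x. ind S x * (\<eta> x * (- F' (u x)) * ((A x *v g x) \<bullet> g x)))"
  and "integrable lborel (%x. ind S x * (F (u x) * ((A x *v g x) \<bullet> grad \<eta> x)))"
proof -
 note [measurable] = sobolevD(1-3)[OF u] C1_measurable[OF C1c_C1[OF \<eta>]] grad_measurable[OF C1c_C1[OF \<eta>]] lipschitz_C1D(5,6)[OF F]
 obtain B where B: "B > 0" "!!x. \<bar>\<eta> x\<bar> <= B" "!!x. norm (grad \<eta> x) <= B" using C1c_bounded[OF \<eta>] by blast
 note fin_A = L2_A_finite[OF sobolevD(3,1,5)[OF u]]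
 have "L2 S (%x. - (\<eta> x *. (F' (u x) *. g x))) < \<infinity>"
 proof (rule L2_bound_mult_finite[of g S _ "B * M"])
  fix x
  have "\<bar>\<eta> x\<bar> * \<bar>F' (u x)\<bar> <= B * M" using B lipschitz_C1D(3)[OF F] by (intro mult_mono) auto
  from mult_right_mono[OF this norm_ge_zero[of "g x"]]
  show "norm (- (\<eta> x *. (F' (u x) *. g x))) <= B * M * norm (g x)" by (simp add: abs_mult mult.assoc)
 qed (use B lipschitz_C1D(4)[OF F] sobolevD(5)[OF u] in auto)
 from L2_inner_integrable[OF _ _ _ fin_A this]
 show "integrable lborel (%x. ind S x * (\<eta> x * (- F' (u x)) * ((A x *v g x) \<bullet> g x)))" by (simp add: mult.assoc)
 have "L2 S (%x. F (u x) *. grad \<eta> x) < \<infinity>"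
  by (rule L2_bound_mult_finite[OF _ _ fin, of _ B]) (use B in \<open>auto simp: mult.commute[of B] intro!: mult_left_mono\<close>)
 from L2_inner_integrable[OF _ _ _ fin_A this]
 show "integrable lborel (%x. ind S x * (F (u x) * ((A x *v g x) \<bullet> grad \<eta> x)))" by simp
qed

lemma sobolev_test_function:
 assumes u: "sobolev S X u g" and F: "lipschitz_C1 M F F'" "!!w x. w : X ==> 0 <= F (w x)"
  and fin: "L2 S (%x. F (u x)) < \<infinity>" and \<eta>: "\<eta> : C1c S" "!!x. 0 <= \<eta> x"
 shows "sobolev S {\<phi> : C1c S. ALL x. 0 <= \<phi> x} (%x. \<eta> x * F (u x)) (%x. \<eta> x *. (F' (u x) *. g x) + F (u x) *. grad \<eta> x)"
proof -
 have F_u: "sobolev S {w. ALL x. 0 <= w x} (%x. F (u x)) (%x. F' (u x) *. g x)"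
  by (rule sobolev_chain[OF u F(1) _ fin]) (use F(2) in auto)
 obtain B where B: "B > 0" "!!x. \<bar>\<eta> x\<bar> <= B" "!!x. norm (grad \<eta> x) <= B" using C1c_bounded[OF \<eta>(1)] by blast
 show ?thesis
  by (rule sobolev_mult_C1[OF F_u C1c_C1[OF \<eta>(1)] _ B(2,3)]) (use sobolevD(1)[OF u] \<eta> C1c_mult[OF \<eta>(1)] in auto)
qed

lemma supersol_test:
 assumes s: "supersol S g" and u: "sobolev S X u g"
  and F: "lipschitz_C1 M F F'" "!!w x. w : X ==> 0 <= F (w x)"
  and fin: "L2 S (%x. F (u x)) < \<infinity>" and \<eta>: "\<eta> : C1c S" "!!x. 0 <= \<eta> x"
 shows "(LBINT x. ind S x * (\<eta> x * (- F' (u x)) * ((A x *v g x) \<bullet> g x)))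
  <= (LBINT x. ind S x * (F (u x) * ((A x *v g x) \<bullet> grad \<eta> x)))" (is "(LBINT x. ?P x) <= (LBINT x. ?Q x)")
proof -
 have "0 <= (LBINT x. ind S x * ((A x *v g x) \<bullet> (\<eta> x *. (F' (u x) *. g x) + F (u x) *. grad \<eta> x)))"
  by (rule supersol_sobolev[OF s sobolevD(3,5)[OF u] sobolev_test_function[OF u F(1) _ fin \<eta>]]) (use F(2) in auto)
 also have "\<dots> = (LBINT x. ?Q x - ?P x)"
  by (intro Bochner_Integration.integral_cong) (auto simp: inner_add_right algebra_simps)
 also have "\<dots> = (LBINT x. ?Q x) - (LBINT x. ?P x)"
  using test_integrable[OF u F(1) fin \<eta>(1)] by (rule Bochner_Integration.integral_diff[rotated])
 finally show ?thesis by simp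
qed

lemma A_young_absorb:
 assumes "0 <= f" "f <= p * q" "0 <= p" "0 <= q"
 shows "f * ((A x *v \<xi>) \<bullet> ((2 * e) *. \<zeta>)) <= e\<^sup>2 * q\<^sup>2 * ((A x *v \<xi>) \<bullet> \<xi>) / 2 + 2 * (p\<^sup>2 * ((A x *v \<zeta>) \<bullet> \<zeta>))"
proof -
 have "f * ((A x *v \<xi>) \<bullet> ((2 * e) *. \<zeta>)) <= \<bar>f * (2 * e) * ((A x *v \<xi>) \<bullet> \<zeta>)\<bar>" by (simp add: mult.assoc)
 also have "\<dots> = f * (2 * \<bar>e\<bar> * \<bar>(A x *v \<xi>) \<bullet> \<zeta>\<bar>)" using assms(1) by (simp add: abs_mult)
 also have "\<dots> <= (p * q) * (2 * \<bar>e\<bar> * \<bar>(A x *v \<xi>) \<bullet> \<zeta>\<bar>)" using assms by (intro mult_right_mono) auto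
 also have "\<dots> = 2 * (2 * \<bar>(A x *v ((e * q / 2) *. \<xi>)) \<bullet> (p *. \<zeta>)\<bar>)"
  using assms by (simp add: matrix_vector_mult_scaleR abs_mult)
 also have "\<dots> <= 2 * ((A x *v ((e * q / 2) *. \<xi>)) \<bullet> ((e * q / 2) *. \<xi>) + (A x *v (p *. \<zeta>)) \<bullet> (p *. \<zeta>))"
  by (intro mult_left_mono A_young) simp
 also have "\<dots> = e\<^sup>2 * q\<^sup>2 * ((A x *v \<xi>) \<bullet> \<xi>) / 2 + 2 * (p\<^sup>2 * ((A x *v \<zeta>) \<bullet> \<zeta>))"
  by (simp add: matrix_vector_mult_scaleR power2_eq_square)
 finally show ?thesis .
qed

end

lemma C1c_square:
 assumes "\<eta> : C1c S"
 shows "(%x. (\<eta> x)^2) : C1c S" "grad (%x. (\<eta> x)^2) = (%x. (2 * \<eta> x) *. grad \<eta> x)"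
 using C1c_mult[OF assms C1c_C1[OF assms]] grad_mult[OF C1c_C1[OF assms] C1c_C1[OF assms]]
 by (simp_all add: power2_eq_square scaleR_left_distrib[symmetric])

lemma nn_integral_absorb:
 fixes P Q E H :: "'a::euclidean_space => real"
 assumes [measurable]: "E : Borel" "H : Borel" and nonneg: "!!x. 0 <= E x" "!!x. 0 <= H x"
  and int: "integrable lborel P" "integrable lborel Q" and integral_le: "(LBINT x. P x) <= (LBINT x. Q x)"
  and E_le_P: "AEL x. E x <= P x" and Q_le: "AEL x. Q x <= E x / 2 + 2 * H x"
 shows "(NN x. ennreal (E x)) <= 4 * (NN x. ennreal (H x))"
proof (cases "(NN x. ennreal (H x)) = \<infinity>")
 case False
 then have int_H: "integrable lborel H" using nonneg by (intro integrableI_nonneg) (auto simp: less_top)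
 have int_E: "integrable lborel E"
  by (rule Bochner_Integration.integrable_bound[OF int(1)]) (measurable, use E_le_P nonneg in \<open>auto elim!: eventually_mono\<close>)
 have "(LBINT x. E x) <= (LBINT x. P x)" by (rule integral_mono_AE[OF int_E int(1) E_le_P])
 also have "\<dots> <= (LBINT x. Q x)" by (rule integral_le)
 also have "\<dots> <= (LBINT x. E x / 2 + 2 * H x)" by (rule integral_mono_AE[OF int(2) _ Q_le]) (use int_E int_H in auto)
 also have "\<dots> = (LBINT x. E x) / 2 + 2 * (LBINT x. H x)" using int_E int_H by simp
 finally have "(LBINT x. E x) <= 4 * (LBINT x. H x)" by simp
 then have "ennreal (LBINT x. E x) <= ennreal (4 * (LBINT x. H x))" by (rule ennreal_leI)
 then show ?thesis
  using nn_integral_eq_integral[OF int_E] nn_integral_eq_integral[OF int_H] nonneg by (simp add: ennreal_mult')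
qed (simp add: ennreal_mult_top)

context elliptic
begin

lemma A_energy_lower:
 assumes [measurable]: "e : Borel" "g : Borel" "S : sets borel" and e: "!!x. 0 <= e x"
 shows "(NN x. ennreal (e x * (norm (g x))^2) * ind S x)
  <= ennreal (1 / lam) * (NN x. ennreal (ind S x * (e x * ((A x *v g x) \<bullet> g x))))"
proof -
 have "(NN x. ennreal (e x * (norm (g x))^2) * ind S x)
  <= (NN x. ennreal (1 / lam) * ennreal (ind S x * (e x * ((A x *v g x) \<bullet> g x))))"
 proof (rule nn_integral_mono)
  fix x
  have "(norm (g x))^2 <= 1 / lam * ((A x *v g x) \<bullet> g x)" using A_lower[of "g x" x] lam_pos by (simp add: field_simps)
  from mult_left_mono[OF this e[of x]]
  show "ennreal (e x * (norm (g x))^2) * ind S x <= ennreal (1 / lam) * ennreal (ind S x * (e x * ((A x *v g x) \<bullet> g x)))"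
   using lam_pos A_nonneg[of x "g x"] e[of x]
   by (auto simp: indicator_def ennreal_mult[symmetric] mult_ac intro!: ennreal_leI)
 qed
 also have "\<dots> = ennreal (1 / lam) * (NN x. ennreal (ind S x * (e x * ((A x *v g x) \<bullet> g x))))"
  by (rule nn_integral_cmult) measurable
 finally show ?thesis .
qed

lemma A_energy_upper:
 assumes [measurable]: "e : Borel" "g : Borel" "S : sets borel" and e: "!!x. 0 <= e x"
 shows "(NN x. ennreal (ind S x * (e x * ((A x *v g x) \<bullet> g x))))
  <= ennreal L * (NN x. ennreal (e x * (norm (g x))^2) * ind S x)"
proof -
 have "(NN x. ennreal (ind S x * (e x * ((A x *v g x) \<bullet> g x)))) <= (NN x. ennreal L * (ennreal (e x * (norm (g x))^2) * ind S x))"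
 proof (rule nn_integral_mono)
  fix x
  show "ennreal (ind S x * (e x * ((A x *v g x) \<bullet> g x))) <= ennreal L * (ennreal (e x * (norm (g x))^2) * ind S x)"
   using mult_left_mono[OF A_upper[of x "g x"] e[of x]] L_pos e[of x]
   by (auto simp: indicator_def ennreal_mult[symmetric] mult_ac intro!: ennreal_leI)
 qed
 also have "\<dots> = ennreal L * (NN x. ennreal (e x * (norm (g x))^2) * ind S x)"
  by (rule nn_integral_cmult) measurable
 finally show ?thesis .
qed

lemma caccioppoli_const_factors: "ennreal (1 / lam) * (4 * (ennreal L * X)) = ennreal (4 * L / lam) * X"
proof -
 have "ennreal (4 * L / lam) = ennreal (1 / lam) * (4 * ennreal L)"
  using lam_pos L_pos by (simp add: ennreal_mult[symmetric] ennreal_numeral[symmetric] del: ennreal_numeral)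
 then show ?thesis by (simp add: mult.assoc)
qed

lemma caccioppoli:
 assumes s: "supersol S g" and u: "sobolev S UNIV u g" and F: "lipschitz_C1 M F F'" "!!t. 0 <= F t"
  and fin: "L2 S (%x. F (u x)) < \<infinity>" and \<eta>: "\<eta> : C1c S"
  and pq: "AE x\<in>S in lborel. F (u x) <= p x * q x & (q x)^2 <= - F' (u x) & 0 <= p x & 0 <= q x"
  and [measurable]: "p : Borel" "q : Borel"
 shows "(NN x. ennreal ((\<eta> x)^2 * (q x)^2 * (norm (g x))^2) * ind S x)
  <= ennreal (4 * L / lam) * (NN x. ennreal ((p x)^2 * (norm (grad \<eta> x))^2) * ind S x)"
proof -
 note [measurable] = sobolevD(1-3)[OF u] C1_measurable[OF C1c_C1[OF \<eta>]] grad_measurable[OF C1c_C1[OF \<eta>]]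
 note square = C1c_square(1)[OF \<eta>]
 define E where "E x = ind S x * ((\<eta> x)^2 * (q x)^2 * ((A x *v g x) \<bullet> g x))" for x
 define H where "H x = ind S x * ((p x)^2 * ((A x *v grad \<eta> x) \<bullet> grad \<eta> x))" for x
 have [measurable]: "E : Borel" "H : Borel" unfolding E_def H_def by measurable
 have absorbed: "(NN x. ennreal (E x)) <= 4 * (NN x. ennreal (H x))"
 proof (rule nn_integral_absorb[OF _ _ _ _ test_integrable[OF u F(1) fin square] supersol_test[OF s u F fin square]])
  show "AEL x. E x <= ind S x * ((\<eta> x)^2 * (- F' (u x)) * ((A x *v g x) \<bullet> g x))"
   using pq
  proof eventually_elim
   case (elim x)
   have "(\<eta> x)^2 * (q x)^2 * ((A x *v g x) \<bullet> g x) <= (\<eta> x)^2 * (- F' (u x)) * ((A x *v g x) \<bullet> g x)" if "x : S"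
    using elim that A_nonneg by (intro mult_right_mono mult_left_mono) auto
   then show ?case by (cases "x : S") (simp_all add: E_def)
  qed
  show "AEL x. ind S x * (F (u x) * ((A x *v g x) \<bullet> grad (%x. (\<eta> x)^2) x)) <= E x / 2 + 2 * H x"
   using pq unfolding E_def H_def C1c_square(2)[OF \<eta>]
  proof eventually_elim
   case (elim x)
   then show ?case using A_young_absorb[OF F(2), of "u x" "p x" "q x" x _ "\<eta> x"] by (cases "x : S") auto
  qed
 qed (use A_nonneg in \<open>auto simp: E_def H_def\<close>)
 have "(NN x. ennreal ((\<eta> x)^2 * (q x)^2 * (norm (g x))^2) * ind S x) <= ennreal (1 / lam) * (NN x. ennreal (E x))"
  unfolding E_def by (rule A_energy_lower) auto
 also note absorbed
 also have "(NN x. ennreal (H x)) <= ennreal L * (NN x. ennreal ((p x)^2 * (norm (grad \<eta> x))^2) * ind S x)"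
  unfolding H_def by (rule A_energy_upper) auto
 also note caccioppoli_const_factors
 finally show ?thesis by (auto simp: mult_left_mono)
qed

end

subsection \<open>Local boundedness\<close>

definition dg_class :: "real => (real^'n) set => (real^'n => real) => (real^'n => real^'n) => bool" where
 "dg_class \<Lambda> S v g \<longleftrightarrow> (ALL k>=0. ALL \<eta>:C1c S.
  (NN x. ennreal ((\<eta> x)^2 * (norm (g x))^2) * ind (S \<inter> {x. k < v x}) x)
   <= ennreal \<Lambda> * (NN x. ennreal ((max (v x - k) 0)^2 * (norm (grad \<eta> x))^2) * ind S x))"

lemma smooth_pos_le:
 assumes "e > 0"
 shows "smooth_pos e t <= max t 0 * sqrt (smooth_pos' e t)"
proof (cases "t <= 0")
 case False
 have "(t / (t + e))^2 <= 1 - (e / (t + e))\<^sup>2"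
 proof -
  have "(t / (t + e))^2 + (e / (t + e))^2 = (t\<^sup>2 + e\<^sup>2) / (t + e)^2" by (simp add: power_divide add_divide_distrib)
  also have "\<dots> <= 1"
  proof -
   have "t\<^sup>2 + e\<^sup>2 <= (t + e)^2" using False assms by (simp add: power2_sum)
   moreover have "0 < (t + e)^2" using False assms by simp
   ultimately show ?thesis by (simp add: divide_le_eq_1_pos)
  qed
  finally show ?thesis by simp
 qed
 then have "t / (t + e) <= sqrt (smooth_pos' e t)"
  using False by (intro real_le_rsqrt) (simp add: smooth_pos'_def)
 from mult_left_mono[OF this, of t] show ?thesis using False by (simp add: smooth_pos_def power2_eq_square)
qed (simp add: smooth_pos_def)

lemma truncation_limit:
 assumes [measurable]: "v : Borel" "f : Borel" "S : sets borel"
  and "!!x. 0 <= f x"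
  and bound: "!!j. (NN x. ennreal (f x * smooth_pos' (1 / Suc j) (v x - k)) * ind S x) <= X"
 shows "(NN x. ennreal (f x) * ind (S \<inter> {x. k < v x}) x) <= X"
proof -
 note [measurable] = smooth_pos'_measurable
 have "(NN x. ennreal (f x) * ind (S \<inter> {x. k < v x}) x)
  = (NN x. liminf (%j. ennreal (f x * smooth_pos' (1 / Suc j) (v x - k)) * ind S x))"
 proof (rule nn_integral_cong)
  fix x
  have "(%j. f x * smooth_pos' (1 / Suc j) (v x - k)) ---> f x * (if v x - k > 0 then 1 else 0)"
   by (intro tendsto_intros smooth_pos'_tendsto)
  then have "(%j. ennreal (f x * smooth_pos' (1 / Suc j) (v x - k))) ---> ennreal (f x * (if v x - k > 0 then 1 else 0))"
   by (rule tendsto_ennrealI)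
  then have "(%j. ennreal (f x * smooth_pos' (1 / Suc j) (v x - k)) * ind S x) ---> ennreal (f x) * ind (S \<inter> {x. k < v x}) x"
   by (cases "x : S"; cases "k < v x") auto
  from lim_imp_Liminf[OF sequentially_bot this]
  show "ennreal (f x) * ind (S \<inter> {x. k < v x}) x = liminf (%j. ennreal (f x * smooth_pos' (1 / Suc j) (v x - k)) * ind S x)"
   by simp
 qed
 also have "\<dots> <= liminf (%j. NN x. ennreal (f x * smooth_pos' (1 / Suc j) (v x - k)) * ind S x)"
  by (rule nn_integral_liminf) measurable
 also have "\<dots> <= X"
  using Liminf_mono[OF always_eventually, of _ "%_. X" sequentially] bound by (simp add: Liminf_const)
 finally show ?thesis .
qed

lemma dg_classI:
 assumes "S : sets borel" "v : Borel" and [measurable]: "g : Borel"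
  and smoothed: "!!e k \<eta>. e > 0 ==> 0 <= k ==> \<eta> : C1c S ==>
   (NN x. ennreal ((\<eta> x)^2 * (norm (g x))^2 * smooth_pos' e (v x - k)) * ind S x)
    <= ennreal \<Lambda> * (NN x. ennreal ((max (v x - k) 0)^2 * (norm (grad \<eta> x))^2) * ind S x)"
 shows "dg_class \<Lambda> S v g"
 unfolding dg_class_def
proof (intro allI ballI impI)
 fix k :: real and \<eta> assume k: "0 <= k" and \<eta>: "\<eta> : C1c S"
 note [measurable] = C1_measurable[OF C1c_C1[OF \<eta>]]
 show "(NN x. ennreal ((\<eta> x)^2 * (norm (g x))^2) * ind (S \<inter> {x. k < v x}) x)
   <= ennreal \<Lambda> * (NN x. ennreal ((max (v x - k) 0)^2 * (norm (grad \<eta> x))^2) * ind S x)"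
  by (rule truncation_limit[OF assms(2) _ assms(1) _ smoothed[OF _ k \<eta>]]) auto
qed

lemma sobolev_truncate_cutoff:
 fixes v :: "real^'n => real"
 assumes v: "sobolev S UNIV v g" and S: "emeasure lborel S < \<infinity>" and \<eta>: "\<eta> : C1c S"
 shows "sobolev UNIV UNIV (%x. \<eta> x * max (v x - k) 0)
  (%x. \<eta> x *. (if k < v x then g x else 0) + max (v x - k) 0 *. grad \<eta> x)"
proof -
 obtain B where B: "B > 0" "!!x. \<bar>\<eta> x\<bar> <= B" "!!x. norm (grad \<eta> x) <= B" using C1c_bounded[OF \<eta>] by blast
 have "sobolev S UNIV (%x. v x - k) g" using sobolev_affine[OF v S, of 1 "- k"] by (simp only: mult_1 scaleR_one diff_conv_add_uminus)
 from sobolev_pos[OF this UNIV_I]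
 have truncated: "sobolev S UNIV (%x. max (v x - k) 0) (%x. if k < v x then g x else 0)" by (simp only: diff_gt_0_iff_gt)
 show ?thesis
 proof (rule sobolev_mult_C1[OF truncated C1c_C1[OF \<eta>] _ B(2,3)])
  show "\<eta> x = 0 & grad \<eta> x = 0" if "x ~: S" for x using C1c_zero[OF \<eta> that] by blast
 qed simp_all
qed

lemma dg_truncated_energy:
 fixes v :: "real^'n => real"
 assumes dg: "dg_class \<Lambda> S v g" and \<Lambda>: "0 <= \<Lambda>" and v: "sobolev S UNIV v g" and k: "0 <= k"
  and \<eta>: "\<eta> : C1c S" "!!x. norm (grad \<eta> x) <= M" "!!x. x ~: T ==> grad \<eta> x = 0" and [measurable]: "T : sets borel"
 shows "L2 UNIV (%x. \<eta> x *. (if k < v x then g x else 0) + max (v x - k) 0 *. grad \<eta> x)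
  <= ennreal (2 * (\<Lambda> + 1) * M\<^sup>2) * L2 T (%x. max (v x - k) 0)"
proof -
 note [measurable] = sobolevD(1-3)[OF v] C1_measurable[OF C1c_C1[OF \<eta>(1)]] grad_measurable[OF C1c_C1[OF \<eta>(1)]]
 have M: "0 <= M" using order_trans[OF norm_ge_zero \<eta>(2)] .
 define X where "X = ennreal (M\<^sup>2) * L2 T (%x. max (v x - k) 0)"
 let ?trunc = "%x. max (v x - k) 0 *. grad \<eta> x"
 have trunc: "L2 UNIV ?trunc <= X"
  unfolding X_def
 proof (rule L2_bound_mult_on)
  show "norm (?trunc x) <= M * norm (max (v x - k) 0)" for x
   using mult_left_mono[OF \<eta>(2), of "\<bar>max (v x - k) 0\<bar>" x] by (simp add: mult.commute)
 qed (use \<eta>(3) M in auto)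
 have "L2 UNIV (%x. \<eta> x *. (if k < v x then g x else 0)) <=
  (NN x. ennreal ((\<eta> x)^2 * (norm (g x))^2) * ind (S \<inter> {x. k < v x}) x)"
  unfolding L2_def using C1c_zero[OF \<eta>(1)]
  by (intro nn_integral_mono) (auto simp: indicator_def power_mult_distrib)
 also have "\<dots> <= ennreal \<Lambda> * (NN x. ennreal ((max (v x - k) 0)^2 * (norm (grad \<eta> x))^2) * ind S x)"
  using dg k \<eta>(1) unfolding dg_class_def by auto
 also have "\<dots> <= ennreal \<Lambda> * L2 UNIV ?trunc"
  unfolding L2_def by (intro mult_left_mono nn_integral_mono) (auto simp: indicator_def power_mult_distrib)
 also have "\<dots> <= ennreal \<Lambda> * X" by (intro mult_left_mono trunc) simp
 finally have "L2 UNIV (%x. \<eta> x *. (if k < v x then g x else 0)) <= ennreal \<Lambda> * X" .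
 then have "L2 UNIV (%x. \<eta> x *. (if k < v x then g x else 0) + ?trunc x) <= 2 * (ennreal \<Lambda> * X) + 2 * X"
  using trunc by (intro order_trans[OF L2_add] add_mono mult_left_mono) auto
 also have "\<dots> = ennreal (2 * (\<Lambda> + 1)) * X"
  using \<Lambda> by (simp add: ennreal_plus ennreal_mult ennreal_numeral distrib_left distrib_right mult.assoc)
 also have "\<dots> = ennreal (2 * (\<Lambda> + 1) * M\<^sup>2) * L2 T (%x. max (v x - k) 0)"
  using \<Lambda> by (simp add: X_def ennreal_mult mult.assoc)
 finally show ?thesis .
qed

lemma chebyshev_level:
 fixes v :: "'a::euclidean_space => real"
 assumes [measurable]: "v : Borel" "T : sets borel" "E : sets borel" and k: "k1 < k2"
  and E: "!!x. x : E ==> x : T & k2 < v x" and small: "L2 T (%x. max (v x - k1) 0) <= ennreal (c * (k2 - k1)^2)"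
 shows "emeasure lborel E <= ennreal c"
proof (rule ennreal_le_mult_cancel)
 show "(k2 - k1)^2 > 0" using k by simp
 have "ennreal ((k2 - k1)^2) * emeasure lborel E = (NN x. ennreal ((k2 - k1)^2) * ind E x)"
  by (subst nn_integral_cmult) auto
 also have "\<dots> <= L2 T (%x. max (v x - k1) 0)"
  unfolding L2_def
 proof (rule nn_integral_mono)
  fix x
  have "(k2 - k1)^2 <= (max (v x - k1) 0)^2" if "x : E" using E[OF that] k by (intro power_mono) auto
  then show "ennreal ((k2 - k1)^2) * ind E x <= ennreal ((norm (max (v x - k1) 0))^2) * ind T x"
   using E by (auto simp: indicator_def intro: ennreal_leI)
 qed
 also have "\<dots> <= ennreal ((k2 - k1)^2) * ennreal c" using small by (simp add: ennreal_mult'' mult.commute)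
 finally show "ennreal ((k2 - k1)^2) * emeasure lborel E <= ennreal ((k2 - k1)^2) * ennreal c" .
qed

lemma dg_step:
 fixes v :: "real^'n => real"
 assumes dg: "dg_class \<Lambda> (ball z R) v g" and \<Lambda>: "\<Lambda> \<ge> 0" and v: "sobolev (ball z R) UNIV v g"
  and r: "0 <= r1" "r1 < r2" "r2 <= R" and k: "0 <= k1" "k1 < k2" and s: "s > 0"
  and small: "L2 (ball z r2) (%x. max (v x - k1) 0) <= ennreal (unit_ball_vol (real CARD('n)) * s ^ CARD('n) / 2 * (k2 - k1)^2)"
 shows "L2 (ball z r1) (%x. max (v x - k2) 0) <=
  ennreal (1152 * (\<Lambda> + 1) * 2 ^ CARD('n) * s\<^sup>2 / (r2 - r1)^2) * L2 (ball z r2) (%x. max (v x - k1) 0)"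
proof -
 define r where "r = (r1 + r2) / 2"
 have r: "r1 < r" "r < r2" "r < R" "r - r1 = (r2 - r1) / 2" "0 <= r1" using r by (auto simp: r_def field_simps)
 note [measurable] = sobolevD(1-3)[OF v]
 obtain \<eta> where \<eta>: "cutoff z r1 r \<eta>" using cutoff_exists[OF \<open>0 <= r1\<close> r(1), of z] by blast
 have \<eta>c: "\<eta> : C1c (ball z R)" by (rule cutoff_C1c[OF \<eta> r(3)])
 note [measurable] = C1_measurable[OF cutoffD(1)[OF \<eta>]]
 define M where "M = 6 / (r2 - r1)"
 have grad_M: "norm (grad \<eta> x) <= M" for x using cutoffD(4)[OF \<eta>] r by (simp add: M_def)
 define \<psi> where "\<psi> x = max (v x - k2) 0" for x
 have [measurable]: "\<psi> : Borel" unfolding \<psi>_def by measurable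
 let ?h = "%x. \<eta> x *. (if k2 < v x then g x else 0) + max (v x - k2) 0 *. grad \<eta> x"
 have out: "\<eta> x = 0" "grad \<eta> x = 0" if "x ~: ball z r2" for x using cutoffD(7,8)[OF \<eta>, of x] that r by auto
 have "L2 (ball z r1) \<psi> <= L2 UNIV (%x. \<eta> x * \<psi> x)"
  unfolding L2_def using cutoffD(5)[OF \<eta>] by (intro nn_integral_mono) (auto simp: indicator_def)
 also have "\<dots> <= ennreal (16 * s\<^sup>2 * 2 ^ CARD('n)) * L2 UNIV ?h"
 proof (rule faber_krahn[OF _ s])
  show "sobolev UNIV UNIV (%x. \<eta> x * \<psi> x) ?h"
   unfolding \<psi>_def by (rule sobolev_truncate_cutoff[OF v emeasure_lborel_ball_finite \<eta>c])
  show "emeasure lborel {x. \<eta> x * \<psi> x ~= 0} <= ennreal (unit_ball_vol (real CARD('n)) * s ^ CARD('n) / 2)"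
   by (rule chebyshev_level[OF _ _ _ k(2) _ small]) (use out(1) in \<open>auto simp: \<psi>_def split: if_splits\<close>)
 qed
 also have "L2 UNIV ?h <= ennreal (2 * (\<Lambda> + 1) * M\<^sup>2) * L2 (ball z r2) \<psi>"
  unfolding \<psi>_def by (rule dg_truncated_energy[OF dg \<Lambda> v _ \<eta>c grad_M out(2)]) (use k in auto)
 also have "L2 (ball z r2) \<psi> <= L2 (ball z r2) (%x. max (v x - k1) 0)" (is "_ <= ?Y")
  using k by (intro L2_mono) (auto simp: \<psi>_def)
 also have "ennreal (16 * s\<^sup>2 * 2 ^ CARD('n)) * (ennreal (2 * (\<Lambda> + 1) * M\<^sup>2) * ?Y)
  = ennreal (16 * s\<^sup>2 * 2 ^ CARD('n) * (2 * (\<Lambda> + 1) * M\<^sup>2)) * ?Y"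
  using \<Lambda> by (simp add: ennreal_mult mult.assoc)
 also have "16 * s\<^sup>2 * 2 ^ CARD('n) * (2 * (\<Lambda> + 1) * M\<^sup>2) = 1152 * (\<Lambda> + 1) * 2 ^ CARD('n) * s\<^sup>2 / (r2 - r1)^2"
  by (simp add: M_def power_divide)
 finally show ?thesis by (simp add: \<psi>_def mult_left_mono)
qed

text \<open>At the scale \<open>dg_scale n \<Lambda> * d / 2^j\<close> each step from radius \<open>d / 2^j\<close> to \<open>d / 2^(j+1)\<close> gains the factor \<open>1 / (4 * 2^n)\<close>.\<close>

definition dg_scale :: "nat => real => real" where
 "dg_scale n \<Lambda> = sqrt (1 / (4 * 2 ^ n) / (4 * (1152 * (\<Lambda> + 1) * 2 ^ n)))"

definition dg_const :: "nat => real => real" where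
 "dg_const n \<Lambda> = unit_ball_vol (real n) * dg_scale n \<Lambda> ^ n / 8"

lemma dg_scale_pos: "0 <= \<Lambda> ==> 0 < dg_scale n \<Lambda>" and dg_const_pos: "0 <= \<Lambda> ==> 0 < dg_const n \<Lambda>"
 by (auto simp: dg_const_def dg_scale_def)

lemma dg_scale_gain:
 assumes "0 <= \<Lambda>" "0 < d"
 shows "1152 * (\<Lambda> + 1) * 2 ^ n * (dg_scale n \<Lambda> * d / 2 ^ j)^2 / (d / 2 ^ Suc j)^2 = 1 / (4 * 2 ^ n)"
proof -
 define C where "C = 1152 * (\<Lambda> + 1) * 2 ^ n"
 have C: "0 < C" using assms(1) by (simp add: C_def)
 then have scale: "(dg_scale n \<Lambda>)^2 = 1 / (4 * 2 ^ n) / (4 * C)"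
  unfolding dg_scale_def C_def[symmetric] by (intro real_sqrt_pow2) simp
 show ?thesis unfolding C_def[symmetric] using C assms(2) by (simp add: scale power_divide power_mult_distrib)
qed

lemma dg_const_level:
 "dg_const n \<Lambda> * d ^ n * K\<^sup>2 * (1 / (4 * 2 ^ n)) ^ j
  = unit_ball_vol (real n) * (dg_scale n \<Lambda> * d / 2 ^ j) ^ n / 2 * (K / 2 ^ Suc j)^2"
proof -
 have "(1 / (4 * 2 ^ n)) ^ j = 1 / (4 ^ j * (2 ^ j) ^ n :: real)"
  by (simp add: power_divide power_mult_distrib power_mult[symmetric] mult.commute)
 moreover have "(K / 2 ^ Suc j)^2 = K\<^sup>2 / (4 * 4 ^ j)"
  by (simp add: power_divide power_mult_distrib power2_eq_square power_mult_distrib[symmetric])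
 ultimately show ?thesis by (auto simp: dg_const_def field_simps)
qed

lemma dg_iteration:
 fixes v :: "real^'n => real"
 assumes dg: "dg_class \<Lambda> (ball z R) v g" and \<Lambda>: "\<Lambda> \<ge> 0" and v: "sobolev (ball z R) UNIV v g"
  and \<rho>: "0 <= \<rho>" "\<rho> < R" and K: "0 < K"
  and start: "L2 (ball z R) (%x. max (v x) 0) <= ennreal (dg_const CARD('n) \<Lambda> * (R - \<rho>) ^ CARD('n) * K\<^sup>2)"
 shows "L2 (ball z (\<rho> + (R - \<rho>) / 2 ^ j)) (%x. max (v x - K * (1 - 1 / 2 ^ j)) 0)
  <= ennreal (dg_const CARD('n) \<Lambda> * (R - \<rho>) ^ CARD('n) * K\<^sup>2 * (1 / (4 * 2 ^ CARD('n))) ^ j)"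
proof (induction j)
 case 0
 then show ?case using start by simp
next
 case (Suc j)
 define d where "d = R - \<rho>"
 define s where "s = dg_scale CARD('n) \<Lambda> * d / 2 ^ j"
 let ?\<tau> = "1 / (4 * 2 ^ CARD('n)) :: real" and ?y = "dg_const CARD('n) \<Lambda> * d ^ CARD('n) * K\<^sup>2"
 let ?r = "%j. \<rho> + d / 2 ^ j" and ?k = "%j. K * (1 - 1 / 2 ^ j)"
 have d: "d > 0" and s: "s > 0" using \<rho> dg_scale_pos[OF \<Lambda>] by (auto simp: d_def s_def)
 have "d / 2 ^ j <= d" using d by (simp add: divide_le_eq)
 then have R: "?r j <= R" by (simp add: d_def)
 have step: "?r j - ?r (Suc j) = d / 2 ^ Suc j" "?k (Suc j) - ?k j = K / 2 ^ Suc j" by (simp_all add: field_simps)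
 have range: "0 <= ?r (Suc j)" "?r (Suc j) < ?r j" "?r j <= R" "0 <= ?k j" "?k j < ?k (Suc j)"
  using \<rho>(1) d K R by (auto simp: field_simps)
 have small: "L2 (ball z (?r j)) (%x. max (v x - ?k j) 0)
   <= ennreal (unit_ball_vol (real CARD('n)) * s ^ CARD('n) / 2 * (?k (Suc j) - ?k j)^2)"
  using Suc unfolding step s_def dg_const_level[symmetric] by (simp only: d_def)
 have "L2 (ball z (?r (Suc j))) (%x. max (v x - ?k (Suc j)) 0)
   <= ennreal (1152 * (\<Lambda> + 1) * 2 ^ CARD('n) * s\<^sup>2 / (?r j - ?r (Suc j))^2) * L2 (ball z (?r j)) (%x. max (v x - ?k j) 0)"
  by (rule dg_step[OF dg \<Lambda> v range s small])
 also have "1152 * (\<Lambda> + 1) * 2 ^ CARD('n) * s\<^sup>2 / (?r j - ?r (Suc j))^2 = ?\<tau>"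
  unfolding step s_def by (rule dg_scale_gain[OF \<Lambda> d])
 also have "L2 (ball z (?r j)) (%x. max (v x - ?k j) 0) <= ennreal (?y * ?\<tau> ^ j)"
  using Suc by (simp only: d_def)
 also have "ennreal ?\<tau> * ennreal (?y * ?\<tau> ^ j) = ennreal (?y * ?\<tau> ^ Suc j)"
  by (simp add: ennreal_mult'[symmetric])
 finally show ?case by (simp only: d_def mult_left_mono zero_le)
qed

lemma dg_local_max:
 fixes v :: "real^'n => real"
 assumes dg: "dg_class \<Lambda> (ball z R) v g" and v: "sobolev (ball z R) UNIV v g" and \<Lambda>: "\<Lambda> \<ge> 0"
  and \<rho>: "0 <= \<rho>" "\<rho> < R" and K: "0 < K"
  and start: "L2 (ball z R) (%x. max (v x) 0) <= ennreal (dg_const CARD('n) \<Lambda> * (R - \<rho>) ^ CARD('n) * K\<^sup>2)"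
 shows "AE x\<in>ball z \<rho> in lborel. v x <= K"
proof -
 note [measurable] = sobolevD(2)[OF v]
 define y where "y = dg_const CARD('n) \<Lambda> * (R - \<rho>) ^ CARD('n) * K\<^sup>2"
 define \<tau> :: real where "\<tau> = 1 / (4 * 2 ^ CARD('n))"
 have "(1::real) <= 2 ^ CARD('n)" by simp
 then have "1 < 4 * (2::real) ^ CARD('n)" by linarith
 then have \<tau>: "0 < \<tau>" "\<tau> < 1" by (simp_all add: \<tau>_def)
 have "L2 (ball z \<rho>) (%x. max (v x - K) 0) <= ennreal (y * \<tau> ^ j)" for j
 proof -
  have "K * (1 - 1 / 2 ^ j) <= K" using K by (simp add: field_simps)
  then have "L2 (ball z \<rho>) (%x. max (v x - K) 0) <= L2 (ball z \<rho>) (%x. max (v x - K * (1 - 1 / 2 ^ j)) 0)"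
   by (intro L2_mono) auto
  also have "\<dots> <= L2 (ball z (\<rho> + (R - \<rho>) / 2 ^ j)) (%x. max (v x - K * (1 - 1 / 2 ^ j)) 0)"
   by (rule L2_mono_set) (use \<rho> in \<open>auto intro!: subset_ball\<close>)
  finally show ?thesis using dg_iteration[OF dg \<Lambda> v \<rho> K start, of j] by (simp add: y_def \<tau>_def)
 qed
 moreover have "(%j. y * \<tau> ^ j) ---> y * 0" using \<tau> by (intro tendsto_intros LIMSEQ_power_zero) auto
 from tendsto_ennrealI[OF this] have "(%j. ennreal (y * \<tau> ^ j)) ---> 0" by simp
 ultimately have "L2 (ball z \<rho>) (%x. max (v x - K) 0) <= 0" by (intro LIMSEQ_le_const) auto
 then have "(NN x. ennreal ((norm (max (v x - K) 0))^2) * ind (ball z \<rho>) x) = 0" by (simp only: L2_def le_zero_eq)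
 then have "AEL x. ennreal ((norm (max (v x - K) 0))^2) * ind (ball z \<rho>) x = 0"
  by (subst (asm) nn_integral_0_iff_AE) (measurable, simp)
 then show ?thesis
  by eventually_elim (auto simp: indicator_def max_def split: if_splits)
qed

subsection \<open>Growth of supersolutions and decay of oscillation\<close>

lemma sobolev_minus:
 assumes u: "sobolev S X u g"
 shows "sobolev S UNIV (%x. - u x) (%x. - g x)"
proof -
 have "L2 S (%x. (-1) * u x + 0) < \<infinity>" using sobolevD(4)[OF u] by (simp add: L2_def)
 from sobolev_chain[OF u lipschitz_C1_affine _ this, of UNIV] show ?thesis by simp
qed

lemma lipschitz_C1_extension:
 fixes f f' :: "real => real"
 assumes deriv: "!!t. \<delta> <= t ==> (f has_real_derivative f' t) (at t)" and cont: "continuous_on {\<delta>..} f'"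
  and bound: "!!t. \<delta> <= t ==> \<bar>f' t\<bar> <= M" and nonneg: "0 <= f \<delta>" "f' \<delta> <= 0"
 obtains F where "lipschitz_C1 M F (%t. f' (max t \<delta>))" "!!t. \<delta> <= t ==> F t = f t" "!!t. t <= \<delta> ==> 0 <= F t"
proof
 define F where "F t = (if t <= \<delta> then f \<delta> + f' \<delta> * (t - \<delta>) else f t)" for t
 have "(F has_real_derivative (if t <= \<delta> then f' \<delta> else f' t)) (at t)" for t
  unfolding F_def by (rule DERIV_join) (auto intro!: derivative_eq_intros deriv)
 moreover have "(if t <= \<delta> then f' \<delta> else f' t) = f' (max t \<delta>)" for t by (simp add: max_def)
 moreover have "continuous_on UNIV (%t. f' (max t \<delta>))"
  by (rule continuous_on_compose2[OF cont]) (auto intro!: continuous_intros)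
 ultimately show "lipschitz_C1 M F (%t. f' (max t \<delta>))" using bound by (simp add: lipschitz_C1_def)
 show "F t = f t" if "\<delta> <= t" for t using that by (auto simp: F_def)
 show "0 <= F t" if "t <= \<delta>" for t using that nonneg by (auto simp: F_def mult_nonpos_nonpos)
qed

definition neg_log :: "real => real => real => real" where
 "neg_log \<delta> k t = - ln (max t \<delta> / k)"

lemma neg_log_measurable: "neg_log \<delta> k : Borel"
 unfolding neg_log_def[abs_def] by measurable

lemma sobolev_neg_log:
 assumes u: "sobolev S X u g" and S: "emeasure lborel S < \<infinity>"
  and \<delta>: "\<delta> > 0" and k: "k > 0" and lower: "AE x\<in>S in lborel. \<delta> <= u x"
 shows "sobolev S UNIV (%x. neg_log \<delta> k (u x)) (%x. (- 1 / max (u x) \<delta>) *. g x)"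
proof -
 note [measurable] = sobolevD(1-3)[OF u] neg_log_measurable
 have deriv: "((%t. ln (\<delta> / k) - ln (t / k)) has_real_derivative - 1 / t) (at t)" if "\<delta> <= t" for t
  using that \<delta> k by (auto intro!: derivative_eq_intros)
 have cont: "continuous_on {\<delta>..} (%t. - 1 / t)" using \<delta> by (auto intro!: continuous_intros)
 have bound: "\<bar>- 1 / t\<bar> <= 1 / \<delta>" if "\<delta> <= t" for t using that \<delta> by (auto simp: abs_divide field_simps)
 have nonneg: "0 <= ln (\<delta> / k) - ln (\<delta> / k)" and decreasing: "- 1 / \<delta> <= 0" using \<delta> by simp_all
 obtain F where F: "lipschitz_C1 (1 / \<delta>) F (%t. - 1 / max t \<delta>)" "!!t. \<delta> <= t ==> F t = ln (\<delta> / k) - ln (t / k)"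
  "!!t. t <= \<delta> ==> 0 <= F t"
  using lipschitz_C1_extension[OF deriv cont bound nonneg decreasing] by blast
 note F' = lipschitz_C1_affine_comp[OF F(1), of 1 "- ln (\<delta> / k)"]
 have "sobolev S UNIV (%x. 1 * F (u x) + - ln (\<delta> / k)) (%x. (1 * (- 1 / max (u x) \<delta>)) *. g x)"
  by (rule sobolev_chain[OF u F' _ L2_lipschitz_C1_finite[OF sobolevD(1,2)[OF u] S sobolevD(4)[OF u] F']]) simp
 then show ?thesis
 proof (rule sobolev_cong)
  show "AE x\<in>S in lborel. neg_log \<delta> k (u x) = 1 * F (u x) + - ln (\<delta> / k)"
   using lower by eventually_elim (auto simp: neg_log_def F(2) max_def)
 qed auto
qed

context elliptic
begin

lemma C1c_integral_superset:
 assumes "\<phi> : C1c S" "S <= T"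
 shows "(LBINT x. ind T x * ((A x *v g x) \<bullet> grad \<phi> x)) = (LBINT x. ind S x * ((A x *v g x) \<bullet> grad \<phi> x))"
 using C1c_zero(2)[OF assms(1)] assms(2) by (intro Bochner_Integration.integral_cong) (auto simp: indicator_def)

lemma supersol_mono:
 assumes "supersol T g" "S <= T"
 shows "supersol S g"
 unfolding supersol_def
proof (intro ballI impI)
 fix \<phi> assume \<phi>: "\<phi> : C1c S" "ALL x. 0 <= \<phi> x"
 show "0 <= (LBINT x. ind S x * ((A x *v g x) \<bullet> grad \<phi> x))"
  using assms(1) C1c_mono[OF \<phi>(1) assms(2)] \<phi>(2)
  unfolding supersol_def C1c_integral_superset[OF \<phi>(1) assms(2), symmetric] by blast
qed

lemma subsolution_dg_class:
 assumes s: "supersol S (%x. - g x)" and v: "sobolev S UNIV v g"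
 shows "dg_class (4 * L / lam) S v g"
proof (rule dg_classI[OF sobolevD(1-3)[OF v]])
 fix e k :: real and \<eta> assume e: "e > 0" and k: "0 <= k" and \<eta>: "\<eta> : C1c S"
 note [measurable] = sobolevD(1-3)[OF v] smooth_pos'_measurable[OF e]
 have F: "lipschitz_C1 1 (%s. smooth_pos e (- s - k)) (%s. - smooth_pos' e (- s - k))"
  using lipschitz_C1_comp_affine[OF lipschitz_C1_smooth_pos[OF e], of "-1" "- k"] by simp
 have "L2 S (%x. smooth_pos e (- (- v x) - k)) <= L2 S v"
 proof (rule L2_mono)
  show "norm (smooth_pos e (- (- v x) - k)) <= norm (v x)" for x
   using smooth_pos_bounds[OF e, of "- (- v x) - k"] k by (auto simp: max_def split: if_splits)
 qed
 then have fin: "L2 S (%x. smooth_pos e (- (- v x) - k)) < \<infinity>" using sobolevD(4)[OF v] by (rule le_less_trans)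
 have "(NN x. ennreal ((\<eta> x)^2 * (sqrt (smooth_pos' e (v x - k)))^2 * (norm (- g x))^2) * ind S x)
  <= ennreal (4 * L / lam) * (NN x. ennreal ((max (v x - k) 0)^2 * (norm (grad \<eta> x))^2) * ind S x)"
  by (rule caccioppoli[OF s sobolev_minus[OF v] F smooth_pos_bounds(1)[OF e] fin \<eta>])
   (use smooth_pos_le[OF e] smooth_pos'_bounds[OF e] in auto)
 then show "(NN x. ennreal ((\<eta> x)^2 * (norm (g x))^2 * smooth_pos' e (v x - k)) * ind S x)
  <= ennreal (4 * L / lam) * (NN x. ennreal ((max (v x - k) 0)^2 * (norm (grad \<eta> x))^2) * ind S x)"
  using smooth_pos'_bounds(1)[OF e] by (simp add: mult_ac)
qed

lemma caccioppoli_bounded_below: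
 assumes s: "supersol S g" and u: "sobolev S UNIV u g" and S: "emeasure lborel S < \<infinity>" and \<eta>: "\<eta> : C1c S"
  and lower: "AE x\<in>S in lborel. \<delta> <= u x"
  and deriv: "!!t. \<delta> <= t ==> (f has_real_derivative f' t) (at t)" and cont: "continuous_on {\<delta>..} f'"
  and bound: "!!t. \<delta> <= t ==> \<bar>f' t\<bar> <= M" and nonneg: "!!t. \<delta> <= t ==> 0 <= f t" "f' \<delta> <= 0"
  and pq: "AE x\<in>S in lborel. f (u x) <= p x * q x & (q x)^2 <= - f' (u x) & 0 <= p x & 0 <= q x"
  and [measurable]: "p : Borel" "q : Borel"
 shows "(NN x. ennreal ((\<eta> x)^2 * (q x)^2 * (norm (g x))^2) * ind S x)
  <= ennreal (4 * L / lam) * (NN x. ennreal ((p x)^2 * (norm (grad \<eta> x))^2) * ind S x)"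
proof -
 obtain F where F: "lipschitz_C1 M F (%t. f' (max t \<delta>))" "!!t. \<delta> <= t ==> F t = f t" "!!t. t <= \<delta> ==> 0 <= F t"
  using lipschitz_C1_extension[OF deriv cont bound nonneg(1)[OF order_refl] nonneg(2)] by blast
 have F_nonneg: "0 <= F t" for t using F(2,3)[of t] nonneg(1)[of t] by fastforce
 show ?thesis
 proof (rule caccioppoli[OF s u F(1) F_nonneg L2_lipschitz_C1_finite[OF sobolevD(1,2)[OF u] S sobolevD(4)[OF u] F(1)] \<eta>])
  show "AE x\<in>S in lborel. F (u x) <= p x * q x & (q x)^2 <= - f' (max (u x) \<delta>) & 0 <= p x & 0 <= q x"
   using lower pq by eventually_elim (auto simp: F(2) max_absorb1)
 qed measurable
qed

lemma log_energy:
 assumes s: "supersol S g" and u: "sobolev S UNIV u g" and S: "emeasure lborel S < \<infinity>" and \<eta>: "\<eta> : C1c S"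
  and \<delta>: "\<delta> > 0" and lower: "AE x\<in>S in lborel. \<delta> <= u x"
 shows "(NN x. ennreal ((\<eta> x)^2 * (norm ((- 1 / max (u x) \<delta>) *. g x))^2) * ind S x)
  <= ennreal (4 * L / lam) * (NN x. ennreal ((norm (grad \<eta> x))^2) * ind S x)"
proof -
 note [measurable] = sobolevD(1-3)[OF u]
 have "(NN x. ennreal ((\<eta> x)^2 * (1 / max (u x) \<delta>)^2 * (norm (g x))^2) * ind S x)
  <= ennreal (4 * L / lam) * (NN x. ennreal (1\<^sup>2 * (norm (grad \<eta> x))^2) * ind S x)"
 proof (rule caccioppoli_bounded_below[OF s u S \<eta> lower])
  show "((%t. 1 / t) has_real_derivative - 1 / t\<^sup>2) (at t)" if "\<delta> <= t" for t
   using that \<delta> by (auto intro!: derivative_eq_intros simp: power2_eq_square)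
  show "continuous_on {\<delta>..} (%t. - 1 / t\<^sup>2)" using \<delta> by (auto intro!: continuous_intros)
  show "\<bar>- 1 / t\<^sup>2\<bar> <= 1 / \<delta>\<^sup>2" if "\<delta> <= t" for t
   using that \<delta> by (auto simp: abs_divide intro!: divide_left_mono power_mono)
  show "AE x\<in>S in lborel. 1 / u x <= 1 * (1 / max (u x) \<delta>) & (1 / max (u x) \<delta>)^2 <= - (- 1 / (u x)^2) &
    (0::real) <= 1 & 0 <= 1 / max (u x) \<delta>"
   using lower by eventually_elim (use \<delta> in \<open>auto simp: max_absorb1 power_divide\<close>)
 qed (use \<delta> in auto)
 moreover have "(norm ((- 1 / max (u x) \<delta>) *. g x))^2 = (1 / max (u x) \<delta>)^2 * (norm (g x))^2" for x
  by (simp add: power_mult_distrib power_divide)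
 ultimately show ?thesis by (simp add: mult.assoc)
qed

end

lemma smooth_pos_log_quotient_deriv:
 assumes e: "e > 0" and k: "k > 0" and t: "t > 0"
 shows "((%t. smooth_pos e (- ln (t / k) - m) / t) has_real_derivative
  - ((smooth_pos' e (- ln (t / k) - m) + smooth_pos e (- ln (t / k) - m)) / t\<^sup>2)) (at t)"
proof -
 have "((%t. - ln (t / k) - m) has_real_derivative - 1 / t) (at t)" using t k by (auto intro!: derivative_eq_intros)
 note DERIV_divide[OF DERIV_chain2[OF smooth_pos_deriv[OF e] this] DERIV_ident]
 moreover have "(smooth_pos' e (- ln (t / k) - m) * (- 1 / t) * t - smooth_pos e (- ln (t / k) - m) * 1) / (t * t)
  = - ((smooth_pos' e (- ln (t / k) - m) + smooth_pos e (- ln (t / k) - m)) / t\<^sup>2)"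
  using t by (simp add: power2_eq_square diff_divide_distrib add_divide_distrib)
 ultimately show ?thesis using t by simp
qed

lemma smooth_pos_log_bound:
 assumes e: "e > 0" and k: "k > 0" and \<delta>: "\<delta> > 0" "\<delta> <= t"
 shows "\<bar>- ((smooth_pos' e (- ln (t / k) - m) + smooth_pos e (- ln (t / k) - m)) / t\<^sup>2)\<bar>
  <= (1 + max (- ln (\<delta> / k) - m) 0) / \<delta>\<^sup>2"
proof -
 let ?l = "%t. - ln (t / k) - m"
 have "ln (\<delta> / k) <= ln (t / k)" using \<delta> k by (simp add: divide_right_mono)
 then have "smooth_pos e (?l t) <= max (?l \<delta>) 0" using smooth_pos_bounds(2)[OF e, of "?l t"] by auto
 then have "smooth_pos' e (?l t) + smooth_pos e (?l t) <= 1 + max (?l \<delta>) 0"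
  using smooth_pos'_bounds(2)[OF e, of "?l t"] by linarith
 moreover have nonneg: "0 <= smooth_pos' e (?l t) + smooth_pos e (?l t)"
  using smooth_pos'_bounds(1)[OF e, of "?l t"] smooth_pos_bounds(1)[OF e, of "?l t"] by linarith
 moreover have "\<delta>\<^sup>2 <= t\<^sup>2" using \<delta> by (intro power_mono) auto
 ultimately have "(smooth_pos' e (?l t) + smooth_pos e (?l t)) / t\<^sup>2 <= (1 + max (?l \<delta>) 0) / \<delta>\<^sup>2"
  using \<delta> by (intro frac_le) auto
 then show ?thesis using nonneg by (simp add: abs_of_nonneg)
qed

context elliptic
begin

lemma smooth_pos_log_continuous:
 assumes e: "e > 0" and k: "k > 0" and \<delta>: "\<delta> > 0"
 shows "continuous_on {\<delta>..} (%t. - ((smooth_pos' e (- ln (t / k) - m) + smooth_pos e (- ln (t / k) - m)) / t\<^sup>2))"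
proof -
 have "continuous_on {\<delta>..} (%t. - ln (t / k) - m)" using \<delta> k by (intro continuous_intros) auto
 note continuous_on_compose2[OF smooth_pos'_continuous[OF e] this]
  continuous_on_compose2[OF DERIV_continuous_on[OF has_field_derivative_at_within[OF smooth_pos_deriv[OF e]]] this]
 then show ?thesis using \<delta> by (intro continuous_intros) auto
qed

lemma log_dg_class:
 assumes s: "supersol S g" and u: "sobolev S UNIV u g" and S: "emeasure lborel S < \<infinity>"
  and \<delta>: "\<delta> > 0" and k: "k > 0" and lower: "AE x\<in>S in lborel. \<delta> <= u x"
 shows "dg_class (4 * L / lam) S (%x. neg_log \<delta> k (u x)) (%x. (- 1 / max (u x) \<delta>) *. g x)" (is "dg_class _ S ?v ?gv")
proof (rule dg_classI[OF sobolevD(1-3)[OF sobolev_neg_log[OF u S \<delta> k lower]]])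
 fix e m :: real and \<eta> assume e: "e > 0" and m: "0 <= m" and \<eta>: "\<eta> : C1c S"
 note [measurable] = sobolevD(1-3)[OF u] neg_log_measurable smooth_pos'_measurable[OF e]
 let ?l = "%t. - ln (t / k) - m"
 define q where "q x = sqrt (smooth_pos' e (?v x - m)) / max (u x) \<delta>" for x
 have [measurable]: "q : Borel" unfolding q_def by measurable
 have "(NN x. ennreal ((\<eta> x)^2 * (q x)^2 * (norm (g x))^2) * ind S x)
  <= ennreal (4 * L / lam) * (NN x. ennreal ((max (?v x - m) 0)^2 * (norm (grad \<eta> x))^2) * ind S x)"
 proof (rule caccioppoli_bounded_below[OF s u S \<eta> lower _ smooth_pos_log_continuous[OF e k \<delta>] smooth_pos_log_bound[OF e k \<delta>]])
  show "((%t. smooth_pos e (?l t) / t) has_real_derivative - ((smooth_pos' e (?l t) + smooth_pos e (?l t)) / t\<^sup>2)) (at t)"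
   if "\<delta> <= t" for t by (rule smooth_pos_log_quotient_deriv[OF e k]) (use that \<delta> in simp)
  show "0 <= smooth_pos e (?l t) / t" if "\<delta> <= t" for t using smooth_pos_bounds(1)[OF e, of "?l t"] that \<delta> by simp
  show "- ((smooth_pos' e (?l \<delta>) + smooth_pos e (?l \<delta>)) / \<delta>\<^sup>2) <= 0"
   using smooth_pos_bounds(1)[OF e, of "?l \<delta>"] smooth_pos'_bounds(1)[OF e, of "?l \<delta>"] by simp
  show "AE x\<in>S in lborel. smooth_pos e (?l (u x)) / u x <= max (?v x - m) 0 * q x &
   (q x)^2 <= - (- ((smooth_pos' e (?l (u x)) + smooth_pos e (?l (u x))) / (u x)^2)) & 0 <= max (?v x - m) 0 & 0 <= q x"
   using lower
  proof (eventually_elim, intro impI conjI)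
   fix x assume "x : S --> \<delta> <= u x" "x : S"
   then have above: "max (u x) \<delta> = u x" "u x > 0" "?v x = - ln (u x / k)" using \<delta> by (auto simp: neg_log_def)
   show "smooth_pos e (?l (u x)) / u x <= max (?v x - m) 0 * q x"
    using above divide_right_mono[OF smooth_pos_le[OF e, of "?l (u x)"], of "u x"] by (simp add: q_def)
   show "(q x)^2 <= - (- ((smooth_pos' e (?l (u x)) + smooth_pos e (?l (u x))) / (u x)^2))"
    using smooth_pos'_bounds(1)[OF e] smooth_pos_bounds(1)[OF e]
    by (simp add: q_def above power_divide divide_right_mono)
  qed (use smooth_pos'_bounds(1)[OF e] \<delta> in \<open>auto simp: q_def\<close>)
 qed auto
 moreover have "(q x)^2 * (norm (g x))^2 = (norm (?gv x))^2 * smooth_pos' e (?v x - m)" for x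
  using smooth_pos'_bounds(1)[OF e] by (simp add: q_def power_mult_distrib power_divide)
 ultimately show "(NN x. ennreal ((\<eta> x)^2 * (norm (?gv x))^2 * smooth_pos' e (?v x - m)) * ind S x)
  <= ennreal (4 * L / lam) * (NN x. ennreal ((max (?v x - m) 0)^2 * (norm (grad \<eta> x))^2) * ind S x)"
  by (simp add: mult.assoc)
qed

end

definition growth_exponent :: "nat => real => real => real" where
 "growth_exponent n \<Lambda> \<theta> = sqrt (8 * 2 ^ n / \<theta> * (\<Lambda> * 36 * (unit_ball_vol (real n) * 2 ^ n)) * 2 ^ n / dg_const n \<Lambda>)"

definition growth_const :: "nat => real => real => real" where
 "growth_const n \<Lambda> \<theta> = exp (- growth_exponent n \<Lambda> \<theta>)"

lemma growth_exponent_pos: "0 < \<Lambda> ==> 0 < \<theta> ==> 0 < growth_exponent n \<Lambda> \<theta>"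
 using dg_const_pos[of \<Lambda> n] by (simp add: growth_exponent_def)

lemma growth_const_bounds:
 assumes "0 < \<Lambda>" "0 < \<theta>"
 shows "0 < growth_const n \<Lambda> \<theta>" "growth_const n \<Lambda> \<theta> <= 1"
 using growth_exponent_pos[OF assms, of n] by (simp_all add: growth_const_def)

lemma growth_exponent_level:
 assumes "0 < \<Lambda>" "0 < \<theta>" "0 < R"
 shows "8 * R\<^sup>2 * 2 ^ n / \<theta> * (\<Lambda> * ((6 / R)^2 * (unit_ball_vol (real n) * (2 * R) ^ n)))
  = dg_const n \<Lambda> * (R - R / 2) ^ n * (growth_exponent n \<Lambda> \<theta>)^2"
proof -
 define E where "E = 8 * 2 ^ n / \<theta> * (\<Lambda> * 36 * (unit_ball_vol (real n) * 2 ^ n))"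
 have "0 < dg_const n \<Lambda>" "0 <= E" using assms dg_const_pos by (auto simp: E_def)
 moreover have "(growth_exponent n \<Lambda> \<theta>)^2 = E * 2 ^ n / dg_const n \<Lambda>"
  unfolding growth_exponent_def E_def[symmetric] using calculation by (intro real_sqrt_pow2) auto
 moreover have "8 * R\<^sup>2 * 2 ^ n / \<theta> * (\<Lambda> * ((6 / R)^2 * (unit_ball_vol (real n) * (2 * R) ^ n))) = E * R ^ n"
  using assms unfolding E_def by (simp add: power_divide power_mult_distrib)
 moreover have "(R - R / 2) ^ n = R ^ n / 2 ^ n" by (simp add: power_divide[symmetric])
 ultimately show ?thesis by simp
qed

context elliptic
begin

lemma log_gradient_bound:
 fixes u :: "real^'n => real"
 assumes R: "R > 0" and s: "supersol (ball z (2 * R)) g" and u: "sobolev (ball z (2 * R)) UNIV u g"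
  and \<delta>: "\<delta> > 0" and lower: "AE x\<in>ball z (2 * R) in lborel. \<delta> <= u x"
 shows "L2 (ball z R) (%x. (- 1 / max (u x) \<delta>) *. g x)
  <= ennreal (4 * L / lam * ((6 / R)^2 * (unit_ball_vol (real CARD('n)) * (2 * R) ^ CARD('n))))" (is "L2 _ ?gv <= _")
proof -
 define S where "S = ball z (2 * R)"
 define \<Lambda> where "\<Lambda> = 4 * L / lam"
 have \<Lambda>: "0 < \<Lambda>" unfolding \<Lambda>_def by (rule caccioppoli_const_pos)
 obtain \<eta> where \<eta>: "cutoff z R (3 / 2 * R) \<eta>" using cutoff_exists[of R "3 / 2 * R" z] R by auto
 have \<eta>c: "\<eta> : C1c S" unfolding S_def by (rule cutoff_C1c[OF \<eta>]) (use R in simp)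
 have "L2 (ball z R) ?gv <= (NN x. ennreal ((\<eta> x)^2 * (norm (?gv x))^2) * ind S x)"
  unfolding L2_def using cutoffD(5)[OF \<eta>] R by (intro nn_integral_mono) (auto simp: indicator_def S_def)
 also have "\<dots> <= ennreal \<Lambda> * (NN x. ennreal ((norm (grad \<eta> x))^2) * ind S x)"
  using s u lower \<eta>c emeasure_lborel_ball_finite[of z "2 * R"] unfolding S_def \<Lambda>_def by (intro log_energy \<delta>) auto
 also have "(NN x. ennreal ((norm (grad \<eta> x))^2) * ind S x) <= ennreal ((6 / R)^2) * emeasure lborel S"
  using L2_bounded[of S "grad \<eta>" "6 / R"] cutoffD(4)[OF \<eta>] R unfolding L2_def by (auto simp: S_def)
 also have "emeasure lborel S = ennreal (unit_ball_vol (real CARD('n)) * (2 * R) ^ CARD('n))"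
  using emeasure_ball_eq[of "2 * R" z] R by (simp add: S_def)
 finally show ?thesis unfolding \<Lambda>_def[symmetric] using \<Lambda> R by (simp add: ennreal_mult mult_left_mono)
qed

lemma log_L2_bound:
 fixes u :: "real^'n => real"
 assumes R: "R > 0" and s: "supersol (ball z (2 * R)) g" and u: "sobolev (ball z (2 * R)) UNIV u g"
  and \<delta>: "\<delta> > 0" and lower: "AE x\<in>ball z (2 * R) in lborel. \<delta> <= u x"
  and k: "k > 0" and \<theta>: "\<theta> > 0" and meas: "ennreal \<theta> * emeasure lborel (ball z R) <= emeasure lborel {x : ball z R. k <= u x}"
 shows "L2 (ball z R) (%x. max (neg_log \<delta> k (u x)) 0)
  <= ennreal (dg_const CARD('n) (4 * L / lam) * (R - R / 2) ^ CARD('n) * (growth_exponent CARD('n) (4 * L / lam) \<theta>)^2)"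
proof -
 define n where "n = CARD('n)"
 define v where "v x = neg_log \<delta> k (u x)" for x
 define gv where "gv x = (- 1 / max (u x) \<delta>) *. g x" for x
 have sub: "ball z R <= ball z (2 * R)" using R by auto
 have u': "sobolev (ball z R) UNIV u g" by (rule sobolev_mono[OF u sub]) auto
 have lower': "AE x\<in>ball z R in lborel. \<delta> <= u x" using lower by eventually_elim (use sub in auto)
 have v: "sobolev (ball z R) UNIV v gv" unfolding v_def gv_def
  by (rule sobolev_neg_log[OF u' _ \<delta> k lower']) (use emeasure_lborel_ball_finite[of z R] in simp)
 note [measurable] = sobolevD(2)[OF u]
 have "L2 (ball z R) (%x. max (v x) 0) <= ennreal (8 * R\<^sup>2 * 2 ^ CARD('n) / \<theta>) * L2 (ball z R) (%x. if v x > 0 then gv x else 0)"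
 proof (rule poincare_vanishing[OF sobolev_pos[OF v UNIV_I] R _ _ _ meas \<theta>])
  show "max (v x) 0 = 0" if "x : {x : ball z R. k <= u x}" for x
  proof -
   have "1 <= max (u x) \<delta> / k" using k that by (simp add: le_max_iff_disj)
   then show ?thesis by (simp add: v_def neg_log_def)
  qed
 qed auto
 also have "\<dots> <= ennreal (8 * R\<^sup>2 * 2 ^ n / \<theta>) * L2 (ball z R) gv"
  unfolding n_def by (intro mult_left_mono L2_mono) auto
 also have "L2 (ball z R) gv <= ennreal (4 * L / lam * ((6 / R)^2 * (unit_ball_vol (real n) * (2 * R) ^ n)))"
  unfolding gv_def n_def by (rule log_gradient_bound[OF R s u \<delta> lower])
 also have "ennreal (8 * R\<^sup>2 * 2 ^ n / \<theta>) * \<dots>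
  = ennreal (8 * R\<^sup>2 * 2 ^ n / \<theta> * (4 * L / lam * ((6 / R)^2 * (unit_ball_vol (real n) * (2 * R) ^ n))))"
  using \<theta> R less_imp_le[OF caccioppoli_const_pos] by (intro ennreal_mult[symmetric] mult_nonneg_nonneg) auto
 also note growth_exponent_level[OF caccioppoli_const_pos \<theta> R]
 finally show ?thesis by (simp add: v_def n_def mult_left_mono)
qed

lemma growth_bounded_below:
 fixes u :: "real^'n => real"
 assumes R: "R > 0" and s: "supersol (ball z (2 * R)) g" and u: "sobolev (ball z (2 * R)) UNIV u g"
  and \<delta>: "\<delta> > 0" and lower: "AE x\<in>ball z (2 * R) in lborel. \<delta> <= u x"
  and k: "k > 0" and \<theta>: "\<theta> > 0" and meas: "ennreal \<theta> * emeasure lborel (ball z R) <= emeasure lborel {x : ball z R. k <= u x}"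
 shows "AE x\<in>ball z (R / 2) in lborel. growth_const CARD('n) (4 * L / lam) \<theta> * k <= u x"
proof -
 define K where "K = growth_exponent CARD('n) (4 * L / lam) \<theta>"
 have K: "K > 0" unfolding K_def by (rule growth_exponent_pos[OF caccioppoli_const_pos \<theta>])
 have sub: "ball z R <= ball z (2 * R)" using R by auto
 have u': "sobolev (ball z R) UNIV u g" by (rule sobolev_mono[OF u sub]) auto
 have lower': "AE x\<in>ball z R in lborel. \<delta> <= u x" using lower by eventually_elim (use sub in auto)
 have fin: "emeasure lborel (ball z R) < \<infinity>" using emeasure_lborel_ball_finite[of z R] by simp
 have "AE x\<in>ball z (R / 2) in lborel. neg_log \<delta> k (u x) <= K"
  by (rule dg_local_max[OF log_dg_class[OF supersol_mono[OF s sub] u' fin \<delta> k lower'] sobolev_neg_log[OF u' fin \<delta> k lower']])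
   (use log_L2_bound[OF assms] K R caccioppoli_const_pos in \<open>auto simp: K_def\<close>)
 with lower' show ?thesis
 proof (eventually_elim, intro impI)
  fix x assume x: "x : ball z (R / 2) --> neg_log \<delta> k (u x) <= K" "x : ball z R --> \<delta> <= u x" "x : ball z (R / 2)"
  then have u: "max (u x) \<delta> = u x" "u x > 0" using R \<delta> by auto
  have "- K <= ln (u x / k)" using x(1,3) by (simp add: neg_log_def u)
  then have "exp (- K) <= u x / k" using u k by (metis divide_pos_pos exp_le_cancel_iff exp_ln)
  then show "growth_const CARD('n) (4 * L / lam) \<theta> * k <= u x"
   using k by (simp add: field_simps growth_const_def K_def)
 qed
qed

lemma growth:
 fixes u :: "real^'n => real"
 assumes R: "R > 0" and s: "supersol (ball z (2 * R)) g" and u: "sobolev (ball z (2 * R)) UNIV u g"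
  and nonneg: "AE x\<in>ball z (2 * R) in lborel. 0 <= u x"
  and k: "k > 0" and \<theta>: "\<theta> > 0" and meas: "ennreal \<theta> * emeasure lborel (ball z R) <= emeasure lborel {x : ball z R. k <= u x}"
 shows "AE x\<in>ball z (R / 2) in lborel. growth_const CARD('n) (4 * L / lam) \<theta> * k <= u x"
proof -
 define c where "c = growth_const CARD('n) (4 * L / lam) \<theta>"
 note [measurable] = sobolevD(2)[OF u]
 have "AE x\<in>ball z (R / 2) in lborel. c * k <= u x + \<delta>" if \<delta>: "\<delta> > 0" for \<delta>
  unfolding c_def
 proof (rule growth_bounded_below[OF R s _ \<delta> _ k \<theta>])
  show "sobolev (ball z (2 * R)) UNIV (%x. u x + \<delta>) g"
   using sobolev_affine[OF u, of 1 \<delta>] emeasure_lborel_ball_finite[of z "2 * R"] by simp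
  show "AE x\<in>ball z (2 * R) in lborel. \<delta> <= u x + \<delta>" using nonneg by eventually_elim simp
  show "ennreal \<theta> * emeasure lborel (ball z R) <= emeasure lborel {x : ball z R. k <= u x + \<delta>}"
   using \<delta> by (intro order_trans[OF meas] emeasure_mono) auto
 qed
 then have "AEL x. ALL j::nat. x : ball z (R / 2) --> c * k <= u x + inverse (Suc j)"
  unfolding AE_all_countable by simp
 then show ?thesis
 proof (eventually_elim, intro impI)
  fix x assume shifted: "ALL j::nat. x : ball z (R / 2) --> c * k <= u x + inverse (Suc j)" and x: "x : ball z (R / 2)"
  have "(%j. u x + inverse (real (Suc j))) ---> u x + 0" by (intro tendsto_intros LIMSEQ_inverse_real_of_nat)
  then have "c * k <= u x + 0" by (rule LIMSEQ_le_const) (use shifted x in auto)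
  then show "growth_const CARD('n) (4 * L / lam) \<theta> * k <= u x" by (simp add: c_def)
 qed
qed

definition sol :: "(real^'n) set => (real^'n => real^'n) => bool" where
 "sol S g \<longleftrightarrow> (ALL \<phi>:C1c S. (LBINT x. ind S x * ((A x *v g x) \<bullet> grad \<phi> x)) = 0)"

lemma sol_mono:
 assumes "sol T g" "S <= T"
 shows "sol S g"
 unfolding sol_def
proof
 fix \<phi> assume \<phi>: "\<phi> : C1c S"
 show "(LBINT x. ind S x * ((A x *v g x) \<bullet> grad \<phi> x)) = 0"
  using assms(1) C1c_mono[OF \<phi> assms(2)] unfolding sol_def C1c_integral_superset[OF \<phi> assms(2), symmetric] by blast
qed

lemma sol_supersol: "sol S g ==> supersol S g" "sol S g ==> supersol S (%x. - g x)"
 by (auto simp: sol_def supersol_def A_minus)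

end

definition osc_factor :: "nat => real => real" where
 "osc_factor n \<Lambda> = 1 - growth_const n \<Lambda> (1 / 2) / 2"

definition osc_exponent :: "nat => real => real" where
 "osc_exponent n \<Lambda> = - log 4 (osc_factor n \<Lambda>)"

lemma osc_factor_bounds: "0 < \<Lambda> ==> 1 / 2 <= osc_factor n \<Lambda>" "0 < \<Lambda> ==> osc_factor n \<Lambda> < 1"
 using growth_const_bounds[of \<Lambda> "1 / 2" n] by (simp_all add: osc_factor_def)

lemma osc_exponent_bounds:
 assumes "0 < \<Lambda>"
 shows "0 < osc_exponent n \<Lambda>" "osc_exponent n \<Lambda> < 1"
proof -
 define \<gamma> where "\<gamma> = osc_factor n \<Lambda>"
 have \<gamma>: "1 / 2 <= \<gamma>" "\<gamma> < 1" unfolding \<gamma>_def by (rule osc_factor_bounds[OF assms])+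
 then have "log 4 \<gamma> < 0" by simp
 moreover have "log 4 (1 / 4) < log 4 \<gamma>" using \<gamma> by (subst log_less_cancel_iff) auto
 then have "- 1 < log 4 \<gamma>" by (simp add: log_divide)
 ultimately show "0 < osc_exponent n \<Lambda>" "osc_exponent n \<Lambda> < 1" by (auto simp: osc_exponent_def \<gamma>_def)
qed

lemma osc_factor_power:
 assumes "0 < \<Lambda>"
 shows "osc_factor n \<Lambda> ^ m = ((1 / 4) ^ m) powr osc_exponent n \<Lambda>"
proof -
 define \<gamma> where "\<gamma> = osc_factor n \<Lambda>"
 have \<gamma>: "0 < \<gamma>" using osc_factor_bounds(1)[OF assms, of n] by (simp add: \<gamma>_def)
 have "(1 / 4) powr osc_exponent n \<Lambda> = 4 powr (- osc_exponent n \<Lambda>)" by (simp add: powr_minus_divide powr_divide)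
 also have "\<dots> = \<gamma>" unfolding osc_exponent_def \<gamma>_def[symmetric] minus_minus using \<gamma> by (intro powr_log_cancel) auto
 finally have "\<gamma> ^ m = ((1 / 4) powr osc_exponent n \<Lambda>) powr (real m)" using \<gamma> by (simp add: powr_realpow)
 also have "\<dots> = ((1 / 4) powr (real m)) powr osc_exponent n \<Lambda>" by (simp only: powr_powr mult.commute)
 also have "(1 / 4::real) powr (real m) = (1 / 4) ^ m" by (rule powr_realpow) simp
 finally show ?thesis by (simp add: \<gamma>_def)
qed

lemma dyadic_radius_exists:
 assumes "0 < \<Lambda>" and r: "0 < r" "r <= R"
 obtains j where "r <= R / 4 ^ j" "osc_factor n \<Lambda> ^ j <= 2 * (r / R) powr osc_exponent n \<Lambda>"
proof -
 have "(%j. (1 / 4::real) ^ j) ---> 0" by (intro LIMSEQ_power_zero) auto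
 then have "\<forall>\<^sub>F j in sequentially. (1 / 4) ^ j < r / R" using r by (intro order_tendstoD) auto
 then have exists: "EX j. (1 / 4) ^ j < r / R" by (auto simp: eventually_sequentially)
 define m where "m = (LEAST j. (1 / 4) ^ j < r / R)"
 have m: "(1 / 4) ^ m < r / R" unfolding m_def by (rule LeastI_ex[OF exists])
 have "m ~= 0"
 proof
  assume "m = 0"
  then have "1 < r / R" using m by simp
  then show False using r by simp
 qed
 then obtain j where j: "m = Suc j" using not0_implies_Suc by blast
 have "\<not> (1 / 4) ^ j < r / R" using not_less_Least[of j "%j. (1 / 4) ^ j < r / R"] j by (auto simp: m_def)
 then have "r <= R / 4 ^ j" using r by (simp add: field_simps power_divide)
 moreover have "osc_factor n \<Lambda> ^ j <= 2 * osc_factor n \<Lambda> ^ m"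
  using osc_factor_bounds(1)[OF assms(1), of n] mult_right_mono[of 1 "2 * osc_factor n \<Lambda>" "osc_factor n \<Lambda> ^ j"] by (simp add: j)
 moreover have "osc_factor n \<Lambda> ^ m <= (r / R) powr osc_exponent n \<Lambda>"
  unfolding osc_factor_power[OF assms(1)] using m osc_exponent_bounds[OF assms(1), of n] by (intro powr_mono2) auto
 ultimately show ?thesis by (intro that) auto
qed

context elliptic
begin

lemma osc_step_half:
 fixes u :: "real^'n => real"
 assumes R: "R > 0" and s: "supersol (ball z R) g" and u: "sobolev (ball z R) UNIV u g" and k: "k > 0"
  and lower: "AE x\<in>ball z R in lborel. a <= u x"
  and half: "ennreal (1 / 2) * emeasure lborel (ball z (R / 2)) <= emeasure lborel {x : ball z (R / 2). k <= u x - a}"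
 shows "AE x\<in>ball z (R / 4) in lborel. a + growth_const CARD('n) (4 * L / lam) (1 / 2) * k <= u x"
proof -
 have "AE x\<in>ball z (R / 2 / 2) in lborel. growth_const CARD('n) (4 * L / lam) (1 / 2) * k <= u x - a"
 proof (rule growth[OF _ _ _ _ k _ half])
  show "supersol (ball z (2 * (R / 2))) g" using s by simp
  show "sobolev (ball z (2 * (R / 2))) UNIV (%x. u x - a) g"
   using sobolev_affine[OF u, of 1 "- a"] emeasure_lborel_ball_finite[of z R] by simp
  show "AE x\<in>ball z (2 * (R / 2)) in lborel. 0 <= u x - a" using lower by eventually_elim auto
 qed (use R in auto)
 then show ?thesis by eventually_elim auto
qed

lemma half_above_or_below:
 fixes u :: "real^'n => real"
 assumes [measurable]: "u : Borel" "B : sets borel"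
 shows "ennreal (1 / 2) * emeasure lborel B <= emeasure lborel {x : B. (b - a) / 2 <= u x - a} \<or>
  ennreal (1 / 2) * emeasure lborel B <= emeasure lborel {x : B. (b - a) / 2 <= - u x - - b}"
  (is "_ <= emeasure lborel ?P \<or> _ <= emeasure lborel ?N")
proof (rule ccontr)
 assume small: "\<not> ?thesis"
 have "emeasure lborel B <= emeasure lborel (?P \<union> ?N)" by (intro emeasure_mono) (auto simp: field_simps)
 also have "\<dots> <= emeasure lborel ?P + emeasure lborel ?N" by (intro emeasure_subadditive) auto
 also have "\<dots> < ennreal (1 / 2) * emeasure lborel B + ennreal (1 / 2) * emeasure lborel B"
  using small by (intro add_strict_mono) auto
 also have "\<dots> = (ennreal (1 / 2) + ennreal (1 / 2)) * emeasure lborel B" by (rule distrib_right[symmetric])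
 also have "ennreal (1 / 2) + ennreal (1 / 2) = 1" by (subst ennreal_plus[symmetric]) auto
 finally show False by simp
qed

lemma osc_step:
 fixes u :: "real^'n => real"
 assumes R: "R > 0" and s: "sol (ball z R) g" and u: "sobolev (ball z R) UNIV u g" and ab: "a <= b"
  and range: "AE x\<in>ball z R in lborel. a <= u x & u x <= b"
 obtains a' b' where "a' <= b'" "b' - a' <= osc_factor CARD('n) (4 * L / lam) * (b - a)"
  "AE x\<in>ball z (R / 4) in lborel. a' <= u x & u x <= b'"
proof (cases "a = b")
 case True
 have "AE x\<in>ball z (R / 4) in lborel. a <= u x & u x <= b" using range by eventually_elim (use R in auto)
 then show ?thesis using that[of a b] True by simp
next
 case False
 define k where "k = (b - a) / 2"
 define c where "c = growth_const CARD('n) (4 * L / lam) (1 / 2)"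
 have k: "k > 0" using ab False by (simp add: k_def)
 have "c * k <= k" using k growth_const_bounds[OF caccioppoli_const_pos, of "1 / 2" "CARD('n)"] by (simp add: c_def)
 moreover have "a + k <= b" using ab by (simp add: k_def field_simps)
 moreover have "osc_factor CARD('n) (4 * L / lam) * (b - a) = b - a - c * k"
  by (simp add: osc_factor_def c_def k_def left_diff_distrib)
 ultimately have shrunk: "a + c * k <= b" "b - (a + c * k) <= osc_factor CARD('n) (4 * L / lam) * (b - a)" by linarith+
 have lower: "AE x\<in>ball z R in lborel. a <= u x" and upper: "AE x\<in>ball z R in lborel. - b <= - u x"
  using range by (eventually_elim, simp)+
 note super = sol_supersol[OF s]
 from half_above_or_below[OF sobolevD(2)[OF u] borel_open[OF open_ball[of z "R / 2"]], of b a]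
 show ?thesis unfolding k_def[symmetric]
 proof
  assume "ennreal (1 / 2) * emeasure lborel (ball z (R / 2)) <= emeasure lborel {x : ball z (R / 2). k <= u x - a}"
  from osc_step_half[OF R super(1) u k lower this] have "AE x\<in>ball z (R / 4) in lborel. a + c * k <= u x"
   by (simp only: c_def)
  with range have "AE x\<in>ball z (R / 4) in lborel. a + c * k <= u x & u x <= b" by eventually_elim (use R in auto)
  then show ?thesis using that[of "a + c * k" b] shrunk by simp
 next
  assume "ennreal (1 / 2) * emeasure lborel (ball z (R / 2)) <= emeasure lborel {x : ball z (R / 2). k <= - u x - - b}"
  from osc_step_half[OF R super(2) sobolev_minus[OF u] k upper this] have "AE x\<in>ball z (R / 4) in lborel. - b + c * k <= - u x"
   by (simp only: c_def)
  with range have "AE x\<in>ball z (R / 4) in lborel. a <= u x & u x <= b - c * k" by eventually_elim (use R in auto)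
  then show ?thesis using that[of a "b - c * k"] shrunk by simp
 qed
qed

lemma osc_iterate:
 fixes u :: "real^'n => real"
 assumes R: "R > 0" and s: "sol (ball z R) g" and u: "sobolev (ball z R) UNIV u g" and ab: "a <= b"
  and range: "AE x\<in>ball z R in lborel. a <= u x & u x <= b"
 shows "EX a' b'. a' <= b' & b' - a' <= osc_factor CARD('n) (4 * L / lam) ^ j * (b - a) &
  (AE x\<in>ball z (R / 4 ^ j) in lborel. a' <= u x & u x <= b')"
proof (induction j)
 case 0
 then show ?case using ab range by auto
next
 case (Suc j)
 let ?\<gamma> = "osc_factor CARD('n) (4 * L / lam)"
 obtain a1 b1 where prev: "a1 <= b1" "b1 - a1 <= ?\<gamma> ^ j * (b - a)" "AE x\<in>ball z (R / 4 ^ j) in lborel. a1 <= u x & u x <= b1"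
  using Suc by (elim exE conjE)
 have R': "0 < R / 4 ^ j" "R / 4 ^ j <= R" using R by (simp_all add: divide_le_eq)
 then have sub: "ball z (R / 4 ^ j) <= ball z R" by (intro subset_ball)
 have u': "sobolev (ball z (R / 4 ^ j)) UNIV u g" by (rule sobolev_mono[OF u sub]) auto
 obtain a' b' where next_range: "a' <= b'" "b' - a' <= ?\<gamma> * (b1 - a1)" "AE x\<in>ball z (R / 4 ^ j / 4) in lborel. a' <= u x & u x <= b'"
  by (rule osc_step[OF R'(1) sol_mono[OF s sub] u' prev(1,3)])
 have "?\<gamma> * (b1 - a1) <= ?\<gamma> * (?\<gamma> ^ j * (b - a))"
  using osc_factor_bounds(1)[OF caccioppoli_const_pos, of "CARD('n)"] prev(2) by (intro mult_left_mono) auto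
 then have width: "b' - a' <= ?\<gamma> ^ Suc j * (b - a)" using next_range(2) by (simp only: power_Suc mult.assoc)
 have radius: "R / 4 ^ Suc j = R / 4 ^ j / 4" by simp
 show ?case unfolding radius using next_range(1,3) width by blast
qed

lemma osc_decay:
 fixes u :: "real^'n => real"
 assumes r: "0 < r" "r <= R" and s: "sol (ball z R) g" and u: "sobolev (ball z R) UNIV u g" and ab: "a <= b"
  and range: "AE x\<in>ball z R in lborel. a <= u x & u x <= b"
 obtains a' b' where "a' <= b'" "b' - a' <= 2 * (r / R) powr osc_exponent CARD('n) (4 * L / lam) * (b - a)"
  "AE x\<in>ball z r in lborel. a' <= u x & u x <= b'"
proof -
 obtain j where j: "r <= R / 4 ^ j"
  "osc_factor CARD('n) (4 * L / lam) ^ j <= 2 * (r / R) powr osc_exponent CARD('n) (4 * L / lam)"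
  using dyadic_radius_exists[OF caccioppoli_const_pos r] by blast
 obtain a' b' where iterated: "a' <= b'" "b' - a' <= osc_factor CARD('n) (4 * L / lam) ^ j * (b - a)"
  "AE x\<in>ball z (R / 4 ^ j) in lborel. a' <= u x & u x <= b'"
  using osc_iterate[OF _ s u ab range, of j] r by auto
 have "b' - a' <= 2 * (r / R) powr osc_exponent CARD('n) (4 * L / lam) * (b - a)"
  using iterated(2) mult_right_mono[OF j(2), of "b - a"] ab by simp
 moreover have "AE x\<in>ball z r in lborel. a' <= u x & u x <= b'" using iterated(3) by eventually_elim (use j(1) in auto)
 ultimately show ?thesis by (rule that[OF iterated(1)])
qed

end

subsection \<open>Removing a point\<close>

text \<open>Points have zero capacity for \<open>n \<ge> 3\<close>: the energy of the cut-off at scale \<open>\<epsilon>\<close> is of order \<open>\<epsilon>\<^bsup>n-2\<^esup>\<close>.\<close>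

lemma cutoff_energy:
 fixes \<eta> :: "real^'n => real"
 assumes n3: "CARD('n) \<ge> 3" and e: "0 < e" "e <= 1" and \<eta>: "cutoff 0 e (2 * e) \<eta>"
 shows "L2 UNIV (grad \<eta>) <= ennreal (9 * unit_ball_vol (real CARD('n)) * 2 ^ CARD('n) * e)"
proof -
 define V where "V = unit_ball_vol (real CARD('n))"
 have V: "V > 0" by (simp add: V_def)
 have "L2 UNIV (grad \<eta>) <= L2 (ball 0 (2 * e)) (grad \<eta>)"
  unfolding L2_def using cutoffD(8)[OF \<eta>] by (intro nn_integral_mono) (auto simp: indicator_def)
 also have "\<dots> <= ennreal ((3 / e)^2) * emeasure lborel (ball (0::real^'n) (2 * e))"
  by (rule L2_bounded) (use cutoffD(4)[OF \<eta>] e in auto)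
 also have "\<dots> = ennreal ((3 / e)^2 * (V * (2 * e) ^ CARD('n)))"
  using e V emeasure_ball_eq[of "2 * e" "0::real^'n"] by (simp add: V_def ennreal_mult)
 also have "\<dots> <= ennreal (9 * V * 2 ^ CARD('n) * e)"
 proof (rule ennreal_leI)
  obtain m where m: "CARD('n) = m + 3" using n3 by (metis add.commute le_Suc_ex)
  have "(3 / e)^2 * (V * (2 * e) ^ CARD('n)) = 9 * V * 2 ^ CARD('n) * (e * e ^ m)"
   using e by (simp add: m power_add power_mult_distrib power_divide power2_eq_square power3_eq_cube)
  also have "\<dots> <= 9 * V * 2 ^ CARD('n) * (e * 1)"
   using e V by (intro mult_left_mono power_le_one) auto
  finally show "(3 / e)^2 * (V * (2 * e) ^ CARD('n)) <= 9 * V * 2 ^ CARD('n) * e" by simp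
 qed
 finally show ?thesis by (simp add: V_def)
qed

definition puncture_seq :: "(nat => real^'n => real) => bool" where
 "puncture_seq \<psi> \<longleftrightarrow> (ALL j. C1 (\<psi> j) & (EX B. ALL x. norm (grad (\<psi> j) x) <= B)) & (ALL j x. 0 <= \<psi> j x & \<psi> j x <= 1) &
  (ALL j. ALL x:cball 0 (1 / Suc j). \<psi> j x = 0 & grad (\<psi> j) x = 0) &
  (ALL x. x ~= 0 --> (%j. \<psi> j x) ---> 1) & (%j. L2 UNIV (grad (\<psi> j))) ---> 0"

lemma puncture_seqD:
 assumes "puncture_seq \<psi>"
 shows "C1 (\<psi> j)" "EX B. ALL x. norm (grad (\<psi> j) x) <= B" "0 <= \<psi> j x" "\<psi> j x <= 1"
  "x : cball 0 (1 / Suc j) ==> \<psi> j x = 0" "x : cball 0 (1 / Suc j) ==> grad (\<psi> j) x = 0"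
  "x ~= 0 ==> (%j. \<psi> j x) ---> 1" "(%j. L2 UNIV (grad (\<psi> j))) ---> 0"
 using assms unfolding puncture_seq_def by blast+

lemma puncture_seq_exists:
 assumes n3: "CARD('n) \<ge> 3"
 obtains \<psi> :: "nat => real^'n => real" where "puncture_seq \<psi>"
proof -
 define e where "e j = inverse (real (Suc j))" for j
 have e: "0 < e j" "e j <= 1" "1 / Suc j = e j" for j by (auto simp: e_def inverse_eq_divide)
 have "EX \<eta>::real^'n => real. cutoff 0 (e j) (2 * e j) \<eta>" for j using cutoff_exists[of "e j" "2 * e j"] e(1)[of j] by auto
 then obtain \<eta> :: "nat => real^'n => real" where \<eta>: "!!j. cutoff 0 (e j) (2 * e j) (\<eta> j)" by metis
 define \<psi> where "\<psi> j = (%x. (-1) * \<eta> j x + 1)" for j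
 have C1: "C1 (\<psi> j)" and grad: "grad (\<psi> j) = (%x. (-1) *. grad (\<eta> j) x)" for j
  unfolding \<psi>_def by (rule lipschitz_C1_compose[OF lipschitz_C1_affine cutoffD(1)[OF \<eta>]] lipschitz_C1_grad[OF lipschitz_C1_affine cutoffD(1)[OF \<eta>]])+
 have lim: "(%j. \<psi> j x) ---> 1" if "x ~= 0" for x
 proof -
  have "(%j. 2 * e j) ---> 2 * 0" unfolding e_def by (intro tendsto_intros LIMSEQ_inverse_real_of_nat)
  then have "\<forall>\<^sub>F j in sequentially. 2 * e j < norm x" using order_tendstoD(2)[of _ "2 * 0" sequentially "norm x"] that by simp
  then have "\<forall>\<^sub>F j in sequentially. \<psi> j x = 1" by eventually_elim (simp add: \<psi>_def cutoffD(7)[OF \<eta>])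
  then show ?thesis by (rule tendsto_eventually)
 qed
 define V where "V = 9 * unit_ball_vol (real CARD('n)) * 2 ^ CARD('n)"
 have "(%j. V * e j) ---> V * 0" unfolding e_def by (intro tendsto_intros LIMSEQ_inverse_real_of_nat)
 from tendsto_ennrealI[OF this] have "(%j. ennreal (V * e j)) ---> 0" by simp
 then have energy: "(%j. L2 UNIV (grad (\<psi> j))) ---> 0"
 proof (rule ennreal_tendsto_0_le)
  show "L2 UNIV (grad (\<psi> j)) <= ennreal (V * e j)" for j
   using cutoff_energy[OF n3 e(1,2) \<eta>, of j] by (simp add: grad V_def L2_def)
 qed
 have "EX B. ALL x. norm (grad (\<psi> j) x) <= B" for j
  using cutoffD(4)[OF \<eta>[of j]] by (intro exI[of _ "3 / (2 * e j - e j)"]) (simp add: grad)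
 moreover have "0 <= \<psi> j x & \<psi> j x <= 1" for j x using cutoffD(2,3)[OF \<eta>, of j x] by (simp add: \<psi>_def)
 moreover have "\<psi> j x = 0 & grad (\<psi> j) x = 0" if "x : cball 0 (e j)" for j x
  unfolding grad using cutoffD(5,6)[OF \<eta> that] by (simp add: \<psi>_def)
 ultimately have "puncture_seq \<psi>"
  unfolding puncture_seq_def e(3) using C1 lim energy by blast
 then show ?thesis by (rule that)
qed

lemma puncture_tendsto:
 fixes f :: "real^'n => 'b::euclidean_space"
 assumes \<psi>: "puncture_seq \<psi>" and [measurable]: "S : sets borel" "f : Borel" and fin: "L2 S f < \<infinity>"
 shows "(%j. L2 S (%x. \<psi> j x *. f x - f x)) ---> 0"
proof (rule L2_dominated[OF _ _ _ _ fin])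
 note [measurable] = C1_measurable[OF puncture_seqD(1)[OF \<psi>]]
 show "(%x. \<psi> j x *. f x - f x) : Borel" for j by measurable
 have shrink: "\<psi> j x *. f x - f x = (\<psi> j x - 1) *. f x" for j x by (simp add: scaleR_left_diff_distrib)
 show "norm (\<psi> j x *. f x - f x) <= norm (f x)" for j x
 proof -
  have "\<bar>\<psi> j x - 1\<bar> <= 1" using puncture_seqD(3,4)[OF \<psi>, of j x] by auto
  then show ?thesis unfolding shrink using mult_right_mono[of "\<bar>\<psi> j x - 1\<bar>" 1 "norm (f x)"] by simp
 qed
 show "AE x\<in>S in lborel. (%j. \<psi> j x *. f x - f x) ---> 0"
  using AE_lborel_singleton[of "0::real^'n"]
 proof (eventually_elim, intro impI)
  fix x :: "real^'n" assume "x ~= 0"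
  then have "(%j. \<psi> j x *. f x - f x) ---> 1 *. f x - f x" by (intro tendsto_intros puncture_seqD(7)[OF \<psi>])
  then show "(%j. \<psi> j x *. f x - f x) ---> 0" by simp
 qed
qed auto

lemma puncture_grad_tendsto:
 assumes \<psi>: "puncture_seq \<psi>" and [measurable]: "S : sets borel" "u : Borel" "g : Borel"
  and bound: "!!x. \<bar>u x\<bar> <= B" and fin: "L2 S g < \<infinity>"
 shows "(%j. L2 S (%x. (\<psi> j x *. g x + u x *. grad (\<psi> j) x) - g x)) ---> 0"
proof (rule ennreal_tendsto_0_le[OF ennreal_tendsto_0_lincomb[OF puncture_tendsto[OF \<psi> _ _ fin] puncture_seqD(8)[OF \<psi>], of 2 "2 * ennreal (B\<^sup>2)"]])
 note [measurable] = C1_measurable[OF puncture_seqD(1)[OF \<psi>]] grad_measurable[OF puncture_seqD(1)[OF \<psi>]]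
 fix j
 have "0 <= B" using bound[of 0] by simp
 have "L2 S (%x. (\<psi> j x *. g x + u x *. grad (\<psi> j) x) - g x) = L2 S (%x. (\<psi> j x *. g x - g x) + u x *. grad (\<psi> j) x)"
  by (simp add: algebra_simps)
 also have "\<dots> <= 2 * L2 S (%x. \<psi> j x *. g x - g x) + 2 * L2 S (%x. u x *. grad (\<psi> j) x)"
  by (rule L2_add) measurable
 also have "L2 S (%x. u x *. grad (\<psi> j) x) <= ennreal (B\<^sup>2) * L2 UNIV (grad (\<psi> j))"
  by (rule L2_bound_mult_on) (use bound \<open>0 <= B\<close> in \<open>auto intro!: mult_right_mono\<close>)
 finally show "L2 S (%x. (\<psi> j x *. g x + u x *. grad (\<psi> j) x) - g x)
  <= 2 * L2 S (%x. \<psi> j x *. g x - g x) + 2 * ennreal (B\<^sup>2) * L2 UNIV (grad (\<psi> j))"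
  by (simp add: mult.assoc mult_left_mono)
qed (auto simp: ennreal_mult_less_top)

lemma puncture_mult_energy:
 assumes \<psi>: "puncture_seq \<psi>" and \<zeta>: "C1 \<zeta>" "!!x. 0 <= \<zeta> x" "!!x. \<zeta> x <= 1"
 shows "L2 UNIV (grad (%x. \<psi> j x * \<zeta> x)) <= 2 * L2 UNIV (grad \<zeta>) + 2 * L2 UNIV (grad (\<psi> j))"
proof -
 note C1 = puncture_seqD(1)[OF \<psi>]
 note [measurable] = C1_measurable[OF C1] grad_measurable[OF C1] C1_measurable[OF \<zeta>(1)] grad_measurable[OF \<zeta>(1)]
 have "L2 UNIV (grad (%x. \<psi> j x * \<zeta> x)) <= 2 * L2 UNIV (%x. \<psi> j x *. grad \<zeta> x) + 2 * L2 UNIV (%x. \<zeta> x *. grad (\<psi> j) x)"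
  unfolding grad_mult[OF C1 \<zeta>(1)] by (rule L2_add) measurable
 also have "\<dots> <= 2 * L2 UNIV (grad \<zeta>) + 2 * L2 UNIV (grad (\<psi> j))"
  using puncture_seqD(3,4)[OF \<psi>] \<zeta>(2,3) by (intro add_mono mult_left_mono L2_mono) (auto simp: mult_left_le_one_le)
 finally show ?thesis .
qed

definition ann :: "real => real => (real^'n) set" where
 "ann a b = {x. a < norm x & norm x < b}"

lemma ann_measurable [measurable, simp]: "ann a b : sets borel"
 unfolding ann_def by measurable

lemma ann_finite: "emeasure lborel (ann a b :: (real^'n) set) < \<infinity>"
proof -
 have "emeasure lborel (ann a b :: (real^'n) set) <= emeasure lborel (ball (0::real^'n) b)"
  by (intro emeasure_mono) (auto simp: ann_def)
 then show ?thesis using emeasure_lborel_ball_finite[of "0::real^'n" b] by (auto intro: le_less_trans)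
qed

lemma puncture_C1c:
 assumes \<phi>: "\<phi> : C1c (ball 0 R)" and \<psi>: "puncture_seq \<psi>"
 shows "(%x. \<psi> j x * \<phi> x) : C1c (ann (1 / Suc j / 2) R)"
proof -
 obtain K where K: "compact K" "K <= ball 0 R" "supported_in \<phi> K" using \<phi> by (rule C1cE)
 define e where "e = 1 / real (Suc j)"
 have e: "0 < e" by (simp add: e_def)
 have "(%x. \<psi> j x * \<phi> x) : C1c (ann (e / 2) R)"
 proof (rule C1cI)
  show "C1 (%x. \<psi> j x * \<phi> x)" by (rule C1_mult[OF puncture_seqD(1)[OF \<psi>] C1c_C1[OF \<phi>]])
  show "compact (K - ball 0 e)" using K(1) by (rule compact_diff) simp
  show "K - ball 0 e <= ann (e / 2) R" using K(2) e by (auto simp: ann_def subset_eq)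
  show "supported_in (%x. \<psi> j x * \<phi> x) (K - ball 0 e)"
   using K(3) puncture_seqD(5)[OF \<psi>, of _ j] by (auto simp: supported_in_def e_def)
 qed
 then show ?thesis by (simp add: e_def)
qed

lemma sobolev_punctured:
 fixes u :: "real^'n => real"
 assumes n3: "CARD('n) \<ge> 3" and u: "!!a. 0 < a ==> sobolev (ann a R) X u g"
  and bound: "!!x. \<bar>u x\<bar> <= B" and fin: "L2 (ball 0 R) g < \<infinity>"
  and X: "!!w \<eta>. w : X ==> C1 w ==> C1 \<eta> ==> (!!x. 0 <= \<eta> x & \<eta> x <= 1) ==> (%x. \<eta> x * w x) : X"
 shows "sobolev (ball 0 R) X u g"
proof -
 obtain \<psi> :: "nat => real^'n => real" where \<psi>: "puncture_seq \<psi>" using puncture_seq_exists[OF n3] by blast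
 note meas [measurable] = sobolevD(2,3)[OF u[of 1]]
 show ?thesis
 proof (rule sobolev_limit)
  fix j
  obtain M where M: "!!x. norm (grad (\<psi> j) x) <= M" using puncture_seqD(2)[OF \<psi>] by blast
  show "sobolev (ball 0 R) X (%x. \<psi> j x * u x) (%x. \<psi> j x *. g x + u x *. grad (\<psi> j) x)"
  proof (rule sobolev_mult_C1[OF u[of "1 / Suc j"] puncture_seqD(1)[OF \<psi>]])
   show "\<bar>\<psi> j x\<bar> <= max M 1" for x using puncture_seqD(3,4)[OF \<psi>, of j x] by auto
   show "norm (grad (\<psi> j) x) <= max M 1" for x using M[of x] by auto
   show "\<psi> j x = 0 & grad (\<psi> j) x = 0" if "x : ball 0 R" "x ~: ann (1 / Suc j) R" for x
    using that puncture_seqD(5,6)[OF \<psi>, of x j] by (auto simp: ann_def)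
   show "(%x. \<psi> j x * w x) : X" if "w : X" "C1 w" for w
    using X[OF that puncture_seqD(1)[OF \<psi>]] puncture_seqD(3,4)[OF \<psi>] by blast
  qed auto
 next
  have "L2 (ball 0 R) u < \<infinity>"
   by (rule L2_bounded_finite[of _ _ B]) (use bound order_trans[OF abs_ge_zero bound] emeasure_lborel_ball_finite[of "0::real^'n" R] in auto)
  from puncture_tendsto[OF \<psi> _ meas(1) this]
  show "(%j. L2 (ball 0 R) (%x. \<psi> j x * u x - u x)) ---> 0" by simp
  show "(%j. L2 (ball 0 R) (%x. \<psi> j x *. g x + u x *. grad (\<psi> j) x - g x)) ---> 0"
   by (rule puncture_grad_tendsto[OF \<psi> _ _ _ bound fin]) auto
 qed auto
qed

lemma (in elliptic) supersol_punctured: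
 fixes g :: "real^'n => real^'n"
 assumes n3: "CARD('n) \<ge> 3" and s: "!!a. 0 < a ==> supersol (ann a R) g"
  and g [measurable]: "g : Borel" and fin: "L2 (ball 0 R) g < \<infinity>"
 shows "supersol (ball 0 R) g"
 unfolding supersol_def
proof (intro ballI impI)
 fix \<phi> :: "real^'n => real" assume \<phi>: "\<phi> : C1c (ball 0 R)" "ALL x. 0 <= \<phi> x"
 obtain \<psi> :: "nat => real^'n => real" where \<psi>: "puncture_seq \<psi>" using puncture_seq_exists[OF n3] by blast
 obtain B where B: "B > 0" "!!x. \<bar>\<phi> x\<bar> <= B" "!!x. norm (grad \<phi> x) <= B" using C1c_bounded[OF \<phi>(1)] by blast
 define \<eta> where "\<eta> j = (%x. \<psi> j x * \<phi> x)" for j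
 have \<eta>: "\<eta> j : C1c (ann (1 / Suc j / 2) R)" for j unfolding \<eta>_def by (rule puncture_C1c[OF \<phi>(1) \<psi>])
 have sub: "ann a R <= ball (0::real^'n) R" for a by (auto simp: ann_def)
 note \<eta>_ball = C1c_mono[OF \<eta> sub]
 note [measurable] = C1_measurable[OF C1c_C1[OF \<phi>(1)]] grad_measurable[OF C1c_C1[OF \<phi>(1)]] grad_measurable[OF C1c_C1[OF \<eta>]]
 have "0 <= (LBINT x. ind (ball 0 R) x * ((A x *v g x) \<bullet> grad (\<eta> j) x))" for j
  using s[of "1 / Suc j / 2"] \<eta>[of j] \<phi>(2) puncture_seqD(3)[OF \<psi>]
  unfolding C1c_integral_superset[OF \<eta>[of j] sub] supersol_def by (simp add: \<eta>_def)
 moreover have "(%j. LBINT x. ind (ball 0 R) x * ((A x *v g x) \<bullet> grad (\<eta> j) x))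
   ---> (LBINT x. ind (ball 0 R) x * ((A x *v g x) \<bullet> grad \<phi> x))"
 proof (rule L2_inner_tendsto)
  show "L2 (ball 0 R) (%x. A x *v g x) < \<infinity>" using fin by (intro L2_A_finite) auto
  show "(%j. L2 (ball 0 R) (%x. grad (\<eta> j) x - grad \<phi> x)) ---> 0"
   unfolding \<eta>_def grad_mult[OF puncture_seqD(1)[OF \<psi>] C1c_C1[OF \<phi>(1)]]
   by (rule puncture_grad_tendsto[OF \<psi> _ _ _ B(2) C1c_L2_finite[OF \<phi>(1)]]) auto
 qed (use C1c_L2_finite[OF \<phi>(1)] C1c_L2_finite[OF \<eta>_ball] in auto)
 ultimately show "0 <= (LBINT x. ind (ball 0 R) x * ((A x *v g x) \<bullet> grad \<phi> x))"
  by (intro LIMSEQ_le_const) auto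
qed

subsection \<open>Truncation\<close>

lemma sobolev_truncation:
 assumes u: "sobolev S UNIV u g" and S: "emeasure lborel S < \<infinity>" and k: "k > 0" and pos: "AE x\<in>S in lborel. 0 < u x"
 shows "sobolev S {w. ALL x. 0 <= w x & w x <= k} (%x. min (u x) k) (%x. if u x < k then g x else 0)"
proof -
 note [measurable] = sobolevD(1-3)[OF u]
 let ?v = "%x. max ((-1) * u x + k) 0" and ?h = "%x. if (-1) * u x + k > 0 then (-1) *. g x else 0"
 have defect: "sobolev S {w. ALL x. 0 <= w x} ?v ?h"
  by (rule sobolev_pos[OF sobolev_affine[OF u S]]) (use smooth_pos_bounds(1) in auto)
 have "sobolev S {w. ALL x. w x <= k} (%x. (-1) * ?v x + k) (%x. (-1) *. ?h x)"
  by (rule sobolev_chain[OF defect lipschitz_C1_affine])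
   (use L2_lipschitz_C1_finite[OF sobolevD(1,2)[OF defect] S sobolevD(4)[OF defect] lipschitz_C1_affine[of "-1" k]] in auto)
 then have "sobolev S {w. ALL x. 0 <= w x & w x <= k} (%x. max ((-1) * ?v x + k) 0) (%x. if (-1) * ?v x + k > 0 then (-1) *. ?h x else 0)"
 proof (rule sobolev_pos)
  fix w :: "real^'n => real" and e :: real assume w: "w : {w. ALL x. w x <= k}" and e: "e > 0"
  have "smooth_pos e (w x) <= k" for x using smooth_pos_bounds(2)[OF e, of "w x"] w k by (auto intro: order_trans)
  then show "(%x. smooth_pos e (w x)) : {w. ALL x. 0 <= w x & w x <= k}" using smooth_pos_bounds(1)[OF e] by simp
 qed
 then show ?thesis
 proof (rule sobolev_cong)
  show "AE x\<in>S in lborel. min (u x) k = max ((-1) * ?v x + k) 0"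
   using pos by eventually_elim (use k in \<open>auto simp: min_def max_def\<close>)
  show "AE x\<in>S in lborel. (if u x < k then g x else 0) = (if (-1) * ?v x + k > 0 then (-1) *. ?h x else 0)"
   using pos by eventually_elim (use k in \<open>auto simp: max_def\<close>)
 qed measurable
qed

lemma sobolev_extend_by_zero:
 assumes u: "sobolev S X u g" and \<theta>: "cutoff z r1 r2 \<theta>" "r1 < r2" "ball z r2 <= S" and T: "T : sets borel"
  and zero: "AE x\<in>T in lborel. x ~: cball z r1 --> u x = 0 & g x = 0"
  and Y: "!!w. w : X ==> C1 w ==> (%x. \<theta> x * w x) : Y"
 shows "sobolev T Y u g"
proof -
 have "sobolev T Y (%x. \<theta> x * u x) (%x. \<theta> x *. g x + u x *. grad \<theta> x)"
 proof (rule sobolev_mult_C1[OF u cutoffD(1)[OF \<theta>(1)] T])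
  show "\<bar>\<theta> x\<bar> <= max 1 (3 / (r2 - r1))" for x using cutoffD(2,3)[OF \<theta>(1), of x] by auto
  show "norm (grad \<theta> x) <= max 1 (3 / (r2 - r1))" for x using cutoffD(4)[OF \<theta>(1), of x] by auto
  show "\<theta> x = 0 & grad \<theta> x = 0" if "x ~: S" for x using that \<theta>(3) cutoffD(7,8)[OF \<theta>(1), of x] by blast
 qed (rule Y)
 then show ?thesis
 proof (rule sobolev_cong[OF _ sobolevD(2,3)[OF u]])
  show "AE x\<in>T in lborel. u x = \<theta> x * u x"
   using zero by eventually_elim (use cutoffD(5)[OF \<theta>(1)] in fastforce)
  show "AE x\<in>T in lborel. g x = \<theta> x *. g x + u x *. grad \<theta> x"
   using zero by eventually_elim (use cutoffD(5,6)[OF \<theta>(1)] in fastforce)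
 qed
qed

definition rational_step :: "real => real" where
 "rational_step y = (if y <= 0 then 0 else y\<^sup>2 / (1 + y\<^sup>2))"

definition rational_step' :: "real => real" where
 "rational_step' y = (if y <= 0 then 0 else 2 * y / (1 + y\<^sup>2)^2)"

lemma rational_step_deriv: "(rational_step has_real_derivative rational_step' y) (at y)"
proof -
 have "((%y. if y <= 0 then 0 else y\<^sup>2 / (1 + y\<^sup>2)) has_real_derivative (if y <= 0 then 0 else 2 * y / (1 + y\<^sup>2)^2)) (at y)"
 proof (rule DERIV_join)
  fix t :: real
  have p: "1 + t\<^sup>2 > 0" by (simp add: add_pos_nonneg)
  then have "((%y. y\<^sup>2 / (1 + y\<^sup>2)) has_real_derivative (2 * t * (1 + t\<^sup>2) - t\<^sup>2 * (2 * t)) / (1 + t\<^sup>2)^2) (at t)"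
   by (auto intro!: derivative_eq_intros simp: power2_eq_square)
  moreover have "2 * t * (1 + t\<^sup>2) - t\<^sup>2 * (2 * t) = 2 * t" by (simp add: algebra_simps)
  ultimately show "((%y. y\<^sup>2 / (1 + y\<^sup>2)) has_real_derivative 2 * t / (1 + t\<^sup>2)^2) (at t)" by simp
 qed auto
 then show ?thesis by (simp add: rational_step_def[abs_def] rational_step'_def)
qed

lemma rational_step'_continuous: "continuous_on UNIV rational_step'"
 unfolding rational_step'_def[abs_def]
 by (rule continuous_join) (auto intro!: continuous_intros simp: add_nonneg_eq_0_iff)

lemma rational_step'_bounds: "0 <= rational_step' y" "rational_step' y <= 1"
proof -
 have "2 * y <= 1 + y\<^sup>2" using zero_le_power2[of "1 - y"] by (simp add: power2_diff)
 also have "\<dots> <= (1 + y\<^sup>2)^2" by (rule self_le_power) auto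
 finally have "2 * y <= (1 + y\<^sup>2)^2" .
 then show "0 <= rational_step' y" "rational_step' y <= 1"
  by (auto simp: rational_step'_def divide_le_eq_1 add_pos_nonneg zero_less_power2)
qed

lemma rational_step_bounds: "0 <= rational_step y" "rational_step y <= 1"
 by (auto simp: rational_step_def divide_le_eq_1 add_pos_nonneg)

lemma rational_step_tendsto: "(%j. rational_step (real (Suc j) * y)) ---> (if y > 0 then 1 else 0)"
proof (cases "y > 0")
 case True
 have "rational_step (real (Suc j) * y) = y\<^sup>2 / ((inverse (real (Suc j)))^2 + y\<^sup>2)" for j
 proof -
  define s where "s = real (Suc j)"
  have s: "s > 0" by (simp add: s_def)
  have "s\<^sup>2 * (inverse s)^2 = 1" using s by (simp add: power_mult_distrib[symmetric])
  then have "(s * y)^2 / (1 + (s * y)^2) = (s\<^sup>2 * y\<^sup>2) / (s\<^sup>2 * ((inverse s)^2 + y\<^sup>2))"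
   by (simp add: power_mult_distrib distrib_left)
  also have "\<dots> = y\<^sup>2 / ((inverse s)^2 + y\<^sup>2)" using s by (intro mult_divide_mult_cancel_left) simp
  finally have "(real (Suc j) * y)^2 / (1 + (real (Suc j) * y)^2) = y\<^sup>2 / ((inverse (real (Suc j)))^2 + y\<^sup>2)"
   by (simp add: s_def)
  then show ?thesis using True by (simp add: rational_step_def not_le)
 qed
 moreover have "(%j. y\<^sup>2 / ((inverse (real (Suc j)))^2 + y\<^sup>2)) ---> y\<^sup>2 / (0\<^sup>2 + y\<^sup>2)"
  using True by (intro tendsto_intros LIMSEQ_inverse_real_of_nat) auto
 ultimately show ?thesis using True by simp
next
 case False
 then have "real (Suc j) * y <= 0" for j by (simp add: mult_nonneg_nonpos)
 then show ?thesis using False by (simp add: rational_step_def)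
qed

lemma lipschitz_C1_rational_step: "lipschitz_C1 1 rational_step rational_step'"
 using rational_step_deriv rational_step'_continuous rational_step'_bounds by (auto simp: lipschitz_C1_def)

context elliptic
begin

lemma supersol_test_nonincreasing:
 assumes s: "supersol S g" and u: "sobolev S UNIV u g" and S: "emeasure lborel S < \<infinity>"
  and F: "lipschitz_C1 M F F'" "!!t. 0 <= F t" "!!t. F' t <= 0" and \<phi>: "\<phi> : C1c S" "!!x. 0 <= \<phi> x"
 shows "0 <= (LBINT x. ind S x * (F (u x) * ((A x *v g x) \<bullet> grad \<phi> x)))"
proof -
 note fin = L2_lipschitz_C1_finite[OF sobolevD(1,2)[OF u] S sobolevD(4)[OF u] F(1)]
 have "0 <= (LBINT x. ind S x * (\<phi> x * (- F' (u x)) * ((A x *v g x) \<bullet> g x)))"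
  using \<phi>(2) F(3) A_nonneg by (intro integral_nonneg_AE always_eventually allI mult_nonneg_nonneg) auto
 also have "\<dots> <= (LBINT x. ind S x * (F (u x) * ((A x *v g x) \<bullet> grad \<phi> x)))"
  by (rule supersol_test[OF s u F(1) _ fin \<phi>(1)]) (use F(2) \<phi>(2) in auto)
 finally show ?thesis .
qed

lemma supersol_truncation:
 assumes s: "supersol S g" and u: "sobolev S UNIV u g" and S: "emeasure lborel S < \<infinity>"
 shows "supersol S (%x. if u x < k then g x else 0)"
 unfolding supersol_def
proof (intro ballI impI)
 fix \<phi> assume \<phi>: "\<phi> : C1c S" "ALL x. 0 <= \<phi> x"
 note [measurable] = sobolevD(1-3)[OF u] C1_measurable[OF C1c_C1[OF \<phi>(1)]] grad_measurable[OF C1c_C1[OF \<phi>(1)]]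
 define F where "F j t = rational_step (- real (Suc j) * t + real (Suc j) * k)" for j t
 define F' where "F' j t = - real (Suc j) * rational_step' (- real (Suc j) * t + real (Suc j) * k)" for j t
 have F: "lipschitz_C1 (\<bar>- real (Suc j)\<bar> * 1) (F j) (F' j)" for j
  unfolding F_def[abs_def] F'_def[abs_def] by (rule lipschitz_C1_comp_affine[OF lipschitz_C1_rational_step])
 have F_bounds: "0 <= F j t" "F j t <= 1" "F' j t <= 0" for j t
  using rational_step_bounds rational_step'_bounds(1) by (auto simp: F_def F'_def mult_nonpos_nonneg)
 note [measurable] = lipschitz_C1D(5)[OF F]
 have "0 <= (LBINT x. ind S x * (F j (u x) * ((A x *v g x) \<bullet> grad \<phi> x)))" for j
  by (rule supersol_test_nonincreasing[OF s u S F _ _ \<phi>(1)]) (use F_bounds \<phi>(2) in auto)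
 moreover have "(%j. LBINT x. ind S x * (F j (u x) * ((A x *v g x) \<bullet> grad \<phi> x)))
   ---> (LBINT x. ind S x * ((A x *v (if u x < k then g x else 0)) \<bullet> grad \<phi> x))"
 proof (rule integral_dominated_convergence)
  show "integrable lborel (%x. \<bar>ind S x * ((A x *v g x) \<bullet> grad \<phi> x)\<bar>)"
   using L2_inner_integrable[OF _ _ _ L2_A_finite[OF sobolevD(3,1,5)[OF u]] C1c_L2_finite[OF \<phi>(1)]] by simp
  show "AEL x. norm (ind S x * (F j (u x) * ((A x *v g x) \<bullet> grad \<phi> x))) <= \<bar>ind S x * ((A x *v g x) \<bullet> grad \<phi> x)\<bar>" for j
   using F_bounds by (intro always_eventually) (auto simp: abs_mult mult_left_le_one_le intro!: mult_left_mono)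
  show "AEL x. (%j. ind S x * (F j (u x) * ((A x *v g x) \<bullet> grad \<phi> x)))
   ---> ind S x * ((A x *v (if u x < k then g x else 0)) \<bullet> grad \<phi> x)"
  proof (intro always_eventually allI)
   fix x
   have "F j (u x) = rational_step (real (Suc j) * (k - u x))" for j unfolding F_def by (simp add: algebra_simps)
   then have "(%j. F j (u x)) ---> (if u x < k then 1 else 0)" using rational_step_tendsto[of "k - u x"] by simp
   from tendsto_mult[OF tendsto_const tendsto_mult[OF this tendsto_const]]
   have "(%j. ind S x * (F j (u x) * ((A x *v g x) \<bullet> grad \<phi> x)))
    ---> ind S x * ((if u x < k then 1 else 0) * ((A x *v g x) \<bullet> grad \<phi> x))" .
   then show "(%j. ind S x * (F j (u x) * ((A x *v g x) \<bullet> grad \<phi> x)))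
    ---> ind S x * ((A x *v (if u x < k then g x else 0)) \<bullet> grad \<phi> x)" by (auto split: if_splits)
  qed
 qed measurable
 ultimately show "0 <= (LBINT x. ind S x * ((A x *v (if u x < k then g x else 0)) \<bullet> grad \<phi> x))"
  by (intro LIMSEQ_le_const) auto
qed

end

subsection \<open>The fundamental solution\<close>

lemma integrable_on_subset:
 assumes "integrable lborel (%x. ind T x * f x :: real)" "S <= T" "S : sets borel"
 shows "integrable lborel (%x. ind S x * f x)"
proof -
 have "integrable lborel (%x. (ind T x * f x) * ind S x)"
  using assms by (intro integrable_real_mult_indicator) auto
 moreover have "(%x. (ind T x * f x) * ind S x) = (%x. ind S x * f x)"
  using assms(2) by (auto simp: indicator_def fun_eq_iff)
 ultimately show ?thesis by simp
qed

lemma weak_grad_L2_ball: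
 fixes u :: "real^'n => real"
 assumes w: "wgrad U u g" "ball z (2 * \<rho>) <= U" and \<rho>: "\<rho> > 0" and [measurable]: "u : Borel" "g : Borel"
  and int: "integrable lborel (%x. ind (ball z (2 * \<rho>)) x * u x)" "!!i. integrable lborel (%x. ind (ball z (2 * \<rho>)) x * g x $ i)"
  and fin: "L2 (ball z (2 * \<rho>)) g < \<infinity>"
 shows "L2 (ball z \<rho>) u < \<infinity>"
proof -
 have sub: "cball x (\<rho> / 2) <= ball z (2 * \<rho>)" if "x : ball z \<rho>" for x
  using that \<rho> by (auto simp: subset_eq) (smt (verit) dist_triangle)
 have meas: "ball z \<rho> : sets borel" "ball z (2 * \<rho>) : sets borel" by simp_all
 obtain w :: "nat => _" where w: "!!j. C1 (w j)" "(%j. NN x. ennreal \<bar>w j x - u x\<bar> * ind (ball z \<rho>) x) ---> 0"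
  "(%j. L2 (ball z \<rho>) (%x. grad (w j) x - g x)) ---> 0"
  "L2 (ball z (2 * \<rho>)) u < \<infinity> ==> (%j. L2 (ball z \<rho>) (%x. w j x - u x)) ---> 0"
  using weak_grad_approximation[OF w meas \<open>u : Borel\<close> \<open>g : Borel\<close> int fin half_gt_zero[OF \<rho>] sub] by blast
 note [measurable] = C1_measurable[OF w(1)]
 obtain q :: "nat => nat" where q: "strict_mono q" "AE x\<in>ball z \<rho> in lborel. (%j. w (q j) x - u x) ---> 0"
  using L1_AE_subseq[of "%j x. w j x - u x" "ball z \<rho>"] w(2) by auto
 have ae: "AE x\<in>ball z \<rho> in lborel. (%j. w (q j) x) ---> u x"
  using q(2) by eventually_elim (simp add: LIM_zero_iff)
 have grad_lim: "(%j. L2 (ball z \<rho>) (%x. grad (w (q j)) x - g x)) ---> 0"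
  using LIMSEQ_subseq_LIMSEQ[OF w(3) q(1)] by (simp add: o_def)
 have fin_g: "L2 (ball z \<rho>) g < \<infinity>" using fin L2_mono_set[of "ball z \<rho>" "ball z (2 * \<rho>)" g] \<rho> by force
 obtain c where c: "L2 (ball z \<rho>) (%x. u x - c) <= ennreal (8 * \<rho>\<^sup>2 * 2 ^ CARD('n)) * L2 (ball z \<rho>) g"
  using poincare_constant[OF w(1) _ _ ae grad_lim fin_g \<rho>] by auto
 have "L2 (ball z \<rho>) (%x. (u x - c) + c) < \<infinity>"
 proof (rule L2_add_finite)
  show "L2 (ball z \<rho>) (%x. u x - c) < \<infinity>" using c fin_g by (auto simp: ennreal_mult_less_top intro: le_less_trans)
  show "L2 (ball z \<rho>) (%x. c) < \<infinity>"
   by (rule L2_bounded_finite[of _ _ "\<bar>c\<bar>"]) (use emeasure_lborel_ball_finite[of z \<rho>] in auto)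
 qed auto
 then show ?thesis by simp
qed

lemma L2_compact_finite:
 fixes f :: "'a::euclidean_space => 'b::real_normed_vector"
 assumes K: "compact K" and [measurable]: "f : Borel" and fin: "!!z. z : K ==> 0 < r z & L2 (ball z (r z)) f < \<infinity>"
 shows "L2 K f < \<infinity>"
proof -
 have "K <= (\<Union>z\<in>K. ball z (r z))" using fin by fastforce
 then obtain D where D: "D <= K" "finite D" "K <= (\<Union>z\<in>D. ball z (r z))"
  using compactE_image[OF K, of K "%z. ball z (r z)"] by auto
 have [measurable]: "ball z t : sets borel" for z :: 'a and t by simp
 have "L2 K f <= (NN x. (\<Sum>z\<in>D. ennreal ((norm (f x))^2) * ind (ball z (r z)) x))"
  unfolding L2_def
 proof (rule nn_integral_mono)
  fix x
  show "ennreal ((norm (f x))^2) * ind K x <= (\<Sum>z\<in>D. ennreal ((norm (f x))^2) * ind (ball z (r z)) x)"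
  proof (cases "x : K")
   case True
   then obtain z where z: "z : D" "x : ball z (r z)" using D by auto
   have "ennreal ((norm (f x))^2) * ind (ball z (r z)) x <= (\<Sum>z\<in>D. ennreal ((norm (f x))^2) * ind (ball z (r z)) x)"
    by (rule member_le_sum) (use z D in auto)
   then show ?thesis using z True by simp
  qed simp
 qed
 also have "\<dots> = (\<Sum>z\<in>D. L2 (ball z (r z)) f)" unfolding L2_def by (rule nn_integral_sum) measurable
 also have "\<dots> < \<infinity>" using fin D by (auto simp: less_top)
 finally show ?thesis .
qed

locale fundamental = elliptic A lam L for A :: "real^'n => real^'n^'n" and lam L +
 fixes G :: "real^'n => real" and H :: "real^'n => real^'n"
 assumes n3: "CARD('n) \<ge> 3"
  and G_measurable [measurable]: "G : Borel"
  and H_measurable [measurable]: "H : Borel"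
  and G_nonneg: "0 <= G x" and G_pos: "AEL x. 0 < G x"
  and G_int: "integrable lborel (%x. ind (ball 0 r) x * G x)"
  and H_int: "integrable lborel (%x. ind (ball 0 r) x * H x $ i)"
  and G_wgrad: "wgrad UNIV G H"
  and H_L2: "\<rho> > 0 ==> L2 (- cball 0 \<rho>) H < \<infinity>"
  and flux: "\<phi> : C1c UNIV ==> (LBINT x. (A x *v H x) \<bullet> grad \<phi> x) = \<phi> 0"
  and G_decay: "\<delta> > 0 ==> EX R>0. AEL x. R <= norm x --> G x < \<delta>"
begin

lemma G_L2_ball:
 assumes "\<rho> > 0" "2 * \<rho> < norm z"
 shows "L2 (ball z \<rho>) G < \<infinity>"
proof (rule weak_grad_L2_ball[OF G_wgrad subset_UNIV assms(1) G_measurable H_measurable])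
 have sub: "ball z (2 * \<rho>) <= ball 0 (norm z + 2 * \<rho>)"
 proof
  fix x assume "x : ball z (2 * \<rho>)"
  then show "x : ball 0 (norm z + 2 * \<rho>)" using norm_triangle_ineq2[of x z] by (simp add: dist_norm norm_minus_commute)
 qed
 show "integrable lborel (%x. ind (ball z (2 * \<rho>)) x * G x)" by (rule integrable_on_subset[OF G_int sub]) simp
 show "integrable lborel (%x. ind (ball z (2 * \<rho>)) x * H x $ i)" for i by (rule integrable_on_subset[OF H_int sub]) simp
 have "ball z (2 * \<rho>) <= - cball 0 ((norm z - 2 * \<rho>) / 2)"
 proof
  fix x assume "x : ball z (2 * \<rho>)"
  then have "norm (z - x) < 2 * \<rho>" by (simp add: dist_norm)
  then show "x : - cball 0 ((norm z - 2 * \<rho>) / 2)" using norm_triangle_ineq2[of z x] assms by auto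
 qed
 then have "L2 (ball z (2 * \<rho>)) H <= L2 (- cball 0 ((norm z - 2 * \<rho>) / 2)) H" by (rule L2_mono_set)
 also have "\<dots> < \<infinity>" using assms by (intro H_L2) auto
 finally show "L2 (ball z (2 * \<rho>)) H < \<infinity>" .
qed

lemma G_L2_ann:
 assumes "0 < a"
 shows "L2 (ann a b) G < \<infinity>"
proof -
 define K where "K = cball (0::real^'n) b - ball 0 a"
 have "L2 (ann a b) G <= L2 K G" by (rule L2_mono_set) (auto simp: ann_def K_def)
 also have "\<dots> < \<infinity>"
 proof (rule L2_compact_finite)
  show "compact K" unfolding K_def by (intro compact_diff) auto
  show "0 < norm z / 4 & L2 (ball z (norm z / 4)) G < \<infinity>" if "z : K" for z
  proof -
   have "0 < norm z" using that assms by (auto simp: K_def)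
   then show ?thesis using G_L2_ball[of "norm z / 4" z] by auto
  qed
 qed simp
 finally show ?thesis .
qed

lemma H_L2_ann: "0 < a ==> L2 (ann a b) H < \<infinity>"
 using H_L2[of "a"] L2_mono_set[of "ann a b" "- cball 0 a" H]
 by (auto simp: ann_def subset_eq intro: le_less_trans)

lemma sobolev_ann:
 assumes "0 < a"
 shows "sobolev (ann a b) UNIV G H"
proof (rule weak_grad_sobolev[OF G_wgrad subset_UNIV, where S'="ann (a / 2) (b + a)" and ?e0.0="a / 4"])
 have sub: "ann (a / 2) (b + a) <= ball (0::real^'n) (b + a)" by (auto simp: ann_def)
 show "integrable lborel (%x. ind (ann (a / 2) (b + a)) x * G x)"
  by (rule integrable_on_subset[OF G_int sub]) simp
 show "integrable lborel (%x. ind (ann (a / 2) (b + a)) x * H x $ i)" for i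
  by (rule integrable_on_subset[OF H_int sub]) simp
 show "cball x (a / 4) <= ann (a / 2) (b + a)" if "x : ann a b" for x :: "real^'n"
 proof
  fix y assume "y : cball x (a / 4)"
  then have "norm (x - y) <= a / 4" by (simp add: dist_norm)
  then have "norm x - norm y <= a / 4" "norm y - norm x <= a / 4"
   using norm_triangle_ineq2[of x y] norm_triangle_ineq2[of y x] by (auto simp: norm_minus_commute)
  then show "y : ann (a / 2) (b + a)" using that assms by (auto simp: ann_def)
 qed
qed (use assms G_L2_ann H_L2_ann in auto)

lemma sol_ann:
 assumes "0 <= a"
 shows "sol (ann a b) H"
 unfolding sol_def
proof
 fix \<phi> :: "real^'n => real" assume \<phi>: "\<phi> : C1c (ann a b)"
 have "(LBINT x. ind (ann a b) x * ((A x *v H x) \<bullet> grad \<phi> x)) = (LBINT x. ind UNIV x * ((A x *v H x) \<bullet> grad \<phi> x))"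
  by (rule C1c_integral_superset[OF \<phi> subset_UNIV, symmetric])
 also have "\<dots> = \<phi> 0" using flux[OF C1c_mono[OF \<phi> subset_UNIV]] by simp
 also have "\<phi> 0 = 0" using C1c_zero(1)[OF \<phi>] assms by (simp add: ann_def)
 finally show "(LBINT x. ind (ann a b) x * ((A x *v H x) \<bullet> grad \<phi> x)) = 0" .
qed

lemma flux_cutoff:
 assumes "cutoff 0 r1 r2 \<theta>" "0 <= r1"
 shows "(LBINT x. (A x *v H x) \<bullet> grad \<theta> x) = 1"
 using flux[OF C1c_mono[OF cutoff_C1c[OF assms(1), of "r2 + 1"] subset_UNIV]] cutoffD(5)[OF assms(1), of 0] assms(2) by simp

definition G_trunc :: "real => real^'n => real" where "G_trunc k x = min (G x) k"

definition H_trunc :: "real => real^'n => real^'n" where "H_trunc k x = (if G x < k then H x else 0)"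

abbreviation between :: "real => (real^'n => real) set" where
 "between k \<equiv> {w. ALL x. 0 <= w x & w x <= k}"

lemma G_trunc_measurable [measurable]: "G_trunc k : Borel"
 unfolding G_trunc_def[abs_def] by measurable

lemma H_trunc_measurable [measurable]: "H_trunc k : Borel"
 unfolding H_trunc_def[abs_def] by measurable

lemma G_trunc_bounds: "k > 0 ==> 0 <= G_trunc k x" "G_trunc k x <= k"
 using G_nonneg[of x] by (auto simp: G_trunc_def)

lemma H_trunc_cutoff_energy:
 assumes a: "0 < a" and k: "k > 0" and \<eta>: "\<eta> : C1c (ann a b)"
 shows "L2 UNIV (%x. \<eta> x *. H_trunc k x) <= ennreal (4 * L / lam) * (ennreal (k\<^sup>2) * L2 UNIV (grad \<eta>))"
proof -
 define S where "S = (ann a b :: (real^'n) set)"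
 have [measurable]: "S : sets borel" by (simp add: S_def)
 note [measurable] = C1_measurable[OF C1c_C1[OF \<eta>]] grad_measurable[OF C1c_C1[OF \<eta>]]
 let ?v = "%x. (-1) * G x + k"
 have "sobolev S UNIV ?v (%x. (-1) *. H x)"
  unfolding S_def by (rule sobolev_affine[OF sobolev_ann[OF a] ann_finite])
 moreover have "supersol S (%x. - ((-1) *. H x))" using sol_supersol(1)[OF sol_ann] a by (simp add: S_def)
 ultimately have dg: "dg_class (4 * L / lam) S ?v (%x. (-1) *. H x)" by (intro subsolution_dg_class)
 have "L2 UNIV (%x. \<eta> x *. H_trunc k x)
  <= (NN x. ennreal ((\<eta> x)^2 * (norm ((-1) *. H x))^2) * ind (S \<inter> {x. 0 < ?v x}) x)"
  unfolding L2_def using C1c_zero(1)[OF \<eta>]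
  by (intro nn_integral_mono) (auto simp: S_def H_trunc_def indicator_def power_mult_distrib)
 also have "\<dots> <= ennreal (4 * L / lam) * (NN x. ennreal ((max (?v x - 0) 0)^2 * (norm (grad \<eta> x))^2) * ind S x)"
  using dg \<eta> unfolding dg_class_def S_def by blast
 also have "(NN x. ennreal ((max (?v x - 0) 0)^2 * (norm (grad \<eta> x))^2) * ind S x) = L2 S (%x. max (?v x) 0 *. grad \<eta> x)"
  unfolding L2_def by (simp add: power_mult_distrib)
 also have "\<dots> <= ennreal (k\<^sup>2) * L2 S (grad \<eta>)"
  by (rule L2_bound_mult) (use G_nonneg k in \<open>auto intro!: mult_right_mono\<close>)
 also have "L2 S (grad \<eta>) <= L2 UNIV (grad \<eta>)" by (rule L2_mono_set) simp
 finally show ?thesis by (simp add: mult_left_mono)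
qed

lemma H_trunc_L2_ball:
 assumes R: "R > 0" and k: "k > 0"
 shows "L2 (ball 0 R) (H_trunc k) < \<infinity>"
proof -
 obtain \<psi> :: "nat => real^'n => real" where \<psi>: "puncture_seq \<psi>" using puncture_seq_exists[OF n3] by blast
 obtain \<zeta> where \<zeta>: "cutoff (0::real^'n) R (2 * R) \<zeta>" using cutoff_exists[of R "2 * R"] R by auto
 have \<zeta>c: "\<zeta> : C1c (ball 0 (3 * R))" by (rule cutoff_C1c[OF \<zeta>]) (use R in simp)
 note [measurable] = C1_measurable[OF puncture_seqD(1)[OF \<psi>]] C1_measurable[OF cutoffD(1)[OF \<zeta>]]
 define c where "c = ennreal (4 * L / lam) * ennreal (k\<^sup>2)"
 have c: "c < \<infinity>" by (simp add: c_def ennreal_mult_less_top)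
 have "L2 (ball 0 R) (H_trunc k) <= L2 UNIV (%x. \<zeta> x *. H_trunc k x)"
  unfolding L2_def using cutoffD(5)[OF \<zeta>] by (intro nn_integral_mono) (auto simp: indicator_def)
 also have "\<dots> <= c * (2 * L2 UNIV (grad \<zeta>))"
 proof (rule L2_fatou)
  show "AE x\<in>UNIV in lborel. (%j. (\<psi> j x * \<zeta> x) *. H_trunc k x) ---> \<zeta> x *. H_trunc k x"
   using AE_lborel_singleton[of "0::real^'n"]
  proof (eventually_elim, intro impI)
   fix x :: "real^'n" assume "x ~= 0"
   then have "(%j. (\<psi> j x * \<zeta> x) *. H_trunc k x) ---> (1 * \<zeta> x) *. H_trunc k x"
    by (intro tendsto_intros puncture_seqD(7)[OF \<psi>])
   then show "(%j. (\<psi> j x * \<zeta> x) *. H_trunc k x) ---> \<zeta> x *. H_trunc k x" by simp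
  qed
  show "L2 UNIV (%x. (\<psi> j x * \<zeta> x) *. H_trunc k x) <= c * (2 * L2 UNIV (grad \<zeta>)) + c * (2 * L2 UNIV (grad (\<psi> j)))" for j
  proof -
   have "L2 UNIV (%x. (\<psi> j x * \<zeta> x) *. H_trunc k x) <= c * L2 UNIV (grad (%x. \<psi> j x * \<zeta> x))"
    using H_trunc_cutoff_energy[OF _ k puncture_C1c[OF \<zeta>c \<psi>]] by (simp add: c_def mult.assoc)
   also have "\<dots> <= c * (2 * L2 UNIV (grad \<zeta>) + 2 * L2 UNIV (grad (\<psi> j)))"
    using cutoffD(1-3)[OF \<zeta>] by (intro mult_left_mono puncture_mult_energy[OF \<psi>]) auto
   finally show ?thesis by (simp add: distrib_left)
  qed
  have "(%j. (c * 2) * L2 UNIV (grad (\<psi> j)) + 0 * L2 UNIV (grad (\<psi> j))) ---> 0"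
   using puncture_seqD(8)[OF \<psi>] c by (intro ennreal_tendsto_0_lincomb) (auto simp: ennreal_mult_less_top)
  then show "(%j. c * (2 * L2 UNIV (grad (\<psi> j)))) ---> 0" by (simp add: mult.assoc)
 qed auto
 also have "\<dots> < \<infinity>" using C1c_L2_finite[OF C1c_mono[OF \<zeta>c subset_UNIV]] c by (simp add: ennreal_mult_less_top)
 finally show ?thesis .
qed

lemma sobolev_G_trunc:
 assumes "R > 0" and k: "k > 0"
 shows "sobolev (ball 0 R) (between k) (G_trunc k) (H_trunc k)"
proof (rule sobolev_punctured[OF n3 _ _ H_trunc_L2_ball[OF assms]])
 show "sobolev (ann a R) (between k) (G_trunc k) (H_trunc k)" if "0 < a" for a
  unfolding G_trunc_def[abs_def] H_trunc_def[abs_def]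
  by (rule sobolev_truncation[OF sobolev_ann[OF that] ann_finite k]) (use G_pos in eventually_elim, simp)
 show "\<bar>G_trunc k x\<bar> <= k" for x using G_trunc_bounds(1)[OF k] G_trunc_bounds(2) by simp
 show "(%x. \<eta> x * w x) : between k" if "w : between k" "!!x. 0 <= \<eta> x & \<eta> x <= 1" for w \<eta> :: "real^'n => real"
  using that mult_mono[of "\<eta> _" 1 "w _" k] by auto
qed

lemma supersol_H_trunc:
 assumes "R > 0" "k > 0"
 shows "supersol (ball 0 R) (H_trunc k)"
proof (rule supersol_punctured[OF n3 _ H_trunc_measurable H_trunc_L2_ball[OF assms]])
 show "supersol (ann a R) (H_trunc k)" if "0 < a" for a
  unfolding H_trunc_def[abs_def]
  by (rule supersol_truncation[OF sol_supersol(1)[OF sol_ann] sobolev_ann[OF that] ann_finite]) (use that in simp)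
qed

lemma decay_cutoff:
 assumes "0 < \<delta>"
 obtains R \<theta> where "R > 0" "AEL x. R <= norm x --> G x < \<delta>" "cutoff (0::real^'n) R (2 * R) \<theta>"
proof -
 obtain R where R: "R > 0" "AEL x. R <= norm x --> G x < \<delta>" using G_decay[OF assms] by blast
 obtain \<theta> where "cutoff (0::real^'n) R (2 * R) \<theta>" using cutoff_exists[of R "2 * R"] R(1) by auto
 then show ?thesis using R that by blast
qed

lemma flux_truncated:
 assumes \<delta>: "\<delta> <= k" and R: "R > 0" and decay: "AEL x. R <= norm x --> G x < \<delta>" and \<theta>: "cutoff (0::real^'n) R (2 * R) \<theta>"
  and F: "F : Borel" "!!t. t < \<delta> ==> F t = k"
 shows "(LBINT x. ind (ball 0 (3 * R)) x * (F (G_trunc k x) * ((A x *v H_trunc k x) \<bullet> grad \<theta> x))) = k"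
proof -
 note [measurable] = F(1) grad_measurable[OF cutoffD(1)[OF \<theta>]]
 have [measurable]: "ball (0::real^'n) (3 * R) : sets borel" by simp
 have "(LBINT x. ind (ball 0 (3 * R)) x * (F (G_trunc k x) * ((A x *v H_trunc k x) \<bullet> grad \<theta> x)))
  = (LBINT x. k * ((A x *v H x) \<bullet> grad \<theta> x))"
 proof (rule integral_cong_AE)
  show "AEL x. ind (ball 0 (3 * R)) x * (F (G_trunc k x) * ((A x *v H_trunc k x) \<bullet> grad \<theta> x)) = k * ((A x *v H x) \<bullet> grad \<theta> x)"
   using decay
  proof eventually_elim
   case (elim x)
   show ?case
   proof (cases "x : ball 0 (3 * R) & R < norm x")
    case True
    then have "G x < \<delta>" using elim by simp
    then have "H_trunc k x = H x" "F (G_trunc k x) = k" using \<delta> F(2) by (auto simp: H_trunc_def G_trunc_def)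
    then show ?thesis using True by simp
   next
    case False
    then have "grad \<theta> x = 0" using cutoffD(6,8)[OF \<theta>, of x] R by auto
    then show ?thesis by simp
   qed
  qed
 qed measurable
 also have "\<dots> = k" using flux_cutoff[OF \<theta>] R by simp
 finally show ?thesis .
qed

lemma H_trunc_energy_smoothed:
 assumes \<delta>: "0 < \<delta>" "\<delta> <= k" and e: "e > 0" and R: "R > 0" and decay: "AEL x. R <= norm x --> G x < \<delta>"
  and \<theta>: "cutoff (0::real^'n) R (2 * R) \<theta>"
 shows "(NN x. ennreal (smooth_pos' e (G_trunc k x - \<delta>) * (norm (H_trunc k x))^2) * ind (ball 0 R) x) <= ennreal (k / lam)"
proof -
 have k: "k > 0" using \<delta> by simp
 define S where "S = ball (0::real^'n) (3 * R)"
 have \<theta>c: "\<theta> : C1c S" unfolding S_def by (rule cutoff_C1c[OF \<theta>]) (use R in simp)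
 define F where "F t = k - smooth_pos e (t - \<delta>)" for t
 let ?w = "%x. smooth_pos' e (G_trunc k x - \<delta>)" and ?E = "%x. (A x *v H_trunc k x) \<bullet> H_trunc k x"
 note [measurable] = smooth_pos_measurable[OF e] smooth_pos'_measurable[OF e] C1_measurable[OF cutoffD(1)[OF \<theta>]] grad_measurable[OF cutoffD(1)[OF \<theta>]]
 have F: "lipschitz_C1 1 F (%t. - smooth_pos' e (t - \<delta>))"
  using lipschitz_C1_affine_comp[OF lipschitz_C1_comp_affine[OF lipschitz_C1_smooth_pos[OF e], of 1 "- \<delta>"], of "-1" k]
  by (simp add: F_def[abs_def])
 have F_range: "0 <= F t & F t <= k" if "0 <= t" "t <= k" for t
  using smooth_pos_bounds[OF e, of "t - \<delta>"] that \<delta> by (auto simp: F_def)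
 have u: "sobolev S (between k) (G_trunc k) (H_trunc k)" unfolding S_def by (rule sobolev_G_trunc) (use R k in auto)
 have S: "emeasure lborel S < \<infinity>" using emeasure_lborel_ball_finite[of "0::real^'n" "3 * R"] by (simp add: S_def)
 note fin = L2_lipschitz_C1_finite[OF sobolevD(1,2)[OF u] S sobolevD(4)[OF u] F]
 have "(LBINT x. ind S x * (\<theta> x * (- (- ?w x)) * ?E x)) <= (LBINT x. ind S x * (F (G_trunc k x) * ((A x *v H_trunc k x) \<bullet> grad \<theta> x)))"
  using supersol_H_trunc[of "3 * R" k] R k F_range cutoffD(2)[OF \<theta>]
  by (intro supersol_test[OF _ u F _ fin \<theta>c]) (auto simp: S_def)
 also have "\<dots> = k"
  unfolding S_def by (rule flux_truncated[OF \<delta>(2) R decay \<theta> lipschitz_C1D(5)[OF F]]) (auto simp: F_def smooth_pos_def)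
 finally have energy: "(LBINT x. ind S x * (\<theta> x * ?w x * ?E x)) <= k" by simp
 have "(NN x. ennreal (?w x * (norm (H_trunc k x))^2) * ind (ball 0 R) x)
  <= ennreal (1 / lam) * (NN x. ennreal (ind (ball 0 R) x * (?w x * ?E x)))"
  using smooth_pos'_bounds(1)[OF e] by (intro A_energy_lower) auto
 also have "(NN x. ennreal (ind (ball 0 R) x * (?w x * ?E x))) <= (NN x. ennreal (ind S x * (\<theta> x * ?w x * ?E x)))"
  using cutoffD(2,5)[OF \<theta>] smooth_pos'_bounds(1)[OF e] A_nonneg R
  by (intro nn_integral_mono ennreal_leI) (auto simp: indicator_def S_def)
 also have "\<dots> = ennreal (LBINT x. ind S x * (\<theta> x * ?w x * ?E x))"
  using test_integrable(1)[OF u F fin \<theta>c] cutoffD(2)[OF \<theta>] smooth_pos'_bounds(1)[OF e] A_nonneg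
  by (intro nn_integral_eq_integral) auto
 also have "\<dots> <= ennreal k" by (rule ennreal_leI[OF energy])
 also have "ennreal (1 / lam) * ennreal k = ennreal (k / lam)" using lam_pos k by (simp add: ennreal_mult[symmetric])
 finally show ?thesis by (simp add: mult_left_mono)
qed

lemma H_trunc_energy_level:
 assumes \<delta>: "0 < \<delta>" "\<delta> <= k"
 shows "(NN x. ennreal ((norm (H_trunc k x))^2) * ind {x. \<delta> < G_trunc k x} x) <= ennreal (k / lam)"
proof -
 obtain R \<theta> where R: "R > 0" and decay: "AEL x. R <= norm x --> G x < \<delta>" and \<theta>: "cutoff (0::real^'n) R (2 * R) \<theta>"
  using decay_cutoff[OF \<delta>(1)] by blast
 have "(NN x. ennreal ((norm (H_trunc k x))^2) * ind (ball 0 R \<inter> {x. \<delta> < G_trunc k x}) x) <= ennreal (k / lam)"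
 proof (rule truncation_limit)
  show "(NN x. ennreal ((norm (H_trunc k x))^2 * smooth_pos' (1 / real (Suc j)) (G_trunc k x - \<delta>)) * ind (ball 0 R) x) <= ennreal (k / lam)" for j
   using H_trunc_energy_smoothed[OF \<delta> _ R decay \<theta>, of "1 / real (Suc j)"] by (simp add: mult.commute)
 qed auto
 moreover have "(NN x. ennreal ((norm (H_trunc k x))^2) * ind {x. \<delta> < G_trunc k x} x)
  = (NN x. ennreal ((norm (H_trunc k x))^2) * ind (ball 0 R \<inter> {x. \<delta> < G_trunc k x}) x)"
  by (rule nn_integral_cong_AE) (use decay in eventually_elim, auto simp: indicator_def G_trunc_def)
 ultimately show ?thesis by simp
qed

lemma H_trunc_energy:
 assumes k: "k > 0"
 shows "L2 UNIV (H_trunc k) <= ennreal (k / lam)"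
proof (rule L2_fatou)
 define f where "f = (%(j::nat) x. (if k / Suc j < G_trunc k x then 1 else 0 :: real) *. H_trunc k x)"
 show "f j : Borel" for j unfolding f_def by measurable
 show "L2 UNIV (f j) <= ennreal (k / lam) + 0" for j
 proof -
  have "L2 UNIV (f j) = (NN x. ennreal ((norm (H_trunc k x))^2) * ind {x. k / Suc j < G_trunc k x} x)"
   unfolding L2_def f_def by (intro nn_integral_cong) (auto simp: indicator_def)
  also have "\<dots> <= ennreal (k / lam)" using k by (intro H_trunc_energy_level) (auto simp: divide_le_eq)
  finally show ?thesis by simp
 qed
 show "AE x\<in>UNIV in lborel. (%j. f j x) ---> H_trunc k x"
  using G_pos
 proof (eventually_elim, intro impI)
  fix x assume "0 < G x"
  then have positive: "0 < G_trunc k x" using k by (simp add: G_trunc_def)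
  have level_lim: "(%j. k * inverse (real (Suc j))) ---> k * 0" by (intro tendsto_intros LIMSEQ_inverse_real_of_nat)
  have "\<forall>\<^sub>F j in sequentially. k * inverse (real (Suc j)) < G_trunc k x" using order_tendstoD(2)[OF level_lim, of "G_trunc k x"] positive by simp
  then have "\<forall>\<^sub>F j in sequentially. f j x = H_trunc k x"
   by eventually_elim (simp add: f_def divide_inverse)
  then show "(%j. f j x) ---> H_trunc k x" by (rule tendsto_eventually)
 qed
qed auto

lemma sobolev_excess:
 assumes k: "k > 0" and \<delta>: "\<delta> > 0"
 shows "sobolev UNIV (C1c UNIV) (%x. max (G_trunc k x - \<delta>) 0) (%x. if \<delta> < G_trunc k x then H_trunc k x else 0)" (is "sobolev _ _ ?v ?g")
proof -
 obtain R \<theta> where R: "R > 0" and decay: "AEL x. R <= norm x --> G x < \<delta>" and \<theta>: "cutoff (0::real^'n) R (2 * R) \<theta>"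
  using decay_cutoff[OF \<delta>] by blast
 define S where "S = ball (0::real^'n) (3 * R)"
 have "sobolev S UNIV (G_trunc k) (H_trunc k)"
  unfolding S_def by (rule sobolev_mono[OF sobolev_G_trunc[of "3 * R" k]]) (use R k in auto)
 from sobolev_affine[OF this, of 1 "- \<delta>"] have "sobolev S UNIV (%x. G_trunc k x - \<delta>) (H_trunc k)"
  using emeasure_lborel_ball_finite[of "0::real^'n" "3 * R"] by (simp add: S_def)
 from sobolev_pos[OF this, of UNIV] have "sobolev S UNIV ?v ?g" by simp
 then show ?thesis
 proof (rule sobolev_extend_by_zero[OF _ \<theta>])
  show "AE x\<in>UNIV in lborel. x ~: cball 0 R --> ?v x = 0 & ?g x = 0"
   using decay by eventually_elim (auto simp: G_trunc_def)
  show "(%x. \<theta> x * w x) : C1c UNIV" if "C1 w" for w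
   using C1c_mult[OF C1c_mono[OF cutoff_C1c[OF \<theta>, of "3 * R"] subset_UNIV] that] R by simp
 qed (use R in \<open>auto simp: S_def\<close>)
qed

lemma G_trunc_hardy:
 assumes k: "k > 0" and r: "r > 0"
 shows "L2 (ball 0 r) (G_trunc k) <= ennreal (16 * r\<^sup>2 * k / lam)"
proof (rule L2_fatou)
 define f where "f = (%(j::nat) x. max (G_trunc k x - k / Suc j) 0)"
 show "f j : Borel" for j unfolding f_def by measurable
 show "AE x\<in>ball 0 r in lborel. (%j. f j x) ---> G_trunc k x"
 proof (intro AE_I2 impI)
  fix x
  have "(%j. max (G_trunc k x - k * inverse (real (Suc j))) 0) ---> max (G_trunc k x - k * 0) 0"
   by (intro tendsto_intros LIMSEQ_inverse_real_of_nat)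
  then show "(%j. f j x) ---> G_trunc k x" using G_trunc_bounds(1)[OF k, of x] by (simp add: f_def divide_inverse)
 qed
 show "L2 (ball 0 r) (f j) <= ennreal (16 * r\<^sup>2 * k / lam) + 0" for j
 proof -
  define \<delta> where "\<delta> = k / Suc j"
  have \<delta>: "0 < \<delta>" using k by (simp add: \<delta>_def)
  let ?g = "%x. if \<delta> < G_trunc k x then H_trunc k x else 0"
  have "L2 (ball 0 r) (f j) <= ennreal (16 * r\<^sup>2) * L2 UNIV ?g"
   unfolding f_def \<delta>_def[symmetric] by (rule hardy_ball[OF sobolev_excess[OF k \<delta>] n3 r])
  also have "L2 UNIV ?g <= L2 UNIV (H_trunc k)" by (rule L2_mono) auto
  also have "\<dots> <= ennreal (k / lam)" by (rule H_trunc_energy[OF k])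
  also have "ennreal (16 * r\<^sup>2) * ennreal (k / lam) = ennreal (16 * r\<^sup>2 * k / lam)"
   using k lam_pos by (simp add: ennreal_mult[symmetric])
  finally show ?thesis by (simp add: mult_left_mono)
 qed
qed auto

end

subsection \<open>Pointwise bounds for the fundamental solution\<close>

definition green_upper :: "nat => real => real => real" where
 "green_upper n lam L = 3 * (576 / (lam * dg_const n (4 * L / lam)) * (2 ^ n)\<^sup>2 / 2) * 5 ^ n"

lemma AE_locally:
 fixes S :: "'a::euclidean_space set"
 assumes "!!z. z : S ==> 0 < r z & (AE x\<in>ball z (r z) in lborel. P x)"
 shows "AE x\<in>S in lborel. P x"
proof -
 obtain D where D: "D <= (%z. ball z (r z)) ` S" "countable D" "\<Union>D = \<Union>((%z. ball z (r z)) ` S)"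
  using Lindelof[of "(%z. ball z (r z)) ` S"] by auto
 have "ALL B:D. AE x\<in>B in lborel. P x" using D(1) assms by blast
 then have "AEL x. ALL B:D. x : B --> P x" using AE_ball_countable[OF D(2), of "%x B. x : B --> P x" lborel] by blast
 then show ?thesis
 proof (eventually_elim, intro impI)
  fix x assume "ALL B:D. x : B --> P x" "x : S"
  moreover have "x : \<Union>((%z. ball z (r z)) ` S)" using \<open>x : S\<close> assms by (intro UnionI[of "ball x (r x)"]) auto
  ultimately show "P x" using D(3) by blast
 qed
qed

lemma ball_norm_bounds:
 fixes z :: "'a::real_normed_vector"
 assumes "x : ball z t"
 shows "norm z - t < norm x" "norm x < norm z + t"
 using assms norm_triangle_ineq2[of x z] norm_triangle_ineq2[of z x] by (auto simp: dist_norm norm_minus_commute)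

lemma quadratic_level_exists:
 fixes c X :: real
 assumes "0 < c" "0 <= X"
 obtains K where "0 < K" "X <= c * K\<^sup>2"
proof
 have "0 <= X / c" using assms by simp
 then show "0 < X / c + 1" by simp
 have "X / c <= (X / c + 1)^2" using \<open>0 <= X / c\<close> self_le_power[of "X / c + 1" 2] by simp
 then show "X <= c * (X / c + 1)^2" using assms by (simp add: pos_divide_le_eq mult.commute)
qed

lemma ennreal_quadratic_level:
 assumes "0 < c" "X < (\<infinity>::ennreal)"
 obtains K where "0 < K" "X <= ennreal (c * K\<^sup>2)"
proof -
 obtain X' where X': "0 <= X'" "X = ennreal X'" using assms(2) by (cases X) auto
 obtain K where "0 < K" "X' <= c * K\<^sup>2" using quadratic_level_exists[OF assms(1) X'(1)] by blast
 then show ?thesis using that[of K] X'(2) by (simp add: ennreal_leI)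
qed

lemma (in elliptic) green_upper_pos: "green_upper CARD('n) lam L > 0"
 using lam_pos dg_const_pos[of "4 * L / lam" "CARD('n)"] caccioppoli_const_pos by (simp add: green_upper_def)

context fundamental
begin

lemma G_local_max:
 assumes r: "r > 0" "norm z = 4 * r" and t: "0 <= t" "t < t'" "t' <= 3 * r" and K: "0 < K"
  and start: "L2 (ball z t') G <= ennreal (dg_const CARD('n) (4 * L / lam) * (t' - t) ^ CARD('n) * K\<^sup>2)"
 shows "AE x\<in>ball z t in lborel. G x <= K"
proof -
 have sub: "ball z t' <= ann (r / 2) (8 * r)"
 proof
  fix x assume "x : ball z t'"
  from ball_norm_bounds[OF this] show "x : ann (r / 2) (8 * r)" using r t by (simp add: ann_def)
 qed
 have u: "sobolev (ball z t') UNIV G H" by (rule sobolev_mono[OF sobolev_ann[of "r / 2" "8 * r"] sub]) (use r in auto)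
 have "supersol (ball z t') (%x. - H x)" using sol_supersol(2)[OF sol_mono[OF sol_ann sub]] r by simp
 from dg_local_max[OF subsolution_dg_class[OF this u] u _ t(1,2) K] start
 show ?thesis using caccioppoli_const_pos G_nonneg by (simp add: max_absorb1)
qed

lemma G_locally_bounded:
 assumes r: "r > 0" "norm z = 4 * r"
 obtains b where "b > 0" "AE x\<in>ball z (2 * r) in lborel. G x <= b"
proof -
 have sub: "ball z (3 * r) <= ann (r / 2) (8 * r)"
 proof
  fix x assume "x : ball z (3 * r)"
  from ball_norm_bounds[OF this] show "x : ann (r / 2) (8 * r)" using r by (simp add: ann_def)
 qed
 have fin: "L2 (ball z (3 * r)) G < \<infinity>" by (rule le_less_trans[OF L2_mono_set[OF sub] G_L2_ann]) (use r(1) in simp)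
 have "0 < dg_const CARD('n) (4 * L / lam) * (3 * r - 2 * r) ^ CARD('n)"
  using dg_const_pos caccioppoli_const_pos r by simp
 then obtain b where b: "0 < b" "L2 (ball z (3 * r)) G <= ennreal (dg_const CARD('n) (4 * L / lam) * (3 * r - 2 * r) ^ CARD('n) * b\<^sup>2)"
  using ennreal_quadratic_level[OF _ fin] by blast
 have "AE x\<in>ball z (2 * r) in lborel. G x <= b" by (rule G_local_max[OF r _ _ _ b]) (use r in auto)
 then show ?thesis using that b(1) by blast
qed

lemma G_bound_step:
 assumes r: "r > 0" "norm z = 4 * r" and t: "0 <= t" "t < t'" "t' <= 2 * r"
  and M: "M > 0" "AE x\<in>ball z t' in lborel. G x <= M"
  and K: "K > 0" "576 * r\<^sup>2 * M / lam <= dg_const CARD('n) (4 * L / lam) * (t' - t) ^ CARD('n) * K\<^sup>2"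
 shows "AE x\<in>ball z t in lborel. G x <= K"
proof (rule G_local_max[OF r t(1,2) _ K(1)])
 have "L2 (ball z t') G = L2 (ball z t') (G_trunc M)"
  by (rule L2_cong_AE) (use M(2) in eventually_elim, auto simp: G_trunc_def)
 also have "\<dots> <= L2 (ball 0 (6 * r)) (G_trunc M)"
 proof (rule L2_mono_set, rule)
  fix x assume "x : ball z t'"
  from ball_norm_bounds[OF this] show "x : ball 0 (6 * r)" using r t by simp
 qed
 also have "\<dots> <= ennreal (16 * (6 * r)^2 * M / lam)" using M r by (intro G_trunc_hardy) auto
 also have "\<dots> <= ennreal (dg_const CARD('n) (4 * L / lam) * (t' - t) ^ CARD('n) * K\<^sup>2)"
  using K(2) by (intro ennreal_leI) (simp add: power_mult_distrib)
 finally show "L2 (ball z t') G <= ennreal (dg_const CARD('n) (4 * L / lam) * (t' - t) ^ CARD('n) * K\<^sup>2)" .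
qed (use t r in simp)

definition G_scale :: "real => real" where
 "G_scale r = 576 / (lam * dg_const CARD('n) (4 * L / lam)) * r\<^sup>2 / r ^ CARD('n) * (2 ^ CARD('n))\<^sup>2 / 2"

lemma G_scale_pos: "r > 0 ==> G_scale r > 0"
 using lam_pos dg_const_pos[of "4 * L / lam" "CARD('n)"] caccioppoli_const_pos by (simp add: G_scale_def)

text \<open>By the inequality \<open>4 x y <= (x + y)^2\<close>, applied to the two summands of the new bound.\<close>

lemma G_scale_level:
 assumes r: "r > 0" and M: "M > 0"
 shows "576 * r\<^sup>2 * M / lam <= dg_const CARD('n) (4 * L / lam) * (r * (1 / 2) ^ Suc m) ^ CARD('n)
  * (1 / (2 * 2 ^ CARD('n)) * M + G_scale r * (2 ^ CARD('n)) ^ m)^2"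
proof -
 define c where "c = dg_const CARD('n) (4 * L / lam)"
 define q :: real where "q = 2 ^ CARD('n)"
 define x where "x = 1 / (2 * q) * M"
 define y where "y = G_scale r * q ^ m"
 have c: "c > 0" using dg_const_pos caccioppoli_const_pos by (simp add: c_def)
 have q: "q > 0" by (simp add: q_def)
 have "((1 / 2 :: real) ^ Suc m) ^ CARD('n) = ((1 / 2) ^ CARD('n)) ^ Suc m" by (simp only: power_mult[symmetric] mult.commute)
 also have "\<dots> = 1 / (q * q ^ m)" by (simp add: q_def power_divide)
 finally have "576 * r\<^sup>2 * M / lam = c * (r * (1 / 2) ^ Suc m) ^ CARD('n) * (4 * x * y)"
  using q r c lam_pos unfolding x_def y_def G_scale_def c_def[symmetric] q_def[symmetric]
  by (simp add: power_mult_distrib power2_eq_square field_simps del: power_Suc)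
 also have "\<dots> <= c * (r * (1 / 2) ^ Suc m) ^ CARD('n) * (x + y)^2"
 proof (rule mult_left_mono)
  show "4 * x * y <= (x + y)^2" using zero_le_power2[of "x - y"] by (simp add: power2_sum power2_diff)
 qed (use c r in simp)
 finally show ?thesis by (simp add: x_def y_def c_def q_def)
qed

lemma G_bound_iterate:
 assumes r: "r > 0" "norm z = 4 * r" and "M > 0" "AE x\<in>ball z (2 * r - r * (1 / 2) ^ m) in lborel. G x <= M"
 shows "AE x\<in>ball z r in lborel. G x <= (1 / (2 * 2 ^ CARD('n))) ^ m * M + 2 * G_scale r * (1 - (1 / 2) ^ m)"
 using assms(3,4)
proof (induction m arbitrary: M)
 case 0
 then show ?case by simp
next
 case (Suc m)
 define q :: real where "q = 2 ^ CARD('n)"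
 define a where "a = G_scale r"
 define K where "K = 1 / (2 * q) * M + a * q ^ m"
 have q: "q > 0" and a: "a > 0" using G_scale_pos[OF r(1)] by (simp_all add: q_def a_def)
 have K: "K > 0" using Suc.prems(1) q a by (simp add: K_def add_pos_pos)
 have "(1 / 2 :: real) ^ m <= 1" by (rule power_le_one) auto
 from mult_left_mono[OF this, of r] have shrink: "r * (1 / 2) ^ m <= r" using r by simp
 have "AE x\<in>ball z (2 * r - r * (1 / 2) ^ m) in lborel. G x <= K"
 proof (rule G_bound_step[OF r _ _ _ Suc.prems K])
  have "2 * r - r * (1 / 2) ^ Suc m - (2 * r - r * (1 / 2) ^ m) = r * (1 / 2) ^ Suc m" by simp
  then show "576 * r\<^sup>2 * M / lam <= dg_const CARD('n) (4 * L / lam)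
    * (2 * r - r * (1 / 2) ^ Suc m - (2 * r - r * (1 / 2) ^ m)) ^ CARD('n) * K\<^sup>2"
   using G_scale_level[OF r(1) Suc.prems(1), of m] by (simp only: K_def a_def q_def)
 qed (use r shrink in auto)
 from Suc.IH[OF K this] show ?case
 proof (eventually_elim, intro impI)
  fix x assume "x : ball z r --> G x <= (1 / (2 * 2 ^ CARD('n))) ^ m * K + 2 * G_scale r * (1 - (1 / 2) ^ m)" "x : ball z r"
  then have bound: "G x <= (1 / (2 * q)) ^ m * K + 2 * a * (1 - (1 / 2) ^ m)" by (simp add: q_def a_def)
  have "(1 / (2 * q)) ^ m * q ^ m = (1 / 2) ^ m" using q by (simp add: power_mult_distrib[symmetric])
  then have "(1 / (2 * q)) ^ m * K = (1 / (2 * q)) ^ Suc m * M + a * (1 / 2) ^ m"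
   unfolding K_def by (simp add: algebra_simps)
  then have "G x <= (1 / (2 * q)) ^ Suc m * M + 2 * a * (1 - (1 / 2) ^ Suc m)"
   using bound by (simp add: algebra_simps)
  then show "G x <= (1 / (2 * 2 ^ CARD('n))) ^ Suc m * M + 2 * G_scale r * (1 - (1 / 2) ^ Suc m)" by (simp only: q_def a_def)
 qed
qed

lemma G_bound_ball:
 assumes r: "r > 0" "norm z = 4 * r"
 shows "AE x\<in>ball z r in lborel. G x <= 3 * G_scale r"
proof -
 obtain b where b: "b > 0" "AE x\<in>ball z (2 * r) in lborel. G x <= b" using G_locally_bounded[OF r] by blast
 define \<tau> :: real where "\<tau> = 1 / (2 * 2 ^ CARD('n))"
 have "(1::real) <= 2 ^ CARD('n)" by (rule one_le_power) simp
 then have "1 < 2 * (2::real) ^ CARD('n)" by linarith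
 then have "\<tau> < 1" by (simp add: \<tau>_def)
 then obtain m where m: "\<tau> ^ m < G_scale r / b" using real_arch_pow_inv[of "G_scale r / b" \<tau>] G_scale_pos[OF r(1)] b by auto
 have "AE x\<in>ball z (2 * r - r * (1 / 2) ^ m) in lborel. G x <= b"
  using b(2) by eventually_elim (use r in \<open>auto intro: less_trans\<close>)
 from G_bound_iterate[OF r b(1) this] show ?thesis
 proof (eventually_elim, intro impI)
  fix x assume x: "x : ball z r --> G x <= (1 / (2 * 2 ^ CARD('n))) ^ m * b + 2 * G_scale r * (1 - (1 / 2) ^ m)" "x : ball z r"
  have "\<tau> ^ m * b <= G_scale r" using m b(1) by (simp add: field_simps)
  moreover have "2 * G_scale r * (1 - (1 / 2) ^ m) <= 2 * G_scale r" using G_scale_pos[OF r(1)] by simp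
  ultimately show "G x <= 3 * G_scale r" using x by (simp add: \<tau>_def)
 qed
qed

lemma G_upper: "AEL x. G x * norm x ^ CARD('n) <= green_upper CARD('n) lam L * (norm x)^2"
proof -
 have "AE x\<in>- {0} in lborel. G x * norm x ^ CARD('n) <= green_upper CARD('n) lam L * (norm x)^2"
 proof (rule AE_locally, intro conjI)
  fix z :: "real^'n" assume z: "z : - {0}"
  define r where "r = norm z / 4"
  have r: "r > 0" "norm z = 4 * r" using z by (auto simp: r_def)
  show "0 < norm z / 4" using z by simp
  show "AE x\<in>ball z (norm z / 4) in lborel. G x * norm x ^ CARD('n) <= green_upper CARD('n) lam L * (norm x)^2"
   using G_bound_ball[OF r]
  proof (eventually_elim, intro impI)
   fix x assume "x : ball z r --> G x <= 3 * G_scale r" "x : ball z (norm z / 4)"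
   then have x: "G x <= 3 * G_scale r" "x : ball z r" by (simp_all add: r_def)
   note bounds = ball_norm_bounds[OF x(2)]
   have "G x * norm x ^ CARD('n) <= 3 * G_scale r * (5 * r) ^ CARD('n)"
    using x(1) bounds r G_nonneg[of x] G_scale_pos[OF r(1)] by (intro mult_mono power_mono) auto
   also have "\<dots> = green_upper CARD('n) lam L * r\<^sup>2"
    using r by (simp add: G_scale_def green_upper_def power_mult_distrib field_simps)
   also have "\<dots> <= green_upper CARD('n) lam L * (norm x)^2"
    using bounds r green_upper_pos by (intro mult_left_mono power_mono) auto
   finally show "G x * norm x ^ CARD('n) <= green_upper CARD('n) lam L * (norm x)^2" .
  qed
 qed
 with AE_lborel_singleton[of "0::real^'n"] show ?thesis by eventually_elim auto
qed

lemma G_upper_outside: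
 assumes r: "r > 0"
 shows "AEL x. r <= norm x --> G x < 2 * green_upper CARD('n) lam L * r\<^sup>2 / r ^ CARD('n)"
 using G_upper
proof (eventually_elim, intro impI)
 fix x :: "real^'n"
 define C where "C = green_upper CARD('n) lam L"
 assume "G x * norm x ^ CARD('n) <= green_upper CARD('n) lam L * (norm x)^2" and x: "r <= norm x"
 then have upper: "G x * norm x ^ CARD('n) <= C * (norm x)^2" by (simp add: C_def)
 obtain m where m: "CARD('n) = m + 2" using n3 by (metis add.commute le_Suc_ex numeral_3_eq_3 numeral_2_eq_2 Suc_leD)
 have "norm x > 0" using r x by linarith
 moreover have "G x * norm x ^ m * (norm x)^2 <= C * (norm x)^2" using upper unfolding m power_add by (simp add: mult.assoc)
 ultimately have "G x * norm x ^ m <= C" by simp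
 moreover have "G x * r ^ m <= G x * norm x ^ m" using x r G_nonneg[of x] by (intro mult_left_mono power_mono) auto
 ultimately have "G x * r ^ m < 2 * C" using green_upper_pos unfolding C_def by linarith
 then have "G x < 2 * C / r ^ m" using r by (simp add: pos_less_divide_eq)
 moreover have "2 * C * r\<^sup>2 / r ^ CARD('n) = 2 * C / r ^ m" unfolding m power_add using r by simp
 ultimately show "G x < 2 * green_upper CARD('n) lam L * r\<^sup>2 / r ^ CARD('n)" by (simp only: C_def)
qed

end

definition level_height :: "nat => real => real => real" where
 "level_height n lam L = lam / (12 * L * (12 * L * unit_ball_vol (real n) * 2 ^ n))"

definition level_fraction :: "nat => real => real => real" where
 "level_fraction n lam L = lam / (12 * L * green_upper n lam L) / (3 * L * unit_ball_vol (real n) * 2 ^ n)"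

definition green_lower :: "nat => real => real => real" where
 "green_lower n lam L = growth_const n (4 * L / lam) (level_fraction n lam L) * level_height n lam L"

lemma two_mult_le_weighted_square:
 fixes a t :: real
 assumes "t > 0"
 shows "2 * a <= t * a\<^sup>2 + 1 / t"
proof -
 have "0 <= (t * a - 1)^2 / t" using assms by simp
 also have "\<dots> = t * a\<^sup>2 + 1 / t - 2 * a" using assms by (simp add: power2_diff field_simps power2_eq_square)
 finally show ?thesis by simp
qed

lemma (in elliptic) level_height_pos: "level_height CARD('n) lam L > 0"
 using lam_pos L_pos by (simp add: level_height_def)

lemma (in elliptic) level_fraction_pos: "level_fraction CARD('n) lam L > 0"
 using lam_pos L_pos green_upper_pos by (simp add: level_fraction_def)

lemma (in elliptic) green_lower_pos: "green_lower CARD('n) lam L > 0"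
 using growth_const_bounds(1)[OF caccioppoli_const_pos level_fraction_pos] level_height_pos by (simp add: green_lower_def)

context fundamental
begin

lemma flux_density_bound:
 assumes r: "r > 0" and s: "s > 0" "s' > 0" and \<eta>: "cutoff 0 r (2 * r) \<eta>" and N: "r <= norm x --> G x < N"
 shows "norm ((A x *v H x) \<bullet> grad \<eta> x) <= 3 * L / (2 * r) * (s * (norm (H_trunc k x))^2 + 1 / s * ind (ball 0 (2 * r)) x
  + s' * (norm (H_trunc N x))^2 + 1 / s' * ind {x : ball 0 (2 * r). k <= G_trunc k x} x)"
proof (cases "x : ball 0 (2 * r) & r < norm x")
 case False
 then have "grad \<eta> x = 0" using cutoffD(6,8)[OF \<eta>, of x] by auto
 then show ?thesis using r s L_pos by simp
next
 case True
 have "norm ((A x *v H x) \<bullet> grad \<eta> x) <= norm (A x *v H x) * norm (grad \<eta> x)"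
  using Cauchy_Schwarz_ineq2[of "A x *v H x" "grad \<eta> x"] by simp
 also have "\<dots> <= (L * norm (H x)) * (3 / r)" using A_norm[of x "H x"] cutoffD(4)[OF \<eta>, of x] L_pos by (intro mult_mono) auto
 also have "\<dots> = 3 * L / (2 * r) * (2 * norm (H x))" by simp
 also have "\<dots> <= 3 * L / (2 * r) * (s * (norm (H_trunc k x))^2 + 1 / s * ind (ball 0 (2 * r)) x
  + s' * (norm (H_trunc N x))^2 + 1 / s' * ind {x : ball 0 (2 * r). k <= G_trunc k x} x)"
 proof (rule mult_left_mono)
  show "2 * norm (H x) <= s * (norm (H_trunc k x))^2 + 1 / s * ind (ball 0 (2 * r)) x
   + s' * (norm (H_trunc N x))^2 + 1 / s' * ind {x : ball 0 (2 * r). k <= G_trunc k x} x"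
  proof (cases "G x < k")
   case below: True
   have "0 <= s' * (norm (H_trunc N x))^2" using s by simp
   moreover have "0 <= 1 / s' * ind {x : ball 0 (2 * r). k <= G_trunc k x} x" using s by simp
   ultimately show ?thesis
    using two_mult_le_weighted_square[OF s(1), of "norm (H x)"] below True by (simp add: H_trunc_def)
  next
   case above: False
   have "2 * norm (H x) <= s' * (norm (H_trunc N x))^2 + 1 / s' * ind {x : ball 0 (2 * r). k <= G_trunc k x} x"
    using two_mult_le_weighted_square[OF s(2), of "norm (H x)"] above True N by (simp add: H_trunc_def G_trunc_def)
   moreover have "0 <= s * (norm (H_trunc k x))^2" "0 <= 1 / s * ind (ball 0 (2 * r)) x" using s by auto
   ultimately show ?thesis by linarith
  qed
 qed (use r L_pos in simp)
 finally show ?thesis .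
qed

lemma flux_lower_bound:
 assumes r: "r > 0" and k: "k > 0" "N > 0" and s: "s > 0" "s' > 0" and decay: "AEL x. r <= norm x --> G x < N"
 shows "1 <= ennreal (3 * L / (2 * r)) * (ennreal (s * k / lam) + ennreal (1 / s) * emeasure lborel (ball (0::real^'n) (2 * r))
  + ennreal (s' * N / lam) + ennreal (1 / s') * emeasure lborel {x : ball 0 (2 * r). k <= G_trunc k x})"
proof -
 obtain \<eta> where \<eta>: "cutoff (0::real^'n) r (2 * r) \<eta>" using cutoff_exists[of r "2 * r"] r by auto
 note [measurable] = grad_measurable[OF cutoffD(1)[OF \<eta>]]
 define m where "m = 3 * L / (2 * r)"
 define T where "T = ball (0::real^'n) (2 * r)"
 define E where "E = {x : ball 0 (2 * r). k <= G_trunc k x}"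
 have [measurable]: "T : sets borel" "E : sets borel" unfolding T_def E_def by measurable
 have m: "m > 0" using L_pos r by (simp add: m_def)
 have flux_eq: "(LBINT x. (A x *v H x) \<bullet> grad \<eta> x) = 1" using flux_cutoff[OF \<eta>] r by simp
 then have "integrable lborel (%x. (A x *v H x) \<bullet> grad \<eta> x)" using not_integrable_integral_eq by force
 then have "1 <= (NN x. ennreal (norm ((A x *v H x) \<bullet> grad \<eta> x)))"
  using integral_norm_bound_ennreal[of lborel "%x. (A x *v H x) \<bullet> grad \<eta> x"] flux_eq by simp
 also have "\<dots> <= (NN x. ennreal m * (ennreal s * (ennreal ((norm (H_trunc k x))^2) * ind UNIV x) + ennreal (1 / s) * ind T x
   + ennreal s' * (ennreal ((norm (H_trunc N x))^2) * ind UNIV x) + ennreal (1 / s') * ind E x))"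
 proof (rule nn_integral_mono_AE, use decay in eventually_elim)
  case (elim x)
  from flux_density_bound[OF r s \<eta> elim, of k, folded m_def T_def E_def] ennreal_leI
  have "ennreal (norm ((A x *v H x) \<bullet> grad \<eta> x)) <= ennreal (m * (s * (norm (H_trunc k x))^2 + 1 / s * ind T x
   + s' * (norm (H_trunc N x))^2 + 1 / s' * ind E x))" by blast
  then show ?case using s m by (cases "x : T"; cases "x : E") (simp_all add: ennreal_mult ennreal_plus)
 qed
 also have "\<dots> = ennreal m * (ennreal s * L2 UNIV (H_trunc k) + ennreal (1 / s) * emeasure lborel T
   + ennreal s' * L2 UNIV (H_trunc N) + ennreal (1 / s') * emeasure lborel E)"
  unfolding L2_def by (simp add: nn_integral_add nn_integral_cmult)
 also have "\<dots> <= ennreal m * (ennreal s * ennreal (k / lam) + ennreal (1 / s) * emeasure lborel T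
   + ennreal s' * ennreal (N / lam) + ennreal (1 / s') * emeasure lborel E)"
  using H_trunc_energy[OF k(1)] H_trunc_energy[OF k(2)] by (intro add_mono mult_left_mono) auto
 finally show ?thesis using s k lam_pos by (simp add: m_def T_def E_def ennreal_mult[symmetric])
qed

lemma level_set_large:
 fixes r :: real
 defines "k \<equiv> level_height CARD('n) lam L * r\<^sup>2 / r ^ CARD('n)"
 assumes r: "r > 0"
 shows "ennreal (level_fraction CARD('n) lam L) * emeasure lborel (ball (0::real^'n) (2 * r))
  <= emeasure lborel {x : ball 0 (2 * r). k <= G_trunc k x}" (is "_ <= emeasure lborel ?E")
proof -
 define n where "n = CARD('n)"
 define V where "V = unit_ball_vol (real n)"
 define C where "C = green_upper n lam L"
 define m where "m = 3 * L / (2 * r)"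
 define s where "s = 12 * L * V * 2 ^ n * r ^ n / r"
 define s' where "s' = lam / (12 * L * C) * r ^ n / r"
 define N where "N = 2 * C * r\<^sup>2 / r ^ n"
 have C: "C > 0" and V: "V > 0" using green_upper_pos by (simp_all add: C_def V_def n_def)
 have pos: "k > 0" "N > 0" "s > 0" "s' > 0" "m > 0"
  using r C V L_pos lam_pos level_height_pos by (simp_all add: k_def N_def s_def s'_def m_def)
 have T: "emeasure lborel (ball (0::real^'n) (2 * r)) = ennreal (V * (2 * r) ^ n)"
  using emeasure_ball_eq[of "2 * r" "0::real^'n"] r by (simp add: V_def n_def)
 have "emeasure lborel ?E <= emeasure lborel (ball (0::real^'n) (2 * r))" by (rule emeasure_mono) auto
 then obtain e where e: "e \<ge> 0" "emeasure lborel ?E = ennreal e" unfolding T by (cases "emeasure lborel ?E") (auto simp: top_unique)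
 have "1 <= ennreal m * (ennreal (s * k / lam) + ennreal (1 / s) * ennreal (V * (2 * r) ^ n) + ennreal (s' * N / lam) + ennreal (1 / s') * ennreal e)"
  using flux_lower_bound[OF r pos(1,2,3,4)] G_upper_outside[OF r] T e(2) by (simp add: m_def N_def C_def n_def)
 also have "\<dots> = ennreal (m * (s * k / lam + 1 / s * (V * (2 * r) ^ n) + s' * N / lam + 1 / s' * e))"
  using pos lam_pos V r e(1) by (simp add: ennreal_mult[symmetric] ennreal_plus[symmetric] del: ennreal_plus)
 finally have "1 <= m * (s * k / lam + 1 / s * (V * (2 * r) ^ n) + s' * N / lam + 1 / s' * e)"
  using pos lam_pos V r e(1) by (simp add: ennreal_1[symmetric] del: ennreal_1)
 moreover have "m * (s * k / lam) = 1 / 8"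
  using r lam_pos L_pos V by (simp add: m_def s_def k_def level_height_def V_def[symmetric] n_def[symmetric] field_simps power2_eq_square)
 moreover have "m * (1 / s * (V * (2 * r) ^ n)) = 1 / 8" using r L_pos V by (simp add: m_def s_def field_simps power_mult_distrib)
 moreover have "m * (s' * N / lam) = 1 / 4" using r lam_pos L_pos C by (simp add: m_def s'_def N_def field_simps power2_eq_square)
 ultimately have "1 / 2 <= m * (1 / s' * e)" unfolding distrib_left by linarith
 then have "s' / (2 * m) <= e" using pos by (simp add: field_simps)
 moreover have "s' / (2 * m) = level_fraction n lam L * (V * (2 * r) ^ n)"
  using r L_pos V by (simp add: s'_def m_def level_fraction_def C_def V_def[symmetric] power_mult_distrib field_simps)
 ultimately show ?thesis
  using level_fraction_pos V r e(2) unfolding T by (simp add: n_def ennreal_mult[symmetric] ennreal_leI)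
qed

lemma G_lower:
 assumes r: "r > 0"
 shows "AE x\<in>ball 0 r in lborel. green_lower CARD('n) lam L * r\<^sup>2 <= G x * r ^ CARD('n)"
proof -
 define k where "k = level_height CARD('n) lam L * r\<^sup>2 / r ^ CARD('n)"
 have k: "k > 0" using r level_height_pos by (simp add: k_def)
 have "AE x\<in>ball 0 (2 * r / 2) in lborel. growth_const CARD('n) (4 * L / lam) (level_fraction CARD('n) lam L) * k <= G_trunc k x"
 proof (rule growth[OF _ supersol_H_trunc _ _ k level_fraction_pos])
  show "sobolev (ball 0 (2 * (2 * r))) UNIV (G_trunc k) (H_trunc k)"
   by (rule sobolev_mono[OF sobolev_G_trunc[of "2 * (2 * r)" k]]) (use r k in auto)
  show "ennreal (level_fraction CARD('n) lam L) * emeasure lborel (ball (0::real^'n) (2 * r))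
   <= emeasure lborel {x : ball 0 (2 * r). k <= G_trunc k x}" unfolding k_def by (rule level_set_large[OF r])
 qed (use r k G_trunc_bounds(1)[OF k] in auto)
 then show ?thesis
 proof (eventually_elim, intro impI)
  fix x :: "real^'n"
  assume "x : ball 0 (2 * r / 2) --> growth_const CARD('n) (4 * L / lam) (level_fraction CARD('n) lam L) * k <= G_trunc k x" "x : ball 0 r"
  then have "growth_const CARD('n) (4 * L / lam) (level_fraction CARD('n) lam L) * k <= G x" by (simp add: G_trunc_def)
  from mult_right_mono[OF this, of "r ^ CARD('n)"] show "green_lower CARD('n) lam L * r\<^sup>2 <= G x * r ^ CARD('n)"
   using r by (simp add: k_def green_lower_def mult.assoc)
 qed
qed

end

subsection \<open>Decay of the weighted energy\<close>

lemma cos_ge_half: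
 fixes t :: real
 assumes "\<bar>t\<bar> <= 1"
 shows "1 / 2 <= cos t"
proof -
 have "(sin (t / 2))^2 <= (t / 2)^2" using abs_sin_x_le_abs_x[of "t / 2"] by (simp only: abs_le_square_iff)
 moreover have "t\<^sup>2 <= 1" using assms by (simp add: abs_square_le_1)
 moreover have "cos t = 1 - 2 * (sin (t / 2))^2" using cos_double_sin[of "t / 2"] by simp
 ultimately show ?thesis by (simp add: power_divide)
qed

lemma lipschitz_C1_sin:
 assumes "m > 0"
 shows "lipschitz_C1 1 (%t. m * sin ((t - c) / m)) (%t. cos ((t - c) / m))"
 unfolding lipschitz_C1_def using assms by (auto intro!: derivative_eq_intros continuous_intros)

lemma lipschitz_C1_cos:
 assumes "m > 0"
 shows "lipschitz_C1 m (%t. m\<^sup>2 * (1 - cos ((t - c) / m))) (%t. m * sin ((t - c) / m))"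
  and "lipschitz_C1 m (%t. m\<^sup>2 * (1 + cos ((t - c) / m))) (%t. - (m * sin ((t - c) / m)))"
 unfolding lipschitz_C1_def using assms
 by (auto intro!: derivative_eq_intros continuous_intros simp: power2_eq_square abs_mult mult_left_le)

lemma C1_diff:
 assumes f: "C1 f" and g: "C1 g"
 shows "C1 (%x. f x - g x)" "grad (%x. f x - g x) = (%x. grad f x - grad g x)"
proof -
 have "((%x. f x - g x) has_derivative (%h. (grad f x - grad g x) \<bullet> h)) (at x)" for x
  unfolding inner_diff_left using f g by (intro has_derivative_diff) (auto simp: C1_def)
 moreover have "continuous_on UNIV (%x. grad f x - grad g x)" using f g by (intro continuous_on_diff C1_continuous_grad)
 ultimately show "C1 (%x. f x - g x)" "grad (%x. f x - g x) = (%x. grad f x - grad g x)" by (rule C1I)+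
qed

lemma sobolev_diff:
 fixes u v :: "real^'n => real"
 assumes u: "sobolev S X u g" and v: "sobolev S Y v h"
  and Z: "!!w w'. w : X ==> w' : Y ==> (%x. w x - w' x) : Z"
 shows "sobolev S Z (%x. u x - v x) (%x. g x - h x)"
proof -
 obtain w where w: "!!j. w j : X" "H1_tendsto S w u g" using sobolevE[OF u] by blast
 obtain w' where w': "!!j. w' j : Y" "H1_tendsto S w' v h" using sobolevE[OF v] by blast
 note lim = H1_tendstoD[OF w(2)] and lim' = H1_tendstoD[OF w'(2)]
 note [measurable] = sobolevD(1-3)[OF u] sobolevD(2,3)[OF v] lim(5,6) lim'(5,6)
 note C1 = C1_diff[OF lim(1) lim'(1)]
 have minus_finite: "L2 S (%x. - f x) < \<infinity>" if "L2 S f < \<infinity>" for f :: "real^'n => 'b::euclidean_space"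
  using that by (simp add: L2_def)
 have tendsto: "(%j. L2 S (%x. (f j x - f' j x) - (p x - p' x))) ---> 0"
  if [measurable]: "!!j. f j : Borel" "!!j. f' j : Borel" "p : Borel" "p' : Borel"
   and "(%j. L2 S (%x. f j x - p x)) ---> 0" "(%j. L2 S (%x. f' j x - p' x)) ---> 0"
  for f f' :: "nat => real^'n => 'b::euclidean_space" and p p'
 proof (rule ennreal_tendsto_0_le[OF ennreal_tendsto_0_lincomb[OF that(5,6), of 2 2]])
  fix j
  have "L2 S (%x. (f j x - f' j x) - (p x - p' x)) = L2 S (%x. (f j x - p x) + (p' x - f' j x))" by (simp add: algebra_simps)
  also have "\<dots> <= 2 * L2 S (%x. f j x - p x) + 2 * L2 S (%x. p' x - f' j x)" by (rule L2_add) measurable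
  finally show "L2 S (%x. (f j x - f' j x) - (p x - p' x)) <= 2 * L2 S (%x. f j x - p x) + 2 * L2 S (%x. f' j x - p' x)"
   by (simp only: L2_minus_commute[of S p'])
 qed auto
 show ?thesis
 proof (rule sobolevI[where w="%j x. w j x - w' j x"])
  show "L2 S (%x. u x - v x) < \<infinity>" "L2 S (%x. g x - h x) < \<infinity>"
   using L2_add_finite[OF _ _ _ sobolevD(4)[OF u] minus_finite[OF sobolevD(4)[OF v]]]
    L2_add_finite[OF _ _ _ sobolevD(5)[OF u] minus_finite[OF sobolevD(5)[OF v]]] by simp_all
  show "(%j. L2 S (%x. w j x - w' j x - (u x - v x))) ---> 0" by (rule tendsto[OF _ _ _ _ lim(2) lim'(2)]) measurable
  show "(%j. L2 S (%x. grad (%x. w j x - w' j x) x - (g x - h x))) ---> 0"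
   unfolding C1(2) by (rule tendsto[OF _ _ _ _ lim(3) lim'(3)]) measurable
 qed (use Z w(1) w'(1) C1(1) in auto)
qed

context elliptic
begin

lemma sol_sobolev:
 assumes s: "sol S g" and g: "g : Borel" "L2 S g < \<infinity>" and \<phi>: "sobolev S (C1c S) \<phi> h"
 shows "(LBINT x. ind S x * ((A x *v g x) \<bullet> h x)) = 0"
proof (rule C1c_pairing_limit[OF g \<phi>])
 fix w :: "nat => real^'n => real" assume w: "!!j. w j : C1c S"
  "(%j. LBINT x. ind S x * ((A x *v g x) \<bullet> grad (w j) x)) ---> (LBINT x. ind S x * ((A x *v g x) \<bullet> h x))"
 have "(LBINT x. ind S x * ((A x *v g x) \<bullet> grad (w j) x)) = 0" for j using s w(1)[of j] by (simp add: sol_def)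
 then show ?thesis using w(2) by (simp add: LIMSEQ_const_iff)
qed simp

lemma sobolev_pairing_integrable:
 assumes "g : Borel" "L2 S g < \<infinity>" "sobolev S X \<phi> h"
 shows "integrable lborel (%x. ind S x * ((A x *v g x) \<bullet> h x))"
proof -
 note [measurable] = assms(1) sobolevD(1-3)[OF assms(3)]
 show ?thesis by (rule L2_inner_integrable[OF _ _ _ L2_A_finite[OF assms(1) _ assms(2)] sobolevD(5)[OF assms(3)]]) measurable
qed

end

text \<open>The identity behind the estimate is \<open>div(A\<nabla>\<Phi>(u - c)) = \<Phi>''(u - c) A\<nabla>u\<cdot>\<nabla>u\<close> for a solution \<open>u\<close>; a bounded \<open>\<Phi>\<close> that is convex on
 \<open>[-m, m]\<close> makes all truncations of \<open>u\<close> unnecessary.\<close>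

locale bounded_oscillation = fundamental A lam L G H
 for A :: "real^'n => real^'n^'n" and lam L and G :: "real^'n => real" and H +
 fixes u :: "real^'n => real" and g :: "real^'n => real^'n" and \<rho> c m k N :: real and \<theta> :: "real^'n => real"
 assumes \<rho>: "\<rho> > 0" and sol: "sol (ball 0 \<rho>) g" and u: "sobolev (ball 0 \<rho>) UNIV u g"
  and m: "m > 0" and osc: "AE x\<in>ball 0 \<rho> in lborel. \<bar>u x - c\<bar> <= m"
  and k: "k > 0" "k < N" and outside: "AEL x. \<rho> / 2 <= norm x --> G x < k"
  and \<theta>: "cutoff 0 (\<rho> / 2) (3 * \<rho> / 4) \<theta>"
begin

abbreviation S :: "(real^'n) set" where "S \<equiv> ball 0 \<rho>"

definition level :: "real^'n => real" where "level x = G_trunc N x - G_trunc k x"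

definition level_grad :: "real^'n => real^'n" where "level_grad x = H_trunc N x - H_trunc k x"

definition phase :: "real^'n => real" where "phase x = (u x - c) / m"

definition upper_flux :: "real^'n => real" where
 "upper_flux x = ind S x * ((A x *v H_trunc N x) \<bullet> (\<theta> x *. ((m * sin (phase x)) *. g x) + (m\<^sup>2 * (1 - cos (phase x))) *. grad \<theta> x))"

definition lower_flux :: "real^'n => real" where
 "lower_flux x = ind S x * ((A x *v H_trunc k x) \<bullet> (\<theta> x *. (- (m * sin (phase x)) *. g x) + (m\<^sup>2 * (1 + cos (phase x))) *. grad \<theta> x))"

definition level_flux :: "real^'n => real" where
 "level_flux x = ind S x * ((A x *v g x) \<bullet> (level x *. (cos (phase x) *. g x) + (m * sin (phase x)) *. level_grad x))"

definition level_energy :: "real^'n => real" where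
 "level_energy x = ind S x * ((A x *v g x) \<bullet> ((level x * cos (phase x)) *. g x))"

lemma N: "N > 0" using k by simp

lemmas u_measurable [measurable] = sobolevD(2)[OF u] sobolevD(3)[OF u]

lemma level_measurable [measurable]: "level : Borel" "level_grad : Borel" "phase : Borel"
 unfolding level_def[abs_def] level_grad_def[abs_def] phase_def[abs_def] by measurable

lemma S_finite: "emeasure lborel S < \<infinity>" using emeasure_lborel_ball_finite[of "0::real^'n" \<rho>] by simp

lemma level_bounds: "0 <= level x" "level x <= N"
 using G_trunc_bounds(1)[OF k(1), of x] G_trunc_bounds(2)[of N x] k by (auto simp: level_def G_trunc_def)

lemma \<theta>_C1c: "\<theta> : C1c S" using \<rho> by (intro cutoff_C1c[OF \<theta>]) simp

lemma sobolev_level: "sobolev S {\<phi> : C1c S. ALL x. \<bar>\<phi> x\<bar> <= N} level level_grad"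
proof -
 have "sobolev S {w. ALL x. \<bar>w x\<bar> <= N} level level_grad"
  unfolding level_def[abs_def] level_grad_def[abs_def]
 proof (rule sobolev_diff[OF sobolev_G_trunc[OF \<rho> N] sobolev_G_trunc[OF \<rho> k(1)]])
  fix w w' :: "real^'n => real" assume w: "w : between N" "w' : between k"
  have "\<bar>w x - w' x\<bar> <= N" for x
  proof -
   have "0 <= w x" "w x <= N" "0 <= w' x" "w' x <= k" using w by auto
   then show ?thesis using k by linarith
  qed
  then show "(%x. w x - w' x) : {w. ALL x. \<bar>w x\<bar> <= N}" by simp
 qed
 then show ?thesis
 proof (rule sobolev_extend_by_zero[OF _ \<theta>])
  show "AE x\<in>S in lborel. x ~: cball 0 (\<rho> / 2) --> level x = 0 & level_grad x = 0"
   using outside by eventually_elim (use k in \<open>auto simp: level_def level_grad_def G_trunc_def H_trunc_def\<close>)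
  fix w :: "real^'n => real" assume w: "w : {w. ALL x. \<bar>w x\<bar> <= N}" "C1 w"
  have "\<bar>\<theta> x * w x\<bar> <= 1 * N" for x
   unfolding abs_mult using w(1) cutoffD(2,3)[OF \<theta>, of x] by (intro mult_mono) auto
  then show "(%x. \<theta> x * w x) : {\<phi> : C1c S. ALL x. \<bar>\<phi> x\<bar> <= N}" using C1c_mult[OF \<theta>_C1c w(2)] by simp
 qed (use \<rho> in auto)
qed

lemma phase_composite_finite: "lipschitz_C1 M F F' ==> L2 S (%x. F (u x)) < \<infinity>"
 by (rule L2_lipschitz_C1_finite[OF sobolevD(1,2)[OF u] S_finite sobolevD(4)[OF u]])

lemma upper_flux: "integrable lborel upper_flux" "0 <= (LBINT x. upper_flux x)"
proof -
 have test: "sobolev S {\<phi> : C1c S. ALL x. 0 <= \<phi> x} (%x. \<theta> x * (m\<^sup>2 * (1 - cos (phase x))))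
  (%x. \<theta> x *. ((m * sin (phase x)) *. g x) + (m\<^sup>2 * (1 - cos (phase x))) *. grad \<theta> x)"
  unfolding phase_def
  by (rule sobolev_test_function[OF u lipschitz_C1_cos(1)[OF m] _ phase_composite_finite[OF lipschitz_C1_cos(1)[OF m]] \<theta>_C1c cutoffD(2)[OF \<theta>]]) simp
 show "integrable lborel upper_flux" unfolding upper_flux_def[abs_def]
  by (rule sobolev_pairing_integrable[OF H_trunc_measurable H_trunc_L2_ball[OF \<rho> N] test])
 show "0 <= (LBINT x. upper_flux x)" unfolding upper_flux_def
  by (rule supersol_sobolev[OF supersol_H_trunc[OF \<rho> N] H_trunc_measurable H_trunc_L2_ball[OF \<rho> N] test])
qed

lemma lower_flux: "integrable lborel lower_flux" "0 <= (LBINT x. lower_flux x)"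
proof -
 have nonneg: "0 <= 1 + cos t" for t :: real using cos_ge_minus_one[of t] by linarith
 have test: "sobolev S {\<phi> : C1c S. ALL x. 0 <= \<phi> x} (%x. \<theta> x * (m\<^sup>2 * (1 + cos (phase x))))
  (%x. \<theta> x *. (- (m * sin (phase x)) *. g x) + (m\<^sup>2 * (1 + cos (phase x))) *. grad \<theta> x)"
  unfolding phase_def
  by (rule sobolev_test_function[OF u lipschitz_C1_cos(2)[OF m] _ phase_composite_finite[OF lipschitz_C1_cos(2)[OF m]] \<theta>_C1c cutoffD(2)[OF \<theta>]])
   (simp add: nonneg)
 show "integrable lborel lower_flux" unfolding lower_flux_def[abs_def]
  by (rule sobolev_pairing_integrable[OF H_trunc_measurable H_trunc_L2_ball[OF \<rho> k(1)] test])
 show "0 <= (LBINT x. lower_flux x)" unfolding lower_flux_def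
  by (rule supersol_sobolev[OF supersol_H_trunc[OF \<rho> k(1)] H_trunc_measurable H_trunc_L2_ball[OF \<rho> k(1)] test])
qed

lemma level_flux: "integrable lborel level_flux" "(LBINT x. level_flux x) = 0"
proof -
 have sin_bound: "\<bar>m * sin t\<bar> <= m" for t using m by (simp add: abs_mult mult_left_le)
 have v: "sobolev S {w. ALL x. \<bar>w x\<bar> <= m} (%x. m * sin (phase x)) (%x. cos (phase x) *. g x)"
  unfolding phase_def
  by (rule sobolev_chain[OF u lipschitz_C1_sin[OF m] _ phase_composite_finite[OF lipschitz_C1_sin[OF m]]]) (use sin_bound in auto)
 have test: "sobolev S (C1c S) (%x. level x * (m * sin (phase x)))
  (%x. level x *. (cos (phase x) *. g x) + (m * sin (phase x)) *. level_grad x)"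
 proof (rule sobolev_mult[OF sobolev_level v, where B="N + m"])
  show "\<bar>w x\<bar> <= N + m" if "w : {\<phi> : C1c S. ALL x. \<bar>\<phi> x\<bar> <= N}" for w x using that m by (auto intro: order_trans)
  show "\<bar>w x\<bar> <= N + m" if "w : {w. ALL x. \<bar>w x\<bar> <= m}" for w x using that N by (auto intro: order_trans)
  show "\<bar>level x\<bar> <= N + m" for x using level_bounds[of x] m by simp
  show "\<bar>m * sin (phase x)\<bar> <= N + m" for x using sin_bound[of "phase x"] N by linarith
 qed (use N m C1c_mult in auto)
 show "integrable lborel level_flux" unfolding level_flux_def[abs_def]
  by (rule sobolev_pairing_integrable[OF sobolevD(3,5)[OF u] test])
 show "(LBINT x. level_flux x) = 0" unfolding level_flux_def by (rule sol_sobolev[OF sol sobolevD(3,5)[OF u] test])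
qed

lemma level_energy_integrable: "integrable lborel level_energy"
proof -
 have "L2 S (%x. (level x * cos (phase x)) *. g x) < \<infinity>"
 proof (rule L2_bound_mult_finite[OF _ _ sobolevD(5)[OF u]])
  show "norm ((level x * cos (phase x)) *. g x) <= N * norm (g x)" for x
  proof -
   have "\<bar>level x\<bar> * \<bar>cos (phase x)\<bar> <= N * 1" using level_bounds[of x] N by (intro mult_mono) auto
   then show ?thesis by (simp add: abs_mult mult_right_mono)
  qed
 qed (use N in auto)
 then show ?thesis unfolding level_energy_def[abs_def]
  by (intro L2_inner_integrable L2_A_finite sobolevD(5)[OF u]) auto
qed

lemma flux_balance:
 "AEL x. level_energy x + (upper_flux x + lower_flux x) = 2 * m\<^sup>2 * ((A x *v H x) \<bullet> grad \<theta> x) + level_flux x"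
 using outside
proof eventually_elim
 case (elim x)
 note defs = level_energy_def upper_flux_def lower_flux_def level_flux_def
 show ?case
 proof (cases "x : cball 0 (\<rho> / 2)")
  case inner: True
  have "(A x *v H_trunc N x) \<bullet> g x = (A x *v H_trunc k x) \<bullet> g x + (A x *v g x) \<bullet> level_grad x"
   by (simp add: level_grad_def inner_diff_right A_commute[of x "g x"])
  moreover have "\<theta> x = 1" "grad \<theta> x = 0" using cutoffD(5,6)[OF \<theta> inner] by auto
  moreover have "x : S" using inner \<rho> by simp
  ultimately show ?thesis unfolding defs by (simp add: inner_add_right algebra_simps)
 next
  case False
  then have "G x < k" using elim by simp
  then have outer: "H_trunc N x = H x" "H_trunc k x = H x" "level x = 0" "level_grad x = 0"
   using k by (auto simp: H_trunc_def level_def level_grad_def G_trunc_def)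
  have "grad \<theta> x = 0" if "x ~: S" using C1c_zero(2)[OF \<theta>_C1c that] .
  then show ?thesis unfolding defs outer by (cases "x : S") (simp_all add: inner_add_right algebra_simps)
 qed
qed

lemma level_energy_le: "(LBINT x. level_energy x) <= 2 * m\<^sup>2"
proof -
 have flux_1: "(LBINT x. (A x *v H x) \<bullet> grad \<theta> x) = 1" using flux_cutoff[OF \<theta>] \<rho> by simp
 then have "integrable lborel (%x. (A x *v H x) \<bullet> grad \<theta> x)" using not_integrable_integral_eq by force
 note int = this level_energy_integrable upper_flux(1) lower_flux(1) level_flux(1)
 have "(LBINT x. level_energy x + (upper_flux x + lower_flux x)) = (LBINT x. 2 * m\<^sup>2 * ((A x *v H x) \<bullet> grad \<theta> x) + level_flux x)"
  by (rule integral_cong_AE[OF _ _ flux_balance]) (use int in auto)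
 then have "(LBINT x. level_energy x) + ((LBINT x. upper_flux x) + (LBINT x. lower_flux x)) = 2 * m\<^sup>2"
  using int flux_1 level_flux(2) by simp
 then show ?thesis using upper_flux(2) lower_flux(2) by linarith
qed

lemma level_weighted_energy: "(NN x. ennreal (level x * ((A x *v g x) \<bullet> g x)) * ind S x) <= ennreal (4 * m\<^sup>2)"
proof -
 have density: "AEL x. 0 <= ind S x * (level x * ((A x *v g x) \<bullet> g x)) & ind S x * (level x * ((A x *v g x) \<bullet> g x)) <= 2 * level_energy x"
  using osc
 proof eventually_elim
  case (elim x)
  have nonneg: "0 <= level x * ((A x *v g x) \<bullet> g x)" using level_bounds(1)[of x] A_nonneg[of x "g x"] by simp
  show ?case
  proof (cases "x : S")
   case True
   then have "\<bar>phase x\<bar> <= 1" using elim m by (simp add: phase_def)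
   from mult_left_mono[OF cos_ge_half[OF this] nonneg] show ?thesis using True nonneg by (simp add: level_energy_def mult_ac)
  qed (simp add: level_energy_def)
 qed
 have "(NN x. ennreal (level x * ((A x *v g x) \<bullet> g x)) * ind S x) <= (NN x. ennreal (2 * level_energy x))"
  by (rule nn_integral_mono_AE) (use density in eventually_elim, auto simp: indicator_def intro!: ennreal_leI)
 also have "\<dots> = ennreal (LBINT x. 2 * level_energy x)"
 proof (rule nn_integral_eq_integral)
  show "AEL x. 0 <= 2 * level_energy x" using density by eventually_elim (blast intro: order_trans)
 qed (use level_energy_integrable in simp)
 also have "\<dots> <= ennreal (4 * m\<^sup>2)" using level_energy_le by (intro ennreal_leI) simp
 finally show ?thesis .
qed

end

context fundamental
begin

lemma energy_above_level:
 fixes u :: "real^'n => real"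
 assumes \<rho>: "\<rho> > 0" and s: "sol (ball 0 \<rho>) g" and u: "sobolev (ball 0 \<rho>) UNIV u g" and m: "m > 0"
  and osc: "AE x\<in>ball 0 \<rho> in lborel. \<bar>u x - c\<bar> <= m"
  and k: "k > 0" and outside: "AEL x. \<rho> / 2 <= norm x --> G x < k"
 shows "(NN x. ennreal (max (G x - k) 0 * ((A x *v g x) \<bullet> g x)) * ind (ball 0 \<rho>) x) <= ennreal (4 * m\<^sup>2)"
proof -
 note [measurable] = sobolevD(3)[OF u]
 obtain \<theta> where \<theta>: "cutoff (0::real^'n) (\<rho> / 2) (3 * \<rho> / 4) \<theta>" using cutoff_exists[of "\<rho> / 2" "3 * \<rho> / 4"] \<rho> by auto
 define q where "q x = (A x *v g x) \<bullet> g x" for x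
 have q: "0 <= q x" for x using A_nonneg by (simp add: q_def)
 have [measurable]: "q : Borel" unfolding q_def[abs_def] by measurable
 define K where "K j = k + real (Suc j)" for j
 have as_L2: "L2 (ball 0 \<rho>) (%x. sqrt (f x * q x)) = (NN x. ennreal (f x * q x) * ind (ball 0 \<rho>) x)"
  if "!!x. 0 <= f x" for f :: "real^'n => real"
  unfolding L2_def using that q by (intro nn_integral_cong) simp
 have level_nonneg: "0 <= G_trunc (K j) x - G_trunc k x" for j x by (auto simp: K_def G_trunc_def)
 have "L2 (ball 0 \<rho>) (%x. sqrt (max (G x - k) 0 * q x)) <= ennreal (4 * m\<^sup>2)"
 proof (rule L2_fatou[where Y="%j. 0"])
  fix j
  interpret bounded_oscillation A lam L G H u g \<rho> c m k "K j" \<theta>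
   using assms \<theta> by unfold_locales (auto simp: K_def)
  show "L2 (ball 0 \<rho>) (%x. sqrt ((G_trunc (K j) x - G_trunc k x) * q x)) <= ennreal (4 * m\<^sup>2) + 0"
   using level_weighted_energy as_L2[OF level_nonneg, of "%_. j"] by (simp add: level_def q_def)
 next
  show "AE x\<in>ball 0 \<rho> in lborel. (%j. sqrt ((G_trunc (K j) x - G_trunc k x) * q x)) ---> sqrt (max (G x - k) 0 * q x)"
  proof (intro AE_I2 impI)
   fix x
   obtain j0 where "G x <= real j0" using real_arch_simple by blast
   then have "ALL j>=j0. G_trunc (K j) x - G_trunc k x = max (G x - k) 0" using k by (auto simp: G_trunc_def K_def)
   then have "\<forall>\<^sub>F j in sequentially. sqrt ((G_trunc (K j) x - G_trunc k x) * q x) = sqrt (max (G x - k) 0 * q x)"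
    unfolding eventually_sequentially by (metis (no_types, lifting))
   then show "(%j. sqrt ((G_trunc (K j) x - G_trunc k x) * q x)) ---> sqrt (max (G x - k) 0 * q x)" by (rule tendsto_eventually)
  qed
 qed auto
 then show ?thesis by (subst (asm) as_L2) (auto simp: q_def)
qed

end

subsection \<open>Hoelder continuity\<close>

lemma powr_add_le:
 fixes a b \<alpha> :: real
 assumes "0 <= a" "0 <= b" "0 < \<alpha>" "\<alpha> <= 1"
 shows "(a + b) powr \<alpha> <= a powr \<alpha> + b powr \<alpha>"
proof (cases "a + b = 0")
 case False
 define s where "s = a + b"
 have s: "s > 0" using False assms by (simp add: s_def)
 have concave: "x / s <= (x / s) powr \<alpha>" if "0 <= x" "x <= s" for x
 proof (cases "x = 0")
  case False
  then have "0 < x / s" "x / s <= 1" using that s by auto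
  then have "(x / s) powr 1 <= (x / s) powr \<alpha>" using assms by (intro powr_mono') auto
  then show ?thesis using powr_one[of "x / s"] \<open>0 < x / s\<close> by linarith
 qed simp
 have "1 = a / s + b / s" using s by (simp add: s_def add_divide_distrib[symmetric])
 also have "\<dots> <= (a / s) powr \<alpha> + (b / s) powr \<alpha>" using assms by (intro add_mono concave) (auto simp: s_def)
 also have "\<dots> = (a powr \<alpha> + b powr \<alpha>) / s powr \<alpha>" using assms s by (simp add: powr_divide add_divide_distrib)
 finally show ?thesis using s by (simp add: s_def pos_le_divide_eq)
qed (use assms in auto)

lemma mcshane_extension:
 fixes u :: "'a => real" and \<omega> :: "'a => 'a => real"
 assumes \<omega>: "!!x. \<omega> x x = 0" "!!x y. \<omega> x y = \<omega> y x" "!!x y z. \<omega> x z <= \<omega> x y + \<omega> y z"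
  and u: "!!x y. x : S ==> y : S ==> \<bar>u x - u y\<bar> <= \<omega> x y" and S: "S ~= {}"
 shows "EX v. (ALL x:S. v x = u x) & (ALL x y. \<bar>v x - v y\<bar> <= \<omega> x y)"
proof (intro exI conjI ballI allI)
 define v where "v x = (INF y\<in>S. u y + \<omega> x y)" for x
 have bdd: "bdd_below ((%y. u y + \<omega> x y) ` S)" for x
 proof -
  obtain y0 where y0: "y0 : S" using S by auto
  have "u y0 - \<omega> y0 x <= u y + \<omega> x y" if "y : S" for y
   using u[OF y0 that] \<omega>(3)[of y0 y x] by (simp add: abs_le_iff)
  then show ?thesis by (rule bdd_belowI2)
 qed
 have shift: "v x <= v y + \<omega> x y" for x y
 proof -
  have "v x - \<omega> x y <= v y"
   unfolding v_def[of y]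
  proof (rule cINF_greatest[OF S])
   fix w assume w: "w : S"
   have "v x <= u w + \<omega> x w" unfolding v_def by (rule cINF_lower[OF bdd w])
   then show "v x - \<omega> x y <= u w + \<omega> y w" using \<omega>(3)[of x w y] by simp
  qed
  then show ?thesis by simp
 qed
 show "\<bar>v x - v y\<bar> <= \<omega> x y" for x y using shift[of x y] shift[of y x] \<omega>(2)[of x y] by (simp add: abs_le_iff)
 show "v x = u x" if x: "x : S" for x
 proof (rule antisym)
  show "v x <= u x" using cINF_lower[OF bdd x, of x] \<omega>(1) by (simp add: v_def)
  show "u x <= v x" unfolding v_def
  proof (rule cINF_greatest[OF S])
   show "u x <= u y + \<omega> x y" if "y : S" for y using u[OF x that] by linarith
  qed
 qed
qed

lemma holder_extension:
 fixes u :: "'a::metric_space => real"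
 assumes \<alpha>: "0 < \<alpha>" "\<alpha> <= 1" and K: "0 <= K"
  and u: "!!x y. x : S ==> y : S ==> \<bar>u x - u y\<bar> <= K * dist x y powr \<alpha>"
 shows "EX v. (ALL x:S. v x = u x) & (ALL x y. \<bar>v x - v y\<bar> <= K * dist x y powr \<alpha>)"
proof (cases "S = {}")
 case True
 then show ?thesis using K by (intro exI[of _ "%x. 0"]) simp
next
 case False
 have triangle: "K * dist x z powr \<alpha> <= K * dist x y powr \<alpha> + K * dist y z powr \<alpha>" for x y z :: 'a
 proof -
  have "dist x z powr \<alpha> <= (dist x y + dist y z) powr \<alpha>" using \<alpha> dist_triangle[of x z y] by (intro powr_mono2) auto
  also have "\<dots> <= dist x y powr \<alpha> + dist y z powr \<alpha>" using \<alpha> by (intro powr_add_le) auto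
  finally show ?thesis using K by (metis distrib_left mult_left_mono)
 qed
 show ?thesis
 proof (rule mcshane_extension[OF _ _ triangle _ False])
  show "K * dist x y powr \<alpha> = K * dist y x powr \<alpha>" for x y :: 'a by (simp only: dist_commute)
 qed (use u in auto)
qed

lemma countable_dense_scales:
 fixes U :: "'a::euclidean_space set"
 assumes "open U"
 shows "EX I. countable I & (ALL i:I. fst i : U & 0 < snd i) &
  (ALL x:U. ALL e>0. EX i:I. dist x (fst i) < e / 2 & 3 * e / 2 < snd i & snd i < 2 * e)"
proof -
 obtain D :: "'a set" where D: "countable D" "!!X. open X ==> X ~= {} ==> EX d:D. d : X" by (rule countable_dense_setE) blast
 define I where "I = (D \<inter> U) \<times> {r::real. r : \<rat> & 0 < r}"
 have "{r::real. r : \<rat> & 0 < r} <= \<rat>" by auto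
 then have "countable {r::real. r : \<rat> & 0 < r}" using countable_rat countable_subset by blast
 then have "countable I" unfolding I_def using D(1) by (intro countable_SIGMA) auto
 moreover have "EX i:I. dist x (fst i) < e / 2 & 3 * e / 2 < snd i & snd i < 2 * e" if x: "x : U" and e: "0 < e" for x e
 proof -
  have "open (U \<inter> ball x (e / 2))" "U \<inter> ball x (e / 2) ~= {}" using assms x e by auto
  then obtain z where z: "z : D" "z : U" "dist x z < e / 2" using D(2) by force
  obtain r where r: "r : \<rat>" "3 * e / 2 < r" "r < 2 * e" using Rats_dense_in_real[of "3 * e / 2" "2 * e"] e by auto
  show ?thesis using z r e by (intro bexI[of _ "(z, r)"]) (auto simp: I_def)
 qed
 moreover have "ALL i:I. fst i : U & 0 < snd i" by (auto simp: I_def)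
 ultimately show ?thesis by blast
qed

lemma oscillation_AE_bounds:
 fixes u :: "'a::euclidean_space => real"
 assumes I: "countable I" and osc: "!!i. i : I ==> EX a b. b - a <= \<omega> (snd i) & (AE x\<in>U \<inter> ball (fst i) (snd i) in lborel. a <= u x & u x <= b)"
 shows "EX good. (AEL x. good x) & (ALL x y. ALL i:I. good x & good y &
  x : U \<inter> ball (fst i) (snd i) & y : U \<inter> ball (fst i) (snd i) --> \<bar>u x - u y\<bar> <= \<omega> (snd i))"
proof -
 define bounds where "bounds i a b \<longleftrightarrow> b - a <= \<omega> (snd i) & (AE x\<in>U \<inter> ball (fst i) (snd i) in lborel. a <= u x & u x <= b)" for i a b
 have "ALL i:I. EX a b. bounds i a b" using osc unfolding bounds_def by blast
 then obtain a b where "!!i. i : I ==> bounds i (a i) (b i)" by metis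
 then have ab: "!!i. i : I ==> b i - a i <= \<omega> (snd i)"
  "!!i. i : I ==> AE x\<in>U \<inter> ball (fst i) (snd i) in lborel. a i <= u x & u x <= b i" unfolding bounds_def by blast+
 define good where "good x \<longleftrightarrow> (ALL i:I. x : U \<inter> ball (fst i) (snd i) --> a i <= u x & u x <= b i)" for x
 have "AEL x. good x"
  unfolding good_def
  using AE_ball_countable[OF I, of "%x i. x : U \<inter> ball (fst i) (snd i) --> a i <= u x & u x <= b i" lborel] ab(2) by blast
 moreover have "\<bar>u x - u y\<bar> <= \<omega> (snd i)"
  if "i : I" "good x" "good y" "x : U \<inter> ball (fst i) (snd i)" "y : U \<inter> ball (fst i) (snd i)" for x y i
 proof -
  have "a i <= u x & u x <= b i" "a i <= u y & u y <= b i" using that unfolding good_def by blast+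
  moreover have "b i - a i <= \<omega> (snd i)" using ab(1) that(1) by blast
  ultimately show ?thesis by linarith
 qed
 ultimately show ?thesis by (intro exI[of _ good]) blast
qed

lemma holder_representative:
 fixes u :: "'a::euclidean_space => real"
 assumes \<alpha>: "0 < \<alpha>" "\<alpha> <= 1" and K: "0 <= K" and U: "open U"
  and osc: "!!z r. z : U ==> 0 < r ==> EX a b. b - a <= K * r powr \<alpha> & (AE x\<in>U \<inter> ball z r in lborel. a <= u x & u x <= b)"
 shows "EX v. (AE x\<in>U in lborel. u x = v x) & (ALL x y. \<bar>v x - v y\<bar> <= 2 * K * dist x y powr \<alpha>)"
proof -
 obtain I where I: "countable I" "ALL i:I. fst i : U & 0 < snd i"
  "ALL x:U. ALL e>0. EX i:I. dist x (fst i) < e / 2 & 3 * e / 2 < snd i & snd i < 2 * e"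
  using countable_dense_scales[OF U] by blast
 have "EX good. (AEL x. good x) & (ALL x y. ALL i:I. good x & good y &
   x : U \<inter> ball (fst i) (snd i) & y : U \<inter> ball (fst i) (snd i) --> \<bar>u x - u y\<bar> <= K * snd i powr \<alpha>)"
  by (rule oscillation_AE_bounds[OF I(1)]) (use osc I(2) in blast)
 then obtain good where good: "AEL x. good x" "ALL x y. ALL i:I. good x & good y &
   x : U \<inter> ball (fst i) (snd i) & y : U \<inter> ball (fst i) (snd i) --> \<bar>u x - u y\<bar> <= K * snd i powr \<alpha>" by blast
 have holder: "\<bar>u x - u y\<bar> <= 2 * K * dist x y powr \<alpha>" if x: "x : {x : U. good x}" and y: "y : {x : U. good x}" for x y
 proof (cases "x = y")
  case False
  define e where "e = dist x y"
  have e: "e > 0" using False by (simp add: e_def)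
  obtain i where i: "i : I" "dist x (fst i) < e / 2" "3 * e / 2 < snd i" "snd i < 2 * e" using I(3) x e by blast
  have "dist (fst i) y <= dist x (fst i) + dist x y" using dist_triangle[of "fst i" y x] by (simp add: dist_commute)
  then have "x : U \<inter> ball (fst i) (snd i)" "y : U \<inter> ball (fst i) (snd i)" using i x y e by (auto simp: e_def dist_commute)
  then have "\<bar>u x - u y\<bar> <= K * snd i powr \<alpha>" using good(2) i(1) x y by blast
  also have "snd i powr \<alpha> <= (e + e) powr \<alpha>" using i e \<alpha> by (intro powr_mono2) auto
  also have "\<dots> <= e powr \<alpha> + e powr \<alpha>" using e \<alpha> by (intro powr_add_le) auto
  finally show ?thesis using K by (simp add: e_def mult_left_mono)
 qed simp
 have "EX v. (ALL x:{x : U. good x}. v x = u x) & (ALL x y. \<bar>v x - v y\<bar> <= 2 * K * dist x y powr \<alpha>)"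
  by (rule holder_extension[OF \<alpha>]) (use K in simp, erule (1) holder)
 then obtain v where v: "ALL x:{x : U. good x}. v x = u x" "ALL x y. \<bar>v x - v y\<bar> <= 2 * K * dist x y powr \<alpha>" by blast
 have "AE x\<in>U in lborel. u x = v x" using good(1) by eventually_elim (use v(1) in auto)
 then show ?thesis using v(2) by blast
qed

context elliptic
begin

lemma sol_local_bound:
 fixes u :: "real^'n => real"
 assumes s: "sol (ball z R) g" and u: "sobolev (ball z R) UNIV u g" and r: "0 <= \<rho>" "\<rho> < R" "0 < K"
  and small: "L2 (ball z R) (%x. u x - c) <= ennreal (dg_const CARD('n) (4 * L / lam) * (R - \<rho>) ^ CARD('n) * K\<^sup>2)"
 shows "AE x\<in>ball z \<rho> in lborel. c - K <= u x & u x <= c + K"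
proof -
 have one_sided: "AE x\<in>ball z \<rho> in lborel. e * u x + (- e * c) <= K" if e: "e = 1 \<or> e = -1" for e :: real
 proof -
  have v: "sobolev (ball z R) UNIV (%x. e * u x + (- e * c)) (%x. e *. g x)"
   by (rule sobolev_affine[OF u emeasure_lborel_ball_finite])
  have "supersol (ball z R) (%x. - (e *. g x))" using sol_supersol[OF s] e by auto
  note dg = subsolution_dg_class[OF this v]
  have "L2 (ball z R) (%x. max (e * u x + (- e * c)) 0) <= L2 (ball z R) (%x. u x - c)" using e by (intro L2_mono) auto
  from dg_local_max[OF dg v _ r order_trans[OF this small]] show ?thesis using caccioppoli_const_pos by simp
 qed
 from one_sided[OF disjI1[OF refl]] one_sided[OF disjI2[OF refl]] show ?thesis by eventually_elim auto
qed

lemma sol_oscillation: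
 fixes u :: "real^'n => real"
 defines "\<alpha> \<equiv> osc_exponent CARD('n) (4 * L / lam)"
 assumes s: "sol (ball 0 (7/8)) g" and u: "sobolev (ball 0 (7/8)) UNIV u g" and b: "0 < b"
  and bound: "AE x\<in>ball 0 (3/4) in lborel. - b <= u x & u x <= b" and z: "z : ball 0 (1/2)" and r: "0 < r"
 shows "EX a' b'. b' - a' <= 16 * b * r powr \<alpha> & (AE x\<in>ball 0 (1/2) \<inter> ball z r in lborel. a' <= u x & u x <= b')"
proof (cases "r <= 1/4")
 case True
 have \<alpha>: "0 < \<alpha>" "\<alpha> < 1" unfolding \<alpha>_def by (rule osc_exponent_bounds[OF caccioppoli_const_pos])+
 have sub: "ball z (1/4) <= ball 0 (3/4)"
 proof
  fix x assume "x : ball z (1/4)"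
  from ball_norm_bounds[OF this] show "x : ball 0 (3/4)" using z by simp
 qed
 then have sub': "ball z (1/4) <= ball 0 (7/8)" by (rule order_trans) auto
 have u': "sobolev (ball z (1/4)) UNIV u g" by (rule sobolev_mono[OF u sub']) auto
 have bound': "AE x\<in>ball z (1/4) in lborel. - b <= u x & u x <= b" using bound by eventually_elim (use sub in auto)
 obtain a' b' where ab: "a' <= b'" "b' - a' <= 2 * (r / (1/4)) powr \<alpha> * (b - (- b))" "AE x\<in>ball z r in lborel. a' <= u x & u x <= b'"
  using osc_decay[OF r True sol_mono[OF s sub'] u' _ bound'] b unfolding \<alpha>_def by auto
 have "2 * (r / (1/4)) powr \<alpha> * (b - (- b)) = 4 * b * (4 powr \<alpha> * r powr \<alpha>)"
  using r by (simp add: powr_mult[symmetric] mult_ac)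
 also have "\<dots> <= 4 * b * (4 * r powr \<alpha>)"
  using b \<alpha> powr_mono[of \<alpha> 1 4] by (intro mult_left_mono mult_right_mono) auto
 finally have "2 * (r / (1/4)) powr \<alpha> * (b - (- b)) <= 16 * b * r powr \<alpha>" by simp
 with ab(2) have "b' - a' <= 16 * b * r powr \<alpha>" by (rule order_trans)
 moreover have "AE x\<in>ball 0 (1/2) \<inter> ball z r in lborel. a' <= u x & u x <= b'" using ab(3) by eventually_elim auto
 ultimately show ?thesis by blast
next
 case False
 have \<alpha>: "0 < \<alpha>" "\<alpha> < 1" unfolding \<alpha>_def by (rule osc_exponent_bounds[OF caccioppoli_const_pos])+
 have "(1/4) powr 1 <= (1/4::real) powr \<alpha>" using \<alpha> by (intro powr_mono') auto
 also have "\<dots> <= r powr \<alpha>" using False \<alpha> by (intro powr_mono2) auto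
 finally have "16 * b * (1 / 4) <= 16 * b * r powr \<alpha>" using b by (intro mult_left_mono) auto
 then have "b - (- b) <= 16 * b * r powr \<alpha>" using b by simp
 moreover have "AE x\<in>ball 0 (1/2) \<inter> ball z r in lborel. - b <= u x & u x <= b" using bound by eventually_elim auto
 ultimately show ?thesis by blast
qed

lemma sol_holder:
 fixes u :: "real^'n => real"
 assumes s: "sol (ball 0 (7/8)) g" and u: "sobolev (ball 0 (7/8)) UNIV u g"
 shows "EX v K. (AE x\<in>ball 0 (1/2) in lborel. u x = v x) &
  (ALL x y. \<bar>v x - v y\<bar> <= K * dist x y powr osc_exponent CARD('n) (4 * L / lam))"
proof -
 define \<alpha> where "\<alpha> = osc_exponent CARD('n) (4 * L / lam)"
 have \<alpha>: "0 < \<alpha>" "\<alpha> < 1" unfolding \<alpha>_def by (rule osc_exponent_bounds[OF caccioppoli_const_pos])+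
 have "0 < dg_const CARD('n) (4 * L / lam) * (7/8 - 3/4) ^ CARD('n)" using dg_const_pos caccioppoli_const_pos by simp
 then obtain b where b: "0 < b" "L2 (ball 0 (7/8)) u <= ennreal (dg_const CARD('n) (4 * L / lam) * (7/8 - 3/4) ^ CARD('n) * b\<^sup>2)"
  using ennreal_quadratic_level[OF _ sobolevD(4)[OF u]] by blast
 have "AE x\<in>ball 0 (3/4) in lborel. 0 - b <= u x & u x <= 0 + b"
  by (rule sol_local_bound[OF s u]) (use b in auto)
 then have "AE x\<in>ball 0 (3/4) in lborel. - b <= u x & u x <= b" by simp
 note osc = sol_oscillation[OF s u b(1) this, folded \<alpha>_def]
 have "EX v. (AE x\<in>ball 0 (1/2) in lborel. u x = v x) & (ALL x y. \<bar>v x - v y\<bar> <= 2 * (16 * b) * dist x y powr \<alpha>)"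
  by (rule holder_representative[OF \<alpha>(1) less_imp_le[OF \<alpha>(2)] _ open_ball osc]) (use b(1) in auto)
 then show ?thesis unfolding \<alpha>_def by blast
qed

end

subsection \<open>Comparison of scales\<close>

definition scale_ratio :: "nat => real => real => real" where
 "scale_ratio n lam L = 1 + 4 * green_upper n lam L / green_lower n lam L"

definition osc_energy_const :: "nat => real => real => real" where
 "osc_energy_const n lam L = 8 * 4 ^ n / (lam * dg_const n (4 * L / lam) * green_lower n lam L)"

definition decay_const :: "nat => real => real => real" where
 "decay_const n lam L = (4 * scale_ratio n lam L) powr (2 * osc_exponent n (4 * L / lam)) * (1 + 128 * osc_energy_const n lam L)"

lemma (in elliptic) scale_ratio_ge_1: "1 <= scale_ratio CARD('n) lam L"
 using green_upper_pos green_lower_pos by (simp add: scale_ratio_def)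

lemma (in elliptic) osc_energy_const_pos: "0 < osc_energy_const CARD('n) lam L"
 using lam_pos dg_const_pos[of "4 * L / lam" "CARD('n)"] caccioppoli_const_pos green_lower_pos by (simp add: osc_energy_const_def)

lemma (in elliptic) decay_const_pos: "0 < decay_const CARD('n) lam L"
 using scale_ratio_ge_1 osc_energy_const_pos by (simp add: decay_const_def add_pos_pos)

context fundamental
begin

definition weighted_energy :: "(real^'n => real^'n) => real => ennreal" where
 "weighted_energy g r = (NN x. ennreal (G x * ((A x *v g x) \<bullet> g x)) * ind (ball 0 r) x)"

lemma weighted_energy_mono: "r <= R ==> weighted_energy g r <= weighted_energy g R"
 unfolding weighted_energy_def by (intro nn_integral_mono) (auto simp: indicator_def)

lemma gradient_le_weighted_energy:
 assumes R: "R > 0" and [measurable]: "g : Borel"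
 shows "L2 (ball 0 R) g <= ennreal (R ^ CARD('n) / (lam * green_lower CARD('n) lam L * R\<^sup>2)) * weighted_energy g R"
proof -
 define c where "c = green_lower CARD('n) lam L"
 define D where "D = R ^ CARD('n) / (lam * c * R\<^sup>2)"
 have c: "c > 0" using green_lower_pos by (simp add: c_def)
 have D: "D > 0" using R lam_pos c by (simp add: D_def)
 have [measurable]: "ball (0::real^'n) R : sets borel" by simp
 have "L2 (ball 0 R) g <= (NN x. ennreal D * (ennreal (G x * ((A x *v g x) \<bullet> g x)) * ind (ball 0 R) x))"
  unfolding L2_def
 proof (rule nn_integral_mono_AE)
  show "AEL x. ennreal ((norm (g x))^2) * ind (ball 0 R) x <= ennreal D * (ennreal (G x * ((A x *v g x) \<bullet> g x)) * ind (ball 0 R) x)"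
   using G_lower[OF R]
  proof eventually_elim
   case (elim x)
   show ?case
   proof (cases "x : ball 0 R")
    case True
    have "(norm (g x))^2 = D / R ^ CARD('n) * ((c * R\<^sup>2) * (lam * (norm (g x))^2))" using R lam_pos c by (simp add: D_def)
    also have "\<dots> <= D / R ^ CARD('n) * ((G x * R ^ CARD('n)) * ((A x *v g x) \<bullet> g x))"
    proof (rule mult_left_mono)
     have "c * R\<^sup>2 <= G x * R ^ CARD('n)" using elim True by (simp add: c_def)
     then show "(c * R\<^sup>2) * (lam * (norm (g x))^2) <= (G x * R ^ CARD('n)) * ((A x *v g x) \<bullet> g x)"
      by (rule mult_mono[OF _ A_lower]) (use R lam_pos G_nonneg[of x] in auto)
    qed (use D R in simp)
    also have "\<dots> = D * (G x * ((A x *v g x) \<bullet> g x))" using R by simp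
    finally have "ennreal ((norm (g x))^2) <= ennreal (D * (G x * ((A x *v g x) \<bullet> g x)))" by (rule ennreal_leI)
    then show ?thesis using True D G_nonneg[of x] A_nonneg[of x "g x"] by (simp add: ennreal_mult)
   qed simp
  qed
 qed
 also have "\<dots> = ennreal D * weighted_energy g R" unfolding weighted_energy_def by (rule nn_integral_cmult) measurable
 finally show ?thesis by (simp add: D_def c_def)
qed

lemma weighted_energy_bounds_oscillation:
 fixes u :: "real^'n => real"
 assumes R: "R > 0" and s: "sol (ball 0 R) g" and u: "sobolev (ball 0 R) UNIV u g"
  and energy: "weighted_energy g R <= ennreal X" and X: "0 <= X" and K: "K > 0" "osc_energy_const CARD('n) lam L * X <= K\<^sup>2"
 obtains c where "AE x\<in>ball 0 (R / 2) in lborel. c - K <= u x & u x <= c + K"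
proof -
 define n where "n = CARD('n)"
 define c0 where "c0 = dg_const n (4 * L / lam)"
 define D where "D = R ^ n / (lam * green_lower n lam L * R\<^sup>2)"
 have pos: "c0 > 0" "green_lower n lam L > 0" "D > 0"
  using dg_const_pos[of "4 * L / lam" n] caccioppoli_const_pos green_lower_pos lam_pos R by (auto simp: c0_def D_def n_def)
 note g = sobolevD(3,5)[OF u]
 obtain w where w: "H1_tendsto (ball 0 R) w u g" using sobolevE[OF u] by blast
 obtain c where "L2 (ball 0 R) (%x. u x - c) <= ennreal (8 * R\<^sup>2 * 2 ^ n) * L2 (ball 0 R) g"
  unfolding n_def using poincare_constant[OF H1_tendstoD(1)[OF w] sobolevD(2,3)[OF u] H1_tendstoD(4,3)[OF w] g(2) R] by blast
 also have "L2 (ball 0 R) g <= ennreal D * ennreal X"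
  using gradient_le_weighted_energy[OF R g(1)] mult_left_mono[OF energy, of "ennreal D"] by (simp add: D_def n_def)
 also have "ennreal (8 * R\<^sup>2 * 2 ^ n) * (ennreal D * ennreal X) = ennreal (8 * R\<^sup>2 * 2 ^ n * (D * X))"
  using pos(3) X by (simp add: ennreal_mult[symmetric])
 also have "8 * R\<^sup>2 * 2 ^ n * (D * X) = c0 * (R - R / 2) ^ n * (osc_energy_const n lam L * X)"
 proof -
  have "(4::real) ^ n = 2 ^ n * 2 ^ n" by (simp add: power_mult_distrib[symmetric])
  then show ?thesis using R lam_pos pos(1,2) unfolding D_def osc_energy_const_def c0_def[symmetric]
   by (simp add: power_divide field_simps power2_eq_square)
 qed
 also have "ennreal \<dots> <= ennreal (c0 * (R - R / 2) ^ n * K\<^sup>2)"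
  using K(2) pos(1) R by (intro ennreal_leI mult_left_mono) (auto simp: n_def)
 finally have "L2 (ball 0 R) (%x. u x - c) <= ennreal (c0 * (R - R / 2) ^ n * K\<^sup>2)" by (simp add: mult_left_mono)
 then have "AE x\<in>ball 0 (R / 2) in lborel. c - K <= u x & u x <= c + K"
  using R K by (intro sol_local_bound[OF s u]) (auto simp: c0_def n_def)
 then show ?thesis by (rule that)
qed

text \<open>That is, \<open>G\<close> is at least twice its bound outside the ball of radius \<open>M * r\<close>.\<close>

lemma green_gap:
 defines "M \<equiv> scale_ratio CARD('n) lam L"
 assumes r: "r > 0"
 shows "AE x\<in>ball 0 r in lborel. 2 * (2 * green_upper CARD('n) lam L * (M * r)^2 / (M * r) ^ CARD('n)) <= G x"
 using G_lower[OF r]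
proof (eventually_elim, intro impI)
 fix x :: "real^'n" assume lower: "x : ball 0 r --> green_lower CARD('n) lam L * r\<^sup>2 <= G x * r ^ CARD('n)" and x: "x : ball 0 r"
 define C where "C = green_upper CARD('n) lam L"
 define c where "c = green_lower CARD('n) lam L"
 have pos: "C > 0" "c > 0" "1 <= M" using green_upper_pos green_lower_pos scale_ratio_ge_1 by (auto simp: C_def c_def M_def)
 obtain i where i: "CARD('n) = Suc i + 2" using n3 by (metis add.commute add_2_eq_Suc le_Suc_ex numeral_3_eq_3 add_Suc)
 have "4 * C <= c * M" using pos by (simp add: M_def scale_ratio_def C_def c_def distrib_left)
 also have "\<dots> <= c * M ^ Suc i" using pos self_le_power[of M "Suc i"] by (intro mult_left_mono) auto
 finally have "4 * C / M ^ Suc i <= c" using pos by (simp add: pos_divide_le_eq)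
 have "2 * (2 * C * (M * r)^2 / (M * r) ^ CARD('n)) * r ^ CARD('n) = 4 * C / M ^ Suc i * r\<^sup>2"
  using r pos unfolding i power_add by (simp add: power_mult_distrib field_simps)
 also have "\<dots> <= c * r\<^sup>2" using \<open>4 * C / M ^ Suc i <= c\<close> by (rule mult_right_mono) simp
 also have "\<dots> <= G x * r ^ CARD('n)" using lower x by (simp add: c_def)
 finally have "2 * (2 * C * (M * r)^2 / (M * r) ^ CARD('n)) <= G x" by (rule mult_right_le_imp_le) (use r in simp)
 then show "2 * (2 * green_upper CARD('n) lam L * (M * r)^2 / (M * r) ^ CARD('n)) <= G x" by (simp only: C_def)
qed

lemma weighted_energy_le_oscillation:
 fixes u :: "real^'n => real"
 defines "M \<equiv> scale_ratio CARD('n) lam L"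
 assumes r: "r > 0" and s: "sol (ball 0 (2 * M * r)) g" and u: "sobolev (ball 0 (2 * M * r)) UNIV u g" and m: "m > 0"
  and osc: "AE x\<in>ball 0 (2 * M * r) in lborel. \<bar>u x - c\<bar> <= m"
 shows "weighted_energy g r <= ennreal (8 * m\<^sup>2)"
proof -
 define \<rho> where "\<rho> = 2 * M * r"
 note [measurable] = sobolevD(1,3)[OF u, folded \<rho>_def]
 define k where "k = 2 * green_upper CARD('n) lam L * (M * r)^2 / (M * r) ^ CARD('n)"
 have M: "1 <= M" by (simp add: M_def scale_ratio_ge_1)
 have k: "k > 0" and \<rho>: "\<rho> > 0" "\<rho> / 2 = M * r" using green_upper_pos r M by (simp_all add: k_def \<rho>_def)
 have "r <= \<rho>" using M r mult_right_mono[of 1 "2 * M" r] by (simp add: \<rho>_def)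
 have outside: "AEL x. \<rho> / 2 <= norm x --> G x < k" unfolding k_def \<rho>(2) by (rule G_upper_outside) (use r M in simp)
 have "weighted_energy g r <= (NN x. 2 * (ennreal (max (G x - k) 0 * ((A x *v g x) \<bullet> g x)) * ind (ball 0 \<rho>) x))"
  unfolding weighted_energy_def
 proof (rule nn_integral_mono_AE)
  show "AEL x. ennreal (G x * ((A x *v g x) \<bullet> g x)) * ind (ball 0 r) x
    <= 2 * (ennreal (max (G x - k) 0 * ((A x *v g x) \<bullet> g x)) * ind (ball 0 \<rho>) x)"
   using green_gap[OF r, folded M_def, folded k_def]
  proof eventually_elim
   case (elim x)
   show ?case
   proof (cases "x : ball 0 r")
    case True
    then have "G x <= 2 * max (G x - k) 0" using elim k by (simp add: max_def)
    from mult_right_mono[OF this A_nonneg[of x "g x"]]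
    have "ennreal (G x * ((A x *v g x) \<bullet> g x)) <= ennreal (2 * (max (G x - k) 0 * ((A x *v g x) \<bullet> g x)))"
     by (intro ennreal_leI) (simp add: mult.assoc)
    then show ?thesis using True \<open>r <= \<rho>\<close> A_nonneg[of x "g x"] by (simp add: ennreal_mult)
   qed simp
  qed
 qed
 also have "\<dots> = 2 * (NN x. ennreal (max (G x - k) 0 * ((A x *v g x) \<bullet> g x)) * ind (ball 0 \<rho>) x)"
  by (rule nn_integral_cmult) measurable
 also have "\<dots> <= 2 * ennreal (4 * m\<^sup>2)"
  using energy_above_level[OF \<rho>(1) _ _ m _ k outside] s u osc by (intro mult_left_mono) (auto simp: \<rho>_def)
 also have "\<dots> = ennreal (8 * m\<^sup>2)" by (simp add: ennreal_mult)
 finally show ?thesis .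
qed

lemma weighted_energy_decay_level:
 fixes u :: "real^'n => real"
 defines "M \<equiv> scale_ratio CARD('n) lam L" and "\<alpha> \<equiv> osc_exponent CARD('n) (4 * L / lam)"
 assumes r: "0 < r" "4 * M * r <= R" and s: "sol (ball 0 R) g" and u: "sobolev (ball 0 R) UNIV u g"
  and energy: "weighted_energy g R <= ennreal X" and X: "0 <= X" and K: "K > 0" "osc_energy_const CARD('n) lam L * X <= K\<^sup>2"
 shows "weighted_energy g r <= ennreal (128 * (4 * M * (r / R)) powr (2 * \<alpha>) * K\<^sup>2)"
proof -
 have M: "1 <= M" by (simp add: M_def scale_ratio_ge_1)
 have R: "0 < R" using r M mult_pos_pos[of "4 * M" r] by linarith
 define \<rho> where "\<rho> = 2 * M * r"
 have \<rho>: "0 < \<rho>" "\<rho> <= R / 2" using r M by (simp_all add: \<rho>_def)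
 have sub: "ball (0::real^'n) t <= ball 0 R" if "t <= R" for t using that by auto
 have u_on: "sobolev (ball 0 t) UNIV u g" if "t <= R" for t by (rule sobolev_mono[OF u sub[OF that]]) auto
 note s_on = sol_mono[OF s sub]
 obtain c where "AE x\<in>ball 0 (R / 2) in lborel. c - K <= u x & u x <= c + K"
  using weighted_energy_bounds_oscillation[OF R s u energy X K] by blast
 then obtain a' b' where ab: "a' <= b'" "b' - a' <= 2 * (\<rho> / (R / 2)) powr \<alpha> * ((c + K) - (c - K))"
  "AE x\<in>ball 0 \<rho> in lborel. a' <= u x & u x <= b'"
  using osc_decay[OF \<rho> s_on u_on, of "c - K" "c + K"] R K(1) unfolding \<alpha>_def by auto
 define t where "t = 4 * M * (r / R)"
 define m where "m = 4 * t powr \<alpha> * K"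
 have t: "0 < t" "\<rho> / (R / 2) = t" using M r R by (simp_all add: t_def \<rho>_def)
 then have m: "m > 0" using K(1) by (simp add: m_def)
 have "b' - a' <= m" using ab(2) unfolding t(2) m_def by (simp add: algebra_simps)
 then have osc: "AE x\<in>ball 0 \<rho> in lborel. \<bar>u x - a'\<bar> <= m" using ab(3) by (auto elim!: eventually_mono)
 have "weighted_energy g r <= ennreal (8 * m\<^sup>2)"
  using weighted_energy_le_oscillation[OF r(1) _ _ m, folded M_def, folded \<rho>_def, OF s_on u_on osc] \<rho> R by simp
 also have "8 * m\<^sup>2 = 128 * t powr (2 * \<alpha>) * K\<^sup>2"
  by (simp add: m_def power_mult_distrib power2_eq_square powr_add[symmetric])
 finally show ?thesis by (simp add: t_def)
qed

lemma weighted_energy_decay_far: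
 fixes u :: "real^'n => real"
 defines "M \<equiv> scale_ratio CARD('n) lam L" and "\<alpha> \<equiv> osc_exponent CARD('n) (4 * L / lam)"
 assumes r: "0 < r" "4 * M * r <= R" and s: "sol (ball 0 R) g" and u: "sobolev (ball 0 R) UNIV u g"
  and X: "0 <= X" "weighted_energy g R = ennreal X"
 shows "weighted_energy g r <= ennreal (128 * (4 * M * (r / R)) powr (2 * \<alpha>) * (osc_energy_const CARD('n) lam L * X))"
proof -
 have M: "1 <= M" by (simp add: M_def scale_ratio_ge_1)
 have R: "0 < R" using r M mult_pos_pos[of "4 * M" r] by linarith
 define P where "P = 128 * (4 * M * (r / R)) powr (2 * \<alpha>)"
 define B where "B = osc_energy_const CARD('n) lam L"
 have P: "P > 0" using M r(1) R by (auto simp: P_def)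
 have B: "B > 0" by (simp add: B_def osc_energy_const_pos)
 have "weighted_energy g r <= ennreal (P * (B * X))"
 proof (rule ennreal_le_epsilon)
  fix e :: real assume e: "e > 0"
  define K where "K = sqrt (B * X + e / P)"
  have "0 < B * X + e / P" using B X(1) e P by (simp add: add_nonneg_pos)
  then have K: "K > 0" "K\<^sup>2 = B * X + e / P" by (auto simp: K_def)
  have "weighted_energy g r <= ennreal (P * K\<^sup>2)"
   unfolding P_def M_def \<alpha>_def
   by (rule weighted_energy_decay_level[OF r(1) _ s u _ X(1) K(1)]) (use r(2) X(2) K(2) e P in \<open>simp_all add: M_def B_def\<close>)
  also have "P * K\<^sup>2 = P * (B * X) + e" using P by (simp add: K(2) distrib_left)
  also have "ennreal \<dots> = ennreal (P * (B * X)) + ennreal e" using P B X(1) e by (intro ennreal_plus) auto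
  finally show "weighted_energy g r <= ennreal (P * (B * X)) + ennreal e" .
 qed
 then show ?thesis by (simp add: P_def B_def)
qed

theorem weighted_energy_decay:
 fixes u :: "real^'n => real"
 defines "\<alpha> \<equiv> osc_exponent CARD('n) (4 * L / lam)"
 assumes r: "0 < r" "r < R" and s: "sol (ball 0 R) g" and u: "sobolev (ball 0 R) UNIV u g"
 shows "weighted_energy g r <= ennreal (decay_const CARD('n) lam L * (r / R) powr (2 * \<alpha>)) * weighted_energy g R"
proof -
 define M where "M = scale_ratio CARD('n) lam L"
 define B where "B = osc_energy_const CARD('n) lam L"
 define t where "t = (4 * M * (r / R)) powr (2 * \<alpha>)"
 have M: "1 <= M" and B: "B > 0" and \<alpha>: "0 < \<alpha>"
  using scale_ratio_ge_1 osc_energy_const_pos osc_exponent_bounds(1)[OF caccioppoli_const_pos] by (auto simp: M_def B_def \<alpha>_def)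
 have t: "t > 0" using M r by (auto simp: t_def)
 have const: "decay_const CARD('n) lam L * (r / R) powr (2 * \<alpha>) = t * (1 + 128 * B)"
 proof -
  have "t = (4 * M) powr (2 * \<alpha>) * (r / R) powr (2 * \<alpha>)" using r M unfolding t_def by (subst powr_mult) auto
  then show ?thesis unfolding decay_const_def M_def[symmetric] B_def[symmetric] \<alpha>_def[symmetric] by (simp only: mult_ac)
 qed
 consider (near) "R <= 4 * M * r" | (infinite) "weighted_energy g R = \<infinity>" | (far) X where "4 * M * r <= R" "0 <= X" "weighted_energy g R = ennreal X"
  using linear[of R "4 * M * r"] by (cases "weighted_energy g R") auto
 then show ?thesis
 proof cases
  case near
  have "1 <= 4 * M * (r / R)" using near r by (simp add: field_simps)
  then have "1 <= t" unfolding t_def using \<alpha> by (intro ge_one_powr_ge_zero) auto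
  also have "t <= t * (1 + 128 * B)" using t B by simp
  finally have "ennreal 1 * weighted_energy g R <= ennreal (t * (1 + 128 * B)) * weighted_energy g R"
   by (intro mult_right_mono ennreal_leI) auto
  then show ?thesis using weighted_energy_mono[of r R g] r unfolding const by simp
 next
  case infinite
  then show ?thesis using t B by (simp add: const ennreal_mult_eq_top_iff add_pos_pos)
 next
  case far
  have "weighted_energy g r <= ennreal (128 * t * (B * X))"
   using weighted_energy_decay_far[OF r(1) _ s u far(2,3)] far(1) by (simp add: t_def M_def B_def \<alpha>_def)
  also have "\<dots> <= ennreal (t * (1 + 128 * B) * X)" using t far(2) by (intro ennreal_leI) (simp add: algebra_simps)
  also have "\<dots> = ennreal (t * (1 + 128 * B)) * weighted_energy g R" using t B far(2,3) by (simp add: ennreal_mult)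
  finally show ?thesis by (simp add: const)
 qed
qed

end

subsection \<open>Borel representatives\<close>

lemma lebesgue_measurable_AE:
 fixes f f' :: "'a::euclidean_space => real"
 assumes "f' : Borel" and ae: "AEL x. f x = f' x"
 shows "f : borel_measurable lebesgue"
proof (rule measurableI)
 have f': "f' : borel_measurable lebesgue" using assms(1) by (intro measurable_completion) simp
 define N where "N = {x. f x ~= f' x}"
 have N: "N : null_sets lebesgue"
  using AE_completion[OF ae] by (simp add: completion.AE_iff_null_sets N_def)
 fix S :: "real set" assume "S : sets borel"
 then have "f' -` S \<inter> space lebesgue : sets lebesgue" by (rule measurable_sets[OF f'])
 then have "f' -` S : sets lebesgue" by simp
 moreover have "f -` S \<inter> N : null_sets lebesgue" by (rule completion.complete2[OF _ N]) auto
 ultimately have "(f' -` S - N) \<union> (f -` S \<inter> N) : sets lebesgue"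
  using N by (intro sets.Un sets.Diff) (auto simp: null_sets_def)
 also have "(f' -` S - N) \<union> (f -` S \<inter> N) = f -` S \<inter> space lebesgue" by (auto simp: N_def)
 finally show "f -` S \<inter> space lebesgue : sets lebesgue" .
qed simp

lemma
 fixes f f' :: "'a::euclidean_space => real"
 assumes f': "f' : Borel" and ae: "AEL x. f x = f' x"
 shows integrable_lebesgue_transfer: "integrable lebesgue f \<longleftrightarrow> integrable lborel f'"
  and integral_lebesgue_transfer: "(\<integral>x. f x \<partial>lebesgue) = (LBINT x. f' x)"
proof -
 have f: "f : borel_measurable lebesgue" by (rule lebesgue_measurable_AE[OF assms])
 have f'_lborel: "f' : borel_measurable lborel" using f' by simp
 then have f'_lebesgue: "f' : borel_measurable lebesgue" by (rule measurable_completion)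
 have eq: "AE x in lebesgue. f x = f' x" by (rule AE_completion[OF ae])
 show "integrable lebesgue f \<longleftrightarrow> integrable lborel f'"
  using integrable_cong_AE[OF f f'_lebesgue eq] integrable_completion[OF f'_lborel] by simp
 show "(\<integral>x. f x \<partial>lebesgue) = (LBINT x. f' x)"
  using integral_cong_AE[OF f f'_lebesgue eq] integral_completion[OF f'_lborel] by simp
qed

lemma integral_lebesgue_transfer_supported:
 fixes f f' :: "'a::euclidean_space => real"
 assumes "f' : Borel" "AE x\<in>U in lborel. f x = f' x" "supported_in f U" "supported_in f' U"
 shows "(\<integral>x. f x \<partial>lebesgue) = (LBINT x. f' x)"
proof (rule integral_lebesgue_transfer[OF assms(1)])
 show "AEL x. f x = f' x" using assms(2) by eventually_elim (use assms(3,4) in \<open>auto simp: supported_in_def\<close>)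
qed

lemma borel_version:
 fixes f :: "real^'n => real"
 assumes U: "open U" and f: "loc_integrable U f"
 shows "EX f':borel_measurable borel. AE x\<in>U in lborel. f x = f' x"
proof -
 obtain C :: "nat => (real^'n) set" where C: "!!j. compact (C j)" "!!j. C j <= U" "!!j. C j <= interior (C (Suc j))" "\<Union>(range C) = U"
  using open_Union_compact_subsets[OF U] by metis
 have mono: "C j <= C (j + i)" for i j using C(3) interior_subset by (induction i) (auto, blast)
 have "(%x. ind U x * f x) : borel_measurable lebesgue"
 proof (rule borel_measurable_LIMSEQ_real)
  show "(%x. ind (C j) x * f x) : borel_measurable lebesgue" for j
   using f C(1,2) by (auto simp: loc_integrable_def set_integrable_def dest!: borel_measurable_integrable)
  fix x
  show "(%j. ind (C j) x * f x) ---> ind U x * f x"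
  proof (cases "x : U")
   case True
   then obtain j where "x : C j" using C(4) by blast
   then have "ALL i>=j. x : C i" using mono[of j] by (metis le_Suc_ex subsetD)
   then have "\<forall>\<^sub>F i in sequentially. ind (C i) x * f x = ind U x * f x"
    unfolding eventually_sequentially using True by force
   then show ?thesis by (rule tendsto_eventually)
  next
   case False
   then have "x ~: C j" for j using C(2) by blast
   then show ?thesis using False by simp
  qed
 qed
 then obtain f' where f': "f' : borel_measurable lborel" "AEL x. ind U x * f x = f' x"
  using completion_ex_borel_measurable_real by blast
 have "AE x\<in>U in lborel. f x = f' x" using f'(2) by eventually_elim auto
 then show ?thesis using f'(1) by auto
qed

lemma vec_lambda_measurable:
 fixes f :: "'n::finite => 'a => 'b::euclidean_space"
 assumes "!!i. f i : borel_measurable M"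
 shows "(%x. \<chi> i. f i x) : borel_measurable M"
 unfolding borel_measurable_euclidean_space[of "%x. \<chi> i. f i x"]
proof
 fix b :: "'b^'n" assume "b : Basis"
 then obtain i c where b: "b = axis i c" "c : Basis" by (auto simp: Basis_vec_def)
 have "(%x. f i x \<bullet> c) : borel_measurable M" using assms by measurable
 then show "(%x. (\<chi> i. f i x) \<bullet> b) : borel_measurable M" by (simp add: b inner_axis)
qed

lemma vector_version:
 fixes f :: "real^'m => 'b::euclidean_space^'n"
 assumes "!!i. EX f':borel_measurable borel. AE x\<in>U in lborel. f x $ i = f' x"
 shows "EX f':borel_measurable borel. AE x\<in>U in lborel. f x = f' x"
proof -
 have "ALL i. EX h. h : Borel & (AE x\<in>U in lborel. f x $ i = h x)" using assms by blast
 from choice[OF this] obtain h where h: "!!i. h i : Borel" "!!i. AE x\<in>U in lborel. f x $ i = h i x" by blast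
 have "AEL x. ALL i:UNIV. x : U --> f x $ i = h i x" using h(2) by (intro AE_finite_allI) auto
 then have "AE x\<in>U in lborel. f x = (\<chi> i. h i x)" by eventually_elim (auto simp: vec_eq_iff)
 then show ?thesis using vec_lambda_measurable[of h, OF h(1)] by (rule bexI)
qed

lemma matrix_version:
 fixes A :: "real^'m => real^'k^'n"
 assumes "!!i j. (%x. A x $ i $ j) : borel_measurable lebesgue"
 shows "EX A':borel_measurable borel. AEL x. A x = A' x"
proof -
 have "EX a:borel_measurable borel. AE x\<in>UNIV in lborel. A x $ i $ j = a x" for i j
  using completion_ex_borel_measurable_real[OF assms[of i j]] by auto
 then have "EX a:borel_measurable borel. AE x\<in>UNIV in lborel. A x $ i = a x" for i
  by (rule vector_version)
 then have "EX A':borel_measurable borel. AE x\<in>UNIV in lborel. A x = A' x" by (rule vector_version)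
 then show ?thesis by simp
qed

lemma elliptic_scaled_identity:
 assumes "0 < lam" "lam <= L"
 shows "elliptic (%x :: real^'n. lam *. mat 1) lam L"
proof
 have form: "((lam *. mat 1) *v \<xi>) \<bullet> \<xi> = lam * (norm \<xi>)^2" for \<xi> :: "real^'n"
  by (simp add: scaleR_matrix_vector_assoc[symmetric] power2_norm_eq_inner)
 show "lam * (norm \<xi>)^2 <= ((lam *. mat 1) *v \<xi>) \<bullet> \<xi>" for \<xi> :: "real^'n" by (simp add: form)
 show "((lam *. mat 1) *v \<xi>) \<bullet> \<xi> <= L * (norm \<xi>)^2" for \<xi> :: "real^'n"
  using assms unfolding form by (intro mult_right_mono) auto
qed (use assms in \<open>simp_all add: transpose_scalar\<close>)

lemma elliptic_version:
 assumes A: "(A :: real^'n => real^'n^'n) : elliptic_class lam L" and lam: "0 < lam" "lam <= L"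
 shows "EX A'. elliptic A' lam L & (AEL x. A x = A' x)"
proof -
 obtain A0 where A0: "A0 : Borel" "AEL x. A x = A0 x"
  using matrix_version[of A] A by (auto simp: elliptic_class_def)
 define ell where "ell B \<longleftrightarrow> transpose B = B & (ALL \<xi>. lam * (norm \<xi>)^2 <= (B *v \<xi>) \<bullet> \<xi> & (B *v \<xi>) \<bullet> \<xi> <= L * (norm \<xi>)^2)"
  for B :: "real^'n^'n"
 have "AE x in lebesgue. ell (A x)" using A by (simp add: elliptic_class_def ell_def)
 then have "AEL x. ell (A x)" by (simp add: AE_completion_iff)
 with A0(2) have "AEL x. ell (A0 x)" by eventually_elim simp
 then obtain N where N: "{x. \<not> ell (A0 x)} <= N" "emeasure lborel N = 0" "N : sets borel"
  by (auto elim!: AE_E)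
 define A' where "A' = (%x. if x : N then lam *. mat 1 else A0 x)"
 interpret identity: elliptic "%x :: real^'n. lam *. mat 1" lam L by (rule elliptic_scaled_identity[OF lam])
 have "ell (lam *. mat 1)" unfolding ell_def using identity.A_sym identity.A_lower identity.A_upper by blast
 then have ell: "ell (A' x)" for x using N(1) by (auto simp: A'_def)
 have "elliptic A' lam L"
 proof
  show "A' : Borel" unfolding A'_def using A0(1) N(3) by (intro measurable_If_set) auto
 qed (use lam ell in \<open>auto simp: ell_def\<close>)
 moreover have "AEL x. x ~: N" using N by (intro AE_not_in) (auto simp: null_sets_def)
 with A0(2) have "AEL x. A x = A' x" by eventually_elim (simp add: A'_def)
 ultimately show ?thesis by blast
qed

lemma loc_integrable_lborel:
 assumes f: "loc_integrable U f" and f': "f' : Borel" and ae: "AE x\<in>U in lborel. f x = f' x"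
  and K: "compact K" "K <= U" and S: "S : sets borel" "S <= K"
 shows "integrable lborel (%x. ind S x * f' x)"
proof (rule integrable_on_subset[OF _ S(2,1)])
 have [measurable]: "K : sets borel" using compact_imp_closed[OF K(1)] by simp
 note [measurable] = f'
 have "AEL x. ind K x *. f x = ind K x * f' x" using ae by eventually_elim (use K in \<open>auto simp: indicator_def\<close>)
 then show "integrable lborel (%x. ind K x * f' x)"
  using f K integrable_lebesgue_transfer[of "%x. ind K x * f' x" "%x. ind K x *. f x"]
  by (auto simp: loc_integrable_def set_integrable_def)
qed

lemma test_fun_C1: "test_fun U \<phi> ==> C1 \<phi>"
 by (auto simp: test_fun_def smooth_def intro: Ck_C1)

lemma test_fun_supported:
 assumes "test_fun U \<phi>"
 shows "supported_in \<phi> U" "supported_in (grad \<phi>) U" "supported_in (pderiv \<phi> i) U"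
proof -
 have sub: "closure {x. \<phi> x ~= 0} <= U" using assms by (simp add: test_fun_def)
 have supp: "supported_in \<phi> (closure {x. \<phi> x ~= 0})"
  using closure_subset[of "{x. \<phi> x ~= 0}"] by (auto simp: supported_in_def)
 show "supported_in \<phi> U" by (rule supported_in_mono[OF supp sub])
 show "supported_in (grad \<phi>) U" by (rule supported_in_mono[OF supported_in_grad[OF supp closed_closure] sub])
 show "supported_in (pderiv \<phi> i) U" by (rule supported_in_mono[OF supported_in_pderiv[OF supp closed_closure] sub])
qed

lemma weak_grad_wgrad:
 fixes u u' :: "real^'n => real"
 assumes weak: "weak_grad U u g" and [measurable]: "u' : Borel" "g' : Borel"
  and u: "AE x\<in>U in lborel. u x = u' x" and g: "AE x\<in>U in lborel. g x = g' x"
 shows "wgrad U u' g'"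
 unfolding wgrad_def
proof (intro allI impI)
 fix \<phi> :: "real^'n => real" and i assume \<phi>: "test_fun U \<phi>"
 note [measurable] = C1_measurable[OF test_fun_C1[OF \<phi>]]
 have [measurable]: "pderiv \<phi> i : Borel"
  using vec_component_measurable[OF grad_measurable[OF test_fun_C1[OF \<phi>]], of i] by (simp add: grad_def)
 have [measurable]: "(%x. g' x $ i) : Borel" by (rule vec_component_measurable) measurable
 have "(\<integral>x. u x * pderiv \<phi> i x \<partial>lebesgue) = (LBINT x. u' x * pderiv \<phi> i x)"
 proof (rule integral_lebesgue_transfer_supported)
  show "AE x\<in>U in lborel. u x * pderiv \<phi> i x = u' x * pderiv \<phi> i x" using u by eventually_elim simp
 qed (use test_fun_supported(3)[OF \<phi>] in \<open>simp_all add: supported_in_def\<close>)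
 moreover have "(\<integral>x. g x $ i * \<phi> x \<partial>lebesgue) = (LBINT x. g' x $ i * \<phi> x)"
 proof (rule integral_lebesgue_transfer_supported)
  show "AE x\<in>U in lborel. g x $ i * \<phi> x = g' x $ i * \<phi> x" using g by eventually_elim simp
 qed (use test_fun_supported(1)[OF \<phi>] in \<open>simp_all add: supported_in_def\<close>)
 ultimately show "(LBINT x. u' x * pderiv \<phi> i x) = - (LBINT x. g' x $ i * \<phi> x)"
  using weak \<phi> unfolding weak_grad_def by simp
qed

lemma square_integrable_L2:
 fixes f f' :: "'a::euclidean_space => real"
 assumes f: "set_integrable lebesgue S (%x. (f x)^2)" and [measurable]: "S : sets borel" "f' : Borel"
  and ae: "AE x\<in>S in lborel. f x = f' x"
 shows "L2 S f' < \<infinity>"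
proof -
 have "L2 S f' = (NN x. ennreal (norm (ind S x *. (f x)\<^sup>2)))"
  unfolding L2_def
 proof (rule nn_integral_cong_AE)
  show "AEL x. ennreal ((norm (f' x))^2) * ind S x = ennreal (norm (ind S x *. (f x)\<^sup>2))"
   using ae by eventually_elim (auto simp: indicator_def)
 qed
 also have "\<dots> = (\<integral>\<^sup>+x. ennreal (norm (ind S x *. (f x)\<^sup>2)) \<partial>lebesgue)" by (rule nn_integral_completion[symmetric])
 also have "\<dots> < \<infinity>" using f unfolding set_integrable_def integrable_iff_bounded by simp
 finally show ?thesis .
qed

lemma square_integrable_L2_vec:
 fixes g' :: "real^'n => real^'n"
 assumes "!!i. set_integrable lebesgue S (%x. (g x $ i)^2)" and S: "S : sets borel" and g': "g' : Borel"
  and ae: "AE x\<in>S in lborel. g x = g' x"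
 shows "L2 S g' < \<infinity>"
proof -
 have "L2 S (%x. g' x $ i) < \<infinity>" for i
  by (rule square_integrable_L2[OF assms(1) S vec_component_measurable[OF g']]) (use ae in eventually_elim, auto)
 then show ?thesis unfolding L2_components[OF g' S] by (simp add: less_top)
qed

lemma integral_inner_supported:
 fixes F h :: "'a::euclidean_space => 'b::euclidean_space"
 assumes [measurable]: "F : Borel" "h : Borel" and F: "integrable lborel (%x. ind K x *. F x)"
  and h: "supported_in h K" "!!x. norm (h x) <= b"
 shows "integrable lborel (%x. F x \<bullet> h x)"
  and "\<bar>LBINT x. F x \<bullet> h x\<bar> <= b * (LBINT x. norm (ind K x *. F x))"
proof -
 have dominating: "integrable lborel (%x. b * norm (ind K x *. F x))" by (intro integrable_mult_right integrable_norm F)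
 have bound: "\<bar>F x \<bullet> h x\<bar> <= b * norm (ind K x *. F x)" for x
 proof (cases "x : K")
  case True
  have "\<bar>F x \<bullet> h x\<bar> <= norm (F x) * norm (h x)" by (rule Cauchy_Schwarz_ineq2)
  also have "\<dots> <= norm (F x) * b" using h(2)[of x] by (intro mult_left_mono) auto
  finally show ?thesis using True by (simp add: mult.commute)
 qed (simp add: supported_inD[OF h(1)])
 show integrable: "integrable lborel (%x. F x \<bullet> h x)"
  by (rule Bochner_Integration.integrable_bound[OF dominating]) (auto intro!: AE_I2 order_trans[OF bound])
 have "\<bar>LBINT x. F x \<bullet> h x\<bar> <= (LBINT x. \<bar>F x \<bullet> h x\<bar>)" by (rule integral_abs_bound)
 also have "\<dots> <= (LBINT x. b * norm (ind K x *. F x))"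
  by (rule integral_mono[OF integrable_abs[OF integrable] dominating bound])
 finally show "\<bar>LBINT x. F x \<bullet> h x\<bar> <= b * (LBINT x. norm (ind K x *. F x))" by simp
qed

lemma zero_if_abs_le_multiples:
 fixes d M :: real
 assumes "!!\<epsilon>. \<epsilon> > 0 ==> \<bar>d\<bar> <= M * \<epsilon>"
 shows "d = 0"
proof -
 have "\<forall>\<^sub>F \<epsilon> in at_right 0. \<bar>d\<bar> <= M * \<epsilon>" by (rule eventually_mono[OF eventually_at_right_less assms])
 moreover have "((%\<epsilon>. M * \<epsilon>) \<longlongrightarrow> M * 0) (at_right 0)" by (intro tendsto_intros)
 ultimately have "\<bar>d\<bar> <= M * 0" by (intro tendsto_lowerbound) auto
 then show ?thesis by simp
qed

lemma integral_grad_C1c: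
 fixes F :: "real^'n => real^'n"
 assumes U: "open U" and [measurable]: "F : Borel"
  and F: "!!K. compact K ==> K <= U ==> integrable lborel (%x. ind K x *. F x)"
  and test: "!!\<psi>. test_fun U \<psi> ==> (LBINT x. F x \<bullet> grad \<psi> x) = c * \<psi> 0"
  and \<phi>: "\<phi> : C1c U"
 shows "(LBINT x. F x \<bullet> grad \<phi> x) = c * \<phi> 0"
proof -
 obtain K where K: "compact K" "K <= U" "supported_in \<phi> K"
  and dense: "!!\<epsilon>. \<epsilon> > 0 ==> EX \<psi>. test_fun U \<psi> & supported_in \<psi> K &
   (ALL x. \<bar>\<psi> x - \<phi> x\<bar> <= \<epsilon> & norm (grad \<psi> x - grad \<phi> x) <= \<epsilon>)"
  using test_fun_dense[OF \<phi> U] by blast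
 note supp_grad = supported_in_grad[OF _ compact_imp_closed[OF K(1)]]
 note [measurable] = grad_measurable[OF C1c_C1[OF \<phi>]]
 define I where "I = (LBINT x. norm (ind K x *. F x))"
 obtain B where "!!x. norm (grad \<phi> x) <= B" using C1c_bounded[OF \<phi>] by metis
 from integral_inner_supported(1)[OF _ _ F[OF K(1,2)] supp_grad[OF K(3)] this]
 have int_\<phi>: "integrable lborel (%x. F x \<bullet> grad \<phi> x)" by measurable
 define d where "d = (LBINT x. F x \<bullet> grad \<phi> x) - c * \<phi> 0"
 have small: "\<bar>d\<bar> <= (I + \<bar>c\<bar>) * \<epsilon>" if \<epsilon>: "\<epsilon> > 0" for \<epsilon>
 proof -
  obtain \<psi> where \<psi>: "test_fun U \<psi>" "supported_in \<psi> K" "\<bar>\<psi> 0 - \<phi> 0\<bar> <= \<epsilon>" "!!x. norm (grad \<psi> x - grad \<phi> x) <= \<epsilon>"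
   using dense[OF \<epsilon>] by blast
  note [measurable] = grad_measurable[OF test_fun_C1[OF \<psi>(1)]]
  have "supported_in (%x. grad \<psi> x - grad \<phi> x) K"
   using supp_grad[OF K(3)] supp_grad[OF \<psi>(2)] by (simp add: supported_in_def)
  note diff = integral_inner_supported[OF _ _ F[OF K(1,2)] this \<psi>(4), folded I_def]
  have "(LBINT x. F x \<bullet> grad \<psi> x) = (LBINT x. F x \<bullet> grad \<phi> x + F x \<bullet> (grad \<psi> x - grad \<phi> x))"
   by (simp add: inner_diff_right)
  also have "\<dots> = (LBINT x. F x \<bullet> grad \<phi> x) + (LBINT x. F x \<bullet> (grad \<psi> x - grad \<phi> x))"
   by (rule Bochner_Integration.integral_add[OF int_\<phi> diff(1)]) measurable
  finally have "d = c * (\<psi> 0 - \<phi> 0) - (LBINT x. F x \<bullet> (grad \<psi> x - grad \<phi> x))"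
   using test[OF \<psi>(1)] by (simp add: d_def right_diff_distrib)
  moreover have "\<bar>c * (\<psi> 0 - \<phi> 0)\<bar> <= \<bar>c\<bar> * \<epsilon>" using \<psi>(3) unfolding abs_mult by (intro mult_left_mono) auto
  moreover have "\<bar>LBINT x. F x \<bullet> (grad \<psi> x - grad \<phi> x)\<bar> <= \<epsilon> * I" by (rule diff(2)) measurable
  ultimately show ?thesis by (simp add: algebra_simps)
 qed
 from zero_if_abs_le_multiples[OF small] have "d = 0" .
 then show ?thesis by (simp add: d_def)
qed

lemma (in elliptic) A_loc_integrable:
 assumes [measurable]: "g : Borel" and K [measurable]: "K : sets borel"
  and g: "!!i. integrable lborel (%x. ind K x * g x $ i)"
 shows "integrable lborel (%x. ind K x *. (A x *v g x))"
proof (rule Bochner_Integration.integrable_bound)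
 show "integrable lborel (%x. L * (\<Sum>i\<in>UNIV. \<bar>ind K x * g x $ i\<bar>))"
  using g by (intro integrable_mult_right Bochner_Integration.integrable_sum integrable_abs) auto
 show "AEL x. norm (ind K x *. (A x *v g x)) <= norm (L * (\<Sum>i\<in>UNIV. \<bar>ind K x * g x $ i\<bar>))"
 proof (rule AE_I2)
  fix x
  have "norm (ind K x *. (A x *v g x)) <= L * (ind K x * norm (g x))"
   using A_norm[of x "g x"] by (simp add: indicator_def)
  also have "\<dots> <= L * (\<Sum>i\<in>UNIV. \<bar>ind K x * g x $ i\<bar>)"
   using norm_le_l1_cart[of "g x"] L_pos by (intro mult_left_mono) (auto simp: indicator_def)
  finally show "norm (ind K x *. (A x *v g x)) <= norm (L * (\<Sum>i\<in>UNIV. \<bar>ind K x * g x $ i\<bar>))"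
   by simp
 qed
qed measurable

lemma integral_flux_transfer:
 assumes ell: "elliptic A' lam L" and A: "AEL x. A x = A' x" and U: "open U"
  and g': "g' : Borel" and g: "AE x\<in>U in lborel. g x = g' x"
  and int: "!!i. loc_integrable U (%x. g x $ i)"
  and test: "!!\<psi>. test_fun U \<psi> ==> (\<integral>x. (A x *v g x) \<bullet> grad \<psi> x \<partial>lebesgue) = c * \<psi> 0"
  and \<phi>: "\<phi> : C1c U"
 shows "(LBINT x. (A' x *v g' x) \<bullet> grad \<phi> x) = c * \<phi> 0"
proof (rule integral_grad_C1c[OF U _ _ _ \<phi>])
 interpret elliptic A' lam L by (rule ell)
 note [measurable] = g'
 show "(%x. A' x *v g' x) : Borel" by measurable
 show "integrable lborel (%x. ind K x *. (A' x *v g' x))" if K: "compact K" "K <= U" for K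
 proof (rule A_loc_integrable[OF g'])
  show borel: "K : sets borel" using compact_imp_closed[OF K(1)] by simp
  show "integrable lborel (%x. ind K x * g' x $ i)" for i
   by (rule loc_integrable_lborel[OF int vec_component_measurable[OF g'] _ K borel subset_refl]) (use g in eventually_elim, auto)
 qed
 fix \<psi> :: "real^'a => real" assume \<psi>: "test_fun U \<psi>"
 note [measurable] = grad_measurable[OF test_fun_C1[OF \<psi>]]
 have "(\<integral>x. (A x *v g x) \<bullet> grad \<psi> x \<partial>lebesgue) = (LBINT x. (A' x *v g' x) \<bullet> grad \<psi> x)"
 proof (rule integral_lebesgue_transfer_supported)
  show "AE x\<in>U in lborel. (A x *v g x) \<bullet> grad \<psi> x = (A' x *v g' x) \<bullet> grad \<psi> x"
   using A g by eventually_elim simp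
 qed (use test_fun_supported(2)[OF \<psi>] in \<open>simp_all add: supported_in_def\<close>)
 then show "(LBINT x. (A' x *v g' x) \<bullet> grad \<psi> x) = c * \<psi> 0" using test[OF \<psi>] by simp
qed

subsection \<open>The main theorem\<close>

lemma positive_borel_version:
 fixes G :: "real^'n => real"
 assumes "loc_integrable UNIV G" and pos: "ALL x. x ~= 0 --> G x > 0"
 obtains G' where "G' : Borel" "!!x. 0 <= G' x" "AEL x. 0 < G' x" "AEL x. G x = G' x"
proof -
 obtain G0 where G0 [measurable]: "G0 : Borel" and eq: "AEL x. G x = G0 x"
  using borel_version[OF open_UNIV assms(1)] by auto
 have off_pole: "AEL x. x ~= (0::real^'n)" by (rule AE_lborel_singleton)
 show thesis
 proof (rule that)
  show "(%x. max (G0 x) 0) : Borel" by measurable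
  show "AEL x. 0 < max (G0 x) 0" using eq off_pole by eventually_elim (use pos in force)
  show "AEL x. G x = max (G0 x) 0"
   using eq off_pole
  proof eventually_elim
   fix x :: "real^'n" assume "G x = G0 x" "x ~= 0"
   then show "G x = max (G0 x) 0" using pos[rule_format, of x] by simp
  qed
 qed simp
qed

lemma tendsto_at_infinity_AE_less:
 fixes G G' :: "'a::euclidean_space => real"
 assumes "(G \<longlongrightarrow> 0) at_infinity" and eq: "AEL x. G x = G' x" and "\<delta> > 0"
 shows "EX R>0. AEL x. R <= norm x --> G' x < \<delta>"
proof -
 obtain b where b: "!!x. b <= norm x ==> dist (G x) 0 < \<delta>"
  using tendstoD[OF assms(1,3)] by (auto simp: eventually_at_infinity)
 have "AEL x. max b 1 <= norm x --> G' x < \<delta>"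
  using eq
 proof (eventually_elim, intro impI)
  fix x assume "G x = G' x" "max b 1 <= norm x"
  then show "G' x < \<delta>" using b[of x] by (simp add: dist_real_def)
 qed
 then show ?thesis by (intro exI[of _ "max b 1"]) auto
qed

lemma fundamental_version:
 assumes F: "fundamental_solution (A :: real^'n => real^'n^'n) G D" and ell: "elliptic A' lam L" and A: "AEL x. A x = A' x"
  and n3: "CARD('n) \<ge> 3"
 shows "EX G' H. fundamental A' lam L G' H & (AEL x. G x = G' x)"
proof -
 have pos: "ALL x. x ~= 0 --> G x > 0" and weak: "weak_grad UNIV G D" and lim: "(G \<longlongrightarrow> 0) at_infinity"
  and D_L2: "ALL \<rho>>0. ALL i. set_integrable lebesgue (- cball 0 \<rho>) (%x. (D x $ i)^2)"
  and flux: "ALL \<phi>. test_fun UNIV \<phi> --> (\<integral>x. (A x *v D x) \<bullet> grad \<phi> x \<partial>lebesgue) = \<phi> 0"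
  using F unfolding fundamental_solution_def by auto
 have G_loc: "loc_integrable UNIV G" and D_loc: "!!i. loc_integrable UNIV (%x. D x $ i)" using weak by (auto simp: weak_grad_def)
 obtain G' where G' [measurable]: "G' : Borel" and G'_pos: "!!x. 0 <= G' x" "AEL x. 0 < G' x" and G_eq: "AEL x. G x = G' x"
  using positive_borel_version[OF G_loc pos] by blast
 obtain H where H [measurable]: "H : Borel" and D_eq: "AE x\<in>UNIV in lborel. D x = H x"
  using vector_version[of UNIV D] borel_version[OF open_UNIV D_loc] by blast
 have D_eq_component: "AE x\<in>UNIV in lborel. D x $ i = H x $ i" for i using D_eq by eventually_elim auto
 have G_eq_UNIV: "AE x\<in>UNIV in lborel. G x = G' x" using G_eq by simp
 interpret elliptic A' lam L by (rule ell)
 have "fundamental A' lam L G' H"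
 proof
  show "integrable lborel (%x. ind (ball 0 r) x * G' x)" for r
   by (rule loc_integrable_lborel[OF G_loc G' G_eq_UNIV compact_cball subset_UNIV _ ball_subset_cball]) simp
  show "integrable lborel (%x. ind (ball 0 r) x * H x $ i)" for r i
   by (rule loc_integrable_lborel[OF D_loc vec_component_measurable[OF H] D_eq_component compact_cball subset_UNIV _ ball_subset_cball]) simp
  show "wgrad UNIV G' H" by (rule weak_grad_wgrad[OF weak G' H G_eq_UNIV D_eq])
  show "L2 (- cball 0 \<rho>) H < \<infinity>" if "\<rho> > 0" for \<rho>
   by (rule square_integrable_L2_vec[where g=D]) (use D_L2 that D_eq H in auto)
  show "(LBINT x. (A' x *v H x) \<bullet> grad \<phi> x) = \<phi> 0" if "\<phi> : C1c UNIV" for \<phi>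
   using integral_flux_transfer[OF ell A open_UNIV H D_eq D_loc _ that, of 1] flux by simp
  show "EX R>0. AEL x. R <= norm x --> G' x < \<delta>" if "\<delta> > 0" for \<delta>
   by (rule tendsto_at_infinity_AE_less[OF lim G_eq that])
 qed (use n3 G'_pos in simp_all)
 then show ?thesis using G_eq by blast
qed

lemma H1_sobolev:
 fixes u :: "real^'n => real"
 assumes H1: "H1 U u D" and U: "open U" and K: "compact K" "K <= U" and [measurable]: "u' : Borel" "g : Borel"
  and u: "AE x\<in>U in lborel. u x = u' x" and g: "AE x\<in>U in lborel. D x = g x"
 shows "sobolev K UNIV u' g"
proof -
 obtain e where e: "e > 0" "(\<Union>x\<in>K. cball x e) <= U"
  using compact_subset_open_imp_cball_epsilon_subset[OF K(1) U K(2)] by blast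
 define K' where "K' = (\<Union>x\<in>K. cball x e)"
 have K': "compact K'" "K' <= U" unfolding K'_def using compact_minkowski_sum_cball[OF K(1)] e(2) by auto
 have borel: "K' : sets borel" "K : sets borel" "U : sets borel" using K(1) K'(1) U by (auto intro: borel_compact borel_open)
 have weak: "weak_grad U u D" using H1 by (simp add: H1_def)
 then have u_loc: "loc_integrable U u" and D_loc: "!!i. loc_integrable U (%x. D x $ i)" by (auto simp: weak_grad_def)
 have "L2 U u' < \<infinity>" by (rule square_integrable_L2[where f=u]) (use H1 u borel in \<open>auto simp: H1_def\<close>)
 then have u'_L2: "L2 K' u' < \<infinity>" by (rule le_less_trans[OF L2_mono_set[OF K'(2)]])
 have "L2 U g < \<infinity>" by (rule square_integrable_L2_vec[where g=D]) (use H1 g borel in \<open>auto simp: H1_def\<close>)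
 then have g_L2: "L2 K' g < \<infinity>" by (rule le_less_trans[OF L2_mono_set[OF K'(2)]])
 have "integrable lborel (%x. ind K' x * u' x)"
  by (rule loc_integrable_lborel[OF u_loc _ u K' borel(1) subset_refl]) measurable
 moreover have "integrable lborel (%x. ind K' x * g x $ i)" for i
  by (rule loc_integrable_lborel[OF D_loc vec_component_measurable _ K' borel(1) subset_refl]) (use g in \<open>auto elim: eventually_mono\<close>)
 ultimately show ?thesis
  using weak_grad_sobolev[OF weak_grad_wgrad[OF weak _ _ u g] K'(2) borel(2,1) _ _ _ _ g_L2 e(1) _ u'_L2]
  by (auto simp: K'_def)
qed

lemma solution_version:
 assumes W: "weak_solution (A :: real^'n => real^'n^'n) (ball 0 1) u D" and ell: "elliptic A' lam L" and A: "AEL x. A x = A' x"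
 shows "EX u' g. elliptic.sol A' (ball 0 (7/8)) g & sobolev (ball 0 (7/8)) UNIV u' g &
  (AE x\<in>ball 0 1 in lborel. u x = u' x) & (AE x\<in>ball 0 1 in lborel. D x = g x)"
proof -
 interpret elliptic A' lam L by (rule ell)
 have H1: "H1 (ball 0 1) u D" and eq: "ALL \<phi>. test_fun (ball 0 1) \<phi> --> (\<integral>x. (A x *v D x) \<bullet> grad \<phi> x \<partial>lebesgue) = 0"
  using W unfolding weak_solution_def by auto
 have u_loc: "loc_integrable (ball 0 1) u" and D_loc: "!!i. loc_integrable (ball 0 1) (%x. D x $ i)"
  using H1 by (auto simp: H1_def weak_grad_def)
 obtain u' where u': "u' : Borel" and u: "AE x\<in>ball 0 1 in lborel. u x = u' x"
  using borel_version[OF open_ball u_loc] by auto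
 obtain g where g': "g : Borel" and g: "AE x\<in>ball 0 1 in lborel. D x = g x"
  using vector_version[of "ball 0 1" D] borel_version[OF open_ball D_loc] by blast
 have "sobolev (cball 0 (7/8)) UNIV u' g" by (rule H1_sobolev[OF H1 open_ball compact_cball _ u' g' u g]) auto
 then have "sobolev (ball 0 (7/8)) UNIV u' g" by (rule sobolev_mono) auto
 moreover have "sol (ball 0 (7/8)) g"
  unfolding sol_def
 proof
  fix \<phi> :: "real^'n => real" assume \<phi>: "\<phi> : C1c (ball 0 (7/8))"
  have "\<phi> : C1c (ball 0 1)" by (rule C1c_mono[OF \<phi>]) auto
  from integral_flux_transfer[OF ell A open_ball g' g D_loc _ this, of 0]
  have "(LBINT x. (A' x *v g x) \<bullet> grad \<phi> x) = 0" using eq by simp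
  then show "(LBINT x. ind (ball 0 (7/8)) x * ((A' x *v g x) \<bullet> grad \<phi> x)) = 0"
   using C1c_integral_superset[OF \<phi> subset_UNIV, of g] by simp
 qed
 ultimately show ?thesis using u g by blast
qed

lemma holder_class_AE:
 assumes "AE x\<in>U in lborel. u x = u' x" "AE x\<in>U in lborel. u' x = v x"
  and "ALL x y. \<bar>v x - v y\<bar> <= K * dist x y powr \<alpha>"
 shows "holder_class \<alpha> U u"
proof -
 have "AE x\<in>U in lborel. u x = v x" using assms(1,2) by eventually_elim auto
 then have "AE x\<in>U in lebesgue. u x = v x" by (rule AE_completion)
 then show ?thesis unfolding holder_class_def using assms(3) by blast
qed

lemma weak_solution_energy_decay:
 fixes A :: "real^'n => real^'n^'n" and lam L :: real
 defines "\<alpha> \<equiv> osc_exponent CARD('n) (4 * L / lam)"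
 assumes n3: "CARD('n) \<ge> 3" and lam: "0 < lam" "lam <= L" and A: "A : elliptic_class lam L"
  and G: "fundamental_solution A G DG" and u: "weak_solution A (ball 0 1) u Du"
 shows "0 < r ==> r < R ==> R <= 1/2 ==>
   (\<integral>\<^sup>+ x\<in>ball 0 r. ennreal (G x * ((A x *v Du x) \<bullet> Du x)) \<partial>lebesgue)
   <= ennreal (decay_const CARD('n) lam L * (r / R) powr (2 * \<alpha>)) *
      (\<integral>\<^sup>+ x\<in>ball 0 R. ennreal (G x * ((A x *v Du x) \<bullet> Du x)) \<partial>lebesgue)"
  and "holder_class \<alpha> (ball 0 (1/2)) u"
proof -
 obtain A' where ell: "elliptic A' lam L" and A': "AEL x. A x = A' x" using elliptic_version[OF A lam] by blast
 obtain G' H where fund: "fundamental A' lam L G' H" and G': "AEL x. G x = G' x"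
  using fundamental_version[OF G ell A' n3] by blast
 interpret fundamental A' lam L G' H by (rule fund)
 obtain u' g where sol: "sol (ball 0 (7/8)) g" and sob: "sobolev (ball 0 (7/8)) UNIV u' g"
  and u': "AE x\<in>ball 0 1 in lborel. u x = u' x" and g: "AE x\<in>ball 0 1 in lborel. Du x = g x"
  using solution_version[OF u ell A'] by blast
 have energy: "(\<integral>\<^sup>+ x\<in>ball 0 t. ennreal (G x * ((A x *v Du x) \<bullet> Du x)) \<partial>lebesgue) = weighted_energy g t" if "t <= 1/2" for t
  unfolding nn_integral_completion weighted_energy_def
  by (rule nn_integral_cong_AE) (use A' G' g in eventually_elim, use that in \<open>auto simp: indicator_def\<close>)
 show "(\<integral>\<^sup>+ x\<in>ball 0 r. ennreal (G x * ((A x *v Du x) \<bullet> Du x)) \<partial>lebesgue)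
   <= ennreal (decay_const CARD('n) lam L * (r / R) powr (2 * \<alpha>)) *
      (\<integral>\<^sup>+ x\<in>ball 0 R. ennreal (G x * ((A x *v Du x) \<bullet> Du x)) \<partial>lebesgue)"
  if r: "0 < r" "r < R" "R <= 1/2"
 proof -
  have sub: "ball 0 R <= ball (0 :: real^'n) (7/8)" using r by auto
  have "sol (ball 0 R) g" by (rule sol_mono[OF sol sub])
  moreover have "sobolev (ball 0 R) UNIV u' g" by (rule sobolev_mono[OF sob sub]) auto
  ultimately show ?thesis using weighted_energy_decay[OF r(1,2)] r by (simp add: energy \<alpha>_def)
 qed
 obtain v K where v: "AE x\<in>ball 0 (1/2) in lborel. u' x = v x" "ALL x y. \<bar>v x - v y\<bar> <= K * dist x y powr \<alpha>"
  using sol_holder[OF sol sob] unfolding \<alpha>_def by blast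
 have "AE x\<in>ball 0 (1/2) in lborel. u x = u' x" using u' by eventually_elim auto
 from holder_class_AE[OF this v] show "holder_class \<alpha> (ball 0 (1/2)) u" .
qed

theorem theorem1p3:
  fixes lam L :: real
  assumes "CARD('n) \<ge> 3" and "0 < lam" and "lam \<le> L"
  shows "\<exists>\<alpha> C. 0 < \<alpha> \<and> \<alpha> < 1 \<and> C > 0 \<and>
    (\<forall>(A :: real^'n \<Rightarrow> real^'n^'n) G DG u Du.
       A \<in> elliptic_class lam L \<and> fundamental_solution A G DG \<and> weak_solution A (ball 0 1) u Du \<longrightarrow>
       (\<forall>r R. 0 < r \<and> r < R \<and> R \<le> 1/2 \<longrightarrow>
          (\<integral>\<^sup>+ x\<in>ball 0 r. ennreal (G x * ((A x *v Du x) \<bullet> Du x)) \<partial>lebesgue)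
            \<le> ennreal (C * (r / R) powr (2 * \<alpha>)) *
              (\<integral>\<^sup>+ x\<in>ball 0 R. ennreal (G x * ((A x *v Du x) \<bullet> Du x)) \<partial>lebesgue)) \<and>
       holder_class \<alpha> (ball 0 (1/2)) u)"
proof -
 interpret elliptic "%x :: real^'n. lam *. mat 1" lam L by (rule elliptic_scaled_identity[OF assms(2,3)])
 let ?\<alpha> = "osc_exponent CARD('n) (4 * L / lam)"
 have "0 < ?\<alpha>" "?\<alpha> < 1" by (rule osc_exponent_bounds[OF caccioppoli_const_pos])+
 moreover note decay_const_pos
 ultimately show ?thesis
  using weak_solution_energy_decay[where 'n = 'n, OF assms]
  by (intro exI[of _ ?\<alpha>] exI[of _ "decay_const CARD('n) lam L"]) blast
qed

end
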